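(* Let $(S,\Pi_S)$ be an embedded Poisson submanifold of a Poisson manifold $(M,\Pi)$ with normal bundle $E=T_SM/TS$. Every transversal $\mathscr L\subset T_SM$ of $S$ (i.e. subbundle with $T_SM=TS\oplus\mathscr L$) induces an infinitesimal Poisson algebra $P_1^{\mathscr L}=(C^\infty_{\mathrm{aff}}(E),\cdot,\{,\}^{\mathscr L})$, where the Lie bracket is $$\{f_1\oplus\eta_1,f_2\oplus\eta_2\}^{\mathscr L}=\{f_1,f_2\}_S\oplus\big(\mathscr D^{\mathscr L}_{\mathrm df_1}\eta_2-\mathscr D^{\mathscr L}_{\mathrm df_2}\eta_1+[\eta_1,\eta_2]_{E^*}+\mathscr K^{\mathscr L}(\mathrm df_1,\mathrm df_2)\big).$$ Moreover, the algebra $P_1^{\mathscr L}$ is independent of $\mathscr L$ up to isomorphism (of Poisson algebras).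
   Context: **Poisson submanifold.** $\{f,g\}_M=\Pi(\mathrm df,\mathrm dg)$; $\Pi^\natural(\alpha)=\mathbf i_\alpha\Pi$. A submanifold $S$ is Poisson if $\Pi_q\in\wedge^2T_qS$ for all $q\in S$; it then carries the restricted Poisson tensor $\Pi_S$ with bracket $\{,\}_S$. $T_SM=TM|_S$, $T^*_SM=T^*M|_S$; $TS^\circ\subset T^*_SM$ is the annihilator of $TS$. $\pi:E\to S$ is the normal bundle, $\nu:T_SM\to E$ the quotient projection; $\nu^*:E^*\to T_S^*M$ is an isomorphism onto $TS^\circ$. **Infinitesimal data.** The bracket of 1-forms on $M$ is $[\alpha,\beta]_A=\mathbf i_{\Pi^\natural(\alpha)}\mathrm d\beta-\mathbf i_{\Pi^\natural(\beta)}\mathrm d\alpha-\mathrm d\langle\alpha,\Pi^\natural(\beta)\rangle$. The restricted Lie algebroid $A_S=(T^*_SM,[,]_{A_S},\Pi^\natural|_S)$ has the unique bracket for which the restriction map $\Gamma T^*M\to\Gamma T^*_SM$ is a Lie algebra homomorphism; $TS^\circ$ is an ideal with zero anchor. The fiberwise Lie bracket on $E^*$ is defined by $\nu^*[\eta_1,\eta_2]_{E^*}=[\nu^*\eta_1,\nu^*\eta_2]_{A_S}$. **Affine functions.** $C^\infty_{\mathrm{aff}}(E)=\pi^*C^\infty(S)\oplus C^\infty_{\mathrm{lin}}(E)\simeq C^\infty(S)\oplus\Gamma E^*$, where $f\oplus\eta$ corresponds to $\pi^*f+\ell_\eta$, $\ell_\eta(z)=\langle\eta_{\pi(z)},z\rangle$.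 Its commutative product is $(f_1\oplus\eta_1)\cdot(f_2\oplus\eta_2)=f_1f_2\oplus(f_1\eta_2+f_2\eta_1)$. On $C^\infty_{\mathrm{lin}}(E)$ there is the Lie bracket $\{\ell_{\eta_1},\ell_{\eta_2}\}^{\mathrm{lin}}=\ell_{[\eta_1,\eta_2]_{E^*}}$. **Infinitesimal Poisson algebra.** A Poisson algebra $(C^\infty_{\mathrm{aff}}(E),\cdot,\{,\}^{\mathrm{aff}})$ with the commutative product $(f_1\oplus\eta_1)\cdot(f_2\oplus\eta_2)=f_1f_2\oplus(f_1\eta_2+f_2\eta_1)$ and a Lie bracket (derivation in each argument) such that (a) the natural projection $C^\infty_{\mathrm{aff}}(E)\to C^\infty(S)$ is a Poisson algebra homomorphism onto $(C^\infty(S),\{,\}_S)$; (b) $\{0\oplus\varphi_1,0\oplus\varphi_2\}^{\mathrm{aff}}=0\oplus\{\varphi_1,\varphi_2\}^{\mathrm{lin}}$ for all $\varphi_1,\varphi_2\in C^\infty_{\mathrm{lin}}(E)$. **Data of a transversal.** A transversal $\mathscr L$ gives $T^*_SM=\mathscr L^\circ\oplus TS^\circ$; let $\varrho_{\mathscr L}:T_S^*M\to TS^\circ$ be the projection along $\mathscr L^\circ$, and $\tau_{\mathscr L}:T^*S\to\mathscr L^\circ$ the isomorphism sending $\alpha$ to the element of $\mathscr L^\circ$ which restricts to $\alpha$ on $TS$. For $\alpha,\beta\in\Gamma T^*S$, $\eta\in\Gamma E^*$: $$\nu^*(\mathscr D^{\mathscr L}_\alpha\eta)=[\tau_{\mathscr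 L}(\alpha),\nu^*\eta]_{A_S},\qquad \nu^*(\mathscr K^{\mathscr L}(\alpha,\beta))=\varrho_{\mathscr L}\big([\tau_{\mathscr L}(\alpha),\tau_{\mathscr L}(\beta)]_{A_S}\big).$$ *)

theory Defs
  imports "HOL-Analysis.Analysis" "HOL-Library.Function_Algebras"
begin

section \<open>Smooth maps between subsets of Euclidean spaces\<close>

primrec Ck_on :: "nat \<Rightarrow> 'b::euclidean_space set \<Rightarrow> ('b \<Rightarrow> 'c::euclidean_space) \<Rightarrow> bool" where
  "Ck_on 0 U f \<longleftrightarrow> continuous_on U f"
| "Ck_on (Suc k) U f \<longleftrightarrow> (\<forall>x\<in>U. f differentiable (at x)) \<and>
     (\<forall>v. Ck_on k U (\<lambda>x. frechet_derivative f (at x) v))"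

text \<open>On arbitrary subsets, a map is smooth if it extends smoothly to an open neighbourhood of
  every point.  This is used on relatively open subsets of linear subspaces.\<close>

definition smooth_on :: "'b::euclidean_space set \<Rightarrow> ('b \<Rightarrow> 'c::euclidean_space) \<Rightarrow> bool" where
  "smooth_on A f \<longleftrightarrow> (\<forall>x\<in>A. \<exists>U g. open U \<and> x \<in> U \<and> (\<forall>k. Ck_on k U g) \<and> (\<forall>y\<in>A \<inter> U. g y = f y))"

section \<open>Manifolds\<close>

text \<open>Charts take values in a linear subspace \<open>model M\<close> of a Euclidean space, whose dimension is
  the dimension of the manifold.  Since the type class \<open>euclidean_space\<close> excludes dimension zero,
  taking the whole type as model space would exclude zero-dimensional manifolds; moreover a
  submanifold can be modelled on a subspace of the model space of the ambient manifold.\<close>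

record ('a, 'b) mfd =
  mtop :: "'a topology"
  model :: "'b set"
  atlas :: "('a set \<times> ('a \<Rightarrow> 'b)) set"

abbreviation pts :: "('a, 'b) mfd \<Rightarrow> 'a set" where
  "pts M \<equiv> topspace (mtop M)"

definition is_chart :: "('a, 'b::euclidean_space) mfd \<Rightarrow> 'a set \<Rightarrow> ('a \<Rightarrow> 'b) \<Rightarrow> bool" where
  "is_chart M U \<phi> \<longleftrightarrow>
     openin (mtop M) U \<and> openin (top_of_set (model M)) (\<phi> ` U) \<and>
     homeomorphic_map (subtopology (mtop M) U) (top_of_set (\<phi> ` U)) \<phi> \<and>
     (\<forall>(V, \<psi>)\<in>atlas M. smooth_on (\<phi> ` (U \<inter> V)) (\<psi> \<circ> inv_into U \<phi>) \<and>
                      smooth_on (\<psi> ` (U \<inter> V)) (\<phi> \<circ> inv_into V \<psi>))"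

definition manifold :: "('a, 'b::euclidean_space) mfd \<Rightarrow> bool" where
  "manifold M \<longleftrightarrow>
     Hausdorff_space (mtop M) \<and> second_countable (mtop M) \<and> subspace (model M) \<and>
     (\<Union>(U, \<phi>)\<in>atlas M. U) = pts M \<and> (\<forall>(U, \<phi>)\<in>atlas M. is_chart M U \<phi>)"

definition smooth_fun_on :: "('a, 'b::euclidean_space) mfd \<Rightarrow> 'a set \<Rightarrow> ('a \<Rightarrow> real) \<Rightarrow> bool" where
  "smooth_fun_on M W f \<longleftrightarrow> (\<forall>(U, \<phi>)\<in>atlas M. smooth_on (\<phi> ` (U \<inter> W)) (f \<circ> inv_into U \<phi>))"

text \<open>Functions on \<open>pts M\<close>, and likewise sections of bundles and elements of dual spaces, are
  represented by total functions that vanish outside their domain.  Thus equality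
  is equality on the domain, and the pointwise operations on functions are the intended ones.\<close>

definition smooth_functions :: "('a, 'b::euclidean_space) mfd \<Rightarrow> ('a \<Rightarrow> real) set" where
  "smooth_functions M = {f. (\<forall>x. x \<notin> pts M \<longrightarrow> f x = 0) \<and> smooth_fun_on M (pts M) f}"

text \<open>The linear dual of a vector space of real-valued functions.\<close>

definition dual_space :: "('x \<Rightarrow> real) set \<Rightarrow> (('x \<Rightarrow> real) \<Rightarrow> real) set" where
  "dual_space V = {\<xi>. (\<forall>v\<in>V. \<forall>w\<in>V. \<xi> (v + w) = \<xi> v + \<xi> w) \<and>
     (\<forall>c. \<forall>v\<in>V. \<xi> (\<lambda>x. c * v x) = c * \<xi> v) \<and> (\<forall>v. v \<notin> V \<longrightarrow> \<xi> v = 0)}"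

type_synonym 'a tvec = "('a \<Rightarrow> real) \<Rightarrow> real"
type_synonym 'a covec = "'a tvec \<Rightarrow> real"

text \<open>Tangent vectors at a point are the derivations of the algebra of smooth functions there.\<close>

definition tangent :: "('a, 'b::euclidean_space) mfd \<Rightarrow> 'a \<Rightarrow> 'a tvec set" where
  "tangent M q = {v \<in> dual_space (smooth_functions M).
     \<forall>f\<in>smooth_functions M. \<forall>g\<in>smooth_functions M. v (f * g) = f q * v g + g q * v f}"

definition cotangent :: "('a, 'b::euclidean_space) mfd \<Rightarrow> 'a \<Rightarrow> 'a covec set" where
  "cotangent M q = dual_space (tangent M q)"

definition differential :: "('a, 'b::euclidean_space) mfd \<Rightarrow> ('a \<Rightarrow> real) \<Rightarrow> 'a \<Rightarrow> 'a covec" where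
  "differential M f = (\<lambda>q v. if q \<in> pts M \<and> v \<in> tangent M q then v f else 0)"

section \<open>Embedded submanifolds and restricted bundles\<close>

text \<open>An embedded submanifold \<open>S\<close> carries the subspace topology and the smooth structure for which
  the restrictions of slice charts are charts.\<close>

definition embedded_submanifold ::
    "('a, 'b::euclidean_space) mfd \<Rightarrow> ('a, 'b) mfd \<Rightarrow> bool" where
  "embedded_submanifold M S \<longleftrightarrow>
     manifold S \<and> pts S \<subseteq> pts M \<and> mtop S = subtopology (mtop M) (pts S) \<and> model S \<subseteq> model M \<and>
     (\<forall>q\<in>pts S. \<exists>U \<phi>. q \<in> U \<and> is_chart M U \<phi> \<and>
        \<phi> ` (U \<inter> pts S) = \<phi> ` U \<inter> model S \<and> is_chart S (U \<inter> pts S) \<phi>)"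

definition restrict_to :: "('a, 'b) mfd \<Rightarrow> ('a \<Rightarrow> 'c::zero) \<Rightarrow> 'a \<Rightarrow> 'c" where
  "restrict_to S f = (\<lambda>x. if x \<in> pts S then f x else 0)"

text \<open>Differential of the inclusion of \<open>S\<close> into \<open>M\<close>, the subspace \<open>T\<^sub>qS\<close> of \<open>T\<^sub>qM\<close>, and the transpose,
  i.e. restriction of covectors from \<open>T\<^sub>qM\<close> to \<open>T\<^sub>qS\<close>.\<close>

definition push :: "('a, 'b::euclidean_space) mfd \<Rightarrow> ('a, 'b) mfd \<Rightarrow> 'a tvec \<Rightarrow> 'a tvec" where
  "push M S w = (\<lambda>f. if f \<in> smooth_functions M then w (restrict_to S f) else 0)"

definition TS :: "('a, 'b::euclidean_space) mfd \<Rightarrow> ('a, 'b) mfd \<Rightarrow> 'a \<Rightarrow> 'a tvec set" where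
  "TS M S q = push M S ` tangent S q"

definition pull ::
    "('a, 'b::euclidean_space) mfd \<Rightarrow> ('a, 'b) mfd \<Rightarrow> 'a \<Rightarrow> 'a covec \<Rightarrow> 'a covec" where
  "pull M S q \<xi> = (\<lambda>w. if w \<in> tangent S q then \<xi> (push M S w) else 0)"

definition annihilator ::
    "('a, 'b::euclidean_space) mfd \<Rightarrow> 'a \<Rightarrow> 'a tvec set \<Rightarrow> 'a covec set" where
  "annihilator M q V = {\<xi> \<in> cotangent M q. \<forall>v\<in>V. \<xi> v = 0}"

text \<open>Smooth sections of \<open>T\<^sub>SM\<close> and \<open>T\<^sup>*\<^sub>SM\<close>.  For \<open>S = M\<close> these are the vector fields and the
  1-forms on \<open>M\<close>.\<close>

definition tangent_sections ::
    "('a, 'b::euclidean_space) mfd \<Rightarrow> ('a, 'b) mfd \<Rightarrow> ('a \<Rightarrow> 'a tvec) set" where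
  "tangent_sections M S = {\<sigma>. (\<forall>q\<in>pts S. \<sigma> q \<in> tangent M q) \<and> (\<forall>q. q \<notin> pts S \<longrightarrow> \<sigma> q = 0) \<and>
     (\<forall>f\<in>smooth_functions M. (\<lambda>q. \<sigma> q f) \<in> smooth_functions S)}"

definition cotangent_sections ::
    "('a, 'b::euclidean_space) mfd \<Rightarrow> ('a, 'b) mfd \<Rightarrow> ('a \<Rightarrow> 'a covec) set" where
  "cotangent_sections M S = {\<alpha>. (\<forall>q\<in>pts S. \<alpha> q \<in> cotangent M q) \<and> (\<forall>q. q \<notin> pts S \<longrightarrow> \<alpha> q = 0) \<and>
     (\<forall>\<sigma>\<in>tangent_sections M S. (\<lambda>q. \<alpha> q (\<sigma> q)) \<in> smooth_functions S)}"

abbreviation vector_fields :: "('a, 'b::euclidean_space) mfd \<Rightarrow> ('a \<Rightarrow> 'a tvec) set" where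
  "vector_fields M \<equiv> tangent_sections M M"

abbreviation one_forms :: "('a, 'b::euclidean_space) mfd \<Rightarrow> ('a \<Rightarrow> 'a covec) set" where
  "one_forms M \<equiv> cotangent_sections M M"

definition vf_bracket ::
    "('a, 'b::euclidean_space) mfd \<Rightarrow> ('a \<Rightarrow> 'a tvec) \<Rightarrow> ('a \<Rightarrow> 'a tvec) \<Rightarrow> 'a \<Rightarrow> 'a tvec" where
  "vf_bracket M X Y = (\<lambda>q f. if f \<in> smooth_functions M
     then X q (\<lambda>p. Y p f) - Y q (\<lambda>p. X p f) else 0)"

text \<open>The 2-form \<open>d\<beta>\<close>, determined at \<open>q\<close> by the invariant formula
  \<open>d\<beta>(X, Y) = X \<beta>(Y) - Y \<beta>(X) - \<beta>([X, Y])\<close> for vector fields with values \<open>v, w\<close> at \<open>q\<close>.\<close>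

definition ext_d ::
    "('a, 'b::euclidean_space) mfd \<Rightarrow> ('a \<Rightarrow> 'a covec) \<Rightarrow> 'a \<Rightarrow> 'a tvec \<Rightarrow> 'a tvec \<Rightarrow> real" where
  "ext_d M \<beta> q v w = (THE r. \<forall>X\<in>vector_fields M. \<forall>Y\<in>vector_fields M. X q = v \<longrightarrow> Y q = w \<longrightarrow>
     r = X q (\<lambda>p. \<beta> p (Y p)) - Y q (\<lambda>p. \<beta> p (X p)) - \<beta> q (vf_bracket M X Y q))"

section \<open>Poisson manifolds and Poisson submanifolds\<close>

text \<open>The space \<open>\<And>\<^sup>2T\<^sub>qM\<close>, as the space of alternating bilinear forms on \<open>T\<^sup>*\<^sub>qM\<close>.\<close>

definition bivectors ::
    "('a, 'b::euclidean_space) mfd \<Rightarrow> 'a \<Rightarrow> ('a covec \<Rightarrow> 'a covec \<Rightarrow> real) set" where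
  "bivectors M q = {P. (\<forall>\<xi>\<in>cotangent M q. P \<xi> \<in> dual_space (cotangent M q)) \<and>
     (\<forall>\<xi>. \<xi> \<notin> cotangent M q \<longrightarrow> P \<xi> = 0) \<and> (\<forall>\<xi> \<zeta>. P \<xi> \<zeta> = - P \<zeta> \<xi>)}"

type_synonym 'a bivf = "'a \<Rightarrow> 'a covec \<Rightarrow> 'a covec \<Rightarrow> real"

definition bivector_fields :: "('a, 'b::euclidean_space) mfd \<Rightarrow> 'a bivf set" where
  "bivector_fields M = {\<pi>. (\<forall>q\<in>pts M. \<pi> q \<in> bivectors M q) \<and> (\<forall>q. q \<notin> pts M \<longrightarrow> \<pi> q = 0) \<and>
     (\<forall>\<alpha>\<in>one_forms M. \<forall>\<beta>\<in>one_forms M. (\<lambda>q. \<pi> q (\<alpha> q) (\<beta> q)) \<in> smooth_functions M)}"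

definition fun_bracket ::
    "('a, 'b::euclidean_space) mfd \<Rightarrow> 'a bivf \<Rightarrow> ('a \<Rightarrow> real) \<Rightarrow> ('a \<Rightarrow> real) \<Rightarrow> 'a \<Rightarrow> real" where
  "fun_bracket M \<pi> f g = (\<lambda>q. \<pi> q (differential M f q) (differential M g q))"

definition poisson_manifold :: "('a, 'b::euclidean_space) mfd \<Rightarrow> 'a bivf \<Rightarrow> bool" where
  "poisson_manifold M \<pi> \<longleftrightarrow> manifold M \<and> \<pi> \<in> bivector_fields M \<and>
     (\<forall>f\<in>smooth_functions M. \<forall>g\<in>smooth_functions M. \<forall>h\<in>smooth_functions M.
        fun_bracket M \<pi> f (fun_bracket M \<pi> g h) + fun_bracket M \<pi> g (fun_bracket M \<pi> h f)
          + fun_bracket M \<pi> h (fun_bracket M \<pi> f g) = 0)"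

text \<open>The map \<open>\<Pi>\<^sup>\<natural>\<close>, with values in tangent vectors: the contraction of \<open>\<pi>\<close> by \<open>\<xi>\<close> sends \<open>f\<close> to
  \<open>\<pi>(\<xi>, df)\<close>.\<close>

definition sharp ::
    "('a, 'b::euclidean_space) mfd \<Rightarrow> 'a bivf \<Rightarrow> ('a \<Rightarrow> 'a covec) \<Rightarrow> 'a \<Rightarrow> 'a tvec" where
  "sharp M \<pi> \<alpha> = (\<lambda>q f. \<pi> q (\<alpha> q) (differential M f q))"

text \<open>The bivector \<open>P\<close> in \<open>\<And>\<^sup>2T\<^sub>qS\<close> is mapped to \<open>\<pi> q\<close> under the inclusion of \<open>\<And>\<^sup>2T\<^sub>qS\<close> into
  \<open>\<And>\<^sup>2T\<^sub>qM\<close>.\<close>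

definition restricts_to_bivector ::
    "('a, 'b::euclidean_space) mfd \<Rightarrow> 'a bivf \<Rightarrow> ('a, 'b) mfd \<Rightarrow> 'a
      \<Rightarrow> ('a covec \<Rightarrow> 'a covec \<Rightarrow> real) \<Rightarrow> bool" where
  "restricts_to_bivector M \<pi> S q P \<longleftrightarrow> P \<in> bivectors S q \<and>
     (\<forall>\<xi>\<in>cotangent M q. \<forall>\<zeta>\<in>cotangent M q. \<pi> q \<xi> \<zeta> = P (pull M S q \<xi>) (pull M S q \<zeta>))"

definition poisson_submanifold ::
    "('a, 'b::euclidean_space) mfd \<Rightarrow> 'a bivf \<Rightarrow> ('a, 'b) mfd \<Rightarrow> bool" where
  "poisson_submanifold M \<pi> S \<longleftrightarrow> embedded_submanifold M S \<and>
     (\<forall>q\<in>pts S. \<exists>P. restricts_to_bivector M \<pi> S q P)"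

definition restricted_tensor ::
    "('a, 'b::euclidean_space) mfd \<Rightarrow> 'a bivf \<Rightarrow> ('a, 'b) mfd \<Rightarrow> 'a bivf" where
  "restricted_tensor M \<pi> S =
     (\<lambda>q. if q \<in> pts S then THE P. restricts_to_bivector M \<pi> S q P else 0)"

section \<open>The Lie algebroid of a Poisson manifold and its restriction\<close>

definition form_bracket ::
    "('a, 'b::euclidean_space) mfd \<Rightarrow> 'a bivf \<Rightarrow> ('a \<Rightarrow> 'a covec) \<Rightarrow> ('a \<Rightarrow> 'a covec)
      \<Rightarrow> 'a \<Rightarrow> 'a covec" where
  "form_bracket M \<pi> \<alpha> \<beta> = (\<lambda>q v. if q \<in> pts M \<and> v \<in> tangent M q
     then ext_d M \<beta> q (sharp M \<pi> \<alpha> q) v - ext_d M \<alpha> q (sharp M \<pi> \<beta> q) v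
          - v (\<lambda>p. \<alpha> p (sharp M \<pi> \<beta> p))
     else 0)"

text \<open>The anchor \<open>\<Pi>\<^sup>\<natural>|\<^sub>S\<close>, which takes values in \<open>TS\<close> because \<open>S\<close> is a Poisson submanifold.\<close>

definition restricted_anchor ::
    "('a, 'b::euclidean_space) mfd \<Rightarrow> 'a bivf \<Rightarrow> ('a, 'b) mfd \<Rightarrow> ('a \<Rightarrow> 'a covec) \<Rightarrow> 'a \<Rightarrow> 'a tvec" where
  "restricted_anchor M \<pi> S a =
     (\<lambda>q. if q \<in> pts S then THE w. w \<in> tangent S q \<and> push M S w = sharp M \<pi> a q else 0)"

text \<open>Lie algebroid structures on the vector bundle \<open>T\<^sup>*\<^sub>SM\<close> over \<open>S\<close> with anchor \<open>\<rho>\<close>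
  (compatibility of \<open>\<rho>\<close> with the brackets follows from the Leibniz rule).\<close>

definition lie_algebroid_bracket ::
    "('a, 'b::euclidean_space) mfd \<Rightarrow> ('a, 'b) mfd \<Rightarrow> (('a \<Rightarrow> 'a covec) \<Rightarrow> 'a \<Rightarrow> 'a tvec)
      \<Rightarrow> (('a \<Rightarrow> 'a covec) \<Rightarrow> ('a \<Rightarrow> 'a covec) \<Rightarrow> 'a \<Rightarrow> 'a covec) \<Rightarrow> bool" where
  "lie_algebroid_bracket M S \<rho> B \<longleftrightarrow>
    (let \<Gamma> = cotangent_sections M S in
      (\<forall>a\<in>\<Gamma>. \<forall>b\<in>\<Gamma>. B a b \<in> \<Gamma> \<and> B a b = - B b a) \<and>
      (\<forall>a\<in>\<Gamma>. \<forall>b\<in>\<Gamma>. \<forall>c\<in>\<Gamma>. B a (b + c) = B a b + B a c) \<and>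
      (\<forall>r. \<forall>a\<in>\<Gamma>. \<forall>b\<in>\<Gamma>. B a (\<lambda>q v. r * b q v) = (\<lambda>q v. r * B a b q v)) \<and>
      (\<forall>a\<in>\<Gamma>. \<forall>b\<in>\<Gamma>. \<forall>c\<in>\<Gamma>. B a (B b c) + B b (B c a) + B c (B a b) = 0) \<and>
      (\<forall>a\<in>\<Gamma>. \<forall>b\<in>\<Gamma>. \<forall>h\<in>smooth_functions S.
         B a (\<lambda>q v. h q * b q v) = (\<lambda>q v. h q * B a b q v + \<rho> a q h * b q v)))"

text \<open>The bracket of \<open>A\<^sub>S\<close>: the unique Lie algebroid bracket for which restriction of 1-forms is a
  homomorphism.  (If \<open>S\<close> is not closed, restriction of 1-forms need not be surjective, and
  uniqueness relies on the Leibniz rule.)\<close>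

definition AS_bracket ::
    "('a, 'b::euclidean_space) mfd \<Rightarrow> 'a bivf \<Rightarrow> ('a, 'b) mfd
      \<Rightarrow> ('a \<Rightarrow> 'a covec) \<Rightarrow> ('a \<Rightarrow> 'a covec) \<Rightarrow> 'a \<Rightarrow> 'a covec" where
  "AS_bracket M \<pi> S = (THE B. lie_algebroid_bracket M S (restricted_anchor M \<pi> S) B \<and>
     (\<forall>\<alpha>\<in>one_forms M. \<forall>\<beta>\<in>one_forms M.
        B (restrict_to S \<alpha>) (restrict_to S \<beta>) = restrict_to S (form_bracket M \<pi> \<alpha> \<beta>)) \<and>
     (\<forall>a b. \<not> (a \<in> cotangent_sections M S \<and> b \<in> cotangent_sections M S) \<longrightarrow> B a b = 0))"

section \<open>The normal bundle and its dual\<close>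

text \<open>Elements of the quotient \<open>E\<^sub>q = T\<^sub>qM / T\<^sub>qS\<close> are cosets of \<open>T\<^sub>qS\<close>; the projection \<open>\<nu>\<close> sends a
  vector to its coset.\<close>

definition nu :: "('a, 'b::euclidean_space) mfd \<Rightarrow> ('a, 'b) mfd \<Rightarrow> 'a \<Rightarrow> 'a tvec \<Rightarrow> 'a tvec set" where
  "nu M S q v = {v + t | t. t \<in> TS M S q}"

definition normal_space ::
    "('a, 'b::euclidean_space) mfd \<Rightarrow> ('a, 'b) mfd \<Rightarrow> 'a \<Rightarrow> 'a tvec set set" where
  "normal_space M S q = nu M S q ` tangent M q"

text \<open>The dual \<open>E\<^sup>*\<^sub>q\<close>.  Linearity refers to the quotient structure:
  \<open>\<nu>(v) + \<nu>(w) = \<nu>(v + w)\<close> and \<open>c \<nu>(v) = \<nu>(c v)\<close>.\<close>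

definition conormal_space ::
    "('a, 'b::euclidean_space) mfd \<Rightarrow> ('a, 'b) mfd \<Rightarrow> 'a \<Rightarrow> ('a tvec set \<Rightarrow> real) set" where
  "conormal_space M S q = {\<eta>.
     (\<forall>v\<in>tangent M q. \<forall>w\<in>tangent M q. \<eta> (nu M S q (v + w)) = \<eta> (nu M S q v) + \<eta> (nu M S q w)) \<and>
     (\<forall>c. \<forall>v\<in>tangent M q. \<eta> (nu M S q (\<lambda>f. c * v f)) = c * \<eta> (nu M S q v)) \<and>
     (\<forall>z. z \<notin> normal_space M S q \<longrightarrow> \<eta> z = 0)}"

type_synonym 'a conormal_section = "'a \<Rightarrow> 'a tvec set \<Rightarrow> real"

definition conormal_sections ::
    "('a, 'b::euclidean_space) mfd \<Rightarrow> ('a, 'b) mfd \<Rightarrow> 'a conormal_section set" where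
  "conormal_sections M S = {\<eta>. (\<forall>q\<in>pts S. \<eta> q \<in> conormal_space M S q) \<and>
     (\<forall>q. q \<notin> pts S \<longrightarrow> \<eta> q = 0) \<and>
     (\<forall>\<sigma>\<in>tangent_sections M S. (\<lambda>q. \<eta> q (nu M S q (\<sigma> q))) \<in> smooth_functions S)}"

definition nu_star ::
    "('a, 'b::euclidean_space) mfd \<Rightarrow> ('a, 'b) mfd \<Rightarrow> 'a conormal_section \<Rightarrow> 'a \<Rightarrow> 'a covec" where
  "nu_star M S \<eta> = (\<lambda>q v. \<eta> q (nu M S q v))"

definition conormal_bracket ::
    "('a, 'b::euclidean_space) mfd \<Rightarrow> 'a bivf \<Rightarrow> ('a, 'b) mfd
      \<Rightarrow> 'a conormal_section \<Rightarrow> 'a conormal_section \<Rightarrow> 'a conormal_section" where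
  "conormal_bracket M \<pi> S \<eta>1 \<eta>2 = (THE \<theta>. \<theta> \<in> conormal_sections M S \<and>
     nu_star M S \<theta> = AS_bracket M \<pi> S (nu_star M S \<eta>1) (nu_star M S \<eta>2))"

section \<open>Poisson algebras\<close>

record 'p palg =
  pcarrier :: "'p set"
  pscale :: "real \<Rightarrow> 'p \<Rightarrow> 'p"
  pmult :: "'p \<Rightarrow> 'p \<Rightarrow> 'p"
  pbracket :: "'p \<Rightarrow> 'p \<Rightarrow> 'p"

definition poisson_algebra :: "'p::ab_group_add palg \<Rightarrow> bool" where
  "poisson_algebra A \<longleftrightarrow>
    (let C = pcarrier A; s = pscale A; m = pmult A; b = pbracket A in
      0 \<in> C \<and> (\<forall>x\<in>C. \<forall>y\<in>C. x + y \<in> C) \<and> (\<forall>r. \<forall>x\<in>C. s r x \<in> C) \<and>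
      (\<forall>r. \<forall>x\<in>C. \<forall>y\<in>C. s r (x + y) = s r x + s r y) \<and>
      (\<forall>r r'. \<forall>x\<in>C. s (r + r') x = s r x + s r' x \<and> s (r * r') x = s r (s r' x)) \<and>
      (\<forall>x\<in>C. s 1 x = x) \<and>
      (\<forall>x\<in>C. \<forall>y\<in>C. m x y \<in> C \<and> m x y = m y x) \<and>
      (\<forall>x\<in>C. \<forall>y\<in>C. \<forall>z\<in>C. m x (m y z) = m (m x y) z \<and> m x (y + z) = m x y + m x z) \<and>
      (\<forall>r. \<forall>x\<in>C. \<forall>y\<in>C. m x (s r y) = s r (m x y)) \<and>
      (\<forall>x\<in>C. \<forall>y\<in>C. b x y \<in> C \<and> b x y = - b y x) \<and>
      (\<forall>x\<in>C. \<forall>y\<in>C. \<forall>z\<in>C. b x (y + z) = b x y + b x z) \<and>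
      (\<forall>r. \<forall>x\<in>C. \<forall>y\<in>C. b x (s r y) = s r (b x y)) \<and>
      (\<forall>x\<in>C. \<forall>y\<in>C. \<forall>z\<in>C. b x (b y z) + b y (b z x) + b z (b x y) = 0) \<and>
      (\<forall>x\<in>C. \<forall>y\<in>C. \<forall>z\<in>C. b x (m y z) = m (b x y) z + m y (b x z)) \<and>
      (\<forall>x\<in>C. \<forall>y\<in>C. \<forall>z\<in>C. b (m x y) z = m (b x z) y + m x (b y z)))"

definition poisson_hom ::
    "'p::ab_group_add palg \<Rightarrow> 'q::ab_group_add palg \<Rightarrow> ('p \<Rightarrow> 'q) \<Rightarrow> bool" where
  "poisson_hom A B h \<longleftrightarrow>
     (\<forall>x\<in>pcarrier A. h x \<in> pcarrier B) \<and>
     (\<forall>x\<in>pcarrier A. \<forall>y\<in>pcarrier A. h (x + y) = h x + h y \<and>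
        h (pmult A x y) = pmult B (h x) (h y) \<and> h (pbracket A x y) = pbracket B (h x) (h y)) \<and>
     (\<forall>r. \<forall>x\<in>pcarrier A. h (pscale A r x) = pscale B r (h x))"

definition poisson_isomorphic :: "'p::ab_group_add palg \<Rightarrow> 'q::ab_group_add palg \<Rightarrow> bool" where
  "poisson_isomorphic A B \<longleftrightarrow> (\<exists>h. poisson_hom A B h \<and> bij_betw h (pcarrier A) (pcarrier B))"

definition function_algebra ::
    "('a, 'b::euclidean_space) mfd \<Rightarrow> 'a bivf \<Rightarrow> ('a \<Rightarrow> real) palg" where
  "function_algebra S \<pi> = \<lparr> pcarrier = smooth_functions S, pscale = (\<lambda>r f x. r * f x),
     pmult = (\<lambda>f g. f * g), pbracket = fun_bracket S \<pi> \<rparr>"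

text \<open>The pair \<open>(f, \<eta>)\<close> stands for the element \<open>f \<oplus> \<eta>\<close>, that is, for the fiberwise affine function
  on \<open>E\<close> whose value at \<open>z\<close> in \<open>E\<^sub>q\<close> is \<open>f q + \<eta> q z\<close>.  Under this identification the bracket of
  fiberwise linear functions is \<open>conormal_bracket\<close>.\<close>

type_synonym 'a aff_fun = "('a \<Rightarrow> real) \<times> 'a conormal_section"

definition affine_algebra ::
    "('a, 'b::euclidean_space) mfd \<Rightarrow> ('a, 'b) mfd \<Rightarrow> ('a aff_fun \<Rightarrow> 'a aff_fun \<Rightarrow> 'a aff_fun)
      \<Rightarrow> 'a aff_fun palg" where
  "affine_algebra M S br = \<lparr>
     pcarrier = smooth_functions S \<times> conormal_sections M S,
     pscale = (\<lambda>r (f, \<eta>). (\<lambda>q. r * f q, \<lambda>q z. r * \<eta> q z)),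
     pmult = (\<lambda>(f1, \<eta>1) (f2, \<eta>2). (f1 * f2, \<lambda>q z. f1 q * \<eta>2 q z + f2 q * \<eta>1 q z)),
     pbracket = br \<rparr>"

definition infinitesimal_poisson_algebra ::
    "('a, 'b::euclidean_space) mfd \<Rightarrow> 'a bivf \<Rightarrow> ('a, 'b) mfd \<Rightarrow> 'a aff_fun palg \<Rightarrow> bool" where
  "infinitesimal_poisson_algebra M \<pi> S A \<longleftrightarrow>
     A = affine_algebra M S (pbracket A) \<and>
     poisson_algebra A \<and>
     poisson_hom A (function_algebra S (restricted_tensor M \<pi> S)) fst \<and>
     fst ` pcarrier A = smooth_functions S \<and>
     (\<forall>\<eta>1\<in>conormal_sections M S. \<forall>\<eta>2\<in>conormal_sections M S.
        pbracket A (0, \<eta>1) (0, \<eta>2) = (0, conormal_bracket M \<pi> S \<eta>1 \<eta>2))"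

section \<open>Transversals\<close>

text \<open>Smooth subbundles of \<open>T\<^sub>SM\<close>: families of subspaces that locally have smooth frames.\<close>

definition subbundle ::
    "('a, 'b::euclidean_space) mfd \<Rightarrow> ('a, 'b) mfd \<Rightarrow> ('a \<Rightarrow> 'a tvec set) \<Rightarrow> bool" where
  "subbundle M S L \<longleftrightarrow>
     (\<forall>q\<in>pts S. \<exists>W (k::nat) s. openin (mtop S) W \<and> q \<in> W \<and>
        (\<forall>i<k. \<forall>p\<in>W. s i p \<in> tangent M p) \<and>
        (\<forall>i<k. \<forall>f\<in>smooth_functions M. smooth_fun_on S W (\<lambda>p. s i p f)) \<and>
        (\<forall>p\<in>W. L p = {v. \<exists>c. v = (\<lambda>f. \<Sum>i<k. c i * s i p f)}) \<and>
        (\<forall>p\<in>W. \<forall>c. (\<lambda>f. \<Sum>i<k. c i * s i p f) = 0 \<longrightarrow> (\<forall>i<k. c i = 0)))"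

definition transversal ::
    "('a, 'b::euclidean_space) mfd \<Rightarrow> ('a, 'b) mfd \<Rightarrow> ('a \<Rightarrow> 'a tvec set) \<Rightarrow> bool" where
  "transversal M S L \<longleftrightarrow> subbundle M S L \<and>
     (\<forall>q\<in>pts S. tangent M q = {t + l | t l. t \<in> TS M S q \<and> l \<in> L q} \<and> TS M S q \<inter> L q = {0})"

definition rho_proj ::
    "('a, 'b::euclidean_space) mfd \<Rightarrow> ('a, 'b) mfd \<Rightarrow> ('a \<Rightarrow> 'a tvec set)
      \<Rightarrow> ('a \<Rightarrow> 'a covec) \<Rightarrow> 'a \<Rightarrow> 'a covec" where
  "rho_proj M S L a = (\<lambda>q. if q \<in> pts S then
     THE \<zeta>. \<zeta> \<in> annihilator M q (TS M S q) \<and> a q - \<zeta> \<in> annihilator M q (L q) else 0)"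

definition tau ::
    "('a, 'b::euclidean_space) mfd \<Rightarrow> ('a, 'b) mfd \<Rightarrow> ('a \<Rightarrow> 'a tvec set)
      \<Rightarrow> ('a \<Rightarrow> 'a covec) \<Rightarrow> 'a \<Rightarrow> 'a covec" where
  "tau M S L \<alpha> = (\<lambda>q. if q \<in> pts S then
     THE \<xi>. \<xi> \<in> annihilator M q (L q) \<and> pull M S q \<xi> = \<alpha> q else 0)"

definition conn ::
    "('a, 'b::euclidean_space) mfd \<Rightarrow> 'a bivf \<Rightarrow> ('a, 'b) mfd \<Rightarrow> ('a \<Rightarrow> 'a tvec set)
      \<Rightarrow> ('a \<Rightarrow> 'a covec) \<Rightarrow> 'a conormal_section \<Rightarrow> 'a conormal_section" where
  "conn M \<pi> S L \<alpha> \<eta> = (THE \<theta>. \<theta> \<in> conormal_sections M S \<and>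
     nu_star M S \<theta> = AS_bracket M \<pi> S (tau M S L \<alpha>) (nu_star M S \<eta>))"

definition curv ::
    "('a, 'b::euclidean_space) mfd \<Rightarrow> 'a bivf \<Rightarrow> ('a, 'b) mfd \<Rightarrow> ('a \<Rightarrow> 'a tvec set)
      \<Rightarrow> ('a \<Rightarrow> 'a covec) \<Rightarrow> ('a \<Rightarrow> 'a covec) \<Rightarrow> 'a conormal_section" where
  "curv M \<pi> S L \<alpha> \<beta> = (THE \<theta>. \<theta> \<in> conormal_sections M S \<and>
     nu_star M S \<theta> = rho_proj M S L (AS_bracket M \<pi> S (tau M S L \<alpha>) (tau M S L \<beta>)))"

definition transversal_algebra ::
    "('a, 'b::euclidean_space) mfd \<Rightarrow> 'a bivf \<Rightarrow> ('a, 'b) mfd \<Rightarrow> ('a \<Rightarrow> 'a tvec set)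
      \<Rightarrow> 'a aff_fun palg" where
  "transversal_algebra M \<pi> S L = affine_algebra M S (\<lambda>(f1, \<eta>1) (f2, \<eta>2).
     (fun_bracket S (restricted_tensor M \<pi> S) f1 f2,
      conn M \<pi> S L (differential S f1) \<eta>2 - conn M \<pi> S L (differential S f2) \<eta>1
        + conormal_bracket M \<pi> S \<eta>1 \<eta>2
        + curv M \<pi> S L (differential S f1) (differential S f2)))"

end

theory Submission
  imports Defs "HOL-Computational_Algebra.Polynomial"
begin

text \<open>Consider the pairs \<open>(f, a)\<close> of a function \<open>f\<close> on \<open>S\<close> and a section \<open>a\<close> of \<open>T\<^sup>*\<^sub>SM\<close> that restricts to
  \<open>df\<close> on \<open>TS\<close>, with the bracket \<open>({f, g}\<^sub>S, [a, b])\<close>, the second component being the bracket of \<open>A\<^sub>S\<close>.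
  Because restriction \<open>A\<^sub>S \<rightarrow> T\<^sup>*S\<close> is a morphism of Lie algebroids, these pairs form a Poisson algebra.
  A transversal splits \<open>a\<close> uniquely as \<open>\<tau>(df) + \<nu>\<^sup>*\<eta>\<close>, and \<open>(f, \<eta>) \<mapsto> (f, \<tau>(df) + \<nu>\<^sup>*\<eta>)\<close> is an isomorphism
  from \<open>P\<^sub>1\<close> onto this algebra, which does not depend on the transversal.

  The bracket of \<open>A\<^sub>S\<close> is constructed without extending sections to \<open>M\<close>: for a section \<open>\<sigma>\<close> of \<open>T\<^sub>SM\<close>,
  \<open>(f, g) \<mapsto> \<sigma>{f, g} - {f, \<sigma>g}\<^sub>S - {\<sigma>f, g}\<^sub>S\<close> is a biderivation, hence gives a bilinear form \<open>T\<^sub>\<sigma>\<close> on covectors, and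
  \<open>\<langle>[a, b], \<sigma>\<rangle> = \<rho>(a)\<langle>b, \<sigma>\<rangle> - \<rho>(b)\<langle>a, \<sigma>\<rangle> + T\<^sub>\<sigma>(a, b)\<close>.  The Jacobi identity, the compatibility with the
  bracket of 1-forms and uniqueness are identities between tensorial expressions, so that it suffices to check them
  on exact forms.\<close>

section \<open>Smooth functions on open sets\<close>

text \<open>Tangent vectors are derivations of the global functions, so analysis is needed before
  any frame exists: bump functions make derivations local, and Hadamard's lemma shows that chart
  derivatives span them. Frames are used in the form
  \<open>u p * v f = (\<Sum>i<n. v (x i) * X i p f)\<close>, valid at every point thanks to a
  cut-off \<open>u\<close>, so that sections are never restricted to open sets. The obstacle is that
  S need not be closed: functions on S extend to M only near a point, and sections of T*_SM need not
  be restrictions of 1-forms. The formula for the bracket of A_S is the known identity for 1-forms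
  in which the last term is the Lie derivative of \<Pi> along the vector field, evaluated on the two
  forms. On differentials it involves the derivatives of f and g along \<sigma> only through their
  values on S, because S is Poisson. The pairs (f, a) are locally the 1-jets along S of functions on
  M. The functions vanishing on S form a Poisson ideal I, and {I^2, h} lies in I^2 for every h, so
  the bracket of M passes to 1-jets; this is why no transversal enters.\<close>

lemma Ck_on_subset: "Ck_on k U f \<Longrightarrow> V \<subseteq> U \<Longrightarrow> Ck_on k V f"
proof (induction k arbitrary: f)
  case 0
  then show ?case using continuous_on_subset by simp
next
  case (Suc k)
  then show ?case unfolding Ck_on.simps by blast
qed

lemma Ck_on_cong:
  assumes "open U" "\<And>x. x \<in> U \<Longrightarrow> f x = g x" "Ck_on k U f"
  shows "Ck_on k U g"
  using assms(2,3)
proof (induction k arbitrary: f g)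
  case 0
  then show ?case using continuous_on_cong[of U U f g] by simp
next
  case (Suc k)
  have d: "(g has_derivative frechet_derivative f (at x)) (at x)" if "x \<in> U" for x
  proof (rule has_derivative_transform_within_open[OF _ assms(1) that])
    show "(f has_derivative frechet_derivative f (at x)) (at x)"
      using Suc.prems(2) that by (simp add: frechet_derivative_works[symmetric])
  qed (use Suc.prems(1) in auto)
  have "frechet_derivative f (at x) v = frechet_derivative g (at x) v" if "x \<in> U" for x v
    using frechet_derivative_at[OF d[OF that]] by simp
  moreover have "Ck_on k U (\<lambda>x. frechet_derivative f (at x) v)" for v
    using Suc.prems(2) by simp
  ultimately have "Ck_on k U (\<lambda>x. frechet_derivative g (at x) v)" for v
    by (rule Suc.IH)
  then show ?case using d unfolding Ck_on.simps(2) differentiable_def by blast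
qed

text \<open>\<open>frechet_derivative\<close> is defined by choice. Here any explicit family of
  derivatives may be supplied, which is how the closure properties below are proved.\<close>

lemma Ck_on_SucI:
  assumes "open U" "\<And>x. x \<in> U \<Longrightarrow> (f has_derivative f' x) (at x)" "\<And>v. Ck_on k U (\<lambda>x. f' x v)"
  shows "Ck_on (Suc k) U f"
proof -
  have "Ck_on k U (\<lambda>x. frechet_derivative f (at x) v)" for v
    by (rule Ck_on_cong[OF assms(1) _ assms(3)[of v]]) (simp add: frechet_derivative_at[OF assms(2), symmetric])
  then show ?thesis using assms(2) unfolding Ck_on.simps(2) differentiable_def by blast
qed

lemma Ck_on_SucD: "Ck_on (Suc k) U f \<Longrightarrow> Ck_on k U f"
proof (induction k arbitrary: f)
  case 0
  then show ?case by (auto simp: continuous_at_imp_continuous_on differentiable_imp_continuous_within)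
next
  case (Suc k)
  have "Ck_on k U (\<lambda>x. frechet_derivative f (at x) v)" for v
    by (rule Suc.IH) (use Suc.prems Ck_on.simps(2)[of "Suc k" U f] in blast)
  then show ?case using Suc.prems Ck_on.simps(2) by blast
qed

lemma Ck_on_has_derivative:
  "Ck_on (Suc k) U f \<Longrightarrow> x \<in> U \<Longrightarrow> (f has_derivative frechet_derivative f (at x)) (at x)"
  by (simp add: frechet_derivative_works[symmetric])

lemma Ck_on_SucD_deriv: "Ck_on (Suc k) U f \<Longrightarrow> Ck_on k U (\<lambda>x. frechet_derivative f (at x) v)"
  by simp

lemma Ck_on_const: "open U \<Longrightarrow> Ck_on k U (\<lambda>x. c)"
proof (induction k arbitrary: c)
  case (Suc k)
  show ?case
    by (rule Ck_on_SucI[where f' = "\<lambda>x v. 0"]) (use Suc in auto)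
qed simp

lemma Ck_on_add:
  assumes "open U"
  shows "Ck_on k U f \<Longrightarrow> Ck_on k U g \<Longrightarrow> Ck_on k U (\<lambda>x. f x + g x)"
proof (induction k arbitrary: f g)
  case 0
  then show ?case by (simp add: continuous_on_add)
next
  case (Suc k)
  show ?case
  proof (rule Ck_on_SucI[OF assms])
    fix x assume "x \<in> U"
    then show "((\<lambda>x. f x + g x) has_derivative
      (\<lambda>v. frechet_derivative f (at x) v + frechet_derivative g (at x) v)) (at x)"
      by (intro has_derivative_add Ck_on_has_derivative[OF Suc.prems(1)] Ck_on_has_derivative[OF Suc.prems(2)])
  next
    show "Ck_on k U (\<lambda>x. frechet_derivative f (at x) v + frechet_derivative g (at x) v)" for v
      by (intro Suc.IH Ck_on_SucD_deriv Suc.prems)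
  qed
qed

lemma Ck_on_sum:
  "open U \<Longrightarrow> (\<And>i. i \<in> I \<Longrightarrow> Ck_on k U (f i)) \<Longrightarrow> Ck_on k U (\<lambda>x. \<Sum>i\<in>I. f i x)"
  by (induction I rule: infinite_finite_induct) (simp_all add: Ck_on_add Ck_on_const)

lemma Ck_on_bilinear:
  assumes "open U" "bounded_bilinear m"
  shows "Ck_on k U f \<Longrightarrow> Ck_on k U g \<Longrightarrow> Ck_on k U (\<lambda>x. m (f x) (g x))"
proof (induction k arbitrary: f g)
  case 0
  then show ?case using assms(2) by (simp add: bounded_bilinear.continuous_on)
next
  case (Suc k)
  show ?case
  proof (rule Ck_on_SucI[OF assms(1)])
    fix x assume "x \<in> U"
    then show "((\<lambda>x. m (f x) (g x)) has_derivative
      (\<lambda>v. m (f x) (frechet_derivative g (at x) v) + m (frechet_derivative f (at x) v) (g x))) (at x)"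
      by (intro bounded_bilinear.FDERIV[OF assms(2)] Ck_on_has_derivative[OF Suc.prems(1)]
          Ck_on_has_derivative[OF Suc.prems(2)])
  next
    show "Ck_on k U (\<lambda>x. m (f x) (frechet_derivative g (at x) v) +
        m (frechet_derivative f (at x) v) (g x))" for v
      by (intro Ck_on_add[OF assms(1)] Suc.IH Ck_on_SucD[OF Suc.prems(1)] Ck_on_SucD[OF Suc.prems(2)]
          Ck_on_SucD_deriv[OF Suc.prems(1)] Ck_on_SucD_deriv[OF Suc.prems(2)])
  qed
qed

lemma Ck_on_bounded_linear:
  assumes "open U" "bounded_linear h"
  shows "Ck_on k U h"
proof (cases k)
  case 0
  then show ?thesis using assms linear_continuous_on by auto
next
  case (Suc n)
  show ?thesis unfolding Suc
    by (rule Ck_on_SucI[OF assms(1), where f' = "\<lambda>x. h"])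
      (simp_all add: assms bounded_linear_imp_has_derivative Ck_on_const)
qed

lemma Ck_on_compose:
  assumes "open U" "open V" "\<And>x. x \<in> U \<Longrightarrow> f x \<in> V"
  shows "Ck_on k V g \<Longrightarrow> Ck_on k U f \<Longrightarrow> Ck_on k U (\<lambda>x. g (f x))"
proof (induction k arbitrary: g)
  case 0
  then show ?case using assms(3) by (auto intro: continuous_on_compose2)
next
  case (Suc k)
  show ?case
  proof (rule Ck_on_SucI[OF assms(1)])
    fix x assume x: "x \<in> U"
    let ?g' = "frechet_derivative g (at (f x))"
    have g: "(g has_derivative ?g') (at (f x))"
      using Suc.prems(1) assms(3) x by (intro Ck_on_has_derivative)
    have f: "(f has_derivative frechet_derivative f (at x)) (at x)"
      using Suc.prems(2) x by (intro Ck_on_has_derivative)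
    have l: "linear ?g'" using g has_derivative_linear by blast
    \<comment> \<open>\<open>Ck_on\<close> controls derivatives in a fixed direction, while the
      chain rule evaluates \<open>?g'\<close> in the direction
      \<open>frechet_derivative f (at x) v\<close>, which moves with \<open>x\<close>. Expanding in
      the basis separates the two dependences.\<close>
    have "?g' w = (\<Sum>b\<in>Basis. (w \<bullet> b) *\<^sub>R ?g' b)" for w
    proof -
      have "?g' w = ?g' (\<Sum>b\<in>Basis. (w \<bullet> b) *\<^sub>R b)" by (simp only: euclidean_representation)
      then show ?thesis by (simp only: linear_sum[OF l] linear_scale[OF l])
    qed
    then have "(\<lambda>v. ?g' (frechet_derivative f (at x) v)) =
        (\<lambda>v. \<Sum>b\<in>Basis. (frechet_derivative f (at x) v \<bullet> b) *\<^sub>R ?g' b)"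
      by (rule ext)
    then show "((\<lambda>x. g (f x)) has_derivative
        (\<lambda>v. \<Sum>b\<in>Basis. (frechet_derivative f (at x) v \<bullet> b) *\<^sub>R ?g' b)) (at x)"
      using has_derivative_compose[OF f g] by simp
  next
    fix v
    have f: "Ck_on k U f" using Suc.prems(2) by (rule Ck_on_SucD)
    have f': "Ck_on k U (\<lambda>x. frechet_derivative f (at x) v)" using Suc.prems by simp
    have g: "Ck_on k U (\<lambda>x. frechet_derivative g (at (f x)) b)" for b
      by (rule Suc.IH[OF _ f]) (use Suc.prems in simp)
    show "Ck_on k U (\<lambda>x. \<Sum>b\<in>Basis. (frechet_derivative f (at x) v \<bullet> b) *\<^sub>R
        frechet_derivative g (at (f x)) b)"
      by (intro Ck_on_sum Ck_on_bilinear[OF assms(1) bounded_bilinear_scaleR]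
          Ck_on_bilinear[OF assms(1) bounded_bilinear_inner] g f' assms(1) Ck_on_const)
  qed
qed

lemma Ck_on_inverse: "Ck_on k (-{0::real}) inverse"
proof (induction k)
  case 0
  then show ?case by (auto intro!: continuous_intros)
next
  case (Suc k)
  show ?case
  proof (rule Ck_on_SucI)
    fix x :: real assume "x \<in> -{0}"
    then show "(inverse has_derivative (\<lambda>v. - (inverse x * v * inverse x))) (at x)"
      by (intro has_derivative_inverse') simp
  next
    fix v :: real
    have "Ck_on k (-{0}) (\<lambda>x::real. (- v) * (inverse x * inverse x))"
      by (intro Ck_on_bilinear[OF _ bounded_bilinear_mult] Suc Ck_on_const) auto
    then show "Ck_on k (-{0}) (\<lambda>x::real. - (inverse x * v * inverse x))"
      by (simp add: algebra_simps)
  qed auto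
qed

section \<open>Maps of class C^k for every k\<close>

definition Cinf_on :: "'b::euclidean_space set \<Rightarrow> ('b \<Rightarrow> 'c::euclidean_space) \<Rightarrow> bool" where
  "Cinf_on U f \<longleftrightarrow> (\<forall>k. Ck_on k U f)"

lemma Cinf_on_deriv: "Cinf_on U f \<Longrightarrow> Cinf_on U (\<lambda>x. frechet_derivative f (at x) v)"
  unfolding Cinf_on_def using Ck_on.simps(2) by blast

lemma Cinf_on_has_derivative:
  "Cinf_on U f \<Longrightarrow> x \<in> U \<Longrightarrow> (f has_derivative frechet_derivative f (at x)) (at x)"
  unfolding Cinf_on_def by (blast intro: Ck_on_has_derivative)

lemma Cinf_on_continuous: "Cinf_on U f \<Longrightarrow> continuous_on U f"
  unfolding Cinf_on_def using Ck_on.simps(1) by blast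

lemma Cinf_on_subset: "Cinf_on U f \<Longrightarrow> V \<subseteq> U \<Longrightarrow> Cinf_on V f"
  unfolding Cinf_on_def by (blast intro: Ck_on_subset)

lemma Cinf_on_const: "open U \<Longrightarrow> Cinf_on U (\<lambda>x. c)"
  unfolding Cinf_on_def by (blast intro: Ck_on_const)

lemma Cinf_on_bounded_linear: "open U \<Longrightarrow> bounded_linear h \<Longrightarrow> Cinf_on U h"
  unfolding Cinf_on_def by (blast intro: Ck_on_bounded_linear)

lemma Cinf_on_add: "open U \<Longrightarrow> Cinf_on U f \<Longrightarrow> Cinf_on U g \<Longrightarrow> Cinf_on U (\<lambda>x. f x + g x)"
  unfolding Cinf_on_def by (blast intro: Ck_on_add)

lemma Cinf_on_bilinear:
  "open U \<Longrightarrow> bounded_bilinear m \<Longrightarrow> Cinf_on U f \<Longrightarrow> Cinf_on U g \<Longrightarrow> Cinf_on U (\<lambda>x. m (f x) (g x))"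
  unfolding Cinf_on_def by (blast intro: Ck_on_bilinear)

lemma Cinf_on_mult:
  fixes f g :: "'b::euclidean_space \<Rightarrow> real"
  shows "open U \<Longrightarrow> Cinf_on U f \<Longrightarrow> Cinf_on U g \<Longrightarrow> Cinf_on U (\<lambda>x. f x * g x)"
  by (rule Cinf_on_bilinear[OF _ bounded_bilinear_mult])

lemma Cinf_on_compose:
  "open U \<Longrightarrow> open V \<Longrightarrow> (\<And>x. x \<in> U \<Longrightarrow> f x \<in> V) \<Longrightarrow> Cinf_on V g \<Longrightarrow> Cinf_on U f \<Longrightarrow>
    Cinf_on U (\<lambda>x. g (f x))"
  unfolding Cinf_on_def using Ck_on_compose[of U V f _ g] by blast

lemma Cinf_on_inverse:
  fixes f :: "'b::euclidean_space \<Rightarrow> real"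
  assumes "open U" "Cinf_on U f" "\<And>x. x \<in> U \<Longrightarrow> f x \<noteq> 0"
  shows "Cinf_on U (\<lambda>x. inverse (f x))"
  by (rule Cinf_on_compose[where V = "-{0}"]) (use assms Ck_on_inverse in \<open>auto simp: Cinf_on_def\<close>)

text \<open>All derivatives of the flat function \<open>exp (-1/t)\<close> have the form below, with a polynomial \<open>p\<close>.\<close>

definition flat :: "real poly \<Rightarrow> real \<Rightarrow> real" where
  "flat p t = (if t > 0 then poly p (inverse t) * exp (- inverse t) else 0)"

text \<open>The growth estimate behind flatness: with s = 1/t it gives the right-hand limit of
  \<open>flat\<close> at 0.\<close>

lemma poly_over_exp: "((\<lambda>s. poly p s * exp (- s)) \<longlongrightarrow> 0) (at_top :: real filter)"
proof -
  have "((\<lambda>s::real. \<Sum>i\<le>degree p. coeff p i * (s ^ i / exp s)) \<longlongrightarrow> (\<Sum>i\<le>degree p. coeff p i * 0)) at_top"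
    by (intro tendsto_intros tendsto_power_div_exp_0)
  moreover have "(\<Sum>i\<le>degree p. coeff p i * (s ^ i / exp s)) = poly p s * exp (- s)" for s :: real
    by (simp add: poly_altdef sum_distrib_right exp_minus divide_inverse mult.assoc)
  ultimately show ?thesis by simp
qed

lemma flat_tendsto_0: "((\<lambda>t. flat p t) \<longlongrightarrow> 0) (at 0)"
proof (rule filterlim_split_at)
  show "(flat p \<longlongrightarrow> 0) (at_left 0)"
    by (rule tendsto_eventually) (auto simp: flat_def eventually_at_filter)
  have "((\<lambda>t. poly p (inverse t) * exp (- inverse t)) \<longlongrightarrow> 0) (at_right (0::real))"
    using filterlim_compose[OF poly_over_exp filterlim_inverse_at_top_right] .
  then show "(flat p \<longlongrightarrow> 0) (at_right 0)"
    by (rule Lim_transform_eventually) (auto simp: flat_def eventually_at_filter)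
qed

text \<open>With s = 1/t one has ds/dt = -s^2, so the derivative of p(s) exp(-s) is s^2 (p - p')(s)
  exp(-s); the factor \<open>[:0, 0, 1:]\<close> is s^2.\<close>

definition flat_deriv :: "real poly \<Rightarrow> real poly" where
  "flat_deriv p = [:0, 0, 1:] * (p - pderiv p)"

lemma has_field_derivative_flat: "(flat p has_field_derivative flat (flat_deriv p) t) (at t)"
proof -
  consider "t > 0" | "t < 0" | "t = 0" by linarith
  then show ?thesis
  proof cases
    case 1
    have "((\<lambda>t. poly p (inverse t) * exp (- inverse t)) has_field_derivative
      flat (flat_deriv p) t) (at t)"
      using 1 by (auto intro!: derivative_eq_intros DERIV_chain2[OF poly_DERIV]
          simp: flat_def flat_deriv_def algebra_simps power2_eq_square)
    then show ?thesis
      by (rule has_field_derivative_transform_within_open[where S = "{0<..}"]) (use 1 in \<open>auto simp: flat_def\<close>)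
  next
    case 2
    have "((\<lambda>t. 0) has_field_derivative flat (flat_deriv p) t) (at t)"
      using 2 by (simp add: flat_def)
    then show ?thesis
      by (rule has_field_derivative_transform_within_open[where S = "{..<0}"]) (use 2 in \<open>auto simp: flat_def\<close>)
  next
    case 3
    \<comment> \<open>The difference quotient at 0 is again of the form \<open>flat\<close>, with
      the polynomial multiplied by s = 1/t.\<close>
    have "flat p t / t = flat ([:0, 1:] * p) t" for t by (simp add: flat_def field_simps)
    then have "((\<lambda>t. flat p t / t) \<longlongrightarrow> 0) (at 0)" using flat_tendsto_0 by simp
    then show ?thesis unfolding 3 has_field_derivative_iff by (simp add: flat_def)
  qed
qed

lemma Cinf_on_flat: "Cinf_on UNIV (flat p)"
proof -
  have "Ck_on k UNIV (flat p)" for k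
  proof (induction k arbitrary: p)
    case 0
    then show ?case
      by (auto intro!: continuous_at_imp_continuous_on DERIV_isCont has_field_derivative_flat)
  next
    case (Suc k)
    show ?case
    proof (rule Ck_on_SucI)
      show "(flat p has_derivative (\<lambda>v. flat (flat_deriv p) x * v)) (at x)" for x
        using has_field_derivative_flat[of p x] by (simp add: has_field_derivative_def)
      show "Ck_on k UNIV (\<lambda>x. flat (flat_deriv p) x * v)" for v
        by (intro Ck_on_bilinear[OF _ bounded_bilinear_mult] Suc Ck_on_const) auto
    qed auto
  qed
  then show ?thesis by (simp add: Cinf_on_def)
qed

text \<open>The quotient a / (a + b), where a is positive exactly inside the ball of radius r and b
  exactly outside the closed ball of radius r/2, so that a + b never vanishes. The squared distance
  \<open>N\<close> keeps everything smooth at the centre.\<close>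

lemma smooth_bump:
  fixes c :: "'b::euclidean_space"
  assumes "r > 0"
  obtains u :: "'b \<Rightarrow> real" where "Cinf_on UNIV u" "\<And>y. dist c y < r / 2 \<Longrightarrow> u y = 1"
    "\<And>y. dist c y \<ge> r \<Longrightarrow> u y = 0"
proof -
  define g where "g = flat 1"
  have g: "Cinf_on UNIV g" "g t \<ge> 0" "g t > 0 \<longleftrightarrow> t > 0" "t \<le> 0 \<Longrightarrow> g t = 0" for t
    using Cinf_on_flat by (auto simp: g_def flat_def)
  define N where "N = (\<lambda>y. (y - c) \<bullet> (y - c))"
  have lin: "Cinf_on UNIV (\<lambda>y. y - c)"
    using Cinf_on_add[OF _ Cinf_on_bounded_linear[OF _ bounded_linear_ident] Cinf_on_const[of UNIV "- c"]]
    by auto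
  have N: "Cinf_on UNIV N" unfolding N_def
    by (intro Cinf_on_bilinear[OF _ bounded_bilinear_inner] lin) auto
  define a where "a = (\<lambda>y. g (r\<^sup>2 - N y))"
  define b where "b = (\<lambda>y. g (N y - (r/2)\<^sup>2))"
  have "Cinf_on UNIV (\<lambda>y. r\<^sup>2 + (- 1) * N y)"
    by (intro Cinf_on_add Cinf_on_mult Cinf_on_const N) auto
  then have a: "Cinf_on UNIV a" unfolding a_def
    by (intro Cinf_on_compose[OF _ _ _ g(1)]) auto
  have "Cinf_on UNIV (\<lambda>y. N y + (- (r/2)\<^sup>2))"
    by (intro Cinf_on_add Cinf_on_mult Cinf_on_const N) auto
  then have b: "Cinf_on UNIV b" unfolding b_def
    by (intro Cinf_on_compose[OF _ _ _ g(1)]) auto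
  have Nd: "N y = (dist c y)\<^sup>2" for y
    by (simp add: N_def power2_norm_eq_inner[symmetric] dist_norm norm_minus_commute)
  have pos: "a y + b y \<noteq> 0" for y
  proof -
    have "(r/2)\<^sup>2 < r\<^sup>2" using assms by (simp add: power2_eq_square)
    then have "r\<^sup>2 - N y > 0 \<or> N y - (r/2)\<^sup>2 > 0" by linarith
    then have "a y > 0 \<or> b y > 0" unfolding a_def b_def using g(3) by blast
    moreover have "a y \<ge> 0" "b y \<ge> 0" unfolding a_def b_def using g(2) by auto
    ultimately show ?thesis by linarith
  qed
  show ?thesis
  proof (rule that[of "\<lambda>y. a y * inverse (a y + b y)"])
    show "Cinf_on UNIV (\<lambda>y. a y * inverse (a y + b y))"
      by (intro Cinf_on_mult Cinf_on_inverse Cinf_on_add a b pos) auto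
  next
    fix y assume "dist c y < r / 2"
    then have "N y \<le> (r/2)\<^sup>2" unfolding Nd by (intro power_mono) auto
    then have "b y = 0" unfolding b_def by (intro g(4)) simp
    then show "a y * inverse (a y + b y) = 1" using pos[of y] by simp
  next
    fix y assume "r \<le> dist c y"
    then have "N y \<ge> r\<^sup>2" unfolding Nd using assms by (intro power_mono) auto
    then have "a y = 0" unfolding a_def by (intro g(4)) simp
    then show "a y * inverse (a y + b y) = 0" by simp
  qed
qed

text \<open>Differentiation under the integral sign produces a factor t. The induction on
  \<open>k\<close> therefore needs an arbitrary continuous weight \<open>h\<close>, which becomes
  \<open>h t * t\<close> in the step.\<close>

lemma Ck_on_segment_integral:
  fixes F :: "'b::euclidean_space \<Rightarrow> real" and h :: "real \<Rightarrow> real"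
  assumes "\<And>k. Ck_on k (ball c r) F" "continuous_on {0..1} h"
  shows "Ck_on k (ball c r) (\<lambda>y. integral {0..1} (\<lambda>t. h t * F (c + t *\<^sub>R (y - c))))"
proof -
  have seg: "c + t *\<^sub>R (y - c) \<in> ball c r" if "y \<in> ball c r" "t \<in> {0..1}" for t y
  proof -
    have "c + t *\<^sub>R (y - c) = (1 - t) *\<^sub>R c + t *\<^sub>R y" by (simp add: algebra_simps)
    moreover have "c \<in> ball c r" using that(1) by (metis centre_in_ball dist_nz mem_ball le_less_trans zero_le_dist)
    ultimately show ?thesis
      using that convex_ball[of c r] by (simp add: convex_alt)
  qed
  have cont: "continuous_on (ball c r \<times> cbox 0 1) (\<lambda>(y, t). h t * F (c + t *\<^sub>R (y - c)))"
    if "continuous_on (ball c r) F" "continuous_on {0..1} h" for F h :: "_ \<Rightarrow> real"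
  proof -
    have "continuous_on (ball c r \<times> cbox 0 1) (\<lambda>p. h (snd p) * F (c + snd p *\<^sub>R (fst p - c)))"
      by (intro continuous_intros continuous_on_compose2[OF that(1)] continuous_on_compose2[OF that(2)])
        (use seg in auto)
    then show ?thesis by (simp add: case_prod_beta')
  qed
  show ?thesis
    using assms
  proof (induction k arbitrary: F h)
    case 0
    have "continuous_on (ball c r) F" using 0(1)[of 0] by simp
    then have "continuous_on (ball c r) (\<lambda>y. integral (cbox 0 1) (\<lambda>t. h t * F (c + t *\<^sub>R (y - c))))"
      by (intro integral_continuous_on_param cont 0(2))
    then show ?case by simp
  next
    case (Suc k)
    define F' where "F' = (\<lambda>y. frechet_derivative F (at y))"
    have F': "Ck_on k (ball c r) (\<lambda>y. F' y v)" for k v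
      using Suc.prems(1)[of "Suc k"] unfolding F'_def by simp
    have dF: "(F has_derivative F' y) (at y)" if "y \<in> ball c r" for y
      using Ck_on_has_derivative[OF Suc.prems(1) that] unfolding F'_def .
    have bl: "bounded_linear (F' y)" if "y \<in> ball c r" for y
      using dF[OF that] has_derivative_bounded_linear by blast
    \<comment> \<open>\<open>leibniz_rule\<close> asks for a derivative with values in the bounded
      linear maps, jointly continuous in y and t. Written in the basis, its continuity reduces to
      that of scalar coefficients.\<close>
    define D where "D = (\<lambda>y t. \<Sum>b\<in>Basis. (h t * (t * F' (c + t *\<^sub>R (y - c)) b)) *\<^sub>R blinfun_inner_left b)"
    have D: "blinfun_apply (D y t) v = h t * F' (c + t *\<^sub>R (y - c)) (t *\<^sub>R v)"
      if "y \<in> ball c r" "t \<in> {0..1}" for y t v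
    proof -
      interpret bounded_linear "F' (c + t *\<^sub>R (y - c))" using bl seg that by blast
      let ?z = "c + t *\<^sub>R (y - c)"
      have "blinfun_apply (D y t) v = (\<Sum>b\<in>Basis. (h t * (t * F' ?z b)) * (v \<bullet> b))"
        by (simp add: D_def blinfun.sum_left blinfun.scaleR_left)
      also have "\<dots> = h t * (t * (\<Sum>b\<in>Basis. (v \<bullet> b) * F' ?z b))"
        by (simp only: sum_distrib_left mult_ac)
      also have "(\<Sum>b\<in>Basis. (v \<bullet> b) * F' ?z b) = F' ?z (\<Sum>b\<in>Basis. (v \<bullet> b) *\<^sub>R b)"
        by (simp only: sum scaleR real_scaleR_def)
      also have "(\<Sum>b\<in>Basis. (v \<bullet> b) *\<^sub>R b) = v"
        using euclidean_representation[of v] by simp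
      finally show ?thesis by (simp add: scaleR)
    qed
    have Dcont: "continuous_on (ball c r \<times> cbox 0 1) (\<lambda>(y, t). D y t)"
    proof -
      have "continuous_on (ball c r \<times> cbox 0 1) (\<lambda>(y, t). (h t * t) * F' (c + t *\<^sub>R (y - c)) b)" for b
        by (intro cont) (use F'[of 0 b] Suc.prems in \<open>auto intro!: continuous_intros\<close>)
      then show ?thesis
        unfolding D_def case_prod_beta' mult.assoc
        by (intro continuous_on_sum continuous_on_scaleR continuous_on_const)
    qed
    have Fc: "continuous_on (ball c r) F" using Suc.prems(1)[of 0] by simp
    show ?case
    proof (rule Ck_on_SucI)
      fix y assume y: "y \<in> ball c r"
      have "((\<lambda>y. integral (cbox 0 1) (\<lambda>t. h t * F (c + t *\<^sub>R (y - c)))) has_derivative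
          blinfun_apply (integral (cbox 0 1) (D y))) (at y within ball c r)"
      proof (rule leibniz_rule)
        fix z t assume z: "z \<in> ball c r" "t \<in> cbox 0 (1::real)"
        have "((\<lambda>y. c + t *\<^sub>R (y - c)) has_derivative (\<lambda>v. t *\<^sub>R v)) (at z within ball c r)"
          by (auto intro!: derivative_eq_intros)
        from has_derivative_compose[OF this dF] seg z
        have "((\<lambda>y. h t * F (c + t *\<^sub>R (y - c))) has_derivative
            (\<lambda>v. h t * F' (c + t *\<^sub>R (z - c)) (t *\<^sub>R v))) (at z within ball c r)"
          by (intro has_derivative_mult_right) auto
        moreover have "(\<lambda>v. h t * F' (c + t *\<^sub>R (z - c)) (t *\<^sub>R v)) = blinfun_apply (D z t)"
          by (rule ext) (use D z in auto)
        ultimately show "((\<lambda>y. h t * F (c + t *\<^sub>R (y - c))) has_derivative blinfun_apply (D z t))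
            (at z within ball c r)"
          by simp
      next
        fix z assume "z \<in> ball c r"
        then have "(\<lambda>t. (z, t)) ` cbox 0 1 \<subseteq> ball c r \<times> cbox 0 1" by blast
        from continuous_on_compose2[OF cont[OF Fc Suc.prems(2)] _ this]
        have "continuous_on (cbox 0 1) (\<lambda>t. h t * F (c + t *\<^sub>R (z - c)))"
          unfolding prod.case by (simp only: continuous_on_Pair continuous_on_const continuous_on_id)
        then show "(\<lambda>t. h t * F (c + t *\<^sub>R (z - c))) integrable_on cbox 0 1"
          by (rule integrable_continuous)
      qed (rule Dcont, rule y, rule convex_ball)
      then have *: "((\<lambda>y. integral {0..1} (\<lambda>t. h t * F (c + t *\<^sub>R (y - c)))) has_derivative
          blinfun_apply (integral {0..1} (D y))) (at y)"
        unfolding at_within_open[OF y open_ball] cbox_interval .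
      have "blinfun_apply (integral {0..1} (D y)) v = integral {0..1} (\<lambda>t. (h t * t) * F' (c + t *\<^sub>R (y - c)) v)" for v
      proof -
        have "(\<lambda>t. (y, t)) ` cbox 0 1 \<subseteq> ball c r \<times> cbox 0 1" using y by blast
        from continuous_on_compose2[OF Dcont _ this] have "continuous_on (cbox 0 1) (D y)"
          unfolding prod.case by (simp only: continuous_on_Pair continuous_on_const continuous_on_id)
        then have "D y integrable_on cbox 0 1" by (rule integrable_continuous)
        then have "blinfun_apply (integral (cbox 0 1) (D y)) v = integral (cbox 0 1) (\<lambda>t. blinfun_apply (D y t) v)"
          by (rule blinfun_apply_integral)
        also have "\<dots> = integral (cbox 0 1) (\<lambda>t. (h t * t) * F' (c + t *\<^sub>R (y - c)) v)"
        proof (rule integral_cong)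
          fix t :: real assume t: "t \<in> cbox 0 1"
          then have "linear (F' (c + t *\<^sub>R (y - c)))" using bl seg y bounded_linear.linear by auto
          then show "blinfun_apply (D y t) v = (h t * t) * F' (c + t *\<^sub>R (y - c)) v"
            using t D[OF y] by (simp add: linear_scale)
        qed
        finally show ?thesis by simp
      qed
      then have "blinfun_apply (integral {0..1} (D y)) =
          (\<lambda>v. integral {0..1} (\<lambda>t. (h t * t) * F' (c + t *\<^sub>R (y - c)) v))"
        by (rule ext)
      with * show "((\<lambda>y. integral {0..1} (\<lambda>t. h t * F (c + t *\<^sub>R (y - c)))) has_derivative
          (\<lambda>v. integral {0..1} (\<lambda>t. (h t * t) * F' (c + t *\<^sub>R (y - c)) v))) (at y)"
        by simp
    next
      show "Ck_on k (ball c r) (\<lambda>y. integral {0..1} (\<lambda>t. (h t * t) * F' (c + t *\<^sub>R (y - c)) v))" for v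
        by (rule Suc.IH[OF F']) (rule continuous_on_mult[OF Suc.prems(2) continuous_on_id])
    qed (rule open_ball)
  qed
qed

text \<open>The factors \<open>g e\<close> are the averages of the partial derivatives of G along
  the segment from c to y. The set \<open>E\<close> is arbitrary because charts take values in a
  subspace: there a displacement is expanded in an orthonormal basis of the model space rather than
  in \<open>Basis\<close>.\<close>

lemma hadamard:
  fixes G :: "'b::euclidean_space \<Rightarrow> real"
  assumes "Cinf_on (ball c r) G" "r > 0"
  obtains g where "\<And>e. Cinf_on (ball c r) (g e)" "\<And>e. g e c = frechet_derivative G (at c) e"
    "\<And>E y. finite E \<Longrightarrow> y \<in> ball c r \<Longrightarrow> y - c = (\<Sum>e\<in>E. ((y - c) \<bullet> e) *\<^sub>R e) \<Longrightarrow>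
        G y = G c + (\<Sum>e\<in>E. ((y - c) \<bullet> e) * g e y)"
proof -
  define G' where "G' = (\<lambda>y. frechet_derivative G (at y))"
  define g where "g = (\<lambda>e y. integral {0..1} (\<lambda>t. 1 * G' (c + t *\<^sub>R (y - c)) e))"
  have G': "Cinf_on (ball c r) (\<lambda>y. G' y e)" for e
    unfolding G'_def by (rule Cinf_on_deriv[OF assms(1)])
  have d: "(G has_derivative G' y) (at y)" if "y \<in> ball c r" for y
    unfolding G'_def by (rule Cinf_on_has_derivative[OF assms(1) that])
  show ?thesis
  proof (rule that[of g])
    show "Cinf_on (ball c r) (g e)" for e
      unfolding g_def Cinf_on_def
      by (intro allI Ck_on_segment_integral) (use G' in \<open>auto simp: Cinf_on_def\<close>)
    show "g e c = frechet_derivative G (at c) e" for e by (simp add: g_def G'_def)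
  next
    fix E y assume E: "finite E" and y: "y \<in> ball c r" and rep: "y - c = (\<Sum>e\<in>E. ((y - c) \<bullet> e) *\<^sub>R e)"
    have seg: "c + t *\<^sub>R (y - c) \<in> ball c r" if "t \<in> {0..1}" for t
    proof -
      have "c + t *\<^sub>R (y - c) = (1 - t) *\<^sub>R c + t *\<^sub>R y" by (simp add: algebra_simps)
      then show ?thesis
        using that y assms(2) convex_ball[of c r] by (simp add: convex_alt)
    qed
    have "((\<lambda>t. G' (c + t *\<^sub>R (y - c)) (y - c)) has_integral
        G (c + 1 *\<^sub>R (y - c)) - G (c + 0 *\<^sub>R (y - c))) {0..1}"
    proof (rule fundamental_theorem_of_calculus)
      fix t :: real assume t: "t \<in> {0..1}"
      have "((\<lambda>t. c + t *\<^sub>R (y - c)) has_derivative (\<lambda>s. s *\<^sub>R (y - c))) (at t within {0..1})"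
        by (auto intro!: derivative_eq_intros)
      from has_derivative_compose[OF this d[OF seg[OF t]]]
      have "((\<lambda>t. G (c + t *\<^sub>R (y - c))) has_derivative (\<lambda>s. G' (c + t *\<^sub>R (y - c)) (s *\<^sub>R (y - c)))) (at t within {0..1})" .
      moreover have "linear (G' (c + t *\<^sub>R (y - c)))" using d[OF seg[OF t]] has_derivative_linear by blast
      ultimately show "((\<lambda>t. G (c + t *\<^sub>R (y - c))) has_vector_derivative G' (c + t *\<^sub>R (y - c)) (y - c)) (at t within {0..1})"
        by (simp add: has_vector_derivative_def linear_scale)
    qed simp
    then have "G y - G c = integral {0..1} (\<lambda>t. G' (c + t *\<^sub>R (y - c)) (y - c))"
      by (simp add: integral_unique)
    also have "\<dots> = integral {0..1} (\<lambda>t. \<Sum>e\<in>E. ((y - c) \<bullet> e) * G' (c + t *\<^sub>R (y - c)) e)"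
    proof (rule integral_cong)
      fix t :: real assume "t \<in> {0..1}"
      then have l: "linear (G' (c + t *\<^sub>R (y - c)))" using d[OF seg] has_derivative_linear by blast
      show "G' (c + t *\<^sub>R (y - c)) (y - c) = (\<Sum>e\<in>E. ((y - c) \<bullet> e) * G' (c + t *\<^sub>R (y - c)) e)"
        by (subst (2) rep) (simp add: linear_sum[OF l] linear_scale[OF l])
    qed
    also have "\<dots> = (\<Sum>e\<in>E. integral {0..1} (\<lambda>t. ((y - c) \<bullet> e) * G' (c + t *\<^sub>R (y - c)) e))"
    proof (rule integral_sum[OF E])
      fix e
      have "continuous_on {0..1} (\<lambda>t. G' (c + t *\<^sub>R (y - c)) e)"
        by (rule continuous_on_compose2[OF Cinf_on_continuous[OF G']]) (use seg in \<open>auto intro!: continuous_intros\<close>)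
      then show "(\<lambda>t. ((y - c) \<bullet> e) * G' (c + t *\<^sub>R (y - c)) e) integrable_on {0..1}"
        by (intro integrable_continuous_interval continuous_intros)
    qed
    also have "\<dots> = (\<Sum>e\<in>E. ((y - c) \<bullet> e) * g e y)"
      by (simp add: g_def)
    finally show "G y = G c + (\<Sum>e\<in>E. ((y - c) \<bullet> e) * g e y)" by simp
  qed
qed

section \<open>Charts and smooth functions on manifolds\<close>

text \<open>The representative G lives on an open set of the ambient Euclidean space, although the
  image of a chart is only relatively open in the model space. Off the model space G is arbitrary,
  so only its derivatives in directions of the model space are meaningful.\<close>

definition chart_rep ::
    "'a set \<Rightarrow> ('a \<Rightarrow> 'b::euclidean_space) \<Rightarrow> ('a \<Rightarrow> real) \<Rightarrow> 'a \<Rightarrow> 'b set \<Rightarrow> ('b \<Rightarrow> real) \<Rightarrow> bool" where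
  "chart_rep U \<phi> f q N G \<longleftrightarrow>
     open N \<and> \<phi> q \<in> N \<and> Cinf_on N G \<and> (\<forall>p\<in>U. \<phi> p \<in> N \<longrightarrow> f p = G (\<phi> p))"

definition smooth_at :: "('a, 'b::euclidean_space) mfd \<Rightarrow> ('a \<Rightarrow> real) \<Rightarrow> 'a \<Rightarrow> bool" where
  "smooth_at M f q \<longleftrightarrow> (\<exists>U \<phi> N G. (U, \<phi>) \<in> atlas M \<and> q \<in> U \<and> chart_rep U \<phi> f q N G)"

lemma chart_repD:
  assumes "chart_rep U \<phi> f q N G"
  shows "open N" "\<phi> q \<in> N" "Cinf_on N G" "\<And>p. p \<in> U \<Longrightarrow> \<phi> p \<in> N \<Longrightarrow> f p = G (\<phi> p)"
  using assms unfolding chart_rep_def by simp_all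

lemma chart_subset: "is_chart M U \<phi> \<Longrightarrow> U \<subseteq> pts M"
  unfolding is_chart_def by (elim conjE) (rule openin_subset)

lemma chart_homeomorphic:
  "is_chart M U \<phi> \<Longrightarrow> homeomorphic_map (subtopology (mtop M) U) (top_of_set (\<phi> ` U)) \<phi>"
  unfolding is_chart_def by (elim conjE)

lemma chart_openin: "is_chart M U \<phi> \<Longrightarrow> openin (mtop M) U"
  unfolding is_chart_def by (elim conjE)

lemma chart_inj:
  assumes "is_chart M U \<phi>"
  shows "inj_on \<phi> U"
  using homeomorphic_imp_injective_map[OF chart_homeomorphic[OF assms]] chart_subset[OF assms]
  by (simp only: topspace_subtopology_subset)

lemma atlas_chart: "manifold M \<Longrightarrow> (U, \<phi>) \<in> atlas M \<Longrightarrow> is_chart M U \<phi>"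
  unfolding manifold_def by blast

lemma atlas_cover: "manifold M \<Longrightarrow> q \<in> pts M \<Longrightarrow> \<exists>U \<phi>. (U, \<phi>) \<in> atlas M \<and> q \<in> U"
  unfolding manifold_def by blast

lemma chart_open_image:
  assumes "is_chart M U \<phi>" "openin (mtop M) W" "q \<in> U" "q \<in> W"
  obtains N where "open N" "\<phi> q \<in> N" "\<And>p. p \<in> U \<Longrightarrow> \<phi> p \<in> N \<Longrightarrow> p \<in> W"
proof -
  have "homeomorphic_map (subtopology (mtop M) U) (top_of_set (\<phi> ` U)) \<phi>"
    by (rule chart_homeomorphic[OF assms(1)])
  then have "open_map (subtopology (mtop M) U) (top_of_set (\<phi> ` U)) \<phi>"
    by (rule homeomorphic_imp_open_map)
  moreover have "openin (subtopology (mtop M) U) (U \<inter> W)"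
    using assms(2) by (rule openin_subtopology_Int2)
  ultimately have "openin (top_of_set (\<phi> ` U)) (\<phi> ` (U \<inter> W))"
    unfolding open_map_def by blast
  then obtain N where N: "open N" "\<phi> ` (U \<inter> W) = \<phi> ` U \<inter> N"
    by (auto simp: openin_open)
  show ?thesis
  proof (rule that[OF N(1)])
    show "\<phi> q \<in> N" using N(2) assms by blast
    fix p assume p: "p \<in> U" "\<phi> p \<in> N"
    then have "\<phi> p \<in> \<phi> ` (U \<inter> W)" using N(2) by blast
    then show "p \<in> W" using chart_inj[OF assms(1)] p(1) by (auto dest: inj_onD)
  qed
qed

lemma chart_open_preimage:
  assumes "is_chart M U \<phi>" "open N"
  shows "openin (mtop M) {p \<in> U. \<phi> p \<in> N}"
proof -
  have "continuous_map (subtopology (mtop M) U) (top_of_set (\<phi> ` U)) \<phi>"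
    by (rule homeomorphic_imp_continuous_map[OF chart_homeomorphic[OF assms(1)]])
  moreover have "openin (top_of_set (\<phi> ` U)) (\<phi> ` U \<inter> N)" using assms(2) by blast
  ultimately have "openin (subtopology (mtop M) U)
      {p \<in> topspace (subtopology (mtop M) U). \<phi> p \<in> \<phi> ` U \<inter> N}"
    by (rule openin_continuous_map_preimage)
  moreover have "{p \<in> topspace (subtopology (mtop M) U). \<phi> p \<in> \<phi> ` U \<inter> N} = {p \<in> U. \<phi> p \<in> N}"
    using chart_subset[OF assms(1)] by auto
  ultimately show ?thesis using openin_trans_full[OF _ chart_openin[OF assms(1)]] by simp
qed

lemma chart_model:
  assumes "is_chart M U \<phi>" "q \<in> U"
  obtains N where "open N" "\<phi> q \<in> N" "model M \<inter> N = \<phi> ` U"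
proof -
  have "openin (top_of_set (model M)) (\<phi> ` U)" using assms(1) unfolding is_chart_def by (elim conjE)
  then obtain N where "open N" "\<phi> ` U = model M \<inter> N" by (auto simp: openin_open)
  with that assms(2) show ?thesis by blast
qed

text \<open>The transition map is only known to extend smoothly near each point, so the new
  representative is G composed with such an extension \<open>h\<close>. The set \<open>N'\<close> is
  the part of its domain that \<open>h\<close> sends into N and over which points of V also lie in
  U.\<close>

lemma chart_rep_change:
  assumes "inj_on \<psi> V" "open N0" "\<psi> q \<in> N0" "\<And>p. p \<in> V \<Longrightarrow> \<psi> p \<in> N0 \<Longrightarrow> p \<in> U"
    and "smooth_on (\<psi> ` (U \<inter> V)) (\<phi> \<circ> inv_into V \<psi>)" "q \<in> V" "chart_rep U \<phi> f q N G"
  shows "\<exists>N' G'. chart_rep V \<psi> f q N' G'"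
proof -
  have q: "q \<in> U" using assms by blast
  then have "\<psi> q \<in> \<psi> ` (U \<inter> V)" using assms by blast
  then obtain N1 h where h: "open N1" "\<psi> q \<in> N1" "Cinf_on N1 h"
      "\<And>y. y \<in> \<psi> ` (U \<inter> V) \<inter> N1 \<Longrightarrow> h y = (\<phi> \<circ> inv_into V \<psi>) y"
    using assms(5) unfolding smooth_on_def Cinf_on_def by meson
  have hp: "h (\<psi> p) = \<phi> p" if "p \<in> V" "\<psi> p \<in> N0" "\<psi> p \<in> N1" for p
    using h(4)[of "\<psi> p"] assms(1,4) that by simp
  have G: "open N" "\<phi> q \<in> N" "Cinf_on N G" "\<And>p. p \<in> U \<Longrightarrow> \<phi> p \<in> N \<Longrightarrow> f p = G (\<phi> p)"
    using assms(7) unfolding chart_rep_def by blast+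
  define N' where "N' = N1 \<inter> h -` N \<inter> N0"
  have "open (N1 \<inter> h -` N)"
    by (rule continuous_open_preimage[OF Cinf_on_continuous[OF h(3)] h(1) G(1)])
  then have N': "open N'" unfolding N'_def using assms(2) by blast
  have "chart_rep V \<psi> f q N' (\<lambda>y. G (h y))"
    unfolding chart_rep_def
  proof (intro conjI ballI impI)
    show "Cinf_on N' (\<lambda>y. G (h y))"
      by (rule Cinf_on_compose[OF N' G(1) _ G(3) Cinf_on_subset[OF h(3)]]) (auto simp: N'_def)
    show "\<psi> q \<in> N'" using hp[OF assms(6)] h(2) assms(3) G(2) unfolding N'_def by simp
    fix p assume "p \<in> V" "\<psi> p \<in> N'"
    then show "f p = G (h (\<psi> p))"
      using hp[of p] G(4)[of p] assms(4)[of p] unfolding N'_def by simp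
  qed (rule N')
  then show ?thesis by blast
qed

text \<open>A chart outside the atlas is compared with one atlas chart in each direction; these are
  the transition maps that \<open>is_chart\<close> controls.\<close>

lemma smooth_at_chart:
  assumes "manifold M" "is_chart M U \<phi>" "q \<in> U"
  shows "smooth_at M f q \<longleftrightarrow> (\<exists>N G. chart_rep U \<phi> f q N G)"
proof
  assume "smooth_at M f q"
  then obtain V \<psi> N G where V: "(V, \<psi>) \<in> atlas M" "q \<in> V" "chart_rep V \<psi> f q N G"
    unfolding smooth_at_def by blast
  have "openin (mtop M) V" by (rule chart_openin[OF atlas_chart[OF assms(1) V(1)]])
  then obtain N0 where N0: "open N0" "\<phi> q \<in> N0" "\<And>p. p \<in> U \<Longrightarrow> \<phi> p \<in> N0 \<Longrightarrow> p \<in> V"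
    by (rule chart_open_image[OF assms(2) _ assms(3) V(2)]) (rule that)
  have "smooth_on (\<phi> ` (U \<inter> V)) (\<psi> \<circ> inv_into U \<phi>)"
    using assms(2) V(1) unfolding is_chart_def by blast
  then show "\<exists>N G. chart_rep U \<phi> f q N G"
    using chart_rep_change[OF chart_inj[OF assms(2)] N0 _ assms(3) V(3)] by (simp add: Int_commute)
next
  assume "\<exists>N G. chart_rep U \<phi> f q N G"
  then obtain N G where G: "chart_rep U \<phi> f q N G" by blast
  have qM: "q \<in> pts M" using chart_subset[OF assms(2)] assms(3) by blast
  obtain V \<psi> where V: "(V, \<psi>) \<in> atlas M" "q \<in> V"
    using atlas_cover[OF assms(1) qM] by (elim exE conjE)
  have c: "is_chart M V \<psi>" using atlas_chart[OF assms(1) V(1)] .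
  have "openin (mtop M) U" by (rule chart_openin[OF assms(2)])
  then obtain N0 where N0: "open N0" "\<psi> q \<in> N0" "\<And>p. p \<in> V \<Longrightarrow> \<psi> p \<in> N0 \<Longrightarrow> p \<in> U"
    by (rule chart_open_image[OF c _ V(2) assms(3)]) (rule that)
  have "smooth_on (\<psi> ` (U \<inter> V)) (\<phi> \<circ> inv_into V \<psi>)"
    using assms(2) V(1) unfolding is_chart_def by blast
  then show "smooth_at M f q"
    using chart_rep_change[OF chart_inj[OF c] N0 _ V(2) G] V unfolding smooth_at_def by blast
qed

lemma smooth_at_chartE:
  assumes "manifold M" "is_chart M U \<phi>" "q \<in> U" "smooth_at M f q"
  obtains N G where "chart_rep U \<phi> f q N G"
  using assms(4) unfolding smooth_at_chart[OF assms(1-3)] by (elim exE) (rule that)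

lemma smooth_atE:
  assumes "smooth_at M f q"
  obtains U \<phi> N G where "(U, \<phi>) \<in> atlas M" "q \<in> U" "chart_rep U \<phi> f q N G"
  using assms unfolding smooth_at_def by (elim exE conjE) (rule that)

lemma smooth_atI: "(U, \<phi>) \<in> atlas M \<Longrightarrow> q \<in> U \<Longrightarrow> chart_rep U \<phi> f q N G \<Longrightarrow> smooth_at M f q"
  unfolding smooth_at_def by (intro exI conjI)

lemma chart_rep_shrink:
  assumes "chart_rep U \<phi> f q N G" "open N'" "\<phi> q \<in> N'"
    and "\<And>p. p \<in> U \<Longrightarrow> \<phi> p \<in> N' \<Longrightarrow> f p = g p"
  shows "chart_rep U \<phi> g q (N \<inter> N') G"
  using assms Cinf_on_subset[of N G "N \<inter> N'"] unfolding chart_rep_def by auto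

lemma smooth_at_cong:
  assumes "manifold M" "openin (mtop M) W" "q \<in> W" "\<And>p. p \<in> W \<Longrightarrow> f p = g p" "smooth_at M f q"
  shows "smooth_at M g q"
proof -
  obtain U \<phi> N G where U: "(U, \<phi>) \<in> atlas M" "q \<in> U" "chart_rep U \<phi> f q N G"
    by (rule smooth_atE[OF assms(5)])
  obtain N0 where N0: "open N0" "\<phi> q \<in> N0" "\<And>p. p \<in> U \<Longrightarrow> \<phi> p \<in> N0 \<Longrightarrow> p \<in> W"
    by (rule chart_open_image[OF atlas_chart[OF assms(1) U(1)] assms(2) U(2) assms(3)]) (rule that)
  show ?thesis
    using chart_rep_shrink[OF U(3) N0(1,2), of g] N0(3) assms(4) U unfolding smooth_at_def by blast
qed

lemma smooth_fun_on_imp_smooth_at: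
  assumes "manifold M" "openin (mtop M) W" "q \<in> W" "smooth_fun_on M W f"
  shows "smooth_at M f q"
proof -
  have qM: "q \<in> pts M" using assms(2,3) openin_subset by blast
  obtain U \<phi> where U: "(U, \<phi>) \<in> atlas M" "q \<in> U"
    using atlas_cover[OF assms(1) qM] by (elim exE conjE)
  have c: "is_chart M U \<phi>" using atlas_chart[OF assms(1) U(1)] .
  obtain N0 where N0: "open N0" "\<phi> q \<in> N0" "\<And>p. p \<in> U \<Longrightarrow> \<phi> p \<in> N0 \<Longrightarrow> p \<in> W"
    by (rule chart_open_image[OF c assms(2) U(2) assms(3)]) (rule that)
  have "smooth_on (\<phi> ` (U \<inter> W)) (f \<circ> inv_into U \<phi>)"
    using assms(4) U(1) unfolding smooth_fun_on_def by blast
  moreover have "\<phi> q \<in> \<phi> ` (U \<inter> W)" using U(2) assms(3) by blast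
  ultimately obtain N G where G: "open N" "\<phi> q \<in> N" "Cinf_on N G"
      "\<And>y. y \<in> \<phi> ` (U \<inter> W) \<inter> N \<Longrightarrow> G y = (f \<circ> inv_into U \<phi>) y"
    unfolding smooth_on_def Cinf_on_def by meson
  have "chart_rep U \<phi> f q (N \<inter> N0) G"
    unfolding chart_rep_def
  proof (intro conjI ballI impI)
    fix p assume p: "p \<in> U" "\<phi> p \<in> N \<inter> N0"
    then have "\<phi> p \<in> \<phi> ` (U \<inter> W) \<inter> N" using N0(3) by blast
    then show "f p = G (\<phi> p)" using G(4)[of "\<phi> p"] chart_inj[OF c] p(1) by simp
  qed (use G N0 Cinf_on_subset[of N G "N \<inter> N0"] in auto)
  then show ?thesis by (rule smooth_atI[OF U(1,2)])
qed

lemma smooth_at_imp_smooth_fun_on: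
  assumes "manifold M" "\<And>q. q \<in> W \<Longrightarrow> smooth_at M f q"
  shows "smooth_fun_on M W f"
  unfolding smooth_fun_on_def smooth_on_def
proof (intro ballI, clarify)
  fix U \<phi> q assume U: "(U, \<phi>) \<in> atlas M" and q: "q \<in> U" "q \<in> W"
  have c: "is_chart M U \<phi>" using atlas_chart[OF assms(1) U] .
  obtain N G where "chart_rep U \<phi> f q N G" by (rule smooth_at_chartE[OF assms(1) c q(1) assms(2)[OF q(2)]])
  note G = chart_repD[OF this]
  have "\<forall>y\<in>\<phi> ` (U \<inter> W) \<inter> N. G y = (f \<circ> inv_into U \<phi>) y"
    using G(4) chart_inj[OF c] by auto
  then show "\<exists>N g. open N \<and> \<phi> q \<in> N \<and> (\<forall>k. Ck_on k N g) \<and>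
      (\<forall>y\<in>\<phi> ` (U \<inter> W) \<inter> N. g y = (f \<circ> inv_into U \<phi>) y)"
    using G unfolding Cinf_on_def by blast
qed

lemma smooth_functions_iff:
  assumes "manifold M"
  shows "f \<in> smooth_functions M \<longleftrightarrow> (\<forall>x. x \<notin> pts M \<longrightarrow> f x = 0) \<and> (\<forall>q\<in>pts M. smooth_at M f q)"
  unfolding smooth_functions_def
  using smooth_fun_on_imp_smooth_at[OF assms openin_topspace, of _ f]
    smooth_at_imp_smooth_fun_on[OF assms, of "pts M" f] by blast

lemma smooth_at_const:
  assumes "manifold M" "q \<in> pts M"
  shows "smooth_at M (\<lambda>p. c) q"
proof -
  obtain U \<phi> where "(U, \<phi>) \<in> atlas M" "q \<in> U" using atlas_cover[OF assms] by (elim exE conjE)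
  moreover have "chart_rep U \<phi> (\<lambda>p. c) q UNIV (\<lambda>y. c)"
    by (auto simp: chart_rep_def intro: Cinf_on_const)
  ultimately show ?thesis unfolding smooth_at_def by blast
qed

lemma smooth_at_binary:
  fixes M :: "('a, 'b::euclidean_space) mfd"
  assumes "manifold M" "smooth_at M f q" "smooth_at M g q"
    and "\<And>(N :: 'b set) F G. open N \<Longrightarrow> Cinf_on N F \<Longrightarrow> Cinf_on N G \<Longrightarrow> Cinf_on N (\<lambda>y. m (F y) (G y))"
  shows "smooth_at M (\<lambda>p. m (f p) (g p)) q"
proof -
  obtain U \<phi> N F where U: "(U, \<phi>) \<in> atlas M" "q \<in> U" "chart_rep U \<phi> f q N F"
    by (rule smooth_atE[OF assms(2)])
  obtain N' G where G: "chart_rep U \<phi> g q N' G"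
    by (rule smooth_at_chartE[OF assms(1) atlas_chart[OF assms(1) U(1)] U(2) assms(3)])
  have N: "open (N \<inter> N')" by (intro open_Int chart_repD(1)[OF U(3)] chart_repD(1)[OF G])
  have "Cinf_on (N \<inter> N') F" "Cinf_on (N \<inter> N') G"
    by (rule Cinf_on_subset[OF chart_repD(3)[OF U(3)]], simp) (rule Cinf_on_subset[OF chart_repD(3)[OF G]], simp)
  then have "Cinf_on (N \<inter> N') (\<lambda>y. m (F y) (G y))" by (rule assms(4)[OF N])
  then have "chart_rep U \<phi> (\<lambda>p. m (f p) (g p)) q (N \<inter> N') (\<lambda>y. m (F y) (G y))"
    using U(3) G N unfolding chart_rep_def by auto
  then show ?thesis by (rule smooth_atI[OF U(1,2)])
qed

lemma smooth_at_add:
  "manifold M \<Longrightarrow> smooth_at M f q \<Longrightarrow> smooth_at M g q \<Longrightarrow> smooth_at M (\<lambda>p. f p + g p) q"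
  by (rule smooth_at_binary) (auto intro: Cinf_on_add)

lemma smooth_at_mult:
  "manifold M \<Longrightarrow> smooth_at M f q \<Longrightarrow> smooth_at M g q \<Longrightarrow> smooth_at M (\<lambda>p. f p * g p) q"
  by (rule smooth_at_binary) (auto intro: Cinf_on_mult)

lemma smooth_at_sum:
  assumes "manifold M" "q \<in> pts M"
  shows "(\<And>i. i \<in> I \<Longrightarrow> smooth_at M (f i) q) \<Longrightarrow> smooth_at M (\<lambda>p. \<Sum>i\<in>I. f i p) q"
  by (induction I rule: infinite_finite_induct)
    (simp_all add: smooth_at_const[OF assms] smooth_at_add[OF assms(1)])

lemma smooth_at_rep_nonzero:
  assumes "chart_rep U \<phi> f q N G" "q \<in> U" "f q \<noteq> 0"
  obtains N' where "N' \<subseteq> N" "chart_rep U \<phi> f q N' G" "\<And>y. y \<in> N' \<Longrightarrow> G y \<noteq> 0"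
proof (rule that)
  note r = chart_repD(1-3)[OF assms(1)] chart_repD(4)[OF assms(1,2) chart_repD(2)[OF assms(1)]]
  have "open (N \<inter> G -` (-{0}))"
    by (rule continuous_open_preimage[OF Cinf_on_continuous[OF r(3)] r(1)]) auto
  then show "chart_rep U \<phi> f q (N \<inter> G -` (-{0})) G"
    using assms r Cinf_on_subset[OF r(3), of "N \<inter> G -` (-{0})"] unfolding chart_rep_def by auto
qed auto

lemma smooth_at_inverse:
  assumes "smooth_at M f q" "f q \<noteq> 0"
  shows "smooth_at M (\<lambda>p. inverse (f p)) q"
proof -
  obtain U \<phi> N G where U: "(U, \<phi>) \<in> atlas M" "q \<in> U" "chart_rep U \<phi> f q N G"
    by (rule smooth_atE[OF assms(1)])
  obtain N' where N': "N' \<subseteq> N" "chart_rep U \<phi> f q N' G" "\<And>y. y \<in> N' \<Longrightarrow> G y \<noteq> 0"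
    by (rule smooth_at_rep_nonzero[OF U(3,2) assms(2)]) (rule that)
  have "chart_rep U \<phi> (\<lambda>p. inverse (f p)) q N' (\<lambda>y. inverse (G y))"
    using N'(2,3) Cinf_on_inverse[of N' G] unfolding chart_rep_def by auto
  then show ?thesis by (rule smooth_atI[OF U(1,2)])
qed

lemma smooth_at_nonzero:
  assumes "manifold M" "smooth_at M f q" "f q \<noteq> 0"
  obtains W where "openin (mtop M) W" "q \<in> W" "\<And>p. p \<in> W \<Longrightarrow> f p \<noteq> 0"
proof -
  obtain U \<phi> N G where U: "(U, \<phi>) \<in> atlas M" "q \<in> U" "chart_rep U \<phi> f q N G"
    by (rule smooth_atE[OF assms(2)])
  obtain N' where N': "N' \<subseteq> N" "chart_rep U \<phi> f q N' G" "\<And>y. y \<in> N' \<Longrightarrow> G y \<noteq> 0"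
    by (rule smooth_at_rep_nonzero[OF U(3,2) assms(3)]) (rule that)
  show ?thesis
  proof (rule that)
    show "openin (mtop M) {p \<in> U. \<phi> p \<in> N'}"
      by (rule chart_open_preimage[OF atlas_chart[OF assms(1) U(1)] chart_repD(1)[OF N'(2)]])
    show "q \<in> {p \<in> U. \<phi> p \<in> N'}" using U(2) chart_repD(2)[OF N'(2)] by simp
    show "f p \<noteq> 0" if "p \<in> {p \<in> U. \<phi> p \<in> N'}" for p
      using that N'(3) chart_repD(4)[OF N'(2)] by simp
  qed
qed

section \<open>Closure properties of the algebra of smooth functions\<close>

lemma smooth_functions_smooth_at:
  "manifold M \<Longrightarrow> f \<in> smooth_functions M \<Longrightarrow> q \<in> pts M \<Longrightarrow> smooth_at M f q"
  by (simp add: smooth_functions_iff)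

lemma smooth_functions_outside: "f \<in> smooth_functions M \<Longrightarrow> q \<notin> pts M \<Longrightarrow> f q = 0"
  by (simp add: smooth_functions_def)

lemma smooth_functions_add:
  "manifold M \<Longrightarrow> f \<in> smooth_functions M \<Longrightarrow> g \<in> smooth_functions M \<Longrightarrow> (\<lambda>p. f p + g p) \<in> smooth_functions M"
  by (simp add: smooth_functions_iff smooth_at_add)

lemma smooth_functions_mult:
  "manifold M \<Longrightarrow> f \<in> smooth_functions M \<Longrightarrow> g \<in> smooth_functions M \<Longrightarrow> (\<lambda>p. f p * g p) \<in> smooth_functions M"
  by (simp add: smooth_functions_iff smooth_at_mult)

lemma smooth_functions_scale:
  "manifold M \<Longrightarrow> f \<in> smooth_functions M \<Longrightarrow> (\<lambda>p. c * f p) \<in> smooth_functions M"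
  by (simp add: smooth_functions_iff smooth_at_mult smooth_at_const)

lemma smooth_functions_sum:
  "manifold M \<Longrightarrow> (\<And>i. i \<in> I \<Longrightarrow> f i \<in> smooth_functions M) \<Longrightarrow>
    (\<lambda>p. \<Sum>i\<in>I. f i p) \<in> smooth_functions M"
  by (auto simp: smooth_functions_iff intro!: sum.neutral smooth_at_sum)

lemma smooth_functions_zero: "manifold M \<Longrightarrow> (\<lambda>p. 0) \<in> smooth_functions M"
  by (simp add: smooth_functions_iff smooth_at_const)

lemma smooth_functions_const:
  assumes "manifold M"
  shows "(\<lambda>p. if p \<in> pts M then c else 0) \<in> smooth_functions M"
  using smooth_at_cong[OF assms openin_topspace _ _ smooth_at_const[OF assms]]
  by (auto simp: smooth_functions_iff[OF assms])

section \<open>Bump functions on manifolds and extension by zero\<close>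

lemma manifold_bump:
  assumes "manifold M" "openin (mtop M) W" "q \<in> W"
  obtains u K W' where "u \<in> smooth_functions M" "openin (mtop M) W'" "q \<in> W'" "W' \<subseteq> K" "K \<subseteq> W"
    "closedin (mtop M) K" "\<And>p. p \<in> W' \<Longrightarrow> u p = 1" "\<And>p. p \<notin> K \<Longrightarrow> u p = 0"
proof -
  have qM: "q \<in> pts M" using assms(2,3) openin_subset by blast
  obtain U \<phi> where U: "(U, \<phi>) \<in> atlas M" "q \<in> U"
    using atlas_cover[OF assms(1) qM] by (elim exE conjE)
  have c: "is_chart M U \<phi>" using atlas_chart[OF assms(1) U(1)] .
  obtain N0 where N0: "open N0" "\<phi> q \<in> N0" "\<And>p. p \<in> U \<Longrightarrow> \<phi> p \<in> N0 \<Longrightarrow> p \<in> W"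
    by (rule chart_open_image[OF c assms(2) U(2) assms(3)]) (rule that)
  obtain N1 where N1: "open N1" "\<phi> q \<in> N1" "model M \<inter> N1 = \<phi> ` U"
    by (rule chart_model[OF c U(2)]) (rule that)
  have "open (N0 \<inter> N1)" "\<phi> q \<in> N0 \<inter> N1" using N0 N1 by auto
  then obtain r where r: "r > 0" "cball (\<phi> q) r \<subseteq> N0 \<inter> N1"
    using open_contains_cball by blast
  obtain w :: "'b \<Rightarrow> real" where w: "Cinf_on UNIV w" "\<And>y. dist (\<phi> q) y < r / 2 \<Longrightarrow> w y = 1"
      "\<And>y. dist (\<phi> q) y \<ge> r \<Longrightarrow> w y = 0"
    by (rule smooth_bump[OF r(1), of "\<phi> q"]) (rule that)
  \<comment> \<open>The closed ball makes \<open>K\<close> compact, hence closed because M is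
    Hausdorff. Closedness of \<open>K\<close> is what makes the extension of \<open>u\<close> by 0
    smooth.\<close>
  define K where "K = {p \<in> U. \<phi> p \<in> cball (\<phi> q) r}"
  define W' where "W' = {p \<in> U. \<phi> p \<in> ball (\<phi> q) (r / 2)}"
  define u where "u = (\<lambda>p. if p \<in> U then w (\<phi> p) else 0)"
  have KK: "\<phi> ` K = cball (\<phi> q) r \<inter> model M" 
  proof (intro equalityI subsetI)
    fix y assume "y \<in> cball (\<phi> q) r \<inter> model M"
    then have "y \<in> cball (\<phi> q) r" "y \<in> \<phi> ` U" using r(2) N1(3) by blast+
    then show "y \<in> \<phi> ` K" unfolding K_def by blast
  next
    fix y assume "y \<in> \<phi> ` K"
    then have "y \<in> cball (\<phi> q) r" "y \<in> \<phi> ` U" unfolding K_def by blast+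
    then show "y \<in> cball (\<phi> q) r \<inter> model M" using N1(3) by blast
  qed
  have "\<phi> ` K \<subseteq> \<phi> ` U" unfolding K_def by blast
  moreover have "compact (cball (\<phi> q) r \<inter> model M)"
    using assms(1) closed_subspace unfolding manifold_def by (intro compact_Int_closed) auto
  ultimately have "compactin (top_of_set (\<phi> ` U)) (\<phi> ` K)"
    by (simp add: compactin_subtopology KK)
  moreover have "homeomorphic_map (subtopology (mtop M) U) (top_of_set (\<phi> ` U)) \<phi>"
    by (rule chart_homeomorphic[OF c])
  moreover have "K \<subseteq> topspace (subtopology (mtop M) U)"
    using chart_subset[OF c] unfolding K_def by auto
  ultimately have "compactin (subtopology (mtop M) U) K"
    using homeomorphic_map_compactness by blast
  then have "compactin (mtop M) K" by (simp add: compactin_subtopology)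
  moreover have "Hausdorff_space (mtop M)" using assms(1) unfolding manifold_def by blast
  ultimately have K: "closedin (mtop M) K" using compactin_imp_closedin by blast
  have out: "u p = 0" if "p \<notin> K" for p using that w(3) unfolding u_def K_def by auto
  show ?thesis
  proof (rule that)
    show "openin (mtop M) W'" unfolding W'_def by (rule chart_open_preimage[OF c open_ball])
    show "q \<in> W'" using U(2) r(1) unfolding W'_def by simp
    show "W' \<subseteq> K" using r(1) unfolding W'_def K_def by auto
    show "K \<subseteq> W" using N0(3) r(2) unfolding K_def by auto
    show "u p = 1" if "p \<in> W'" for p using that w(2) unfolding W'_def u_def by auto
    have "smooth_at M u p" if p: "p \<in> pts M" for p
    proof (cases "p \<in> U")
      case True
      have "chart_rep U \<phi> u p UNIV w" using w(1) unfolding chart_rep_def u_def by auto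
      then show ?thesis unfolding smooth_at_chart[OF assms(1) c True] by (intro exI)
    next
      case False
      have "openin (mtop M) (pts M - K)" using K by blast
      then show ?thesis
        by (rule smooth_at_cong[OF assms(1) _ _ _ smooth_at_const[OF assms(1) p, of 0]])
          (use p False out in \<open>auto simp: K_def\<close>)
    qed
    then show "u \<in> smooth_functions M"
      using out chart_subset[OF c] unfolding smooth_functions_iff[OF assms(1)] u_def by auto
  qed (use K out in auto)
qed

text \<open>Extension by zero: off the closed set that carries u, the product vanishes on an open
  set, so f only has to be smooth on that closed set.\<close>

lemma cutoff_smooth:
  assumes "manifold M" "u \<in> smooth_functions M" "closedin (mtop M) K" "\<And>p. p \<notin> K \<Longrightarrow> u p = 0"
    and "\<And>p. p \<in> K \<Longrightarrow> smooth_at M f p"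
  shows "(\<lambda>p. u p * f p) \<in> smooth_functions M"
proof -
  have "smooth_at M (\<lambda>p. u p * f p) p" if p: "p \<in> pts M" for p
  proof (cases "p \<in> K")
    case True
    then show ?thesis
      by (intro smooth_at_mult[OF assms(1)] smooth_functions_smooth_at[OF assms(1,2) p] assms(5))
  next
    case False
    have "openin (mtop M) (pts M - K)" using assms(3) by blast
    then show ?thesis
      by (rule smooth_at_cong[OF assms(1) _ _ _ smooth_at_const[OF assms(1) p, of 0]])
        (use p False assms(4) in auto)
  qed
  then show ?thesis
    using smooth_functions_outside[OF assms(2)] unfolding smooth_functions_iff[OF assms(1)] by auto
qed

text \<open>Tangent vectors act on global functions only, so a local construction has to be replaced
  by a global function with the same germ.\<close>

lemma local_to_global:
  assumes "manifold M" "openin (mtop M) W" "q \<in> W" "\<And>p. p \<in> W \<Longrightarrow> smooth_at M f p"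
  obtains g W' where "g \<in> smooth_functions M" "openin (mtop M) W'" "q \<in> W'" "W' \<subseteq> W"
    "\<And>p. p \<in> W' \<Longrightarrow> g p = f p"
proof -
  obtain u K W' where u: "u \<in> smooth_functions M" "openin (mtop M) W'" "q \<in> W'" "W' \<subseteq> K" "K \<subseteq> W"
    "closedin (mtop M) K" "\<And>p. p \<in> W' \<Longrightarrow> u p = 1" "\<And>p. p \<notin> K \<Longrightarrow> u p = 0"
    by (rule manifold_bump[OF assms(1-3)]) (rule that)
  have "(\<lambda>p. u p * f p) \<in> smooth_functions M"
    using u assms(4) by (intro cutoff_smooth[OF assms(1) u(1) u(6)]) auto
  then show ?thesis using u by (intro that[of "\<lambda>p. u p * f p" W']) auto
qed

text \<open>Frame identities determine a quantity only after multiplication by the cut-off of the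
  frame; smoothness near q is recovered by dividing by it.\<close>

lemma smooth_functions_divide:
  assumes "manifold M" "\<And>x. x \<notin> pts M \<Longrightarrow> f x = 0"
    and "\<And>q. q \<in> pts M \<Longrightarrow> \<exists>u\<in>smooth_functions M. u q \<noteq> 0 \<and> (\<lambda>p. u p * f p) \<in> smooth_functions M"
  shows "f \<in> smooth_functions M"
proof -
  have "smooth_at M f q" if q: "q \<in> pts M" for q
  proof -
    obtain u where u: "u \<in> smooth_functions M" "u q \<noteq> 0" "(\<lambda>p. u p * f p) \<in> smooth_functions M"
      using assms(3)[OF q] by blast
    have su: "smooth_at M u q" using smooth_functions_smooth_at[OF assms(1) u(1) q] .
    obtain W where W: "openin (mtop M) W" "q \<in> W" "\<And>p. p \<in> W \<Longrightarrow> u p \<noteq> 0"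
      by (rule smooth_at_nonzero[OF assms(1) su u(2)]) (rule that)
    have "smooth_at M (\<lambda>p. inverse (u p) * (u p * f p)) q"
      by (rule smooth_at_mult[OF assms(1) smooth_at_inverse[OF su u(2)]
            smooth_functions_smooth_at[OF assms(1) u(3) q]])
    then show ?thesis
      by (rule smooth_at_cong[OF assms(1) W(1,2), rotated]) (use W(3) in simp)
  qed
  then show ?thesis using assms(2) unfolding smooth_functions_iff[OF assms(1)] by blast
qed

subsection \<open>Tangent vectors\<close>

lemma dual_space_add: "\<xi> \<in> dual_space V \<Longrightarrow> v \<in> V \<Longrightarrow> w \<in> V \<Longrightarrow> \<xi> (\<lambda>x. v x + w x) = \<xi> v + \<xi> w"
  unfolding dual_space_def by (auto simp: plus_fun_def)

lemma dual_space_scale: "\<xi> \<in> dual_space V \<Longrightarrow> v \<in> V \<Longrightarrow> \<xi> (\<lambda>x. c * v x) = c * \<xi> v"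
  unfolding dual_space_def by auto

lemma dual_space_outside: "\<xi> \<in> dual_space V \<Longrightarrow> v \<notin> V \<Longrightarrow> \<xi> v = 0"
  unfolding dual_space_def by auto

lemma dual_space_zero: "\<xi> \<in> dual_space V \<Longrightarrow> \<xi> (\<lambda>x. 0) = 0"
  using dual_space_scale[of \<xi> V "\<lambda>x. 0" 0] dual_space_outside[of \<xi> V "\<lambda>x. 0"]
  by (cases "(\<lambda>x. 0) \<in> V") auto

lemma dual_spaceI:
  assumes "\<And>v w. v \<in> V \<Longrightarrow> w \<in> V \<Longrightarrow> \<xi> (\<lambda>x. v x + w x) = \<xi> v + \<xi> w"
    and "\<And>c v. v \<in> V \<Longrightarrow> \<xi> (\<lambda>x. c * v x) = c * \<xi> v" "\<And>v. v \<notin> V \<Longrightarrow> \<xi> v = 0"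
  shows "\<xi> \<in> dual_space V"
  using assms unfolding dual_space_def by (auto simp: plus_fun_def)

lemma tangentI:
  assumes "\<And>f g. f \<in> smooth_functions M \<Longrightarrow> g \<in> smooth_functions M \<Longrightarrow> v (\<lambda>x. f x + g x) = v f + v g"
    and "\<And>c f. f \<in> smooth_functions M \<Longrightarrow> v (\<lambda>x. c * f x) = c * v f"
    and "\<And>f g. f \<in> smooth_functions M \<Longrightarrow> g \<in> smooth_functions M \<Longrightarrow> v (\<lambda>x. f x * g x) = f q * v g + g q * v f"
    and "\<And>f. f \<notin> smooth_functions M \<Longrightarrow> v f = 0"
  shows "v \<in> tangent M q"
  using assms dual_spaceI[of "smooth_functions M" v] unfolding tangent_def by (auto simp: times_fun_def)

lemma tangent_dual: "v \<in> tangent M q \<Longrightarrow> v \<in> dual_space (smooth_functions M)"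
  unfolding tangent_def by blast

lemma tangent_mult:
  "v \<in> tangent M q \<Longrightarrow> f \<in> smooth_functions M \<Longrightarrow> g \<in> smooth_functions M \<Longrightarrow>
    v (\<lambda>x. f x * g x) = f q * v g + g q * v f"
  unfolding tangent_def by (auto simp: times_fun_def)

lemmas tangent_add = dual_space_add[OF tangent_dual]
lemmas tangent_scale = dual_space_scale[OF tangent_dual]
lemmas tangent_outside = dual_space_outside[OF tangent_dual]
lemmas tangent_zero = dual_space_zero[OF tangent_dual]

lemma tangent_sum:
  assumes "manifold M" "v \<in> tangent M q"
  shows "(\<And>i. i \<in> I \<Longrightarrow> f i \<in> smooth_functions M) \<Longrightarrow> v (\<lambda>p. \<Sum>i\<in>I. f i p) = (\<Sum>i\<in>I. v (f i))"
  by (induction I rule: infinite_finite_induct)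
    (simp_all add: tangent_zero[OF assms(2)] tangent_add[OF assms(2)] smooth_functions_sum[OF assms(1)])

text \<open>If u is 1 at q and vanishes off W, then u (f - g) = 0, and the Leibniz rule at q leaves
  v(f - g) = 0.\<close>

lemma tangent_local:
  assumes "manifold M" "v \<in> tangent M q" "f \<in> smooth_functions M" "g \<in> smooth_functions M"
    and "openin (mtop M) W" "q \<in> W" "\<And>p. p \<in> W \<Longrightarrow> f p = g p"
  shows "v f = v g"
proof -
  obtain u K W' where u: "u \<in> smooth_functions M" "openin (mtop M) W'" "q \<in> W'" "W' \<subseteq> K" "K \<subseteq> W"
    "closedin (mtop M) K" "\<And>p. p \<in> W' \<Longrightarrow> u p = 1" "\<And>p. p \<notin> K \<Longrightarrow> u p = 0"
    by (rule manifold_bump[OF assms(1,5,6)]) (rule that)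
  define d where "d = (\<lambda>p. f p + (- 1) * g p)"
  have g': "(\<lambda>p. (- 1) * g p) \<in> smooth_functions M" by (rule smooth_functions_scale[OF assms(1,4)])
  have d: "d \<in> smooth_functions M"
    unfolding d_def by (rule smooth_functions_add[OF assms(1,3) g'])
  have "(\<lambda>p. u p * d p) = (\<lambda>p. 0)"
  proof
    show "u p * d p = 0" for p using u(5,8) assms(7) unfolding d_def by (cases "p \<in> K") auto
  qed
  then have "v (\<lambda>p. u p * d p) = 0" using tangent_zero[OF assms(2)] by simp
  then have "u q * v d + d q * v u = 0" using tangent_mult[OF assms(2) u(1) d] by simp
  then have "v d = 0" using u(7)[OF u(3)] assms(6,7) unfolding d_def by simp
  then show ?thesis
    unfolding d_def using tangent_add[OF assms(2,3) g'] tangent_scale[OF assms(2,4), of "- 1"] by simp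
qed

text \<open>The unit satisfies 1 = 1 * 1, so the Leibniz rule gives v(1) = 2 v(1).\<close>

lemma tangent_const:
  assumes "manifold M" "v \<in> tangent M q" "q \<in> pts M"
  shows "v (\<lambda>p. if p \<in> pts M then c else 0) = 0"
proof -
  let ?i = "\<lambda>c p. if p \<in> pts M then c else (0::real)"
  have i: "?i 1 \<in> smooth_functions M" by (rule smooth_functions_const[OF assms(1)])
  have "(\<lambda>p. ?i 1 p * ?i 1 p) = ?i 1" by auto
  then have "v (?i 1) = 1 * v (?i 1) + 1 * v (?i 1)"
    using tangent_mult[OF assms(2) i i] assms(3) by simp
  then have "v (?i 1) = 0" by simp
  moreover have "?i c = (\<lambda>p. c * ?i 1 p)" by auto
  ultimately show ?thesis using tangent_scale[OF assms(2) i, of c] by simp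
qed

section \<open>Directional derivatives in a chart\<close>

definition chart_deriv :: "'a set \<Rightarrow> ('a \<Rightarrow> 'b::euclidean_space) \<Rightarrow> 'b \<Rightarrow> ('a \<Rightarrow> real) \<Rightarrow> 'a \<Rightarrow> real" where
  "chart_deriv U \<phi> e f p = frechet_derivative (\<lambda>t::real. f (inv_into U \<phi> (\<phi> p + t *\<^sub>R e))) (at 0) 1"

text \<open>The derivative is taken along the curve that has constant velocity e in the chart. Since
  e lies in the model space, the curve stays in the image of the chart for small times, where any
  representative G computes f.\<close>

lemma chart_deriv_rep:
  assumes "manifold M" "is_chart M U \<phi>" "e \<in> model M" "p \<in> U" "chart_rep U \<phi> f p N G"
  shows "chart_deriv U \<phi> e f p = frechet_derivative G (at (\<phi> p)) e"
proof -
  obtain N1 where N1: "open N1" "\<phi> p \<in> N1" "model M \<inter> N1 = \<phi> ` U"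
    by (rule chart_model[OF assms(2,4)]) (rule that)
  note G = chart_repD[OF assms(5)]
  have sub: "subspace (model M)" using assms(1) unfolding manifold_def by blast
  let ?T = "(\<lambda>t::real. \<phi> p + t *\<^sub>R e) -` (N \<inter> N1)"
  have T: "open ?T"
    by (rule open_vimage) (use G N1 in \<open>auto intro!: continuous_intros\<close>)
  have "((\<lambda>t::real. \<phi> p + t *\<^sub>R e) has_derivative (\<lambda>s. s *\<^sub>R e)) (at 0)"
    by (auto intro!: derivative_eq_intros)
  moreover have "(G has_derivative frechet_derivative G (at (\<phi> p))) (at (\<phi> p + 0 *\<^sub>R e))"
    using Cinf_on_has_derivative[OF G(3,2)] by simp
  ultimately have d: "((\<lambda>t::real. G (\<phi> p + t *\<^sub>R e)) has_derivative
      (\<lambda>s. frechet_derivative G (at (\<phi> p)) (s *\<^sub>R e))) (at 0)"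
    by (rule has_derivative_compose)
  have "((\<lambda>t::real. f (inv_into U \<phi> (\<phi> p + t *\<^sub>R e))) has_derivative
      (\<lambda>s. frechet_derivative G (at (\<phi> p)) (s *\<^sub>R e))) (at 0)"
  proof (rule has_derivative_transform_within_open[OF d T])
    show "0 \<in> ?T" using G(2) N1(2) by simp
    fix t assume t: "t \<in> ?T"
    have "\<phi> p \<in> model M" using N1(3) assms(4) by blast
    then have "\<phi> p + t *\<^sub>R e \<in> model M" using sub assms(3) by (simp add: subspace_add subspace_scale)
    then have "\<phi> p + t *\<^sub>R e \<in> \<phi> ` U" using t N1(3) by blast
    then obtain p' where p': "p' \<in> U" "\<phi> p + t *\<^sub>R e = \<phi> p'" by blast
    then show "G (\<phi> p + t *\<^sub>R e) = f (inv_into U \<phi> (\<phi> p + t *\<^sub>R e))"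
      using G(4)[of p'] t chart_inj[OF assms(2)] by simp
  qed
  from frechet_derivative_at[OF this, symmetric] show ?thesis
    unfolding chart_deriv_def by simp
qed

text \<open>The scalar c will be the value at p of the cut-off that turns chart derivatives into
  global vector fields.\<close>

lemma chart_deriv_tangent:
  assumes "manifold M" "is_chart M U \<phi>" "e \<in> model M" "p \<in> U"
  shows "(\<lambda>f. if f \<in> smooth_functions M then c * chart_deriv U \<phi> e f p else 0) \<in> tangent M p"
proof (rule tangentI)
  have p: "p \<in> pts M" using chart_subset[OF assms(2)] assms(4) by blast
  have rep: "\<exists>N G. chart_rep U \<phi> f p N G" if "f \<in> smooth_functions M" for f
    using smooth_functions_smooth_at[OF assms(1) that p] unfolding smooth_at_chart[OF assms(1,2,4)] .
  note cd = chart_deriv_rep[OF assms]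
  fix f g assume fg: "f \<in> smooth_functions M" "g \<in> smooth_functions M"
  obtain N F where F: "chart_rep U \<phi> f p N F" using rep[OF fg(1)] by blast
  obtain N' G where G: "chart_rep U \<phi> g p N' G" using rep[OF fg(2)] by blast
  have N: "open (N \<inter> N')" "\<phi> p \<in> N \<inter> N'" "Cinf_on (N \<inter> N') F" "Cinf_on (N \<inter> N') G"
    using F G Cinf_on_subset[of N F "N \<inter> N'"] Cinf_on_subset[of N' G "N \<inter> N'"] unfolding chart_rep_def by auto
  have d: "(F has_derivative frechet_derivative F (at (\<phi> p))) (at (\<phi> p))"
      "(G has_derivative frechet_derivative G (at (\<phi> p))) (at (\<phi> p))"
    using N by (auto intro: Cinf_on_has_derivative)
  have v: "f p = F (\<phi> p)" "g p = G (\<phi> p)" using F G assms(4) unfolding chart_rep_def by auto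
  have "chart_rep U \<phi> (\<lambda>x. f x + g x) p (N \<inter> N') (\<lambda>y. F y + G y)"
    using F G N(1) Cinf_on_add[OF N(1,3,4)] unfolding chart_rep_def by auto
  from cd[OF this] frechet_derivative_at[OF has_derivative_add[OF d], symmetric]
  have "chart_deriv U \<phi> e (\<lambda>x. f x + g x) p = chart_deriv U \<phi> e f p + chart_deriv U \<phi> e g p"
    using cd[OF F] cd[OF G] by simp
  then show "(if (\<lambda>x. f x + g x) \<in> smooth_functions M then c * chart_deriv U \<phi> e (\<lambda>x. f x + g x) p else 0) =
      (if f \<in> smooth_functions M then c * chart_deriv U \<phi> e f p else 0) +
      (if g \<in> smooth_functions M then c * chart_deriv U \<phi> e g p else 0)"
    using fg smooth_functions_add[OF assms(1) fg] by (simp add: distrib_left)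
  have "chart_rep U \<phi> (\<lambda>x. f x * g x) p (N \<inter> N') (\<lambda>y. F y * G y)"
    using F G N(1) Cinf_on_mult[OF N(1,3,4)] unfolding chart_rep_def by auto
  from cd[OF this] frechet_derivative_at[OF has_derivative_mult[OF d], symmetric]
  have "chart_deriv U \<phi> e (\<lambda>x. f x * g x) p = f p * chart_deriv U \<phi> e g p + g p * chart_deriv U \<phi> e f p"
    using cd[OF F] cd[OF G] v by simp
  then show "(if (\<lambda>x. f x * g x) \<in> smooth_functions M then c * chart_deriv U \<phi> e (\<lambda>x. f x * g x) p else 0) =
      f p * (if g \<in> smooth_functions M then c * chart_deriv U \<phi> e g p else 0) +
      g p * (if f \<in> smooth_functions M then c * chart_deriv U \<phi> e f p else 0)"
    using fg smooth_functions_mult[OF assms(1) fg] by (simp add: algebra_simps)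
next
  have p: "p \<in> pts M" using chart_subset[OF assms(2)] assms(4) by blast
  fix a f assume f: "f \<in> smooth_functions M"
  obtain N F where F: "chart_rep U \<phi> f p N F"
    by (rule smooth_at_chartE[OF assms(1,2,4) smooth_functions_smooth_at[OF assms(1) f p]])
  then have N: "open N" "\<phi> p \<in> N" "Cinf_on N F" unfolding chart_rep_def by auto
  have "chart_rep U \<phi> (\<lambda>x. a * f x) p N (\<lambda>y. a * F y)"
    using F Cinf_on_mult[OF N(1) Cinf_on_const[OF N(1)] N(3)] unfolding chart_rep_def by auto
  from chart_deriv_rep[OF assms this]
    frechet_derivative_at[OF has_derivative_mult_right[OF Cinf_on_has_derivative[OF N(3,2)]], symmetric]
  have "chart_deriv U \<phi> e (\<lambda>x. a * f x) p = a * chart_deriv U \<phi> e f p"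
    using chart_deriv_rep[OF assms F] by simp
  then show "(if (\<lambda>x. a * f x) \<in> smooth_functions M then c * chart_deriv U \<phi> e (\<lambda>x. a * f x) p else 0) =
      a * (if f \<in> smooth_functions M then c * chart_deriv U \<phi> e f p else 0)"
    using f smooth_functions_scale[OF assms(1) f] by simp
qed simp

section \<open>Local frames\<close>

text \<open>The indices form an orthonormal basis of the model space, the \<open>x e\<close> are
  cut-off coordinates and the \<open>X e\<close> cut-off chart derivatives. By Hadamard's lemma a
  derivation is determined by its values on coordinates. The factor \<open>u\<close> makes the
  expansion hold at all points of M, also where the frame degenerates.\<close>

lemma local_frame_set:
  fixes M :: "('a, 'b::euclidean_space) mfd"
  assumes M: "manifold M" and q: "q \<in> pts M"
  obtains E :: "'b set" and x X u where "finite E" "\<And>e. e \<in> E \<Longrightarrow> x e \<in> smooth_functions M"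
    "\<And>e. e \<in> E \<Longrightarrow> X e \<in> vector_fields M" "u \<in> smooth_functions M" "u q = 1"
    "\<And>p v f. p \<in> pts M \<Longrightarrow> v \<in> tangent M p \<Longrightarrow> f \<in> smooth_functions M \<Longrightarrow>
      u p * v f = (\<Sum>e\<in>E. v (x e) * X e p f)"
    "\<And>e e'. e \<in> E \<Longrightarrow> e' \<in> E \<Longrightarrow> X e q (x e') = (if e = e' then 1 else 0)"
proof -
  obtain U \<phi> where U: "(U, \<phi>) \<in> atlas M" "q \<in> U"
    using atlas_cover[OF M q] by (elim exE conjE)
  have c: "is_chart M U \<phi>" using atlas_chart[OF M U(1)] .
  have sub: "subspace (model M)" using M unfolding manifold_def by (elim conjE)
  obtain E where E: "E \<subseteq> model M" "pairwise orthogonal E" "\<And>e. e \<in> E \<Longrightarrow> norm e = 1"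
      "independent E" "card E = dim (model M)" "span E = model M"
    by (rule orthonormal_basis_subspace[OF sub]) (rule that)
  have fin: "finite E" using independent_imp_finite[OF E(4)] .
  have expand: "y = (\<Sum>e\<in>E. (y \<bullet> e) *\<^sub>R e)" if "y \<in> model M" for y
    using orthonormal_basis_expand[OF E(2,3) _ fin, of y] that E(6) by simp
  obtain u0 K0 W0 where u0: "u0 \<in> smooth_functions M" "openin (mtop M) W0" "q \<in> W0" "W0 \<subseteq> K0" "K0 \<subseteq> U"
    "closedin (mtop M) K0" "\<And>p. p \<in> W0 \<Longrightarrow> u0 p = 1" "\<And>p. p \<notin> K0 \<Longrightarrow> u0 p = 0"
    by (rule manifold_bump[OF M chart_openin[OF c] U(2)]) (rule that)
  \<comment> \<open>Two nested cut-offs: u is supported where u0 = 1, so that the \<open>x e\<close>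
    are genuine coordinates near every point at which u does not vanish.\<close>
  obtain u K W where u: "u \<in> smooth_functions M" "openin (mtop M) W" "q \<in> W" "W \<subseteq> K" "K \<subseteq> W0"
    "closedin (mtop M) K" "\<And>p. p \<in> W \<Longrightarrow> u p = 1" "\<And>p. p \<notin> K \<Longrightarrow> u p = 0"
    by (rule manifold_bump[OF M u0(2,3)]) (rule that)
  define x where "x = (\<lambda>e p. u0 p * (\<phi> p \<bullet> e))"
  have sm_coord: "smooth_at M (\<lambda>p. \<phi> p \<bullet> e) p" if "p \<in> U" for e p
  proof (rule smooth_atI[OF U(1) that])
    show "chart_rep U \<phi> (\<lambda>p. \<phi> p \<bullet> e) p UNIV (\<lambda>y. y \<bullet> e)"
      unfolding chart_rep_def by (auto intro!: Cinf_on_bounded_linear bounded_linear_inner_left)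
  qed
  have x: "x e \<in> smooth_functions M" for e
    unfolding x_def by (rule cutoff_smooth[OF M u0(1,6,8) sm_coord]) (use u0(5) in auto)
  define X where "X = (\<lambda>e p f. if p \<in> U \<and> f \<in> smooth_functions M then u p * chart_deriv U \<phi> e f p else 0)"
  have K: "p \<in> U" if "p \<in> K" for p using that u(5) u0(4,5) by blast
  have Xt: "X e p \<in> tangent M p" if e: "e \<in> E" and p: "p \<in> pts M" for e p
  proof (cases "p \<in> U")
    case True
    have "e \<in> model M" using E(1) e by blast
    from chart_deriv_tangent[OF M c this True, of "u p"] True show ?thesis
      unfolding X_def by simp
  next
    case False
    then show ?thesis unfolding X_def by (intro tangentI) simp_all
  qed
  have sm_deriv: "smooth_at M (chart_deriv U \<phi> e f) p"
    if e: "e \<in> E" and f: "f \<in> smooth_functions M" and p: "p \<in> U" for e f p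
  proof -
    have em: "e \<in> model M" using E(1) e by blast
    have pM: "p \<in> pts M" using chart_subset[OF c] p by blast
    obtain N G where G: "chart_rep U \<phi> f p N G"
      by (rule smooth_at_chartE[OF M c p smooth_functions_smooth_at[OF M f pM]])
    have "chart_rep U \<phi> (chart_deriv U \<phi> e f) p N (\<lambda>y. frechet_derivative G (at y) e)"
      unfolding chart_rep_def
    proof (intro conjI ballI impI chart_repD(1,2)[OF G] Cinf_on_deriv[OF chart_repD(3)[OF G]])
      fix p' assume p': "p' \<in> U" "\<phi> p' \<in> N"
      then have "chart_rep U \<phi> f p' N G" using G unfolding chart_rep_def by simp
      from chart_deriv_rep[OF M c em p'(1) this]
      show "chart_deriv U \<phi> e f p' = frechet_derivative G (at (\<phi> p')) e" .
    qed
    then show ?thesis by (rule smooth_atI[OF U(1) p])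
  qed
  have Xs: "(\<lambda>p. X e p f) \<in> smooth_functions M" if e: "e \<in> E" and f: "f \<in> smooth_functions M" for e f
  proof -
    have "(\<lambda>p. u p * chart_deriv U \<phi> e f p) \<in> smooth_functions M"
      by (rule cutoff_smooth[OF M u(1,6,8) sm_deriv[OF e f K]])
    moreover have "(\<lambda>p. u p * chart_deriv U \<phi> e f p) = (\<lambda>p. X e p f)"
    proof
      show "u p * chart_deriv U \<phi> e f p = X e p f" for p
        using f u(8)[of p] K[of p] unfolding X_def by (cases "p \<in> K") auto
    qed
    ultimately show ?thesis by simp
  qed
  show ?thesis
  proof (rule that[of E x X u])
    show "X e \<in> vector_fields M" if e: "e \<in> E" for e
      unfolding tangent_sections_def
    proof (intro CollectI conjI ballI allI impI)
      fix p assume "p \<notin> pts M"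
      then have "p \<notin> U" using chart_subset[OF c] by blast
      then show "X e p = 0" unfolding X_def zero_fun_def by simp
    qed (use Xt[OF e] Xs[OF e] in auto)
  next
    fix p v f assume p: "p \<in> pts M" and v: "v \<in> tangent M p" and f: "f \<in> smooth_functions M"
    show "u p * v f = (\<Sum>e\<in>E. v (x e) * X e p f)"
    proof (cases "p \<in> K")
      case False
      then have "u p = 0" by (rule u(8))
      moreover from this have "X e p f = 0" for e unfolding X_def by simp
      ultimately show ?thesis by simp
    next
      case True
      then have pU: "p \<in> U" and pW0: "p \<in> W0" using K u(5) by auto
      obtain N G where G: "chart_rep U \<phi> f p N G"
        by (rule smooth_at_chartE[OF M c pU smooth_functions_smooth_at[OF M f p]])
      obtain r where r: "r > 0" "ball (\<phi> p) r \<subseteq> N"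
        using chart_repD(1,2)[OF G] open_contains_ball by blast
      have GB: "Cinf_on (ball (\<phi> p) r) G" by (rule Cinf_on_subset[OF chart_repD(3)[OF G] r(2)])
      obtain g where g: "\<And>e. Cinf_on (ball (\<phi> p) r) (g e)"
          "\<And>e. g e (\<phi> p) = frechet_derivative G (at (\<phi> p)) e"
          "\<And>E y. finite E \<Longrightarrow> y \<in> ball (\<phi> p) r \<Longrightarrow> y - \<phi> p = (\<Sum>e\<in>E. ((y - \<phi> p) \<bullet> e) *\<^sub>R e) \<Longrightarrow>
            G y = G (\<phi> p) + (\<Sum>e\<in>E. ((y - \<phi> p) \<bullet> e) * g e y)"
        by (rule hadamard[OF GB r(1)]) (rule that)
      \<comment> \<open>The factors of Hadamard's lemma live only near \<open>\<phi> p\<close>.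
        Multiplied by a bump function \<open>w\<close> around \<open>p\<close> they become global
        functions \<open>h e\<close>, to which derivations apply.\<close>
      define B where "B = {p' \<in> U. \<phi> p' \<in> ball (\<phi> p) r}"
      have B: "openin (mtop M) B" "p \<in> B"
        using chart_open_preimage[OF c open_ball] pU r(1) unfolding B_def by auto
      obtain w Kw Ww where w: "w \<in> smooth_functions M" "openin (mtop M) Ww" "p \<in> Ww" "Ww \<subseteq> Kw" "Kw \<subseteq> B"
        "closedin (mtop M) Kw" "\<And>p. p \<in> Ww \<Longrightarrow> w p = 1" "\<And>p. p \<notin> Kw \<Longrightarrow> w p = 0"
        by (rule manifold_bump[OF M B]) (rule that)
      define h where "h = (\<lambda>e p. w p * g e (\<phi> p))"
      have h: "h e \<in> smooth_functions M" for e
        unfolding h_def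
      proof (rule cutoff_smooth[OF M w(1,6,8)])
        fix p' assume "p' \<in> Kw"
        then have p': "p' \<in> U" "\<phi> p' \<in> ball (\<phi> p) r" using w(5) unfolding B_def by auto
        have "chart_rep U \<phi> (\<lambda>p. g e (\<phi> p)) p' (ball (\<phi> p) r) (g e)"
          using p'(2) g(1) unfolding chart_rep_def by simp
        then show "smooth_at M (\<lambda>p. g e (\<phi> p)) p'" by (rule smooth_atI[OF U(1) p'(1)])
      qed
      let ?c = "\<lambda>c p. if p \<in> pts M then c else (0::real)"
      let ?y = "\<lambda>e p'. x e p' + ?c (- x e p) p'"
      have cs: "?c a \<in> smooth_functions M" for a by (rule smooth_functions_const[OF M])
      have y: "?y e \<in> smooth_functions M" for e by (rule smooth_functions_add[OF M x cs])
      have yh: "(\<lambda>p'. ?y e p' * h e p') \<in> smooth_functions M" for e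
        by (rule smooth_functions_mult[OF M y h])
      have S: "(\<lambda>p'. \<Sum>e\<in>E. ?y e p' * h e p') \<in> smooth_functions M"
        by (rule smooth_functions_sum[OF M yh])
      \<comment> \<open>Near p the function f equals its Hadamard expansion, so v takes the same
        value on both. In the Leibniz rule the factors \<open>?y e\<close> vanish at p, which leaves
        v(x e) times a partial derivative.\<close>
      have "v f = v (\<lambda>p'. ?c (f p) p' + (\<Sum>e\<in>E. ?y e p' * h e p'))"
      proof (rule tangent_local[OF M v f smooth_functions_add[OF M cs S] openin_Int[OF w(2) u0(2)]])
        show "p \<in> Ww \<inter> W0" using w(3) pW0 by blast
        fix p' assume p': "p' \<in> Ww \<inter> W0"
        then have p'B: "p' \<in> U" "\<phi> p' \<in> ball (\<phi> p) r" using w(4,5) unfolding B_def by auto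
        then have p'M: "p' \<in> pts M" using chart_subset[OF c] by blast
        obtain N1 where N1: "model M \<inter> N1 = \<phi> ` U" by (rule chart_model[OF c pU])
        have "\<phi> p' \<in> model M" "\<phi> p \<in> model M" using N1 p'B(1) pU by blast+
        then have "\<phi> p' - \<phi> p = (\<Sum>e\<in>E. ((\<phi> p' - \<phi> p) \<bullet> e) *\<^sub>R e)"
          by (intro expand subspace_diff[OF sub])
        from g(3)[OF fin p'B(2) this]
        have "G (\<phi> p') = G (\<phi> p) + (\<Sum>e\<in>E. ((\<phi> p' - \<phi> p) \<bullet> e) * g e (\<phi> p'))" .
        moreover have "f p' = G (\<phi> p')" "f p = G (\<phi> p)"
          using chart_repD(4)[OF G] p'B pU r(2) chart_repD(2)[OF G] by auto
        moreover have "?y e p' * h e p' = ((\<phi> p' - \<phi> p) \<bullet> e) * g e (\<phi> p')" for e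
          using p' p'M pW0 u0(7) w(7) unfolding x_def h_def by (simp add: inner_diff_left)
        ultimately show "f p' = ?c (f p) p' + (\<Sum>e\<in>E. ?y e p' * h e p')" using p'M by simp
      qed
      also have "\<dots> = v (?c (f p)) + (\<Sum>e\<in>E. v (\<lambda>p'. ?y e p' * h e p'))"
        unfolding tangent_add[OF v cs S] tangent_sum[OF M v yh] by (rule refl)
      also have "\<dots> = (\<Sum>e\<in>E. v (x e) * frechet_derivative G (at (\<phi> p)) e)"
      proof -
        have "v (\<lambda>p'. ?y e p' * h e p') = v (x e) * frechet_derivative G (at (\<phi> p)) e" for e
          unfolding tangent_mult[OF v y h] tangent_add[OF v x cs] tangent_const[OF M v p]
          using p w(3,7) g(2) unfolding h_def by simp
        then show ?thesis unfolding tangent_const[OF M v p] by simp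
      qed
      finally have vf: "v f = (\<Sum>e\<in>E. v (x e) * frechet_derivative G (at (\<phi> p)) e)" .
      have "X e p f = u p * frechet_derivative G (at (\<phi> p)) e" if "e \<in> E" for e
      proof -
        have "e \<in> model M" using E(1) that by blast
        from chart_deriv_rep[OF M c this pU G] show ?thesis using pU f unfolding X_def by simp
      qed
      then show ?thesis unfolding vf by (simp add: sum_distrib_left mult_ac)
    qed
  next
    fix e e' assume e: "e \<in> E" and e': "e' \<in> E"
    obtain N where N: "open N" "\<phi> q \<in> N" "\<And>p. p \<in> U \<Longrightarrow> \<phi> p \<in> N \<Longrightarrow> p \<in> W0"
      by (rule chart_open_image[OF c u0(2) U(2) u0(3)]) (rule that)
    have "chart_rep U \<phi> (x e') q N (\<lambda>y. y \<bullet> e')"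
      unfolding chart_rep_def x_def
      using N u0(7) by (auto intro: Cinf_on_bounded_linear bounded_linear_inner_left)
    moreover have "e \<in> model M" using E(1) e by blast
    ultimately have "chart_deriv U \<phi> e (x e') q = frechet_derivative (\<lambda>y. y \<bullet> e') (at (\<phi> q)) e"
      by (intro chart_deriv_rep[OF M c _ U(2)])
    also have "frechet_derivative (\<lambda>y. y \<bullet> e') (at (\<phi> q)) = (\<lambda>y. y \<bullet> e')"
      by (rule frechet_derivative_at[symmetric, OF bounded_linear_imp_has_derivative[OF bounded_linear_inner_left]])
    finally have "X e q (x e') = e \<bullet> e'" using U(2) x u(3,7) unfolding X_def by simp
    moreover have "e \<bullet> e = 1" using E(3)[OF e] by (simp add: norm_eq_1)
    moreover have "e \<bullet> e' = 0" if "e \<noteq> e'"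
      using E(2) e e' that unfolding pairwise_def orthogonal_def by blast
    ultimately show "X e q (x e') = (if e = e' then 1 else 0)" by auto
  qed (use fin x u(1,3,7) in auto)
qed

lemma local_frame:
  fixes M :: "('a, 'b::euclidean_space) mfd"
  assumes "manifold M" "q \<in> pts M"
  obtains n :: nat and x X u where "\<And>i. i < n \<Longrightarrow> x i \<in> smooth_functions M"
    "\<And>i. i < n \<Longrightarrow> X i \<in> vector_fields M" "u \<in> smooth_functions M" "u q = 1"
    "\<And>p v f. p \<in> pts M \<Longrightarrow> v \<in> tangent M p \<Longrightarrow> f \<in> smooth_functions M \<Longrightarrow>
      u p * v f = (\<Sum>i<n. v (x i) * X i p f)"
    "\<And>i j. i < n \<Longrightarrow> j < n \<Longrightarrow> X i q (x j) = (if i = j then 1 else 0)"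
proof -
  obtain E :: "'b set" and x X u where E: "finite E" "\<And>e. e \<in> E \<Longrightarrow> x e \<in> smooth_functions M"
    "\<And>e. e \<in> E \<Longrightarrow> X e \<in> vector_fields M" "u \<in> smooth_functions M" "u q = 1"
    "\<And>p v f. p \<in> pts M \<Longrightarrow> v \<in> tangent M p \<Longrightarrow> f \<in> smooth_functions M \<Longrightarrow>
      u p * v f = (\<Sum>e\<in>E. v (x e) * X e p f)"
    "\<And>e e'. e \<in> E \<Longrightarrow> e' \<in> E \<Longrightarrow> X e q (x e') = (if e = e' then 1 else 0)"
    by (rule local_frame_set[OF assms]) (rule that)
  obtain h where h: "bij_betw h {..<card E} E"
    using ex_bij_betw_nat_finite[OF E(1)] unfolding atLeast0LessThan by blast
  show ?thesis
  proof (rule that[of "card E" "\<lambda>i. x (h i)" "\<lambda>i. X (h i)" u])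
    fix p v f assume "p \<in> pts M" "v \<in> tangent M p" "f \<in> smooth_functions M"
    then show "u p * v f = (\<Sum>i<card E. v (x (h i)) * X (h i) p f)"
      using E(6)[of p v f] sum.reindex_bij_betw[OF h, of "\<lambda>e. v (x e) * X e p f"] by simp
  next
    fix i j assume ij: "i < card E" "j < card E"
    then have "h i = h j \<longleftrightarrow> i = j" using h unfolding bij_betw_def inj_on_def by auto
    then show "X (h i) q (x (h j)) = (if i = j then 1 else 0)"
      using E(7)[of "h i" "h j"] bij_betwE[OF h] ij by simp
  qed (use E bij_betwE[OF h] in auto)
qed

section \<open>Embedded submanifolds: restriction, local extension and frames\<close>

locale embedded =
  fixes M S :: "('a, 'b::euclidean_space) mfd"
  assumes manifold_M: "manifold M" and embedded: "embedded_submanifold M S"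
begin

abbreviation "CM \<equiv> smooth_functions M"
abbreviation "CS \<equiv> smooth_functions S"

lemma manifold_S: "manifold S"
  using embedded unfolding embedded_submanifold_def by (elim conjE)

lemma pts_S: "pts S \<subseteq> pts M"
  using embedded unfolding embedded_submanifold_def by (elim conjE)

lemma mtop_S: "mtop S = subtopology (mtop M) (pts S)"
  using embedded unfolding embedded_submanifold_def by (elim conjE)

lemma slice_chart:
  assumes "q \<in> pts S"
  obtains U \<phi> where "q \<in> U" "is_chart M U \<phi>" "is_chart S (U \<inter> pts S) \<phi>"
proof -
  have "\<exists>U \<phi>. q \<in> U \<and> is_chart M U \<phi> \<and> \<phi> ` (U \<inter> pts S) = \<phi> ` U \<inter> model S \<and> is_chart S (U \<inter> pts S) \<phi>"
    using embedded assms unfolding embedded_submanifold_def by simp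
  then show ?thesis by (elim exE conjE) (rule that)
qed

lemma restrict_smooth:
  assumes f: "f \<in> CM"
  shows "restrict_to S f \<in> CS"
  unfolding smooth_functions_iff[OF manifold_S]
proof (intro conjI allI impI ballI)
  fix q assume q: "q \<in> pts S"
  obtain U \<phi> where U: "q \<in> U" "is_chart M U \<phi>" "is_chart S (U \<inter> pts S) \<phi>" by (rule slice_chart[OF q])
  have qM: "q \<in> pts M" using q pts_S by blast
  obtain N G where G: "chart_rep U \<phi> f q N G"
    by (rule smooth_at_chartE[OF manifold_M U(2,1) smooth_functions_smooth_at[OF manifold_M f qM]])
  have "q \<in> U \<inter> pts S" using U(1) q by blast
  moreover have "chart_rep (U \<inter> pts S) \<phi> (restrict_to S f) q N G"
    using G unfolding chart_rep_def restrict_to_def by simp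
  ultimately show "smooth_at S (restrict_to S f) q"
    using smooth_at_chart[OF manifold_S U(3)] by metis
qed (simp add: restrict_to_def)

text \<open>In a slice chart, a representative of g on S also represents a function on M. As S need
  not be closed, agreement with g is claimed only near q.\<close>

lemma local_extension:
  assumes g: "g \<in> CS" and q: "q \<in> pts S"
  obtains f W where "f \<in> CM" "openin (mtop S) W" "q \<in> W" "\<And>p. p \<in> W \<Longrightarrow> restrict_to S f p = g p"
proof -
  obtain U \<phi> where U: "q \<in> U" "is_chart M U \<phi>" "is_chart S (U \<inter> pts S) \<phi>" by (rule slice_chart[OF q])
  have qU: "q \<in> U \<inter> pts S" using U(1) q by blast
  obtain N G where G: "chart_rep (U \<inter> pts S) \<phi> g q N G"
    by (rule smooth_at_chartE[OF manifold_S U(3) qU smooth_functions_smooth_at[OF manifold_S g q]])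
  define B where "B = {p \<in> U. \<phi> p \<in> N}"
  have B: "openin (mtop M) B" "q \<in> B"
    using chart_open_preimage[OF U(2) chart_repD(1)[OF G]] chart_repD(2)[OF G] U(1) unfolding B_def by auto
  have sm: "smooth_at M (\<lambda>p. G (\<phi> p)) p" if "p \<in> B" for p
  proof -
    have p: "p \<in> U" using that unfolding B_def by simp
    have "chart_rep U \<phi> (\<lambda>p. G (\<phi> p)) p N G"
      using that chart_repD(1,3)[OF G] unfolding chart_rep_def B_def by simp
    then show ?thesis unfolding smooth_at_chart[OF manifold_M U(2) p] by (intro exI)
  qed
  obtain f W where f: "f \<in> CM" "openin (mtop M) W" "q \<in> W" "W \<subseteq> B" "\<And>p. p \<in> W \<Longrightarrow> f p = G (\<phi> p)"
    by (rule local_to_global[OF manifold_M B sm]) (assumption, rule that)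
  show ?thesis
  proof (rule that[OF f(1)])
    show "openin (mtop S) (W \<inter> pts S)" using openin_subtopology_Int[OF f(2), of "pts S"] by (simp only: mtop_S[symmetric])
    show "q \<in> W \<inter> pts S" using f(3) q by blast
    show "restrict_to S f p = g p" if "p \<in> W \<inter> pts S" for p
      using that f(4,5) chart_repD(4)[OF G, of p] unfolding restrict_to_def B_def by auto
  qed
qed

lemma vector_field_restrict:
  assumes "X \<in> vector_fields M"
  shows "restrict_to S X \<in> tangent_sections M S"
  unfolding tangent_sections_def
proof (intro CollectI conjI ballI allI impI)
  fix f assume f: "f \<in> CM"
  have "(\<lambda>q. X q f) \<in> CM" using assms f unfolding tangent_sections_def by simp
  from restrict_smooth[OF this] show "(\<lambda>q. restrict_to S X q f) \<in> CS"
    unfolding restrict_to_def by (simp add: if_distribR zero_fun_def cong: if_cong)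
qed (use assms pts_S in \<open>auto simp: tangent_sections_def restrict_to_def\<close>)

lemma frame:
  assumes q: "q \<in> pts S"
  obtains n :: nat and x \<sigma> u where "\<And>i. i < n \<Longrightarrow> x i \<in> CM"
    "\<And>i. i < n \<Longrightarrow> \<sigma> i \<in> tangent_sections M S" "u \<in> CS" "u q = 1"
    "\<And>p v f. p \<in> pts S \<Longrightarrow> v \<in> tangent M p \<Longrightarrow> f \<in> CM \<Longrightarrow> u p * v f = (\<Sum>i<n. v (x i) * \<sigma> i p f)"
proof -
  have qM: "q \<in> pts M" using q pts_S by blast
  obtain n :: nat and x X u where X: "\<And>i. i < n \<Longrightarrow> x i \<in> smooth_functions M"
    "\<And>i. i < n \<Longrightarrow> X i \<in> vector_fields M" "u \<in> smooth_functions M" "u q = 1"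
    "\<And>p v f. p \<in> pts M \<Longrightarrow> v \<in> tangent M p \<Longrightarrow> f \<in> smooth_functions M \<Longrightarrow>
      u p * v f = (\<Sum>i<n. v (x i) * X i p f)"
    "\<And>i j. i < n \<Longrightarrow> j < n \<Longrightarrow> X i q (x j) = (if i = j then 1 else 0)"
    by (rule local_frame[OF manifold_M qM]) (rule that)
  show ?thesis
  proof (rule that[of n x "\<lambda>i. restrict_to S (X i)" "restrict_to S u"])
    fix p v f assume p: "p \<in> pts S" and v: "v \<in> tangent M p" and f: "f \<in> CM"
    have "p \<in> pts M" using p pts_S by blast
    from X(5)[OF this v f] p show "restrict_to S u p * v f = (\<Sum>i<n. v (x i) * restrict_to S (X i) p f)"
      by (simp add: restrict_to_def)
  qed (use X q vector_field_restrict restrict_smooth in \<open>auto simp: restrict_to_def\<close>)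
qed

end

text \<open>This makes every statement about sections along a submanifold available for the vector
  fields and 1-forms of M and of S themselves.\<close>

lemma embedded_self:
  assumes "manifold M"
  shows "embedded M M"
proof
  show "embedded_submanifold M M"
    unfolding embedded_submanifold_def
  proof (intro conjI ballI)
    fix q assume "q \<in> pts M"
    then obtain U \<phi> where U: "(U, \<phi>) \<in> atlas M" "q \<in> U" using atlas_cover[OF assms] by blast
    have c: "is_chart M U \<phi>" by (rule atlas_chart[OF assms U(1)])
    obtain N where N: "model M \<inter> N = \<phi> ` U" by (rule chart_model[OF c U(2)])
    have "U \<inter> pts M = U" using chart_subset[OF c] by blast
    then show "\<exists>U \<phi>. q \<in> U \<and> is_chart M U \<phi> \<and> \<phi> ` (U \<inter> pts M) = \<phi> ` U \<inter> model M \<and>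
        is_chart M (U \<inter> pts M) \<phi>"
      using U(2) c N by (intro exI[of _ U] exI[of _ \<phi>]) auto
  qed (use assms in auto)
qed (rule assms)

section \<open>Sections of restricted bundles\<close>

lemma dual_space_sum:
  assumes "\<xi> \<in> dual_space V" "(\<lambda>x. 0) \<in> V"
    and "\<And>v w. v \<in> V \<Longrightarrow> w \<in> V \<Longrightarrow> (\<lambda>x. v x + w x) \<in> V" "\<And>c v. v \<in> V \<Longrightarrow> (\<lambda>x. c * v x) \<in> V"
    and "finite I" "\<And>i. i \<in> I \<Longrightarrow> w i \<in> V"
  shows "(\<lambda>x. \<Sum>i\<in>I. c i * w i x) \<in> V \<and> \<xi> (\<lambda>x. \<Sum>i\<in>I. c i * w i x) = (\<Sum>i\<in>I. c i * \<xi> (w i))"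
  using assms(5,6)
proof (induction I)
  case empty
  then show ?case using assms(2) dual_space_zero[OF assms(1)] by simp
next
  case (insert j I)
  have "(\<lambda>x. c j * w j x) \<in> V" using insert.prems by (intro assms(4)) simp
  then show ?case
    using insert assms(3)[of "\<lambda>x. c j * w j x"] dual_space_add[OF assms(1), of "\<lambda>x. c j * w j x"]
      dual_space_scale[OF assms(1), of "w j" "c j"] by simp
qed

lemma tangent_closed_zero: "(\<lambda>f. 0) \<in> tangent M q"
  by (rule tangentI) simp_all

lemma tangent_closed_add: "v \<in> tangent M q \<Longrightarrow> w \<in> tangent M q \<Longrightarrow> (\<lambda>f. v f + w f) \<in> tangent M q"
  by (rule tangentI) (simp_all add: tangent_add tangent_scale tangent_mult tangent_outside algebra_simps)

lemma tangent_closed_scale: "v \<in> tangent M q \<Longrightarrow> (\<lambda>f. c * v f) \<in> tangent M q"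
  by (rule tangentI) (simp_all add: tangent_add tangent_scale tangent_mult tangent_outside algebra_simps)

lemma dual_closed_zero: "(\<lambda>v. 0) \<in> dual_space V"
  by (rule dual_spaceI) simp_all

lemma dual_closed_add: "\<xi> \<in> dual_space V \<Longrightarrow> \<zeta> \<in> dual_space V \<Longrightarrow> (\<lambda>v. \<xi> v + \<zeta> v) \<in> dual_space V"
  by (rule dual_spaceI) (simp_all add: dual_space_add dual_space_scale dual_space_outside algebra_simps)

lemma dual_closed_scale: "\<xi> \<in> dual_space V \<Longrightarrow> (\<lambda>v. c * \<xi> v) \<in> dual_space V"
  by (rule dual_spaceI) (simp_all add: dual_space_add dual_space_scale dual_space_outside algebra_simps)

lemma cotangent_sum:
  assumes "\<xi> \<in> cotangent M q" "finite I" "\<And>i. i \<in> I \<Longrightarrow> w i \<in> tangent M q"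
  shows "\<xi> (\<lambda>f. \<Sum>i\<in>I. c i * w i f) = (\<Sum>i\<in>I. c i * \<xi> (w i))"
  by (rule conjunct2[OF dual_space_sum[OF assms(1)[unfolded cotangent_def] tangent_closed_zero
      tangent_closed_add tangent_closed_scale assms(2,3)]])

lemma dual_closed_sum:
  assumes "finite I" "\<And>i. i \<in> I \<Longrightarrow> \<xi> i \<in> dual_space V"
  shows "(\<lambda>v. \<Sum>i\<in>I. c i * \<xi> i v) \<in> dual_space V"
  by (rule conjunct1[OF dual_space_sum[OF dual_closed_zero dual_closed_zero dual_closed_add
      dual_closed_scale assms]])

lemma differential_cotangent: "differential M f q \<in> cotangent M q"
  unfolding cotangent_def
  by (rule dual_spaceI) (simp_all add: differential_def tangent_closed_add tangent_closed_scale)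

lemma differential_eval: "q \<in> pts M \<Longrightarrow> v \<in> tangent M q \<Longrightarrow> differential M f q v = v f"
  by (simp add: differential_def)

lemma differential_add:
  "f \<in> smooth_functions M \<Longrightarrow> g \<in> smooth_functions M \<Longrightarrow>
    differential M (\<lambda>p. f p + g p) q = (\<lambda>v. differential M f q v + differential M g q v)"
  by (rule ext) (auto simp: differential_def intro: tangent_add)

lemma differential_scale:
  "f \<in> smooth_functions M \<Longrightarrow> differential M (\<lambda>p. c * f p) q = (\<lambda>v. c * differential M f q v)"
  by (rule ext) (auto simp: differential_def intro: tangent_scale)

lemma differential_mult:
  "f \<in> smooth_functions M \<Longrightarrow> g \<in> smooth_functions M \<Longrightarrow>
    differential M (\<lambda>p. f p * g p) q = (\<lambda>v. f q * differential M g q v + g q * differential M f q v)"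
  by (rule ext) (auto simp: differential_def intro: tangent_mult)

lemma differential_outside: "f \<notin> smooth_functions M \<Longrightarrow> differential M f q = (\<lambda>v. 0)"
  by (rule ext) (auto simp: differential_def intro: tangent_outside)

lemma bivector_dual: "P \<in> bivectors M q \<Longrightarrow> \<xi> \<in> cotangent M q \<Longrightarrow> P \<xi> \<in> dual_space (cotangent M q)"
  unfolding bivectors_def by blast

lemma bivector_skew: "P \<in> bivectors M q \<Longrightarrow> P \<xi> \<zeta> = - P \<zeta> \<xi>"
  unfolding bivectors_def by blast

lemma bivector_outside: "P \<in> bivectors M q \<Longrightarrow> \<xi> \<notin> cotangent M q \<Longrightarrow> P \<xi> = (\<lambda>\<zeta>. 0)"
  unfolding bivectors_def zero_fun_def by blast

lemma bivector_tangent: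
  assumes P: "P \<in> bivectors M q" and \<xi>: "\<xi> \<in> cotangent M q"
  shows "(\<lambda>g. P \<xi> (differential M g q)) \<in> tangent M q"
  using dual_space_add[OF bivector_dual[OF P \<xi>]] dual_space_scale[OF bivector_dual[OF P \<xi>]]
    dual_space_zero[OF bivector_dual[OF P \<xi>]] differential_cotangent[of M _ q]
    dual_closed_scale[of _ "tangent M q"]
  by (intro tangentI)
    (simp_all add: differential_add differential_scale differential_mult differential_outside cotangent_def)

text \<open>The contraction of P by \<xi> is a tangent vector known through its values on functions.
  A frame expands \<zeta> into differentials of coordinates, and linearity of P reduces the claim to
  those.\<close>

lemma pairing:
  assumes M: "manifold M" and q: "q \<in> pts M" and P: "P \<in> bivectors M q"
    and \<xi>: "\<xi> \<in> cotangent M q" and \<zeta>: "\<zeta> \<in> cotangent M q"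
  shows "\<zeta> (\<lambda>g. P \<xi> (differential M g q)) = P \<xi> \<zeta>"
proof -
  obtain n :: nat and x X u where X: "\<And>i. i < n \<Longrightarrow> x i \<in> smooth_functions M"
    "\<And>i. i < n \<Longrightarrow> X i \<in> vector_fields M" "u \<in> smooth_functions M" "u q = 1"
    "\<And>p v f. p \<in> pts M \<Longrightarrow> v \<in> tangent M p \<Longrightarrow> f \<in> smooth_functions M \<Longrightarrow>
      u p * v f = (\<Sum>i<n. v (x i) * X i p f)"
    "\<And>i j. i < n \<Longrightarrow> j < n \<Longrightarrow> X i q (x j) = (if i = j then 1 else 0)"
    by (rule local_frame[OF M q]) (rule that)
  have Xt: "X i q \<in> tangent M q" if "i < n" for i
    using X(2)[OF that] q unfolding tangent_sections_def by blast
  have expand: "v = (\<lambda>f. \<Sum>i<n. v (x i) * X i q f)" if v: "v \<in> tangent M q" for v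
  proof
    show "v f = (\<Sum>i<n. v (x i) * X i q f)" for f
      using X(5)[OF q v, of f] X(4) tangent_outside[OF v, of f] tangent_outside[OF Xt, of _ f]
      by (cases "f \<in> smooth_functions M") auto
  qed
  have ev: "\<theta> v = (\<Sum>i<n. v (x i) * \<theta> (X i q))" if "\<theta> \<in> cotangent M q" "v \<in> tangent M q" for \<theta> v
    using trans[OF arg_cong[OF expand[OF that(2)], of \<theta>] cotangent_sum[OF that(1) finite_lessThan]] Xt
    by simp
  have "\<zeta> = (\<lambda>v. \<Sum>i<n. \<zeta> (X i q) * differential M (x i) q v)"
  proof
    fix v show "\<zeta> v = (\<Sum>i<n. \<zeta> (X i q) * differential M (x i) q v)"
    proof (cases "v \<in> tangent M q")
      case True
      then show ?thesis using ev[OF \<zeta> True] differential_eval[OF q True] by (simp add: mult.commute)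
    next
      case False
      then show ?thesis using dual_space_outside[OF \<zeta>[unfolded cotangent_def] False]
        by (simp add: differential_def)
    qed
  qed
  moreover have "P \<xi> (\<lambda>v. \<Sum>i<n. \<zeta> (X i q) * differential M (x i) q v) =
      (\<Sum>i<n. \<zeta> (X i q) * P \<xi> (differential M (x i) q))"
    by (rule conjunct2[OF dual_space_sum[OF bivector_dual[OF P \<xi>, unfolded cotangent_def] dual_closed_zero
        dual_closed_add dual_closed_scale finite_lessThan differential_cotangent[unfolded cotangent_def]]])
  ultimately have "P \<xi> \<zeta> = (\<Sum>i<n. \<zeta> (X i q) * P \<xi> (differential M (x i) q))" by simp
  then show ?thesis using ev[OF \<zeta> bivector_tangent[OF P \<xi>]] by (simp add: mult.commute)
qed

context embedded
begin

abbreviation "TSec \<equiv> tangent_sections M S"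
abbreviation "Cov \<equiv> cotangent_sections M S"
abbreviation "dM f \<equiv> restrict_to S (differential M f)"

lemmas CS_add = smooth_functions_add[OF manifold_S]
  and CS_mult = smooth_functions_mult[OF manifold_S]
  and CS_scale = smooth_functions_scale[OF manifold_S]
  and CS_sum = smooth_functions_sum[OF manifold_S]
  and CS_zero = smooth_functions_zero[OF manifold_S]
  and CS_const = smooth_functions_const[OF manifold_S]
  and CM_add = smooth_functions_add[OF manifold_M]
  and CM_mult = smooth_functions_mult[OF manifold_M]
  and CM_scale = smooth_functions_scale[OF manifold_M]

lemma CS_diff: "f \<in> CS \<Longrightarrow> g \<in> CS \<Longrightarrow> (\<lambda>p. f p - g p) \<in> CS"
  using CS_add[of f "\<lambda>p. (- 1) * g p"] CS_scale[of g "- 1"] by simp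

lemma TSec_tangent: "\<sigma> \<in> TSec \<Longrightarrow> p \<in> pts S \<Longrightarrow> \<sigma> p \<in> tangent M p"
  unfolding tangent_sections_def by blast

lemma TSec_smooth: "\<sigma> \<in> TSec \<Longrightarrow> f \<in> CM \<Longrightarrow> (\<lambda>p. \<sigma> p f) \<in> CS"
  unfolding tangent_sections_def by blast

lemma TSec_outside: "\<sigma> \<in> TSec \<Longrightarrow> p \<notin> pts S \<Longrightarrow> \<sigma> p = (\<lambda>f. 0)"
  unfolding tangent_sections_def zero_fun_def by blast

lemma TSecI:
  "(\<And>p. p \<in> pts S \<Longrightarrow> \<sigma> p \<in> tangent M p) \<Longrightarrow> (\<And>p. p \<notin> pts S \<Longrightarrow> \<sigma> p = (\<lambda>f. 0)) \<Longrightarrow>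
    (\<And>f. f \<in> CM \<Longrightarrow> (\<lambda>p. \<sigma> p f) \<in> CS) \<Longrightarrow> \<sigma> \<in> TSec"
  unfolding tangent_sections_def zero_fun_def by blast

lemma Cov_cotangent: "a \<in> Cov \<Longrightarrow> p \<in> pts S \<Longrightarrow> a p \<in> cotangent M p"
  unfolding cotangent_sections_def by blast

lemma Cov_smooth: "a \<in> Cov \<Longrightarrow> \<sigma> \<in> TSec \<Longrightarrow> (\<lambda>p. a p (\<sigma> p)) \<in> CS"
  unfolding cotangent_sections_def by blast

lemma Cov_outside: "a \<in> Cov \<Longrightarrow> p \<notin> pts S \<Longrightarrow> a p = (\<lambda>v. 0)"
  unfolding cotangent_sections_def zero_fun_def by blast

lemma CovI:
  "(\<And>p. p \<in> pts S \<Longrightarrow> a p \<in> cotangent M p) \<Longrightarrow> (\<And>p. p \<notin> pts S \<Longrightarrow> a p = (\<lambda>v. 0)) \<Longrightarrow>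
    (\<And>\<sigma>. \<sigma> \<in> TSec \<Longrightarrow> (\<lambda>p. a p (\<sigma> p)) \<in> CS) \<Longrightarrow> a \<in> Cov"
  unfolding cotangent_sections_def zero_fun_def by blast

lemma Cov_dual: "a \<in> Cov \<Longrightarrow> p \<in> pts S \<Longrightarrow> a p \<in> dual_space (tangent M p)"
  using Cov_cotangent unfolding cotangent_def .

lemma Cov_eqI:
  assumes "a \<in> Cov" "b \<in> Cov" "\<And>p v. p \<in> pts S \<Longrightarrow> v \<in> tangent M p \<Longrightarrow> a p v = b p v"
  shows "a = b"
proof (intro ext)
  fix p v
  show "a p v = b p v"
    using assms(3)[of p v] Cov_outside[OF assms(1), of p] Cov_outside[OF assms(2), of p]
      dual_space_outside[OF Cov_dual[OF assms(1)], of p v] dual_space_outside[OF Cov_dual[OF assms(2)], of p v]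
    by (cases "p \<in> pts S"; cases "v \<in> tangent M p") auto
qed

section \<open>Modules of sections over the functions on S\<close>

lemma TSec_add: "\<sigma> \<in> TSec \<Longrightarrow> \<tau> \<in> TSec \<Longrightarrow> (\<lambda>p f. \<sigma> p f + \<tau> p f) \<in> TSec"
  by (rule TSecI) (simp_all add: TSec_tangent TSec_smooth TSec_outside tangent_closed_add CS_add)

lemma TSec_smult: "h \<in> CS \<Longrightarrow> \<sigma> \<in> TSec \<Longrightarrow> (\<lambda>p f. h p * \<sigma> p f) \<in> TSec"
  by (rule TSecI) (simp_all add: TSec_tangent TSec_smooth TSec_outside tangent_closed_scale CS_mult)

lemma TSec_zero: "(\<lambda>p f. 0) \<in> TSec"
  by (rule TSecI) (simp_all add: tangent_closed_zero CS_zero)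

lemma Cov_add: "a \<in> Cov \<Longrightarrow> b \<in> Cov \<Longrightarrow> (\<lambda>p v. a p v + b p v) \<in> Cov"
  by (rule CovI) (simp_all add: Cov_dual Cov_smooth Cov_outside dual_closed_add CS_add cotangent_def)

lemma Cov_smult: "h \<in> CS \<Longrightarrow> a \<in> Cov \<Longrightarrow> (\<lambda>p v. h p * a p v) \<in> Cov"
  by (rule CovI) (simp_all add: Cov_dual Cov_smooth Cov_outside dual_closed_scale CS_mult cotangent_def)

lemma Cov_scale: "a \<in> Cov \<Longrightarrow> (\<lambda>p v. c * a p v) \<in> Cov"
  by (rule CovI) (simp_all add: Cov_dual Cov_smooth Cov_outside dual_closed_scale CS_scale cotangent_def)

lemma Cov_zero: "(\<lambda>p v. 0) \<in> Cov"
  by (rule CovI) (simp_all add: dual_closed_zero CS_zero cotangent_def)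

lemma Cov_diff: "a \<in> Cov \<Longrightarrow> b \<in> Cov \<Longrightarrow> (\<lambda>p v. a p v - b p v) \<in> Cov"
  using Cov_add[of a "\<lambda>p v. (- 1) * b p v"] Cov_scale[of b "- 1"] by simp

lemma dM_eval: "p \<in> pts S \<Longrightarrow> v \<in> tangent M p \<Longrightarrow> dM f p v = v f"
  using pts_S by (auto simp: restrict_to_def differential_def)

lemma dM_Cov: "f \<in> CM \<Longrightarrow> dM f \<in> Cov"
proof (rule CovI)
  fix \<sigma> assume f: "f \<in> CM" and \<sigma>: "\<sigma> \<in> TSec"
  have "(\<lambda>p. dM f p (\<sigma> p)) = (\<lambda>p. \<sigma> p f)"
  proof
    show "dM f p (\<sigma> p) = \<sigma> p f" for p
      using dM_eval[OF _ TSec_tangent[OF \<sigma>], of p f] TSec_outside[OF \<sigma>, of p]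
      by (cases "p \<in> pts S") (simp_all add: restrict_to_def)
  qed
  then show "(\<lambda>p. dM f p (\<sigma> p)) \<in> CS" using TSec_smooth[OF \<sigma> f] by simp
qed (simp_all add: restrict_to_def differential_cotangent zero_fun_def)

text \<open>Linearity over \<open>CS\<close> evaluated at the point q, for functionals with real
  values. The type \<open>'x\<close> is left open so that sections of the tangent and of the
  cotangent bundle are both covered.\<close>

definition tensorial :: "'a \<Rightarrow> ('a \<Rightarrow> 'x \<Rightarrow> real) set \<Rightarrow> (('a \<Rightarrow> 'x \<Rightarrow> real) \<Rightarrow> real) \<Rightarrow> bool" where
  "tensorial q X \<Phi> \<longleftrightarrow> (\<forall>s\<in>X. \<forall>t\<in>X. \<Phi> (\<lambda>p x. s p x + t p x) = \<Phi> s + \<Phi> t) \<and>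
     (\<forall>h\<in>CS. \<forall>s\<in>X. \<Phi> (\<lambda>p x. h p * s p x) = h q * \<Phi> s)"

lemma tensorialI:
  "(\<And>s t. s \<in> X \<Longrightarrow> t \<in> X \<Longrightarrow> \<Phi> (\<lambda>p x. s p x + t p x) = \<Phi> s + \<Phi> t) \<Longrightarrow>
   (\<And>h s. h \<in> CS \<Longrightarrow> s \<in> X \<Longrightarrow> \<Phi> (\<lambda>p x. h p * s p x) = h q * \<Phi> s) \<Longrightarrow> tensorial q X \<Phi>"
  unfolding tensorial_def by blast

lemma tensorial_smult: "tensorial q X \<Phi> \<Longrightarrow> h \<in> CS \<Longrightarrow> s \<in> X \<Longrightarrow> \<Phi> (\<lambda>p x. h p * s p x) = h q * \<Phi> s"
  unfolding tensorial_def by blast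

lemma tensorial_add: "tensorial q X \<Phi> \<Longrightarrow> s \<in> X \<Longrightarrow> t \<in> X \<Longrightarrow> \<Phi> (\<lambda>p x. s p x + t p x) = \<Phi> s + \<Phi> t"
  unfolding tensorial_def by blast

lemma tensorial_sum:
  fixes n :: nat
  assumes X: "(\<lambda>p x. 0) \<in> X" "\<And>s t. s \<in> X \<Longrightarrow> t \<in> X \<Longrightarrow> (\<lambda>p x. s p x + t p x) \<in> X"
      "\<And>h s. h \<in> CS \<Longrightarrow> s \<in> X \<Longrightarrow> (\<lambda>p x. h p * s p x) \<in> X"
    and \<Phi>: "tensorial q X \<Phi>" and s: "\<And>i. i < n \<Longrightarrow> s i \<in> X" and h: "\<And>i. i < n \<Longrightarrow> h i \<in> CS"
  shows "(\<lambda>p x. \<Sum>i<n. h i p * s i p x) \<in> X \<and>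
    \<Phi> (\<lambda>p x. \<Sum>i<n. h i p * s i p x) = (\<Sum>i<n. h i q * \<Phi> (s i))"
  using s h
proof (induction n)
  case 0
  show ?case using tensorial_smult[OF \<Phi> CS_zero X(1)] X(1) by simp
next
  case (Suc n)
  let ?s = "\<lambda>p x. \<Sum>i<n. h i p * s i p x"
  have IH: "?s \<in> X" "\<Phi> ?s = (\<Sum>i<n. h i q * \<Phi> (s i))" using Suc by auto
  have l: "(\<lambda>p x. h n p * s n p x) \<in> X" using X(3) Suc.prems by simp
  have "\<Phi> (\<lambda>p x. ?s p x + h n p * s n p x) = \<Phi> ?s + h n q * \<Phi> (s n)"
    using tensorial_add[OF \<Phi> IH(1) l] tensorial_smult[OF \<Phi>, of "h n" "s n"] Suc.prems by simp
  then show ?case using X(2)[OF IH(1) l] IH(2) by simp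
qed

lemma frame_expand:
  fixes n :: nat
  assumes \<sigma>: "\<And>i. i < n \<Longrightarrow> \<sigma> i \<in> TSec"
    and fr: "\<And>p v f. p \<in> pts S \<Longrightarrow> v \<in> tangent M p \<Longrightarrow> f \<in> CM \<Longrightarrow> u p * v f = (\<Sum>i<n. v (x i) * \<sigma> i p f)"
    and p: "p \<in> pts S" and v: "v \<in> tangent M p"
  shows "(\<lambda>f. u p * v f) = (\<lambda>f. \<Sum>i<n. v (x i) * \<sigma> i p f)"
proof
  fix f show "u p * v f = (\<Sum>i<n. v (x i) * \<sigma> i p f)"
    using fr[OF p v, of f] tangent_outside[OF v, of f] tangent_outside[OF TSec_tangent[OF \<sigma> p], of _ f]
    by (cases "f \<in> CM") auto
qed

lemma frame_covector:
  fixes n :: nat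
  assumes \<sigma>: "\<And>i. i < n \<Longrightarrow> \<sigma> i \<in> TSec"
    and fr: "\<And>p v f. p \<in> pts S \<Longrightarrow> v \<in> tangent M p \<Longrightarrow> f \<in> CM \<Longrightarrow> u p * v f = (\<Sum>i<n. v (x i) * \<sigma> i p f)"
    and p: "p \<in> pts S" and v: "v \<in> tangent M p" and \<xi>: "\<xi> \<in> cotangent M p"
  shows "u p * \<xi> v = (\<Sum>i<n. v (x i) * \<xi> (\<sigma> i p))"
proof -
  have "u p * \<xi> v = \<xi> (\<lambda>f. u p * v f)"
    using dual_space_scale[OF \<xi>[unfolded cotangent_def] v] by simp
  also have "\<dots> = \<xi> (\<lambda>f. \<Sum>i<n. v (x i) * \<sigma> i p f)"
    by (rule arg_cong[OF frame_expand[OF \<sigma> fr p v]]) assumption+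
  also have "\<dots> = (\<Sum>i<n. v (x i) * \<xi> (\<sigma> i p))"
    by (rule cotangent_sum[OF \<xi>]) (auto intro: TSec_tangent[OF \<sigma> p])
  finally show ?thesis .
qed

text \<open>A section satisfies u a = sum of a(\<sigma> i) d(x i) with u = 1 at q, so a functional
  that is tensorial at q is determined by its values on exact forms. The identities for the bracket
  of sections are all reduced to functions in this way.\<close>

lemma tensorial_exact:
  assumes q: "q \<in> pts S" and \<Psi>: "tensorial q Cov \<Psi>" "\<And>f. f \<in> CM \<Longrightarrow> \<Psi> (dM f) = 0" and a: "a \<in> Cov"
  shows "\<Psi> a = 0"
proof -
  obtain n :: nat and x \<sigma> u where fr: "\<And>i. i < n \<Longrightarrow> x i \<in> CM"
    "\<And>i. i < n \<Longrightarrow> \<sigma> i \<in> TSec" "u \<in> CS" "u q = 1"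
    "\<And>p v f. p \<in> pts S \<Longrightarrow> v \<in> tangent M p \<Longrightarrow> f \<in> CM \<Longrightarrow> u p * v f = (\<Sum>i<n. v (x i) * \<sigma> i p f)"
    by (rule frame[OF q]) (rule that)
  have sums: "(\<lambda>p v. \<Sum>i<n. a p (\<sigma> i p) * dM (x i) p v) \<in> Cov \<and>
      \<Psi> (\<lambda>p v. \<Sum>i<n. a p (\<sigma> i p) * dM (x i) p v) = (\<Sum>i<n. a q (\<sigma> i q) * \<Psi> (dM (x i)))"
    by (rule tensorial_sum[OF Cov_zero Cov_add Cov_smult \<Psi>(1) dM_Cov[OF fr(1)] Cov_smooth[OF a fr(2)]])
  have "(\<lambda>p v. u p * a p v) = (\<lambda>p v. \<Sum>i<n. a p (\<sigma> i p) * dM (x i) p v)"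
  proof (rule Cov_eqI)
    show "(\<lambda>p v. u p * a p v) \<in> Cov" by (rule Cov_smult[OF fr(3) a])
    show "(\<lambda>p v. \<Sum>i<n. a p (\<sigma> i p) * dM (x i) p v) \<in> Cov" by (rule conjunct1[OF sums])
    fix p v assume pv: "p \<in> pts S" "v \<in> tangent M p"
    have "u p * a p v = (\<Sum>i<n. v (x i) * a p (\<sigma> i p))"
      by (rule frame_covector[OF fr(2,5) pv Cov_cotangent[OF a pv(1)]])
    then show "u p * a p v = (\<Sum>i<n. a p (\<sigma> i p) * dM (x i) p v)"
      unfolding dM_eval[OF pv] by (simp only: mult.commute)
  qed
  then have "u q * \<Psi> a = (\<Sum>i<n. a q (\<sigma> i q) * \<Psi> (dM (x i)))"
    using tensorial_smult[OF \<Psi>(1) fr(3) a] conjunct2[OF sums] by (simp only:)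
  then show ?thesis using fr(1,4) \<Psi>(2) by simp
qed

text \<open>The frame coefficients of \<tau> are the functions \<tau>(x i). By linearity over
  functions only their values at q enter, and these depend on \<tau> q alone.\<close>

lemma tensorial_tangent:
  assumes q: "q \<in> pts S" and \<Phi>: "tensorial q TSec \<Phi>"
  obtains \<xi> where "\<xi> \<in> cotangent M q" "\<And>\<sigma>. \<sigma> \<in> TSec \<Longrightarrow> \<Phi> \<sigma> = \<xi> (\<sigma> q)"
proof -
  obtain n :: nat and x \<sigma> u where fr: "\<And>i. i < n \<Longrightarrow> x i \<in> CM"
    "\<And>i. i < n \<Longrightarrow> \<sigma> i \<in> TSec" "u \<in> CS" "u q = 1"
    "\<And>p v f. p \<in> pts S \<Longrightarrow> v \<in> tangent M p \<Longrightarrow> f \<in> CM \<Longrightarrow> u p * v f = (\<Sum>i<n. v (x i) * \<sigma> i p f)"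
    by (rule frame[OF q]) (rule that)
  have qM: "q \<in> pts M" using q pts_S by blast
  let ?\<xi> = "\<lambda>v. \<Sum>i<n. \<Phi> (\<sigma> i) * differential M (x i) q v"
  show ?thesis
  proof (rule that[of ?\<xi>])
    show "?\<xi> \<in> cotangent M q"
      unfolding cotangent_def
      by (intro dual_closed_sum finite_lessThan differential_cotangent[unfolded cotangent_def])
    fix \<tau> assume \<tau>: "\<tau> \<in> TSec"
    have "(\<lambda>p f. u p * \<tau> p f) = (\<lambda>p f. \<Sum>i<n. \<tau> p (x i) * \<sigma> i p f)"
    proof
      fix p
      show "(\<lambda>f. u p * \<tau> p f) = (\<lambda>f. \<Sum>i<n. \<tau> p (x i) * \<sigma> i p f)"
      proof (cases "p \<in> pts S")
        case True
        show ?thesis by (rule frame_expand[OF fr(2,5) True TSec_tangent[OF \<tau> True]])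
      next
        case False
        then show ?thesis using TSec_outside[OF \<tau> False] TSec_outside[OF fr(2) False] by simp
      qed
    qed
    moreover have "(\<lambda>p f. \<Sum>i<n. \<tau> p (x i) * \<sigma> i p f) \<in> TSec \<and>
        \<Phi> (\<lambda>p f. \<Sum>i<n. \<tau> p (x i) * \<sigma> i p f) = (\<Sum>i<n. \<tau> q (x i) * \<Phi> (\<sigma> i))"
      by (rule tensorial_sum[OF TSec_zero TSec_add TSec_smult \<Phi> fr(2) TSec_smooth[OF \<tau> fr(1)]])
    ultimately have "u q * \<Phi> \<tau> = (\<Sum>i<n. \<tau> q (x i) * \<Phi> (\<sigma> i))"
      using tensorial_smult[OF \<Phi> fr(3) \<tau>] by (simp only:)
    then show "\<Phi> \<tau> = ?\<xi> (\<tau> q)"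
      using fr(4) differential_eval[OF qM TSec_tangent[OF \<tau> q]] by (simp add: mult.commute)
  qed
qed

lemma TSec_extend:
  assumes q: "q \<in> pts S" and v: "v \<in> tangent M q"
  obtains \<tau> where "\<tau> \<in> TSec" "\<tau> q = v"
proof -
  obtain n :: nat and x \<sigma> u where fr: "\<And>i. i < n \<Longrightarrow> x i \<in> CM"
    "\<And>i. i < n \<Longrightarrow> \<sigma> i \<in> TSec" "u \<in> CS" "u q = 1"
    "\<And>p v f. p \<in> pts S \<Longrightarrow> v \<in> tangent M p \<Longrightarrow> f \<in> CM \<Longrightarrow> u p * v f = (\<Sum>i<n. v (x i) * \<sigma> i p f)"
    by (rule frame[OF q]) (rule that)
  \<comment> \<open>The zero functional, with which \<open>tensorial_sum\<close> yields membership
    of the combination in \<open>TSec\<close>.\<close>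
  have t: "tensorial q TSec (\<lambda>s. 0)" by (rule tensorialI) simp_all
  have "(\<lambda>p f. \<Sum>i<n. (if p \<in> pts S then v (x i) else 0) * \<sigma> i p f) \<in> TSec"
    by (rule conjunct1[OF tensorial_sum[where s = \<sigma> and h = "\<lambda>i p. if p \<in> pts S then v (x i) else 0",
          OF TSec_zero TSec_add TSec_smult t fr(2) CS_const]])
  then show ?thesis
  proof (rule that)
    show "(\<lambda>f. \<Sum>i<n. (if q \<in> pts S then v (x i) else 0) * \<sigma> i q f) = v"
    proof -
      have "(\<lambda>f. \<Sum>i<n. (if q \<in> pts S then v (x i) else 0) * \<sigma> i q f) =
          (\<lambda>f. \<Sum>i<n. v (x i) * \<sigma> i q f)"
        by (simp only: if_P[OF q])
      also have "\<dots> = (\<lambda>f. u q * v f)"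
        by (rule sym[OF frame_expand[OF fr(2,5) q v]])
      finally show ?thesis by (simp only: fr(4) mult_1)
    qed
  qed
qed

section \<open>Push-forward of tangent vectors and pull-back of covectors\<close>

lemma push_tangent:
  assumes "q \<in> pts S" "w \<in> tangent S q"
  shows "push M S w \<in> tangent M q"
proof (rule tangentI)
  fix f g assume fg: "f \<in> CM" "g \<in> CM"
  note r = restrict_smooth[OF fg(1)] restrict_smooth[OF fg(2)]
  have "restrict_to S (\<lambda>x. f x + g x) = (\<lambda>x. restrict_to S f x + restrict_to S g x)"
    by (rule ext) (simp add: restrict_to_def)
  then show "push M S w (\<lambda>x. f x + g x) = push M S w f + push M S w g"
    using fg CM_add[OF fg] tangent_add[OF assms(2) r] by (simp add: push_def)
  have "restrict_to S (\<lambda>x. f x * g x) = (\<lambda>x. restrict_to S f x * restrict_to S g x)"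
    by (rule ext) (simp add: restrict_to_def)
  then show "push M S w (\<lambda>x. f x * g x) = f q * push M S w g + g q * push M S w f"
    using fg CM_mult[OF fg] tangent_mult[OF assms(2) r] assms(1)
    by (simp add: push_def) (simp add: restrict_to_def)
next
  fix c f assume f: "f \<in> CM"
  have "restrict_to S (\<lambda>x. c * f x) = (\<lambda>x. c * restrict_to S f x)"
    by (rule ext) (simp add: restrict_to_def)
  then show "push M S w (\<lambda>x. c * f x) = c * push M S w f"
    using f CM_scale[OF f] tangent_scale[OF assms(2) restrict_smooth[OF f]] by (simp add: push_def)
qed (simp add: push_def)

lemma push_eval: "f \<in> CM \<Longrightarrow> push M S w f = w (restrict_to S f)"
  by (simp add: push_def)

text \<open>Near q every function on S is the restriction of a function on M, and tangent vectors of
  S are local.\<close>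

lemma push_inj:
  assumes "q \<in> pts S" "w \<in> tangent S q" "w' \<in> tangent S q" "push M S w = push M S w'"
  shows "w = w'"
proof
  fix g show "w g = w' g"
  proof (cases "g \<in> CS")
    case True
    obtain f W where f: "f \<in> CM" "openin (mtop S) W" "q \<in> W" "\<And>p. p \<in> W \<Longrightarrow> restrict_to S f p = g p"
      by (rule local_extension[OF True assms(1)]) (rule that)
    have ev: "v g = push M S v f" if "v \<in> tangent S q" for v
      using tangent_local[OF manifold_S that restrict_smooth[OF f(1)] True f(2,3,4)] push_eval[OF f(1)]
      by simp
    show ?thesis unfolding ev[OF assms(2)] ev[OF assms(3)] assms(4) by (rule refl)
  qed (simp add: tangent_outside[OF assms(2)] tangent_outside[OF assms(3)])
qed

lemma push_add: "push M S (\<lambda>f. v f + w f) = (\<lambda>f. push M S v f + push M S w f)"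
  by (rule ext) (simp add: push_def)

lemma push_scale: "push M S (\<lambda>f. c * v f) = (\<lambda>f. c * push M S v f)"
  by (rule ext) (simp add: push_def)

lemma push_section:
  assumes "Z \<in> vector_fields S"
  shows "(\<lambda>p. push M S (Z p)) \<in> TSec"
  using assms push_tangent restrict_smooth
  by (intro TSecI) (auto simp: tangent_sections_def push_def zero_fun_def)

lemma pull_eval: "w \<in> tangent S q \<Longrightarrow> pull M S q \<xi> w = \<xi> (push M S w)"
  by (simp add: pull_def)

lemma pull_cotangent:
  assumes "q \<in> pts S" "\<xi> \<in> cotangent M q"
  shows "pull M S q \<xi> \<in> cotangent S q"
  unfolding cotangent_def
proof (rule dual_spaceI)
  note \<xi> = assms(2)[unfolded cotangent_def]
  fix v w assume "v \<in> tangent S q" "w \<in> tangent S q"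
  then show "pull M S q \<xi> (\<lambda>x. v x + w x) = pull M S q \<xi> v + pull M S q \<xi> w"
    using dual_space_add[OF \<xi>] assms(1)
    by (simp add: pull_def push_add tangent_closed_add push_tangent)
next
  note \<xi> = assms(2)[unfolded cotangent_def]
  fix c v assume "v \<in> tangent S q"
  then show "pull M S q \<xi> (\<lambda>x. c * v x) = c * pull M S q \<xi> v"
    using dual_space_scale[OF \<xi>] assms(1)
    by (simp add: pull_def push_scale tangent_closed_scale push_tangent)
qed (simp add: pull_def)

lemma pull_add: "pull M S q (\<lambda>v. \<xi> v + \<zeta> v) = (\<lambda>w. pull M S q \<xi> w + pull M S q \<zeta> w)"
  by (rule ext) (simp add: pull_def)

lemma pull_scale: "pull M S q (\<lambda>v. c * \<xi> v) = (\<lambda>w. c * pull M S q \<xi> w)"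
  by (rule ext) (simp add: pull_def)

lemma pull_differential:
  assumes "q \<in> pts S" "f \<in> CM"
  shows "pull M S q (differential M f q) = differential S (restrict_to S f) q"
  using assms pts_S push_tangent[OF assms(1)] push_eval by (intro ext) (auto simp: pull_def differential_def)

text \<open>Coordinates of S extend near q to functions on M. The covector is lifted by taking the
  differentials of these extensions with the same coefficients.\<close>

lemma pull_surj:
  assumes q: "q \<in> pts S" and \<theta>: "\<theta> \<in> cotangent S q"
  obtains \<xi> where "\<xi> \<in> cotangent M q" "pull M S q \<xi> = \<theta>"
proof -
  interpret S: embedded S S by (rule embedded_self[OF manifold_S])
  obtain n :: nat and x \<sigma> u where fr: "\<And>i. i < n \<Longrightarrow> x i \<in> CS"
    "\<And>i. i < n \<Longrightarrow> \<sigma> i \<in> vector_fields S" "u \<in> CS" "u q = 1"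
    "\<And>p v f. p \<in> pts S \<Longrightarrow> v \<in> tangent S p \<Longrightarrow> f \<in> CS \<Longrightarrow> u p * v f = (\<Sum>i<n. v (x i) * \<sigma> i p f)"
    by (rule S.frame[OF q]) (rule that)
  have "\<exists>f. f \<in> CM \<and> (\<forall>w\<in>tangent S q. w (x i) = push M S w f)" if i: "i < n" for i
  proof -
    obtain f W where f: "f \<in> CM" "openin (mtop S) W" "q \<in> W" "\<And>p. p \<in> W \<Longrightarrow> restrict_to S f p = x i p"
      by (rule local_extension[OF fr(1)[OF i] q]) (rule that)
    have "w (x i) = push M S w f" if w: "w \<in> tangent S q" for w
      unfolding push_eval[OF f(1)]
      by (rule tangent_local[OF manifold_S w fr(1)[OF i] restrict_smooth[OF f(1)] f(2,3) f(4)[symmetric]])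
    then show ?thesis using f(1) by blast
  qed
  then obtain f where f: "\<And>i. i < n \<Longrightarrow> f i \<in> CM"
      "\<And>i w. i < n \<Longrightarrow> w \<in> tangent S q \<Longrightarrow> w (x i) = push M S w (f i)"
    by metis
  have qM: "q \<in> pts M" using q pts_S by blast
  let ?\<xi> = "\<lambda>v. \<Sum>i<n. \<theta> (\<sigma> i q) * differential M (f i) q v"
  show ?thesis
  proof (rule that[of ?\<xi>])
    show "?\<xi> \<in> cotangent M q"
      unfolding cotangent_def
      by (intro dual_closed_sum finite_lessThan differential_cotangent[unfolded cotangent_def])
    show "pull M S q ?\<xi> = \<theta>"
    proof
      fix w show "pull M S q ?\<xi> w = \<theta> w"
      proof (cases "w \<in> tangent S q")
        case True
        have "u q * \<theta> w = (\<Sum>i<n. w (x i) * \<theta> (\<sigma> i q))"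
          by (rule S.frame_covector[OF fr(2,5) q True \<theta>])
        then have "\<theta> w = (\<Sum>i<n. \<theta> (\<sigma> i q) * push M S w (f i))"
          using fr(4) f(2)[OF _ True] by (simp add: mult.commute)
        then show ?thesis
          unfolding pull_eval[OF True] differential_eval[OF qM push_tangent[OF q True]] by simp
      next
        case False
        then show ?thesis
          using dual_space_outside[OF \<theta>[unfolded cotangent_def] False] by (simp add: pull_def)
      qed
    qed
  qed
qed

text \<open>Tangent vectors of S are local and functions on S extend locally, so smooth dependence
  on the point can be tested on restrictions of functions on M. Brackets and the anchor are shown to
  be smooth by this criterion.\<close>

lemma smooth_derivations:
  assumes w: "\<And>p. p \<in> pts S \<Longrightarrow> w p \<in> tangent S p"
    and sm: "\<And>f. f \<in> CM \<Longrightarrow> (\<lambda>p. if p \<in> pts S then w p (restrict_to S f) else 0) \<in> CS"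
    and g: "g \<in> CS"
  shows "(\<lambda>p. if p \<in> pts S then w p g else 0) \<in> CS"
  unfolding smooth_functions_iff[OF manifold_S]
proof (intro conjI allI impI ballI)
  fix q assume q: "q \<in> pts S"
  obtain f W where f: "f \<in> CM" "openin (mtop S) W" "q \<in> W" "\<And>p. p \<in> W \<Longrightarrow> restrict_to S f p = g p"
    by (rule local_extension[OF g q]) (rule that)
  show "smooth_at S (\<lambda>p. if p \<in> pts S then w p g else 0) q"
  proof (rule smooth_at_cong[OF manifold_S f(2,3) _ smooth_functions_smooth_at[OF manifold_S sm[OF f(1)] q]])
    fix p assume p: "p \<in> W"
    then have pS: "p \<in> pts S" using f(2) openin_subset by blast
    show "(if p \<in> pts S then w p (restrict_to S f) else 0) = (if p \<in> pts S then w p g else 0)"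
      using tangent_local[OF manifold_S w[OF pS] restrict_smooth[OF f(1)] g f(2) p f(4)] pS by simp
  qed
qed simp

end

section \<open>Poisson submanifolds\<close>

lemma restrict_add: "restrict_to S (\<lambda>x. f x + g x) = (\<lambda>x. restrict_to S f x + restrict_to S g x :: real)"
  by (rule ext) (simp add: restrict_to_def)

lemma restrict_mult: "restrict_to S (\<lambda>x. f x * g x) = (\<lambda>x. restrict_to S f x * restrict_to S g x :: real)"
  by (rule ext) (simp add: restrict_to_def)

lemma restrict_scale: "restrict_to S (\<lambda>x. c * g x) = (\<lambda>x. c * restrict_to S g x :: real)"
  by (rule ext) (simp add: restrict_to_def)

lemma restrict_eval: "q \<in> pts S \<Longrightarrow> restrict_to S f q = f q"
  by (simp add: restrict_to_def)

lemma fun_bracket_tangent: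
  assumes "P q \<in> bivectors M q"
  shows "(\<lambda>g. fun_bracket M P f g q) \<in> tangent M q"
  unfolding fun_bracket_def by (rule bivector_tangent[OF assms differential_cotangent])

lemma fun_bracket_skew:
  assumes "P q \<in> bivectors M q"
  shows "fun_bracket M P f g q = - fun_bracket M P g f q"
  unfolding fun_bracket_def by (rule bivector_skew[OF assms])

lemma fun_bracket_tangent':
  assumes "P q \<in> bivectors M q"
  shows "(\<lambda>f. fun_bracket M P f g q) \<in> tangent M q"
proof -
  have "(\<lambda>f. fun_bracket M P f g q) = (\<lambda>f. (- 1) * fun_bracket M P g f q)"
    by (rule ext) (simp add: fun_bracket_skew[where P = P and q = q and M = M and g = g, OF assms])
  then show ?thesis
    using tangent_closed_scale[OF fun_bracket_tangent[where P = P and q = q, OF assms], of "- 1" g] by (simp only:)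
qed

locale poisson_sub = embedded M S for M S :: "('a, 'b::euclidean_space) mfd" +
  fixes \<pi> :: "'a bivf"
  assumes poisson_M: "poisson_manifold M \<pi>" and poisson_S: "poisson_submanifold M \<pi> S"
begin

abbreviation "PS \<equiv> restricted_tensor M \<pi> S"
abbreviation "brM \<equiv> fun_bracket M \<pi>"
abbreviation "brS \<equiv> fun_bracket S PS"
abbreviation "rho \<equiv> restricted_anchor M \<pi> S"
abbreviation "res \<equiv> restrict_to S"

lemma pi_field: "\<pi> \<in> bivector_fields M"
  using poisson_M unfolding poisson_manifold_def by (elim conjE)

lemma pi_bivector: "q \<in> pts M \<Longrightarrow> \<pi> q \<in> bivectors M q"
  using pi_field unfolding bivector_fields_def by blast

lemma pi_outside: "q \<notin> pts M \<Longrightarrow> \<pi> q \<xi> \<zeta> = 0"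
  using pi_field unfolding bivector_fields_def by simp

lemma S_in_M: "q \<in> pts S \<Longrightarrow> q \<in> pts M"
  using pts_S by blast

text \<open>Restriction of covectors to TS is onto, so a bivector on S is determined by its image in
  M, and the description in \<open>restricted_tensor\<close> is definite.\<close>

lemma PS_restricts:
  assumes q: "q \<in> pts S"
  shows "restricts_to_bivector M \<pi> S q (PS q)"
proof -
  obtain P where P: "restricts_to_bivector M \<pi> S q P"
    using poisson_S q unfolding poisson_submanifold_def by blast
  have "P' = P" if P': "restricts_to_bivector M \<pi> S q P'" for P'
  proof (intro ext)
    fix \<eta> \<theta>
    have b: "P \<in> bivectors S q" "P' \<in> bivectors S q"
      using P P' unfolding restricts_to_bivector_def by blast+
    consider "\<eta> \<in> cotangent S q" "\<theta> \<in> cotangent S q" | "\<eta> \<notin> cotangent S q" | "\<theta> \<notin> cotangent S q" by blast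
    then show "P' \<eta> \<theta> = P \<eta> \<theta>"
    proof cases
      case 1
      obtain \<xi> where \<xi>: "\<xi> \<in> cotangent M q" "pull M S q \<xi> = \<eta>" by (rule pull_surj[OF q 1(1)])
      obtain \<zeta> where \<zeta>: "\<zeta> \<in> cotangent M q" "pull M S q \<zeta> = \<theta>" by (rule pull_surj[OF q 1(2)])
      have "\<pi> q \<xi> \<zeta> = P \<eta> \<theta>" "\<pi> q \<xi> \<zeta> = P' \<eta> \<theta>"
        using P P' \<xi> \<zeta> unfolding restricts_to_bivector_def by blast+
      then show ?thesis by simp
    next
      case 2
      show ?thesis unfolding bivector_outside[OF b(1) 2] bivector_outside[OF b(2) 2] by (rule refl)
    next
      case 3
      show ?thesis
        unfolding bivector_skew[OF b(1), of \<eta>] bivector_skew[OF b(2), of \<eta>]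
          bivector_outside[OF b(1) 3] bivector_outside[OF b(2) 3] by (rule refl)
    qed
  qed
  then have "restricts_to_bivector M \<pi> S q (THE P. restricts_to_bivector M \<pi> S q P)"
    using P by (intro theI'[of "restricts_to_bivector M \<pi> S q"]) blast
  then show ?thesis unfolding restricted_tensor_def using q by simp
qed

lemma PS_bivector: "q \<in> pts S \<Longrightarrow> PS q \<in> bivectors S q"
  using PS_restricts unfolding restricts_to_bivector_def by blast

lemma PS_pull:
  "q \<in> pts S \<Longrightarrow> \<xi> \<in> cotangent M q \<Longrightarrow> \<zeta> \<in> cotangent M q \<Longrightarrow>
    PS q (pull M S q \<xi>) (pull M S q \<zeta>) = \<pi> q \<xi> \<zeta>"
  using PS_restricts unfolding restricts_to_bivector_def by simp

section \<open>The Poisson brackets on M and on S\<close>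

lemma brM_outside: "q \<notin> pts M \<Longrightarrow> brM f g q = 0"
  by (simp add: fun_bracket_def pi_outside)

lemma brS_outside: "q \<notin> pts S \<Longrightarrow> brS f g q = 0"
  by (simp add: fun_bracket_def restricted_tensor_def)

lemmas brM_tangent = fun_bracket_tangent[where P = \<pi>, OF pi_bivector]
  and brS_tangent = fun_bracket_tangent[where P = PS, OF PS_bivector]
  and brS_tangent' = fun_bracket_tangent'[where P = PS, OF PS_bivector]

lemma brM_skew: "brM f g q = - brM g f q"
  using fun_bracket_skew[where P = \<pi> and q = q and f = f and g = g, OF pi_bivector] brM_outside[of q] by (cases "q \<in> pts M") auto

lemma brS_skew: "brS f g q = - brS g f q"
  using fun_bracket_skew[where P = PS and q = q and f = f and g = g, OF PS_bivector] brS_outside[of q] by (cases "q \<in> pts S") auto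

lemma differential_one_form: "f \<in> CM \<Longrightarrow> differential M f \<in> one_forms M"
proof -
  assume f: "f \<in> CM"
  interpret M: embedded M M by (rule embedded_self[OF manifold_M])
  have "restrict_to M (differential M f) = differential M f"
    by (intro ext) (simp add: restrict_to_def differential_def zero_fun_def)
  then show ?thesis using M.dM_Cov[OF f] by simp
qed

lemma brM_CM: "f \<in> CM \<Longrightarrow> g \<in> CM \<Longrightarrow> brM f g \<in> CM"
  using pi_field differential_one_form unfolding bivector_fields_def fun_bracket_def by blast

lemma brS_restrict:
  assumes "f \<in> CM" "g \<in> CM" "q \<in> pts S"
  shows "brS (res f) (res g) q = brM f g q"
  unfolding fun_bracket_def pull_differential[OF assms(3,1), symmetric]
    pull_differential[OF assms(3,2), symmetric]
  by (rule PS_pull[OF assms(3) differential_cotangent differential_cotangent])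

lemma brS_restrict_fun: "f \<in> CM \<Longrightarrow> g \<in> CM \<Longrightarrow> brS (res f) (res g) = res (brM f g)"
  by (rule ext) (simp add: restrict_to_def[of S "brM f g"] brS_restrict brS_outside)

lemma if_brS: "(\<lambda>p. if p \<in> pts S then brS f g p else 0) = brS f g"
  by (rule ext) (simp add: brS_outside)

text \<open>On restrictions of functions on M the bracket is the restriction of the bracket of M.
  General functions are reached by treating one argument at a time.\<close>

lemma brS_CS:
  assumes f: "f \<in> CS" and g: "g \<in> CS"
  shows "brS f g \<in> CS"
proof -
  have 1: "brS (res F) g \<in> CS" if F: "F \<in> CM" for F
  proof -
    have "(\<lambda>p. if p \<in> pts S then brS (res F) g p else 0) \<in> CS"
    proof (rule smooth_derivations[where w = "\<lambda>p g. brS (res F) g p", OF brS_tangent _ g])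
      fix G assume G: "G \<in> CM"
      show "(\<lambda>p. if p \<in> pts S then brS (res F) (res G) p else 0) \<in> CS"
        unfolding if_brS unfolding brS_restrict_fun[OF F G] by (rule restrict_smooth[OF brM_CM[OF F G]])
    qed
    then show ?thesis unfolding if_brS .
  qed
  have "(\<lambda>p. if p \<in> pts S then brS f g p else 0) \<in> CS"
  proof (rule smooth_derivations[where w = "\<lambda>p f. brS f g p", OF brS_tangent' _ f])
    show "(\<lambda>p. if p \<in> pts S then brS (res F) g p else 0) \<in> CS" if "F \<in> CM" for F
      unfolding if_brS by (rule 1[OF that])
  qed
  then show ?thesis unfolding if_brS .
qed

lemma brS_ext:
  assumes f: "f \<in> CS" and g: "g \<in> CS" and F: "F \<in> CM" and G: "G \<in> CM"
    and W: "openin (mtop S) W" "p \<in> W"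
    and eq: "\<And>p. p \<in> W \<Longrightarrow> res F p = f p" "\<And>p. p \<in> W \<Longrightarrow> res G p = g p"
  shows "brS f g p = brM F G p"
proof -
  have p: "p \<in> pts S" using W openin_subset by blast
  have "brS f g p = brS f (res G) p"
    by (rule tangent_local[OF manifold_S brS_tangent[OF p] g restrict_smooth[OF G] W eq(2)[symmetric]])
  also have "\<dots> = brS (res F) (res G) p"
    by (rule tangent_local[OF manifold_S brS_tangent'[OF p] f restrict_smooth[OF F] W eq(1)[symmetric]])
  finally show ?thesis using brS_restrict[OF F G p] by simp
qed

lemma brM_jacobi:
  assumes "f \<in> CM" "g \<in> CM" "h \<in> CM"
  shows "brM f (brM g h) q + brM g (brM h f) q + brM h (brM f g) q = 0"
proof -
  have "brM f (brM g h) + brM g (brM h f) + brM h (brM f g) = 0"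
    using poisson_M assms unfolding poisson_manifold_def by blast
  from fun_cong[OF this, of q] show ?thesis by simp
qed

text \<open>The inner brackets must agree with brackets on M on a whole neighbourhood of q, because
  the outer bracket differentiates them; this is why a common \<open>W\<close> is taken for the
  three local extensions.\<close>

lemma brS_jacobi:
  assumes f: "f \<in> CS" and g: "g \<in> CS" and h: "h \<in> CS"
  shows "brS f (brS g h) q + brS g (brS h f) q + brS h (brS f g) q = 0"
proof (cases "q \<in> pts S")
  case q: True
  obtain F W1 where F: "F \<in> CM" "openin (mtop S) W1" "q \<in> W1" "\<And>p. p \<in> W1 \<Longrightarrow> res F p = f p"
    by (rule local_extension[OF f q]) (rule that)
  obtain G W2 where G: "G \<in> CM" "openin (mtop S) W2" "q \<in> W2" "\<And>p. p \<in> W2 \<Longrightarrow> res G p = g p"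
    by (rule local_extension[OF g q]) (rule that)
  obtain H W3 where H: "H \<in> CM" "openin (mtop S) W3" "q \<in> W3" "\<And>p. p \<in> W3 \<Longrightarrow> res H p = h p"
    by (rule local_extension[OF h q]) (rule that)
  define W where "W = W1 \<inter> (W2 \<inter> W3)"
  have W: "openin (mtop S) W" "q \<in> W" using F G H unfolding W_def by (auto intro: openin_Int)
  have e: "res F p = f p" "res G p = g p" "res H p = h p" if "p \<in> W" for p
    using that F(4) G(4) H(4) unfolding W_def by auto
  have WS: "p \<in> pts S" if "p \<in> W" for p using that W openin_subset by blast
  have gh: "res (brM G H) p = brS g h p" if p: "p \<in> W" for p
    unfolding restrict_eval[OF WS[OF p]] by (rule brS_ext[symmetric, OF g h G(1) H(1) W(1) p e(2,3)])
  have hf: "res (brM H F) p = brS h f p" if p: "p \<in> W" for p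
    unfolding restrict_eval[OF WS[OF p]] by (rule brS_ext[symmetric, OF h f H(1) F(1) W(1) p e(3,1)])
  have fg: "res (brM F G) p = brS f g p" if p: "p \<in> W" for p
    unfolding restrict_eval[OF WS[OF p]] by (rule brS_ext[symmetric, OF f g F(1) G(1) W(1) p e(1,2)])
  have "brS f (brS g h) q = brM F (brM G H) q"
    by (rule brS_ext[OF f brS_CS[OF g h] F(1) brM_CM[OF G(1) H(1)] W e(1) gh])
  moreover have "brS g (brS h f) q = brM G (brM H F) q"
    by (rule brS_ext[OF g brS_CS[OF h f] G(1) brM_CM[OF H(1) F(1)] W e(2) hf])
  moreover have "brS h (brS f g) q = brM H (brM F G) q"
    by (rule brS_ext[OF h brS_CS[OF f g] H(1) brM_CM[OF F(1) G(1)] W e(3) fg])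
  ultimately show ?thesis using brM_jacobi[OF F(1) G(1) H(1), of q] by simp
qed (simp add: brS_outside)

lemma brM_add: "g \<in> CM \<Longrightarrow> h \<in> CM \<Longrightarrow> brM f (\<lambda>x. g x + h x) = (\<lambda>p. brM f g p + brM f h p)"
proof
  fix p assume "g \<in> CM" "h \<in> CM"
  then show "brM f (\<lambda>x. g x + h x) p = brM f g p + brM f h p"
    using tangent_add[OF brM_tangent, of p g h f] brM_outside[of p] by (cases "p \<in> pts M") auto
qed

lemma brM_scale: "g \<in> CM \<Longrightarrow> brM f (\<lambda>x. c * g x) = (\<lambda>p. c * brM f g p)"
proof
  fix p assume "g \<in> CM"
  then show "brM f (\<lambda>x. c * g x) p = c * brM f g p"
    using tangent_scale[OF brM_tangent, of p g f c] brM_outside[of p] by (cases "p \<in> pts M") auto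
qed

lemma brM_mult:
  assumes "g \<in> CM" "h \<in> CM"
  shows "brM f (\<lambda>x. g x * h x) = (\<lambda>p. g p * brM f h p + h p * brM f g p)"
proof
  fix p show "brM f (\<lambda>x. g x * h x) p = g p * brM f h p + h p * brM f g p"
    using tangent_mult[OF brM_tangent assms, of p f] brM_outside[of p] by (cases "p \<in> pts M") auto
qed

lemma brS_add: "g \<in> CS \<Longrightarrow> h \<in> CS \<Longrightarrow> brS f (\<lambda>x. g x + h x) = (\<lambda>p. brS f g p + brS f h p)"
proof
  fix p assume "g \<in> CS" "h \<in> CS"
  then show "brS f (\<lambda>x. g x + h x) p = brS f g p + brS f h p"
    using tangent_add[OF brS_tangent, of p g h f] brS_outside[of p] by (cases "p \<in> pts S") auto
qed

lemma brS_scale: "g \<in> CS \<Longrightarrow> brS f (\<lambda>x. c * g x) = (\<lambda>p. c * brS f g p)"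
proof
  fix p assume "g \<in> CS"
  then show "brS f (\<lambda>x. c * g x) p = c * brS f g p"
    using tangent_scale[OF brS_tangent, of p g f c] brS_outside[of p] by (cases "p \<in> pts S") auto
qed

lemma brS_mult:
  assumes "g \<in> CS" "h \<in> CS"
  shows "brS f (\<lambda>x. g x * h x) = (\<lambda>p. g p * brS f h p + h p * brS f g p)"
proof
  fix p show "brS f (\<lambda>x. g x * h x) p = g p * brS f h p + h p * brS f g p"
    using tangent_mult[OF brS_tangent assms, of p f] brS_outside[of p] by (cases "p \<in> pts S") auto
qed

lemma brS_add': "g \<in> CS \<Longrightarrow> h \<in> CS \<Longrightarrow> brS (\<lambda>x. g x + h x) f p = brS g f p + brS h f p"
  by (simp add: brS_skew[of _ f] brS_add)

lemma brS_mult': "g \<in> CS \<Longrightarrow> h \<in> CS \<Longrightarrow> brS (\<lambda>x. g x * h x) f p = g p * brS h f p + h p * brS g f p"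
  by (simp add: brS_skew[of _ f] brS_mult)

section \<open>The anchor of the restricted cotangent bundle\<close>

lemma sharp_tangent:
  assumes "q \<in> pts M" "\<xi> \<in> cotangent M q"
  shows "(\<lambda>f. \<pi> q \<xi> (differential M f q)) \<in> tangent M q"
  by (rule bivector_tangent[OF pi_bivector[OF assms(1)] assms(2)])

text \<open>Contraction with the restricted tensor gives a vector on S whose push-forward is the
  contraction on M; injectivity of \<open>push\<close> makes it the one described by
  \<open>restricted_anchor\<close>.\<close>

lemma rho_eval:
  assumes a: "a \<in> Cov" and q: "q \<in> pts S"
  shows "rho a q = (\<lambda>g. PS q (pull M S q (a q)) (differential S g q))"
proof -
  let ?w = "\<lambda>g. PS q (pull M S q (a q)) (differential S g q)"
  have w: "?w \<in> tangent S q"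
    by (rule bivector_tangent[OF PS_bivector[OF q] pull_cotangent[OF q Cov_cotangent[OF a q]]])
  have "push M S ?w = sharp M \<pi> a q"
  proof
    fix f show "push M S ?w f = sharp M \<pi> a q f"
    proof (cases "f \<in> CM")
      case True
      show ?thesis
        unfolding push_eval[OF True] sharp_def pull_differential[OF q True, symmetric]
        by (rule PS_pull[OF q Cov_cotangent[OF a q] differential_cotangent])
    next
      case False
      then show ?thesis
        unfolding push_def sharp_def
        using tangent_outside[OF sharp_tangent[OF S_in_M[OF q] Cov_cotangent[OF a q]] False] by simp
    qed
  qed
  then have pw: "push M S ?w = sharp M \<pi> a q" .
  show ?thesis
    unfolding restricted_anchor_def if_P[OF q]
  proof (rule the_equality)
    show "?w \<in> tangent S q \<and> push M S ?w = sharp M \<pi> a q" by (intro conjI w pw)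
    fix w' assume w': "w' \<in> tangent S q \<and> push M S w' = sharp M \<pi> a q"
    show "w' = ?w"
      by (rule push_inj[OF q conjunct1[OF w'] w trans[OF conjunct2[OF w'] sym[OF pw]]])
  qed
qed

lemma rho_outside: "q \<notin> pts S \<Longrightarrow> rho a q = (\<lambda>g. 0)"
  by (simp add: restricted_anchor_def zero_fun_def)

lemma rho_tangent: "a \<in> Cov \<Longrightarrow> q \<in> pts S \<Longrightarrow> rho a q \<in> tangent S q"
  unfolding rho_eval
  by (rule bivector_tangent[OF PS_bivector pull_cotangent[OF _ Cov_cotangent]])

lemma rho_add: "a \<in> Cov \<Longrightarrow> b \<in> Cov \<Longrightarrow> rho (\<lambda>p v. a p v + b p v) q g = rho a q g + rho b q g"
proof (cases "q \<in> pts S")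
  case q: True
  assume ab: "a \<in> Cov" "b \<in> Cov"
  \<comment> \<open>Linearity of a bivector is available in its second slot; skewness moves the
    section there.\<close>
  have P: "PS q \<theta> \<eta> = - PS q \<eta> \<theta>" for \<theta> \<eta> by (rule bivector_skew[OF PS_bivector[OF q]])
  have c: "pull M S q (a q) \<in> cotangent S q" "pull M S q (b q) \<in> cotangent S q"
    using pull_cotangent[OF q] Cov_cotangent[OF _ q] ab by auto
  show ?thesis
    unfolding rho_eval[OF Cov_add[OF ab] q] rho_eval[OF ab(1) q] rho_eval[OF ab(2) q] pull_add
    unfolding P[of _ "differential S g q"]
    unfolding dual_space_add[OF bivector_dual[OF PS_bivector[OF q] differential_cotangent] c] by simp
qed (simp add: rho_outside)

lemma rho_smult: "h \<in> CS \<Longrightarrow> a \<in> Cov \<Longrightarrow> rho (\<lambda>p v. h p * a p v) q g = h q * rho a q g"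
proof (cases "q \<in> pts S")
  case q: True
  assume ha: "h \<in> CS" "a \<in> Cov"
  have P: "PS q \<theta> \<eta> = - PS q \<eta> \<theta>" for \<theta> \<eta> by (rule bivector_skew[OF PS_bivector[OF q]])
  have c: "pull M S q (a q) \<in> cotangent S q"
    using pull_cotangent[OF q] Cov_cotangent[OF _ q] ha by auto
  show ?thesis
    unfolding rho_eval[OF Cov_smult[OF ha] q] rho_eval[OF ha(2) q] pull_scale
    unfolding P[of _ "differential S g q"]
    unfolding dual_space_scale[OF bivector_dual[OF PS_bivector[OF q] differential_cotangent] c] by simp
qed (simp add: rho_outside)

text \<open>The section a need not be the restriction of a 1-form, so smoothness of \<pi> on 1-forms
  does not apply to it. In a frame, u \<pi>(a, df) is the sum of the functions {x i, f} a(\<sigma>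
  i).\<close>

lemma pi_smooth:
  assumes a: "a \<in> Cov" and f: "f \<in> CM"
  shows "(\<lambda>p. if p \<in> pts S then \<pi> p (a p) (differential M f p) else 0) \<in> CS"
proof (rule smooth_functions_divide[OF manifold_S])
  fix q assume q: "q \<in> pts S"
  obtain n :: nat and x \<sigma> u where fr: "\<And>i. i < n \<Longrightarrow> x i \<in> CM"
    "\<And>i. i < n \<Longrightarrow> \<sigma> i \<in> TSec" "u \<in> CS" "u q = 1"
    "\<And>p v f. p \<in> pts S \<Longrightarrow> v \<in> tangent M p \<Longrightarrow> f \<in> CM \<Longrightarrow> u p * v f = (\<Sum>i<n. v (x i) * \<sigma> i p f)"
    by (rule frame[OF q]) (rule that)
  let ?H = "\<lambda>p. if p \<in> pts S then \<pi> p (a p) (differential M f p) else 0"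
  have "u p * ?H p = (\<Sum>i<n. res (brM (x i) f) p * a p (\<sigma> i p))" for p
  proof (cases "p \<in> pts S")
    case p: True
    have v: "(\<lambda>g. \<pi> p (differential M f p) (differential M g p)) \<in> tangent M p"
      by (rule sharp_tangent[OF S_in_M[OF p] differential_cotangent])
    have sk: "\<pi> p \<theta> \<eta> = - \<pi> p \<eta> \<theta>" for \<theta> \<eta> by (rule bivector_skew[OF pi_bivector[OF S_in_M[OF p]]])
    have "u p * a p (\<lambda>g. \<pi> p (differential M f p) (differential M g p)) =
        (\<Sum>i<n. \<pi> p (differential M f p) (differential M (x i) p) * a p (\<sigma> i p))"
      by (rule frame_covector[OF fr(2,5) p v Cov_cotangent[OF a p]])
    then have "u p * \<pi> p (differential M f p) (a p) =
        (\<Sum>i<n. \<pi> p (differential M f p) (differential M (x i) p) * a p (\<sigma> i p))"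
      unfolding pairing[OF manifold_M S_in_M[OF p] pi_bivector[OF S_in_M[OF p]] differential_cotangent
          Cov_cotangent[OF a p]] .
    then show ?thesis
      unfolding if_P[OF p] restrict_eval[OF p] sk[of _ "differential M f p"] fun_bracket_def
      by (simp add: sum_negf)
  qed (simp add: restrict_to_def)
  then have "(\<lambda>p. u p * ?H p) = (\<lambda>p. \<Sum>i<n. res (brM (x i) f) p * a p (\<sigma> i p))" by (rule ext)
  moreover have "(\<lambda>p. \<Sum>i<n. res (brM (x i) f) p * a p (\<sigma> i p)) \<in> CS"
    by (intro CS_sum CS_mult restrict_smooth brM_CM f Cov_smooth[OF a] fr(1,2)) auto
  ultimately have "(\<lambda>p. u p * ?H p) \<in> CS" by (simp only:)
  then show "\<exists>u\<in>CS. u q \<noteq> 0 \<and> (\<lambda>p. u p * ?H p) \<in> CS" using fr(3,4) by (intro bexI[of _ u]) auto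
qed simp

lemma rho_smooth:
  assumes a: "a \<in> Cov" and g: "g \<in> CS"
  shows "(\<lambda>p. rho a p g) \<in> CS"
proof -
  have "(\<lambda>p. if p \<in> pts S then rho a p g else 0) \<in> CS"
  proof (rule smooth_derivations[where w = "rho a", OF rho_tangent[OF a] _ g])
    fix f assume f: "f \<in> CM"
    have "rho a p (res f) = \<pi> p (a p) (differential M f p)" if p: "p \<in> pts S" for p
      unfolding rho_eval[OF a p] pull_differential[OF p f, symmetric]
      by (rule PS_pull[OF p Cov_cotangent[OF a p] differential_cotangent])
    then have "(\<lambda>p. if p \<in> pts S then rho a p (res f) else 0) =
        (\<lambda>p. if p \<in> pts S then \<pi> p (a p) (differential M f p) else 0)"
      by (intro ext) simp
    then show "(\<lambda>p. if p \<in> pts S then rho a p (res f) else 0) \<in> CS"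
      using pi_smooth[OF a f] by (simp only:)
  qed
  moreover have "(\<lambda>p. if p \<in> pts S then rho a p g else 0) = (\<lambda>p. rho a p g)"
    by (rule ext) (simp add: rho_outside)
  ultimately show ?thesis by (simp only:)
qed

lemma rho_pull:
  assumes "a \<in> Cov" "q \<in> pts S" "pull M S q (a q) = differential S f q"
  shows "rho a q g = brS f g q"
  unfolding rho_eval[OF assms(1,2)] assms(3) fun_bracket_def by (rule refl)

lemma rho_dM: "f \<in> CM \<Longrightarrow> rho (dM f) q g = brS (res f) g q"
  using rho_pull[OF dM_Cov, of f q "res f" g] pull_differential[of q f]
  by (cases "q \<in> pts S") (simp_all add: restrict_eval rho_outside brS_outside)

text \<open>This converts the correction terms of \<open>triC_smult_section\<close>, which involve
  the derivation {_, h} of S, into anchor terms.\<close>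

lemma pull_hamiltonian:
  assumes q: "q \<in> pts S" and a: "a \<in> Cov"
  shows "a q (push M S (\<lambda>f. brS f g q)) = rho a q g"
proof -
  let ?\<theta> = "pull M S q (a q)"
  have \<theta>: "?\<theta> \<in> cotangent S q" by (rule pull_cotangent[OF q Cov_cotangent[OF a q]])
  have "a q (push M S (\<lambda>f. brS f g q)) = ?\<theta> (\<lambda>f. brS f g q)"
    by (rule pull_eval[OF brS_tangent'[OF q], symmetric])
  also have "\<dots> = ?\<theta> (\<lambda>f. (- 1) * brS g f q)"
    by (rule arg_cong[where f = ?\<theta>], rule ext) (simp add: brS_skew[of _ g])
  also have "\<dots> = (- 1) * ?\<theta> (\<lambda>f. brS g f q)"
    by (rule dual_space_scale[OF \<theta>[unfolded cotangent_def] brS_tangent[OF q]])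
  also have "?\<theta> (\<lambda>f. brS g f q) = PS q (differential S g q) ?\<theta>"
    unfolding fun_bracket_def
    by (rule pairing[OF manifold_S q PS_bivector[OF q] differential_cotangent \<theta>])
  finally show ?thesis
    unfolding rho_eval[OF a q] using bivector_skew[OF PS_bivector[OF q], of ?\<theta> "differential S g q"] by simp
qed

section \<open>The bilinear form attached to a section of the restricted tangent bundle\<close>

lemma TSec_app_add:
  "\<sigma> \<in> TSec \<Longrightarrow> f \<in> CM \<Longrightarrow> g \<in> CM \<Longrightarrow> (\<lambda>p. \<sigma> p (\<lambda>x. f x + g x)) = (\<lambda>p. \<sigma> p f + \<sigma> p g)"
proof
  fix p assume "\<sigma> \<in> TSec" "f \<in> CM" "g \<in> CM"
  then show "\<sigma> p (\<lambda>x. f x + g x) = \<sigma> p f + \<sigma> p g"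
    using tangent_add[OF TSec_tangent] TSec_outside[of \<sigma> p] by (cases "p \<in> pts S") auto
qed

lemma TSec_app_scale:
  "\<sigma> \<in> TSec \<Longrightarrow> f \<in> CM \<Longrightarrow> (\<lambda>p. \<sigma> p (\<lambda>x. c * f x)) = (\<lambda>p. c * \<sigma> p f)"
proof
  fix p assume "\<sigma> \<in> TSec" "f \<in> CM"
  then show "\<sigma> p (\<lambda>x. c * f x) = c * \<sigma> p f"
    using tangent_scale[OF TSec_tangent] TSec_outside[of \<sigma> p] by (cases "p \<in> pts S") auto
qed

lemma TSec_app_mult:
  "\<sigma> \<in> TSec \<Longrightarrow> f \<in> CM \<Longrightarrow> g \<in> CM \<Longrightarrow>
    (\<lambda>p. \<sigma> p (\<lambda>x. f x * g x)) = (\<lambda>p. res f p * \<sigma> p g + res g p * \<sigma> p f)"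
proof
  fix p assume "\<sigma> \<in> TSec" "f \<in> CM" "g \<in> CM"
  then show "\<sigma> p (\<lambda>x. f x * g x) = res f p * \<sigma> p g + res g p * \<sigma> p f"
    using tangent_mult[OF TSec_tangent] TSec_outside[of \<sigma> p]
    by (cases "p \<in> pts S") (auto simp: restrict_to_def)
qed

text \<open>The Lie derivative of \<open>\<pi>\<close> along an extension of \<open>\<sigma>\<close>, evaluated on two differentials: since
  \<open>S\<close> is Poisson, no extension of \<open>\<sigma>\<close> is needed to define it.\<close>

definition tri :: "('a \<Rightarrow> 'a tvec) \<Rightarrow> 'a \<Rightarrow> ('a \<Rightarrow> real) \<Rightarrow> ('a \<Rightarrow> real) \<Rightarrow> real" where
  "tri \<sigma> q f g = (if f \<in> CM \<and> g \<in> CM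
     then \<sigma> q (brM f g) - brS (res f) (\<lambda>p. \<sigma> p g) q - brS (\<lambda>p. \<sigma> p f) (res g) q else 0)"

lemma tri_skew:
  assumes "\<sigma> \<in> TSec" "q \<in> pts S"
  shows "tri \<sigma> q f g = - tri \<sigma> q g f"
proof (cases "f \<in> CM \<and> g \<in> CM")
  case True
  have "brM f g = (\<lambda>p. (- 1) * brM g f p)" by (rule ext) (simp add: brM_skew[of f])
  then have "\<sigma> q (brM f g) = - \<sigma> q (brM g f)"
    using tangent_scale[OF TSec_tangent[OF assms] brM_CM, of g f "- 1"] True by simp
  then show ?thesis
    using True brS_skew[of "res f" "\<lambda>p. \<sigma> p g" q] brS_skew[of "res g" "\<lambda>p. \<sigma> p f" q]
    by (simp add: tri_def)
qed (auto simp: tri_def)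

text \<open>Products of a derivative of g along \<sigma> with {f, h}, and the same with g and h
  exchanged, occur both in \<sigma>{f, g h} and in {f, \<sigma>(g h)}, and cancel. This uses that
  the bracket of S restricts the bracket of M.\<close>

lemma tri_tangent:
  assumes \<sigma>: "\<sigma> \<in> TSec" and q: "q \<in> pts S"
  shows "(\<lambda>g. tri \<sigma> q f g) \<in> tangent M q"
proof (cases "f \<in> CM")
  case f: True
  note t = TSec_tangent[OF \<sigma> q]
  have sf: "(\<lambda>p. \<sigma> p f) \<in> CS" by (rule TSec_smooth[OF \<sigma> f])
  show ?thesis
  proof (rule tangentI)
    fix g h assume g: "g \<in> CM" and h: "h \<in> CM"
    note sg = TSec_smooth[OF \<sigma> g] and sh = TSec_smooth[OF \<sigma> h]
    note rg = restrict_smooth[OF g] and rh = restrict_smooth[OF h]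
    note bg = brM_CM[OF f g] and bh = brM_CM[OF f h]
    show "tri \<sigma> q f (\<lambda>x. g x + h x) = tri \<sigma> q f g + tri \<sigma> q f h"
      using f g h CM_add[OF g h]
      by (simp add: tri_def brM_add[OF g h] tangent_add[OF t bg bh] TSec_app_add[OF \<sigma> g h]
          brS_add[OF sg sh] restrict_add brS_add[OF rg rh])
    have 1: "\<sigma> q (brM f (\<lambda>x. g x * h x)) =
        (g q * \<sigma> q (brM f h) + brM f h q * \<sigma> q g) + (h q * \<sigma> q (brM f g) + brM f g q * \<sigma> q h)"
      unfolding brM_mult[OF g h] tangent_add[OF t CM_mult[OF g bh] CM_mult[OF h bg]]
        tangent_mult[OF t g bh] tangent_mult[OF t h bg] by (rule refl)
    have 2: "brS (res f) (\<lambda>p. \<sigma> p (\<lambda>x. g x * h x)) q =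
        (g q * brS (res f) (\<lambda>p. \<sigma> p h) q + \<sigma> q h * brM f g q) +
        (h q * brS (res f) (\<lambda>p. \<sigma> p g) q + \<sigma> q g * brM f h q)"
      unfolding TSec_app_mult[OF \<sigma> g h] brS_add[OF CS_mult[OF rg sh] CS_mult[OF rh sg]]
        brS_mult[OF rg sh] brS_mult[OF rh sg] brS_restrict[OF f g q] brS_restrict[OF f h q] restrict_eval[OF q]
      by (rule refl)
    have 3: "brS (\<lambda>p. \<sigma> p f) (res (\<lambda>x. g x * h x)) q =
        g q * brS (\<lambda>p. \<sigma> p f) (res h) q + h q * brS (\<lambda>p. \<sigma> p f) (res g) q"
      unfolding restrict_mult brS_mult[OF rg rh] restrict_eval[OF q] by (rule refl)
    show "tri \<sigma> q f (\<lambda>x. g x * h x) = g q * tri \<sigma> q f h + h q * tri \<sigma> q f g"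
      using f g h CM_mult[OF g h] by (simp add: tri_def 1 2 3 algebra_simps)
  next
    fix c g assume g: "g \<in> CM"
    show "tri \<sigma> q f (\<lambda>x. c * g x) = c * tri \<sigma> q f g"
      using f g CM_scale[OF g]
      by (simp add: tri_def brM_scale[OF g] tangent_scale[OF t brM_CM[OF f g]] TSec_app_scale[OF \<sigma> g]
          brS_scale[OF TSec_smooth[OF \<sigma> g]] restrict_scale brS_scale[OF restrict_smooth[OF g]] algebra_simps)
  qed (simp add: tri_def)
next
  case False
  then show ?thesis by (simp add: tri_def tangent_closed_zero)
qed

lemma tri_tangent':
  assumes \<sigma>: "\<sigma> \<in> TSec" and q: "q \<in> pts S"
  shows "(\<lambda>f. tri \<sigma> q f g) \<in> tangent M q"
proof -
  have "(\<lambda>f. tri \<sigma> q f g) = (\<lambda>f. (- 1) * tri \<sigma> q g f)"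
    by (rule ext) (simp add: tri_skew[OF assms, of _ g])
  then show ?thesis using tangent_closed_scale[OF tri_tangent[OF assms], of "- 1" g] by (simp only:)
qed

text \<open>The bilinear extension of \<open>tri\<close> from differentials to all covectors. As
  \<open>tri\<close> is a tangent vector in each slot, covectors can be applied directly, first in
  \<open>f\<close> and then in \<open>g\<close>, without choosing functions with prescribed
  differentials.\<close>

definition triC :: "('a \<Rightarrow> 'a tvec) \<Rightarrow> 'a \<Rightarrow> 'a covec \<Rightarrow> 'a covec \<Rightarrow> real" where
  "triC \<sigma> q \<xi> \<zeta> = \<zeta> (\<lambda>g. \<xi> (\<lambda>f. tri \<sigma> q f g))"

lemma tri_half_tangent:
  assumes \<sigma>: "\<sigma> \<in> TSec" and q: "q \<in> pts S" and \<xi>: "\<xi> \<in> cotangent M q"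
  shows "(\<lambda>g. \<xi> (\<lambda>f. tri \<sigma> q f g)) \<in> tangent M q"
proof (rule tangentI)
  note d = \<xi>[unfolded cotangent_def]
  note t = tri_tangent'[OF \<sigma> q]
  fix g h assume gh: "g \<in> CM" "h \<in> CM"
  have "(\<lambda>f. tri \<sigma> q f (\<lambda>x. g x + h x)) = (\<lambda>f. tri \<sigma> q f g + tri \<sigma> q f h)"
    by (rule ext) (rule tangent_add[OF tri_tangent[OF \<sigma> q] gh])
  then show "\<xi> (\<lambda>f. tri \<sigma> q f (\<lambda>x. g x + h x)) = \<xi> (\<lambda>f. tri \<sigma> q f g) + \<xi> (\<lambda>f. tri \<sigma> q f h)"
    using dual_space_add[OF d t t] by (simp only:)
  have "(\<lambda>f. tri \<sigma> q f (\<lambda>x. g x * h x)) = (\<lambda>f. g q * tri \<sigma> q f h + h q * tri \<sigma> q f g)"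
    by (rule ext) (rule tangent_mult[OF tri_tangent[OF \<sigma> q] gh])
  then show "\<xi> (\<lambda>f. tri \<sigma> q f (\<lambda>x. g x * h x)) = g q * \<xi> (\<lambda>f. tri \<sigma> q f h) + h q * \<xi> (\<lambda>f. tri \<sigma> q f g)"
    using dual_space_add[OF d tangent_closed_scale[OF t] tangent_closed_scale[OF t]] dual_space_scale[OF d t]
    by (simp only:)
next
  note d = \<xi>[unfolded cotangent_def]
  note t = tri_tangent'[OF \<sigma> q]
  fix c g assume g: "g \<in> CM"
  have "(\<lambda>f. tri \<sigma> q f (\<lambda>x. c * g x)) = (\<lambda>f. c * tri \<sigma> q f g)"
    by (rule ext) (rule tangent_scale[OF tri_tangent[OF \<sigma> q] g])
  then show "\<xi> (\<lambda>f. tri \<sigma> q f (\<lambda>x. c * g x)) = c * \<xi> (\<lambda>f. tri \<sigma> q f g)"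
    using dual_space_scale[OF d t] by (simp only:)
next
  fix g assume "g \<notin> CM"
  then show "\<xi> (\<lambda>f. tri \<sigma> q f g) = 0"
    using dual_space_zero[OF \<xi>[unfolded cotangent_def]] by (simp add: tri_def)
qed

text \<open>The cut-off appears squared because both slots are expanded. The double sum derives
  skewness and smoothness of \<open>triC\<close> from those of \<open>tri\<close> on
  coordinates.\<close>

lemma triC_expand:
  fixes n :: nat
  assumes s: "\<And>i. i < n \<Longrightarrow> s i \<in> TSec"
    and fr: "\<And>p v f. p \<in> pts S \<Longrightarrow> v \<in> tangent M p \<Longrightarrow> f \<in> CM \<Longrightarrow> u p * v f = (\<Sum>i<n. v (x i) * s i p f)"
    and \<sigma>: "\<sigma> \<in> TSec" and q: "q \<in> pts S" and \<xi>: "\<xi> \<in> cotangent M q" and \<zeta>: "\<zeta> \<in> cotangent M q"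
  shows "(u q * u q) * triC \<sigma> q \<xi> \<zeta> =
    (\<Sum>i<n. \<Sum>j<n. tri \<sigma> q (x j) (x i) * (\<xi> (s j q) * \<zeta> (s i q)))"
proof -
  have "u q * triC \<sigma> q \<xi> \<zeta> = (\<Sum>i<n. \<xi> (\<lambda>f. tri \<sigma> q f (x i)) * \<zeta> (s i q))"
    unfolding triC_def by (rule frame_covector[OF s fr q tri_half_tangent[OF \<sigma> q \<xi>] \<zeta>])
  then have "(u q * u q) * triC \<sigma> q \<xi> \<zeta> = (\<Sum>i<n. (u q * \<xi> (\<lambda>f. tri \<sigma> q f (x i))) * \<zeta> (s i q))"
    by (simp add: mult.assoc sum_distrib_left)
  also have "\<dots> = (\<Sum>i<n. (\<Sum>j<n. tri \<sigma> q (x j) (x i) * \<xi> (s j q)) * \<zeta> (s i q))"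
  proof (rule sum.cong[OF refl])
    fix i
    have "u q * \<xi> (\<lambda>f. tri \<sigma> q f (x i)) = (\<Sum>j<n. tri \<sigma> q (x j) (x i) * \<xi> (s j q))"
      by (rule frame_covector[OF s fr q tri_tangent'[OF \<sigma> q] \<xi>])
    then show "u q * \<xi> (\<lambda>f. tri \<sigma> q f (x i)) * \<zeta> (s i q) =
        (\<Sum>j<n. tri \<sigma> q (x j) (x i) * \<xi> (s j q)) * \<zeta> (s i q)" by (simp only:)
  qed
  finally show ?thesis by (simp add: sum_distrib_right mult.assoc)
qed

lemma triC_skew:
  assumes \<sigma>: "\<sigma> \<in> TSec" and q: "q \<in> pts S" and \<xi>: "\<xi> \<in> cotangent M q" and \<zeta>: "\<zeta> \<in> cotangent M q"
  shows "triC \<sigma> q \<xi> \<zeta> = - triC \<sigma> q \<zeta> \<xi>"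
proof -
  obtain n :: nat and x s u where fr: "\<And>i. i < n \<Longrightarrow> x i \<in> CM"
    "\<And>i. i < n \<Longrightarrow> s i \<in> TSec" "u \<in> CS" "u q = 1"
    "\<And>p v f. p \<in> pts S \<Longrightarrow> v \<in> tangent M p \<Longrightarrow> f \<in> CM \<Longrightarrow> u p * v f = (\<Sum>i<n. v (x i) * s i p f)"
    by (rule frame[OF q]) (rule that)
  have 1: "(u q * u q) * triC \<sigma> q \<xi> \<zeta> =
    (\<Sum>i<n. \<Sum>j<n. tri \<sigma> q (x j) (x i) * (\<xi> (s j q) * \<zeta> (s i q)))"
    by (rule triC_expand[OF fr(2,5) \<sigma> q \<xi> \<zeta>])
  have "(u q * u q) * triC \<sigma> q \<zeta> \<xi> =
    (\<Sum>i<n. \<Sum>j<n. tri \<sigma> q (x j) (x i) * (\<zeta> (s j q) * \<xi> (s i q)))"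
    by (rule triC_expand[OF fr(2,5) \<sigma> q \<zeta> \<xi>])
  also have "\<dots> = (\<Sum>j<n. \<Sum>i<n. tri \<sigma> q (x j) (x i) * (\<zeta> (s j q) * \<xi> (s i q)))"
    by (rule sum.swap)
  also have "\<dots> = (\<Sum>i<n. \<Sum>j<n. - (tri \<sigma> q (x j) (x i) * (\<xi> (s j q) * \<zeta> (s i q))))"
  proof (intro sum.cong refl)
    fix i j
    show "tri \<sigma> q (x i) (x j) * (\<zeta> (s i q) * \<xi> (s j q)) = - (tri \<sigma> q (x j) (x i) * (\<xi> (s j q) * \<zeta> (s i q)))"
      unfolding tri_skew[OF \<sigma> q, of "x i" "x j"] by simp
  qed
  also have "\<dots> = - ((u q * u q) * triC \<sigma> q \<xi> \<zeta>)" unfolding 1 by (simp add: sum_negf)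
  finally show ?thesis using fr(4) by simp
qed

lemma triC_dM:
  assumes \<sigma>: "\<sigma> \<in> TSec" and q: "q \<in> pts S"
  shows "triC \<sigma> q (dM f q) (dM g q) = tri \<sigma> q f g"
proof -
  have "triC \<sigma> q (dM f q) (dM g q) = dM f q (\<lambda>f. tri \<sigma> q f g)"
    unfolding triC_def
    by (rule dM_eval[OF q tri_half_tangent[OF \<sigma> q]]) (simp add: restrict_eval[OF q] differential_cotangent)
  also have "\<dots> = tri \<sigma> q f g" by (rule dM_eval[OF q tri_tangent'[OF \<sigma> q]])
  finally show ?thesis .
qed

lemma triC_smooth:
  assumes a: "a \<in> Cov" and b: "b \<in> Cov" and \<sigma>: "\<sigma> \<in> TSec"
  shows "(\<lambda>p. if p \<in> pts S then triC \<sigma> p (a p) (b p) else 0) \<in> CS"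
proof (rule smooth_functions_divide[OF manifold_S])
  fix q assume q: "q \<in> pts S"
  obtain n :: nat and x s u where fr: "\<And>i. i < n \<Longrightarrow> x i \<in> CM"
    "\<And>i. i < n \<Longrightarrow> s i \<in> TSec" "u \<in> CS" "u q = 1"
    "\<And>p v f. p \<in> pts S \<Longrightarrow> v \<in> tangent M p \<Longrightarrow> f \<in> CM \<Longrightarrow> u p * v f = (\<Sum>i<n. v (x i) * s i p f)"
    by (rule frame[OF q]) (rule that)
  let ?H = "\<lambda>p. if p \<in> pts S then triC \<sigma> p (a p) (b p) else 0"
  let ?T = "\<lambda>i j p. \<sigma> p (brM (x j) (x i)) - brS (res (x j)) (\<lambda>p. \<sigma> p (x i)) p - brS (\<lambda>p. \<sigma> p (x j)) (res (x i)) p"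
  have "(u p * u p) * ?H p = (\<Sum>i<n. \<Sum>j<n. ?T i j p * (a p (s j p) * b p (s i p)))" for p
  proof (cases "p \<in> pts S")
    case p: True
    have "(u p * u p) * triC \<sigma> p (a p) (b p) =
        (\<Sum>i<n. \<Sum>j<n. tri \<sigma> p (x j) (x i) * (a p (s j p) * b p (s i p)))"
      by (rule triC_expand[OF fr(2,5) \<sigma> p Cov_cotangent[OF a p] Cov_cotangent[OF b p]])
    also have "\<dots> = (\<Sum>i<n. \<Sum>j<n. ?T i j p * (a p (s j p) * b p (s i p)))"
      using fr(1) by (intro sum.cong refl) (simp add: tri_def)
    finally show ?thesis unfolding if_P[OF p] .
  qed (simp add: Cov_outside[OF a])
  then have e: "(\<lambda>p. (u p * u p) * ?H p) = (\<lambda>p. \<Sum>i<n. \<Sum>j<n. ?T i j p * (a p (s j p) * b p (s i p)))"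
    by (rule ext)
  have "(\<lambda>p. \<Sum>i<n. \<Sum>j<n. ?T i j p * (a p (s j p) * b p (s i p))) \<in> CS"
  proof (intro CS_sum)
    fix i j assume "i \<in> {..<n}" "j \<in> {..<n}"
    then have ij: "x i \<in> CM" "x j \<in> CM" "s i \<in> TSec" "s j \<in> TSec" using fr(1,2) by auto
    show "(\<lambda>p. ?T i j p * (a p (s j p) * b p (s i p))) \<in> CS"
      by (intro CS_mult CS_diff TSec_smooth[OF \<sigma>] brM_CM brS_CS restrict_smooth ij
          Cov_smooth[OF a] Cov_smooth[OF b])
  qed
  then have "(\<lambda>p. (u p * u p) * ?H p) \<in> CS" unfolding e .
  then show "\<exists>u\<in>CS. u q \<noteq> 0 \<and> (\<lambda>p. u p * ?H p) \<in> CS"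
    using CS_mult[OF fr(3) fr(3)] fr(4) by (intro bexI[of _ "\<lambda>p. u p * u p"]) auto
qed simp

lemma tri_add:
  assumes "\<sigma> \<in> TSec" "\<tau> \<in> TSec"
  shows "tri (\<lambda>p f. \<sigma> p f + \<tau> p f) q f g = tri \<sigma> q f g + tri \<tau> q f g"
  using assms by (simp add: tri_def TSec_smooth brS_add brS_add')

text \<open>In \<sigma> the form is not linear over functions, since the two brackets on S
  differentiate h. The correction is the wedge of \<sigma> with the derivation {_, h} of S.\<close>

lemma tri_smult:
  assumes h: "h \<in> CS" and \<sigma>: "\<sigma> \<in> TSec" and q: "q \<in> pts S"
  shows "tri (\<lambda>p f. h p * \<sigma> p f) q f g = h q * tri \<sigma> q f g
    - (\<sigma> q g * push M S (\<lambda>k. brS k h q) f - \<sigma> q f * push M S (\<lambda>k. brS k h q) g)"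
  by (simp add: tri_def push_def brS_mult[OF h TSec_smooth[OF \<sigma>]] brS_mult'[OF h TSec_smooth[OF \<sigma>]]
      TSec_smooth[OF \<sigma>] tangent_outside[OF TSec_tangent[OF \<sigma> q]] brS_skew[of h] algebra_simps)

end

section \<open>The Lie algebroid bracket on the restricted cotangent bundle\<close>

lemma cotangent_lin3:
  assumes \<xi>: "\<xi> \<in> cotangent M q" and uvw: "u \<in> tangent M q" "v \<in> tangent M q" "w \<in> tangent M q"
  shows "\<xi> (\<lambda>f. a * u f + b * v f + c * w f) = a * \<xi> u + b * \<xi> v + c * \<xi> w"
proof -
  note d = \<xi>[unfolded cotangent_def]
  note s = tangent_closed_scale
  show ?thesis
    unfolding dual_space_add[OF d tangent_closed_add[OF s[OF uvw(1)] s[OF uvw(2)]] s[OF uvw(3)]]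
      dual_space_add[OF d s[OF uvw(1)] s[OF uvw(2)]] dual_space_scale[OF d uvw(1)]
      dual_space_scale[OF d uvw(2)] dual_space_scale[OF d uvw(3)] by (rule refl)
qed

context embedded
begin

lemma Cov_app_add:
  "b \<in> Cov \<Longrightarrow> \<sigma> \<in> TSec \<Longrightarrow> \<tau> \<in> TSec \<Longrightarrow> (\<lambda>p. b p (\<lambda>f. \<sigma> p f + \<tau> p f)) = (\<lambda>p. b p (\<sigma> p) + b p (\<tau> p))"
proof
  fix p assume "b \<in> Cov" "\<sigma> \<in> TSec" "\<tau> \<in> TSec"
  then show "b p (\<lambda>f. \<sigma> p f + \<tau> p f) = b p (\<sigma> p) + b p (\<tau> p)"
    using dual_space_add[OF Cov_dual[of b p] TSec_tangent[of \<sigma> p] TSec_tangent[of \<tau> p]] Cov_outside[of b p]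
    by (cases "p \<in> pts S") auto
qed

lemma Cov_app_smult:
  "b \<in> Cov \<Longrightarrow> \<sigma> \<in> TSec \<Longrightarrow> (\<lambda>p. b p (\<lambda>f. h p * \<sigma> p f)) = (\<lambda>p. h p * b p (\<sigma> p))"
proof
  fix p assume "b \<in> Cov" "\<sigma> \<in> TSec"
  then show "b p (\<lambda>f. h p * \<sigma> p f) = h p * b p (\<sigma> p)"
    using dual_space_scale[OF Cov_dual[of b p] TSec_tangent[of \<sigma> p], of "h p"] Cov_outside[of b p]
    by (cases "p \<in> pts S") auto
qed

lemma Cov_scale_const:
  assumes "a \<in> Cov"
  shows "(\<lambda>p v. c * a p v) = (\<lambda>p v. (if p \<in> pts S then c else 0) * a p v)"
  by (intro ext) (simp add: Cov_outside[OF assms])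

lemma dM_app: "\<sigma> \<in> TSec \<Longrightarrow> (\<lambda>p. dM f p (\<sigma> p)) = (\<lambda>p. \<sigma> p f)"
proof
  fix p assume \<sigma>: "\<sigma> \<in> TSec"
  show "dM f p (\<sigma> p) = \<sigma> p f"
    using dM_eval[OF _ TSec_tangent[OF \<sigma>], of p f] TSec_outside[OF \<sigma>, of p]
    by (cases "p \<in> pts S") (simp_all add: restrict_to_def)
qed

end

context poisson_sub
begin

section \<open>Construction of the bracket of sections\<close>

lemma triC_add_section:
  assumes \<sigma>: "\<sigma> \<in> TSec" and \<tau>: "\<tau> \<in> TSec" and q: "q \<in> pts S"
    and \<xi>: "\<xi> \<in> cotangent M q" and \<zeta>: "\<zeta> \<in> cotangent M q"
  shows "triC (\<lambda>p f. \<sigma> p f + \<tau> p f) q \<xi> \<zeta> = triC \<sigma> q \<xi> \<zeta> + triC \<tau> q \<xi> \<zeta>"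
  unfolding triC_def tri_add[OF \<sigma> \<tau>]
    dual_space_add[OF \<xi>[unfolded cotangent_def] tri_tangent'[OF \<sigma> q] tri_tangent'[OF \<tau> q]]
  by (rule dual_space_add[OF \<zeta>[unfolded cotangent_def] tri_half_tangent[OF \<sigma> q \<xi>] tri_half_tangent[OF \<tau> q \<xi>]])

lemma triC_smult_section:
  assumes h: "h \<in> CS" and \<sigma>: "\<sigma> \<in> TSec" and q: "q \<in> pts S"
    and \<xi>: "\<xi> \<in> cotangent M q" and \<zeta>: "\<zeta> \<in> cotangent M q"
  shows "triC (\<lambda>p f. h p * \<sigma> p f) q \<xi> \<zeta> = h q * triC \<sigma> q \<xi> \<zeta>
    - (\<zeta> (\<sigma> q) * \<xi> (push M S (\<lambda>k. brS k h q)) - \<xi> (\<sigma> q) * \<zeta> (push M S (\<lambda>k. brS k h q)))"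
proof -
  let ?P = "push M S (\<lambda>k. brS k h q)"
  have P: "?P \<in> tangent M q" by (rule push_tangent[OF q brS_tangent'[OF q]])
  have s: "\<sigma> q \<in> tangent M q" by (rule TSec_tangent[OF \<sigma> q])
  have "(\<lambda>f. tri (\<lambda>p f. h p * \<sigma> p f) q f g) =
      (\<lambda>f. h q * tri \<sigma> q f g + (- \<sigma> q g) * ?P f + ?P g * \<sigma> q f)" for g
    by (rule ext) (simp add: tri_smult[OF h \<sigma> q])
  then have "\<xi> (\<lambda>f. tri (\<lambda>p f. h p * \<sigma> p f) q f g) =
      h q * \<xi> (\<lambda>f. tri \<sigma> q f g) + (- \<sigma> q g) * \<xi> ?P + ?P g * \<xi> (\<sigma> q)" for g
    using cotangent_lin3[OF \<xi> tri_tangent'[OF \<sigma> q] P s] by (simp only:)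
  then have e: "(\<lambda>g. \<xi> (\<lambda>f. tri (\<lambda>p f. h p * \<sigma> p f) q f g)) =
      (\<lambda>g. h q * \<xi> (\<lambda>f. tri \<sigma> q f g) + (- \<xi> ?P) * \<sigma> q g + \<xi> (\<sigma> q) * ?P g)"
    by (intro ext) (simp add: mult.commute)
  show ?thesis
    unfolding triC_def e cotangent_lin3[OF \<zeta> tri_half_tangent[OF \<sigma> q \<xi>] s P] by simp
qed

definition Phi :: "('a \<Rightarrow> 'a covec) \<Rightarrow> ('a \<Rightarrow> 'a covec) \<Rightarrow> ('a \<Rightarrow> 'a tvec) \<Rightarrow> 'a \<Rightarrow> real" where
  "Phi a b \<sigma> = (\<lambda>q. rho a q (\<lambda>p. b p (\<sigma> p)) - rho b q (\<lambda>p. a p (\<sigma> p)) +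
     (if q \<in> pts S then triC \<sigma> q (a q) (b q) else 0))"

lemma Phi_smooth:
  assumes a: "a \<in> Cov" and b: "b \<in> Cov" and \<sigma>: "\<sigma> \<in> TSec"
  shows "Phi a b \<sigma> \<in> CS"
  unfolding Phi_def
  by (rule CS_add[OF CS_diff[OF rho_smooth[OF a Cov_smooth[OF b \<sigma>]] rho_smooth[OF b Cov_smooth[OF a \<sigma>]]]
        triC_smooth[OF a b \<sigma>]])

text \<open>When \<sigma> is multiplied by h, the anchor terms contribute \<rho>(a)h b(\<sigma>) -
  \<rho>(b)h a(\<sigma>). By \<open>pull_hamiltonian\<close> these are the correction terms of
  \<open>triC\<close> with the opposite sign.\<close>

lemma Phi_tensorial:
  assumes a: "a \<in> Cov" and b: "b \<in> Cov" and q: "q \<in> pts S"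
  shows "tensorial q TSec (\<lambda>\<sigma>. Phi a b \<sigma> q)"
proof (rule tensorialI)
  note ca = Cov_cotangent[OF a q] and cb = Cov_cotangent[OF b q]
  note ra = rho_tangent[OF a q] and rb = rho_tangent[OF b q]
  {
    fix \<sigma> \<tau> assume s: "\<sigma> \<in> TSec" "\<tau> \<in> TSec"
    show "Phi a b (\<lambda>p x. \<sigma> p x + \<tau> p x) q = Phi a b \<sigma> q + Phi a b \<tau> q"
      unfolding Phi_def if_P[OF q] Cov_app_add[OF a s] Cov_app_add[OF b s] triC_add_section[OF s q ca cb]
        tangent_add[OF ra Cov_smooth[OF b s(1)] Cov_smooth[OF b s(2)]]
        tangent_add[OF rb Cov_smooth[OF a s(1)] Cov_smooth[OF a s(2)]] by simp
  next
    fix h \<sigma> assume h: "h \<in> CS" and s: "\<sigma> \<in> TSec"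
    show "Phi a b (\<lambda>p x. h p * \<sigma> p x) q = h q * Phi a b \<sigma> q"
      unfolding Phi_def if_P[OF q] Cov_app_smult[OF a s] Cov_app_smult[OF b s] triC_smult_section[OF h s q ca cb]
        tangent_mult[OF ra h Cov_smooth[OF b s]] tangent_mult[OF rb h Cov_smooth[OF a s]]
        pull_hamiltonian[OF q a] pull_hamiltonian[OF q b]
      by (simp add: algebra_simps)
  }
qed

text \<open>By tensoriality, the value does not depend on the section chosen through \<open>v\<close>.\<close>

definition ASb :: "('a \<Rightarrow> 'a covec) \<Rightarrow> ('a \<Rightarrow> 'a covec) \<Rightarrow> 'a \<Rightarrow> 'a covec" where
  "ASb a b = (\<lambda>q v. if a \<in> Cov \<and> b \<in> Cov \<and> q \<in> pts S \<and> v \<in> tangent M q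
     then Phi a b (SOME \<sigma>. \<sigma> \<in> TSec \<and> \<sigma> q = v) q else 0)"

lemma ASb_covector:
  assumes a: "a \<in> Cov" and b: "b \<in> Cov" and q: "q \<in> pts S"
  obtains \<xi> where "\<xi> \<in> cotangent M q" "ASb a b q = \<xi>" "\<And>\<sigma>. \<sigma> \<in> TSec \<Longrightarrow> Phi a b \<sigma> q = \<xi> (\<sigma> q)"
proof -
  obtain \<xi> where \<xi>: "\<xi> \<in> cotangent M q" "\<And>\<sigma>. \<sigma> \<in> TSec \<Longrightarrow> Phi a b \<sigma> q = \<xi> (\<sigma> q)"
    by (rule tensorial_tangent[OF q Phi_tensorial[OF a b q]]) (rule that)
  have "ASb a b q v = \<xi> v" for v
  proof (cases "v \<in> tangent M q")
    case True
    obtain \<tau> where \<tau>: "\<tau> \<in> TSec" "\<tau> q = v" by (rule TSec_extend[OF q True])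
    then have "(SOME \<sigma>. \<sigma> \<in> TSec \<and> \<sigma> q = v) \<in> TSec \<and> (SOME \<sigma>. \<sigma> \<in> TSec \<and> \<sigma> q = v) q = v"
      by (intro someI[where P = "\<lambda>\<sigma>. \<sigma> \<in> TSec \<and> \<sigma> q = v" and x = \<tau>]) simp
    then show ?thesis using \<xi>(2) a b q True by (simp add: ASb_def)
  next
    case False
    then show ?thesis using dual_space_outside[OF \<xi>(1)[unfolded cotangent_def]] by (simp add: ASb_def)
  qed
  then have "ASb a b q = \<xi>" by (rule ext)
  then show ?thesis by (rule that[OF \<xi>(1) _ \<xi>(2)])
qed

lemma ASb_eval:
  assumes "a \<in> Cov" "b \<in> Cov" "q \<in> pts S" "\<sigma> \<in> TSec"
  shows "ASb a b q (\<sigma> q) = Phi a b \<sigma> q"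
  by (rule ASb_covector[OF assms(1-3)]) (simp add: assms(4))

lemma ASb_outside: "\<not> (a \<in> Cov \<and> b \<in> Cov) \<Longrightarrow> ASb a b = (\<lambda>q v. 0)"
  by (intro ext) (auto simp: ASb_def)

lemma ASb_outside_pts: "q \<notin> pts S \<Longrightarrow> ASb a b q = (\<lambda>v. 0)"
  by (intro ext) (simp add: ASb_def)

lemma ASb_Cov:
  assumes a: "a \<in> Cov" and b: "b \<in> Cov"
  shows "ASb a b \<in> Cov"
proof (rule CovI)
  show "ASb a b q \<in> cotangent M q" if "q \<in> pts S" for q
    by (rule ASb_covector[OF a b that]) simp
  fix \<sigma> assume \<sigma>: "\<sigma> \<in> TSec"
  have "(\<lambda>q. ASb a b q (\<sigma> q)) = Phi a b \<sigma>"
  proof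
    show "ASb a b q (\<sigma> q) = Phi a b \<sigma> q" for q
      using ASb_eval[OF a b _ \<sigma>, of q] by (cases "q \<in> pts S") (simp_all add: ASb_outside_pts Phi_def rho_outside)
  qed
  then show "(\<lambda>q. ASb a b q (\<sigma> q)) \<in> CS" using Phi_smooth[OF a b \<sigma>] by simp
qed (simp add: ASb_outside_pts)

lemma ASb_skew: "ASb a b q v = - ASb b a q v"
proof (cases "a \<in> Cov \<and> b \<in> Cov \<and> q \<in> pts S \<and> v \<in> tangent M q")
  case True
  then have a: "a \<in> Cov" and b: "b \<in> Cov" and q: "q \<in> pts S" and v: "v \<in> tangent M q" by auto
  obtain \<sigma> where \<sigma>: "\<sigma> \<in> TSec" "\<sigma> q = v" by (rule TSec_extend[OF q v])
  have "Phi a b \<sigma> q = - Phi b a \<sigma> q"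
    unfolding Phi_def if_P[OF q] triC_skew[OF \<sigma>(1) q Cov_cotangent[OF a q] Cov_cotangent[OF b q]] by simp
  then show ?thesis using ASb_eval[OF a b q \<sigma>(1)] ASb_eval[OF b a q \<sigma>(1)] \<sigma>(2) by simp
next
  case False
  then show ?thesis by (auto simp: ASb_def)
qed

lemma ASb_add:
  assumes a: "a \<in> Cov" and b: "b \<in> Cov" and c: "c \<in> Cov"
  shows "ASb a (\<lambda>p v. b p v + c p v) = (\<lambda>p v. ASb a b p v + ASb a c p v)"
proof (rule Cov_eqI[OF ASb_Cov[OF a Cov_add[OF b c]] Cov_add[OF ASb_Cov[OF a b] ASb_Cov[OF a c]]])
  fix q v assume q: "q \<in> pts S" and v: "v \<in> tangent M q"
  obtain \<sigma> where \<sigma>: "\<sigma> \<in> TSec" "\<sigma> q = v" by (rule TSec_extend[OF q v])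
  have "Phi a (\<lambda>p v. b p v + c p v) \<sigma> q = Phi a b \<sigma> q + Phi a c \<sigma> q"
    unfolding Phi_def if_P[OF q] rho_add[OF b c] triC_def
      tangent_add[OF rho_tangent[OF a q] Cov_smooth[OF b \<sigma>(1)] Cov_smooth[OF c \<sigma>(1)]] by simp
  then show "ASb a (\<lambda>p v. b p v + c p v) q v = ASb a b q v + ASb a c q v"
    using ASb_eval[OF a Cov_add[OF b c] q \<sigma>(1)] ASb_eval[OF a b q \<sigma>(1)] ASb_eval[OF a c q \<sigma>(1)] \<sigma>(2)
    by simp
qed

text \<open>Only the term in which \<rho>(a) acts on b(\<sigma>) differentiates h; the other two are
  linear over functions in b.\<close>

lemma ASb_smult:
  assumes a: "a \<in> Cov" and b: "b \<in> Cov" and h: "h \<in> CS"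
  shows "ASb a (\<lambda>p v. h p * b p v) = (\<lambda>p v. h p * ASb a b p v + rho a p h * b p v)"
proof (rule Cov_eqI[OF ASb_Cov[OF a Cov_smult[OF h b]]
      Cov_add[OF Cov_smult[OF h ASb_Cov[OF a b]] Cov_smult[OF rho_smooth[OF a h] b]]])
  fix q v assume q: "q \<in> pts S" and v: "v \<in> tangent M q"
  obtain \<sigma> where \<sigma>: "\<sigma> \<in> TSec" "\<sigma> q = v" by (rule TSec_extend[OF q v])
  have "Phi a (\<lambda>p v. h p * b p v) \<sigma> q = h q * Phi a b \<sigma> q + rho a q h * b q v"
    unfolding Phi_def if_P[OF q] rho_smult[OF h b] triC_def
      tangent_mult[OF rho_tangent[OF a q] h Cov_smooth[OF b \<sigma>(1)]] \<sigma>(2) by (simp add: algebra_simps)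
  then show "ASb a (\<lambda>p v. h p * b p v) q v = h q * ASb a b q v + rho a q h * b q v"
    using ASb_eval[OF a Cov_smult[OF h b] q \<sigma>(1)] ASb_eval[OF a b q \<sigma>(1)] \<sigma>(2) by simp
qed

lemma ASb_add':
  assumes "a \<in> Cov" "b \<in> Cov" "c \<in> Cov"
  shows "ASb (\<lambda>p v. b p v + c p v) a = (\<lambda>p v. ASb b a p v + ASb c a p v)"
  by (intro ext) (simp add: ASb_skew[of _ a] ASb_add[OF assms])

lemma ASb_smult':
  assumes "a \<in> Cov" "b \<in> Cov" "h \<in> CS"
  shows "ASb (\<lambda>p v. h p * b p v) a = (\<lambda>p v. h p * ASb b a p v + (- rho a p h) * b p v)"
  by (intro ext) (simp add: ASb_skew[of _ a] ASb_smult[OF assms] algebra_simps)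

lemma ASb_scale:
  assumes a: "a \<in> Cov" and b: "b \<in> Cov"
  shows "ASb a (\<lambda>p v. c * b p v) = (\<lambda>p v. c * ASb a b p v)"
proof -
  \<comment> \<open>Scaling by a number is multiplication by a function that is constant on S, and
    the anchor annihilates such a function.\<close>
  have r: "rho a p (\<lambda>p. if p \<in> pts S then c else 0) = 0" for p
    using tangent_const[OF manifold_S rho_tangent[OF a], of p c] rho_outside[of p a]
    by (cases "p \<in> pts S") auto
  show ?thesis
    unfolding Cov_scale_const[OF b] Cov_scale_const[OF ASb_Cov[OF a b]] ASb_smult[OF a b CS_const] r
    by simp
qed

lemma rho_scale:
  assumes "a \<in> Cov"
  shows "rho (\<lambda>p v. c * a p v) q g = c * rho a q g"
  unfolding Cov_scale_const[OF assms] rho_smult[OF CS_const assms] by (simp add: rho_outside)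

text \<open>For exact forms the two brackets subtracted in \<open>tri\<close> cancel the anchor
  terms, which leaves \<sigma>{f, g}.\<close>

lemma ASb_exact:
  assumes f: "f \<in> CM" and g: "g \<in> CM"
  shows "ASb (dM f) (dM g) = dM (brM f g)"
proof (rule Cov_eqI[OF ASb_Cov[OF dM_Cov[OF f] dM_Cov[OF g]] dM_Cov[OF brM_CM[OF f g]]])
  fix q v assume q: "q \<in> pts S" and v: "v \<in> tangent M q"
  obtain \<sigma> where \<sigma>: "\<sigma> \<in> TSec" "\<sigma> q = v" by (rule TSec_extend[OF q v])
  have "Phi (dM f) (dM g) \<sigma> q = \<sigma> q (brM f g)"
    unfolding Phi_def if_P[OF q] dM_app[OF \<sigma>(1)] triC_dM[OF \<sigma>(1) q] rho_dM[OF f] rho_dM[OF g]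
    using f g brS_skew[of "res g" "\<lambda>p. \<sigma> p f" q] by (simp add: tri_def)
  then show "ASb (dM f) (dM g) q v = dM (brM f g) q v"
    using ASb_eval[OF dM_Cov[OF f] dM_Cov[OF g] q \<sigma>(1)] \<sigma>(2) dM_eval[OF q v] by simp
qed

text \<open>Skewness carries tensoriality from the first slot to the second, so exact forms can be
  substituted in one slot after the other.\<close>

lemma tensorial_exact2:
  assumes q: "q \<in> pts S" and D: "\<And>b. b \<in> Cov \<Longrightarrow> tensorial q Cov (\<lambda>a. D a b)"
    and skew: "\<And>a b. a \<in> Cov \<Longrightarrow> b \<in> Cov \<Longrightarrow> D a b = - D b a"
    and exact: "\<And>f g. f \<in> CM \<Longrightarrow> g \<in> CM \<Longrightarrow> D (dM f) (dM g) = 0"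
    and a: "a \<in> Cov" and b: "b \<in> Cov"
  shows "D a b = 0"
proof -
  have "D c (dM g) = 0" if c: "c \<in> Cov" and g: "g \<in> CM" for c g
    by (rule tensorial_exact[OF q D[OF dM_Cov[OF g]] exact c]) (use g in auto)
  then have "D (dM g) c = 0" if "c \<in> Cov" "g \<in> CM" for c g
    using skew[OF dM_Cov[OF that(2)] that(1)] that by simp
  then show ?thesis
    by (intro tensorial_exact[OF q D[OF b] _ a]) (use b in auto)
qed

text \<open>The defect \<open>D\<close> is tensorial in both sections, and on exact forms it is the
  Jacobi identity of the bracket on S. It precedes the Jacobi identity for sections, because
  tensoriality of the Jacobiator rests on it.\<close>

lemma rho_ASb:
  assumes a: "a \<in> Cov" and b: "b \<in> Cov" and g: "g \<in> CS"
  shows "rho (ASb a b) q g = rho a q (\<lambda>p. rho b p g) - rho b q (\<lambda>p. rho a p g)"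
proof (cases "q \<in> pts S")
  case q: True
  define D where "D = (\<lambda>a b. rho (ASb a b) q g - rho a q (\<lambda>p. rho b p g) + rho b q (\<lambda>p. rho a p g))"
  have "D a b = 0"
  proof (rule tensorial_exact2[where D = D, OF q _ _ _ a b])
    fix b assume b: "b \<in> Cov"
    note rb = rho_tangent[OF b q]
    show "tensorial q Cov (\<lambda>a. D a b)"
    proof (rule tensorialI)
      fix a c assume ac: "a \<in> Cov" "c \<in> Cov"
      show "D (\<lambda>p x. a p x + c p x) b = D a b + D c b"
        unfolding D_def ASb_add'[OF b ac] rho_add[OF ac] rho_add[OF ASb_Cov[OF ac(1) b] ASb_Cov[OF ac(2) b]]
          tangent_add[OF rb rho_smooth[OF ac(1) g] rho_smooth[OF ac(2) g]] by simp
    next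
      fix h a assume h: "h \<in> CS" and a: "a \<in> Cov"
      have nr: "(\<lambda>p. - rho b p h) \<in> CS" using CS_scale[OF rho_smooth[OF b h], of "- 1"] by simp
      show "D (\<lambda>p x. h p * a p x) b = h q * D a b"
        unfolding D_def ASb_smult'[OF b a h]
          rho_add[OF Cov_smult[OF h ASb_Cov[OF a b]] Cov_smult[OF nr a]]
          rho_smult[OF h ASb_Cov[OF a b]] rho_smult[OF nr a] rho_smult[OF h a]
          tangent_mult[OF rb h rho_smooth[OF a g]] by (simp add: algebra_simps)
    qed
  next
    fix a b assume ab: "a \<in> Cov" "b \<in> Cov"
    have "ASb a b = (\<lambda>p v. (- 1) * ASb b a p v)" by (intro ext) (simp add: ASb_skew[of a b])
    then have "rho (ASb a b) q g = - rho (ASb b a) q g"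
      using rho_scale[OF ASb_Cov[OF ab(2,1)], of "- 1" q g] by simp
    then show "D a b = - D b a" unfolding D_def by simp
  next
    fix f k assume f: "f \<in> CM" and k: "k \<in> CM"
    note rf = restrict_smooth[OF f] and rk = restrict_smooth[OF k]
    have "brS g (res f) = (\<lambda>p. (- 1) * brS (res f) g p)" by (rule ext) (simp add: brS_skew[of g])
    then have "brS (res k) (brS g (res f)) q = - brS (res k) (brS (res f) g) q"
      using brS_scale[OF brS_CS[OF rf g], of "res k" "- 1"] by simp
    moreover have "brS g (brS (res f) (res k)) q = - brS (brS (res f) (res k)) g q" by (rule brS_skew)
    ultimately show "D (dM f) (dM k) = 0"
      unfolding D_def ASb_exact[OF f k] rho_dM[OF f] rho_dM[OF k] rho_dM[OF brM_CM[OF f k]]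
        brS_restrict_fun[OF f k, symmetric]
      using brS_jacobi[OF rf rk g, of q] by simp
  qed
  then show ?thesis unfolding D_def by simp
qed (simp add: rho_outside)

text \<open>The Jacobiator is cyclically symmetric, so tensoriality in the last slot allows all
  three sections to be replaced by exact forms. There it is the differential of the Jacobiator of
  functions on M.\<close>

lemma ASb_jacobi:
  assumes a: "a \<in> Cov" and b: "b \<in> Cov" and c: "c \<in> Cov"
  shows "ASb a (ASb b c) q v + ASb b (ASb c a) q v + ASb c (ASb a b) q v = 0"
proof (cases "q \<in> pts S \<and> v \<in> tangent M q")
  case True
  then have q: "q \<in> pts S" and v: "v \<in> tangent M q" by auto
  define J where "J = (\<lambda>a b c. ASb a (ASb b c) q v + ASb b (ASb c a) q v + ASb c (ASb a b) q v)"
  have cyc: "J a b c = J b c a" for a b c unfolding J_def by simp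
  have t: "tensorial q Cov (J a b)" if a: "a \<in> Cov" and b: "b \<in> Cov" for a b
  proof (rule tensorialI)
    fix c d assume c: "c \<in> Cov" and d: "d \<in> Cov"
    show "J a b (\<lambda>p x. c p x + d p x) = J a b c + J a b d"
      unfolding J_def ASb_add[OF b c d] ASb_add'[OF a c d] ASb_add'[OF ASb_Cov[OF a b] c d]
        ASb_add[OF a ASb_Cov[OF b c] ASb_Cov[OF b d]] ASb_add[OF b ASb_Cov[OF c a] ASb_Cov[OF d a]] by simp
  next
    fix h c assume h: "h \<in> CS" and c: "c \<in> Cov"
    note ra = rho_smooth[OF a h] and rb = rho_smooth[OF b h]
    have na: "(\<lambda>p. - rho a p h) \<in> CS" using CS_scale[OF ra, of "- 1"] by simp
    have rna: "rho b q (\<lambda>p. - rho a p h) = - rho b q (\<lambda>p. rho a p h)"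
      using tangent_scale[OF rho_tangent[OF b q] ra, of "- 1"] by simp
    have 1: "ASb a (ASb b (\<lambda>p x. h p * c p x)) q v =
        (h q * ASb a (ASb b c) q v + rho a q h * ASb b c q v) +
        (rho b q h * ASb a c q v + rho a q (\<lambda>p. rho b p h) * c q v)"
      unfolding ASb_smult[OF b c h] ASb_add[OF a Cov_smult[OF h ASb_Cov[OF b c]] Cov_smult[OF rb c]]
        ASb_smult[OF a ASb_Cov[OF b c] h] ASb_smult[OF a c rb] by (rule refl)
    have 2: "ASb b (ASb (\<lambda>p x. h p * c p x) a) q v =
        (h q * ASb b (ASb c a) q v + rho b q h * ASb c a q v) +
        (- rho a q h * ASb b c q v + rho b q (\<lambda>p. - rho a p h) * c q v)"
      unfolding ASb_smult'[OF a c h] ASb_add[OF b Cov_smult[OF h ASb_Cov[OF c a]] Cov_smult[OF na c]]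
        ASb_smult[OF b ASb_Cov[OF c a] h] ASb_smult[OF b c na] by (rule refl)
    have 3: "ASb (\<lambda>p x. h p * c p x) (ASb a b) q v =
        h q * ASb c (ASb a b) q v + - rho (ASb a b) q h * c q v"
      unfolding ASb_smult'[OF ASb_Cov[OF a b] c h] by (rule refl)
    \<comment> \<open>The terms with a first derivative of h cancel by skewness; those with a second
      derivative form the commutator of \<rho>(a) and \<rho>(b) applied to h, which cancels against
      \<rho>([a, b])h.\<close>
    show "J a b (\<lambda>p x. h p * c p x) = h q * J a b c"
      unfolding J_def 1 2 3 rna rho_ASb[OF a b h] ASb_skew[of c a] by (simp add: algebra_simps)
  qed
  have ex: "J (dM f) (dM g) (dM h) = 0" if f: "f \<in> CM" and g: "g \<in> CM" and h: "h \<in> CM" for f g h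
  proof -
    have s: "v (\<lambda>p. brM f (brM g h) p + brM g (brM h f) p + brM h (brM f g) p) = 0"
      unfolding brM_jacobi[OF f g h] by (rule tangent_zero[OF v])
    show ?thesis
      unfolding J_def ASb_exact[OF g h] ASb_exact[OF h f] ASb_exact[OF f g]
        ASb_exact[OF f brM_CM[OF g h]] ASb_exact[OF g brM_CM[OF h f]] ASb_exact[OF h brM_CM[OF f g]]
        dM_eval[OF q v]
      using s tangent_add[OF v CM_add[OF brM_CM[OF f brM_CM[OF g h]] brM_CM[OF g brM_CM[OF h f]]]
            brM_CM[OF h brM_CM[OF f g]]]
        tangent_add[OF v brM_CM[OF f brM_CM[OF g h]] brM_CM[OF g brM_CM[OF h f]]] by simp
  qed
  have 1: "J (dM f) (dM g) c = 0" if "f \<in> CM" "g \<in> CM" "c \<in> Cov" for f g c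
    by (rule tensorial_exact[OF q t[OF dM_Cov[OF that(1)] dM_Cov[OF that(2)]] ex[OF that(1,2)] that(3)])
  have 2: "J c (dM f) b = 0" if f: "f \<in> CM" and b: "b \<in> Cov" and c: "c \<in> Cov" for f b c
  proof (rule tensorial_exact[OF q t[OF c dM_Cov[OF f]] _ b])
    fix g assume g: "g \<in> CM"
    show "J c (dM f) (dM g) = 0" unfolding cyc[of c "dM f" "dM g"] by (rule 1[OF f g c])
  qed
  have "J a b c = 0"
  proof (rule tensorial_exact[OF q t[OF a b] _ c])
    fix g assume g: "g \<in> CM"
    show "J a b (dM g) = 0" unfolding cyc[of a b "dM g"] by (rule 2[OF g a b])
  qed
  then show ?thesis unfolding J_def .
next
  case False
  then show ?thesis by (auto simp: ASb_def)
qed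

end

section \<open>Comparison with the bracket of 1-forms\<close>

context embedded
begin

lemma tensorial_value:
  assumes "q \<in> pts S" "tensorial q TSec \<Phi>" "\<sigma> \<in> TSec" "\<tau> \<in> TSec" "\<sigma> q = \<tau> q"
  shows "\<Phi> \<sigma> = \<Phi> \<tau>"
  by (rule tensorial_tangent[OF assms(1,2)]) (simp add: assms(3-5))

end

section \<open>Brackets of vector fields and the exterior derivative\<close>

lemma vf_bracket_tangent:
  assumes M: "manifold M" and X: "X \<in> vector_fields M" and Y: "Y \<in> vector_fields M" and q: "q \<in> pts M"
  shows "vf_bracket M X Y q \<in> tangent M q"
proof -
  interpret M: embedded M M by (rule embedded_self[OF M])
  note Xt = M.TSec_tangent[OF X] and Yt = M.TSec_tangent[OF Y]
  note Xs = M.TSec_smooth[OF X] and Ys = M.TSec_smooth[OF Y]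
  have app_add: "(\<lambda>p. Z p (\<lambda>x. f x + g x)) = (\<lambda>p. Z p f + Z p g)"
    if Z: "Z \<in> vector_fields M" and f: "f \<in> smooth_functions M" and g: "g \<in> smooth_functions M" for Z f g
  proof
    fix p show "Z p (\<lambda>x. f x + g x) = Z p f + Z p g"
      using tangent_add[OF M.TSec_tangent[OF Z] f g] M.TSec_outside[OF Z, of p] by (cases "p \<in> pts M") auto
  qed
  have app_mult: "(\<lambda>p. Z p (\<lambda>x. f x * g x)) = (\<lambda>p. f p * Z p g + g p * Z p f)"
    if Z: "Z \<in> vector_fields M" and f: "f \<in> smooth_functions M" and g: "g \<in> smooth_functions M" for Z f g
  proof
    fix p show "Z p (\<lambda>x. f x * g x) = f p * Z p g + g p * Z p f"
      using tangent_mult[OF M.TSec_tangent[OF Z] f g] M.TSec_outside[OF Z, of p] by (cases "p \<in> pts M") auto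
  qed
  have app_scale: "(\<lambda>p. Z p (\<lambda>x. c * f x)) = (\<lambda>p. c * Z p f)"
    if Z: "Z \<in> vector_fields M" and f: "f \<in> smooth_functions M" for Z f c
  proof
    fix p show "Z p (\<lambda>x. c * f x) = c * Z p f"
      using tangent_scale[OF M.TSec_tangent[OF Z] f] M.TSec_outside[OF Z, of p] by (cases "p \<in> pts M") auto
  qed
  show ?thesis
  proof (rule tangentI)
    fix f g assume f: "f \<in> smooth_functions M" and g: "g \<in> smooth_functions M"
    show "vf_bracket M X Y q (\<lambda>x. f x + g x) = vf_bracket M X Y q f + vf_bracket M X Y q g"
      unfolding vf_bracket_def app_add[OF X f g] app_add[OF Y f g]
        tangent_add[OF Xt[OF q] Ys[OF f] Ys[OF g]] tangent_add[OF Yt[OF q] Xs[OF f] Xs[OF g]]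
      using f g M.CS_add[OF f g] by simp
    show "vf_bracket M X Y q (\<lambda>x. f x * g x) = f q * vf_bracket M X Y q g + g q * vf_bracket M X Y q f"
      unfolding vf_bracket_def app_mult[OF X f g] app_mult[OF Y f g]
        tangent_add[OF Xt[OF q] M.CS_mult[OF f Ys[OF g]] M.CS_mult[OF g Ys[OF f]]]
        tangent_add[OF Yt[OF q] M.CS_mult[OF f Xs[OF g]] M.CS_mult[OF g Xs[OF f]]]
        tangent_mult[OF Xt[OF q] f Ys[OF g]] tangent_mult[OF Xt[OF q] g Ys[OF f]]
        tangent_mult[OF Yt[OF q] f Xs[OF g]] tangent_mult[OF Yt[OF q] g Xs[OF f]]
      using f g M.CS_mult[OF f g] by (simp add: algebra_simps)
  next
    fix c f assume f: "f \<in> smooth_functions M"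
    show "vf_bracket M X Y q (\<lambda>x. c * f x) = c * vf_bracket M X Y q f"
      unfolding vf_bracket_def app_scale[OF X f] app_scale[OF Y f]
        tangent_scale[OF Xt[OF q] Ys[OF f]] tangent_scale[OF Yt[OF q] Xs[OF f]]
      using f M.CS_scale[OF f] by (simp add: algebra_simps)
  qed (simp add: vf_bracket_def)
qed

lemma vf_bracket_skew: "vf_bracket M X Y q = (\<lambda>f. (- 1) * vf_bracket M Y X q f)"
  by (rule ext) (simp add: vf_bracket_def)

lemma vf_bracket_add:
  assumes M: "manifold M" and X: "X \<in> vector_fields M" "X' \<in> vector_fields M" and Y: "Y \<in> vector_fields M"
    and q: "q \<in> pts M"
  shows "vf_bracket M (\<lambda>p f. X p f + X' p f) Y q = (\<lambda>f. vf_bracket M X Y q f + vf_bracket M X' Y q f)"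
proof -
  interpret M: embedded M M by (rule embedded_self[OF M])
  show ?thesis
    by (rule ext) (simp add: vf_bracket_def tangent_add[OF M.TSec_tangent[OF Y q]] M.TSec_smooth[OF X(1)]
        M.TSec_smooth[OF X(2)])
qed

lemma vf_bracket_smult:
  assumes M: "manifold M" and X: "X \<in> vector_fields M" and Y: "Y \<in> vector_fields M"
    and q: "q \<in> pts M" and h: "h \<in> smooth_functions M"
  shows "vf_bracket M (\<lambda>p f. h p * X p f) Y q = (\<lambda>f. h q * vf_bracket M X Y q f + (- Y q h) * X q f)"
proof -
  interpret M: embedded M M by (rule embedded_self[OF M])
  show ?thesis
    by (rule ext) (simp add: vf_bracket_def tangent_mult[OF M.TSec_tangent[OF Y q] h M.TSec_smooth[OF X]]
        tangent_outside[OF M.TSec_tangent[OF X q]] algebra_simps)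
qed

text \<open>The right-hand side of the invariant formula in \<open>ext_d\<close>, with the vector
  fields kept as arguments so that tensoriality can be stated.\<close>

definition ext_d_form where
  "ext_d_form M \<beta> X Y q = X q (\<lambda>p. \<beta> p (Y p)) - Y q (\<lambda>p. \<beta> p (X p)) - \<beta> q (vf_bracket M X Y q)"

lemma ext_d_form_skew:
  assumes M: "manifold M" and \<beta>: "\<beta> \<in> one_forms M" and X: "X \<in> vector_fields M" and Y: "Y \<in> vector_fields M"
    and q: "q \<in> pts M"
  shows "ext_d_form M \<beta> X Y q = - ext_d_form M \<beta> Y X q"
proof -
  interpret M: embedded M M by (rule embedded_self[OF M])
  have "\<beta> q (vf_bracket M X Y q) = (- 1) * \<beta> q (vf_bracket M Y X q)"
    unfolding vf_bracket_skew[of M X]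
    by (rule dual_space_scale[OF M.Cov_dual[OF \<beta> q] vf_bracket_tangent[OF M Y X q]])
  then show ?thesis unfolding ext_d_form_def by simp
qed

lemma ext_d_form_tensorial:
  assumes M: "manifold M" and \<beta>: "\<beta> \<in> one_forms M" and Y: "Y \<in> vector_fields M" and q: "q \<in> pts M"
  shows "embedded.tensorial M q (vector_fields M) (\<lambda>X. ext_d_form M \<beta> X Y q)"
proof -
  interpret M: embedded M M by (rule embedded_self[OF M])
  note d = M.Cov_dual[OF \<beta> q]
  note Yt = M.TSec_tangent[OF Y q]
  note bt = vf_bracket_tangent[OF M _ Y q]
  show ?thesis
  proof (rule M.tensorialI)
    fix X X' assume X: "X \<in> vector_fields M" "X' \<in> vector_fields M"
    show "ext_d_form M \<beta> (\<lambda>p x. X p x + X' p x) Y q = ext_d_form M \<beta> X Y q + ext_d_form M \<beta> X' Y q"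
      unfolding ext_d_form_def M.Cov_app_add[OF \<beta> X] vf_bracket_add[OF M X Y q]
        tangent_add[OF Yt M.Cov_smooth[OF \<beta> X(1)] M.Cov_smooth[OF \<beta> X(2)]]
        dual_space_add[OF d bt[OF X(1)] bt[OF X(2)]] by simp
  next
    fix h X assume h: "h \<in> smooth_functions M" and X: "X \<in> vector_fields M"
    show "ext_d_form M \<beta> (\<lambda>p x. h p * X p x) Y q = h q * ext_d_form M \<beta> X Y q"
      unfolding ext_d_form_def M.Cov_app_smult[OF \<beta> X] vf_bracket_smult[OF M X Y q h]
        tangent_mult[OF Yt h M.Cov_smooth[OF \<beta> X]]
        dual_space_add[OF d tangent_closed_scale[OF bt[OF X]] tangent_closed_scale[OF M.TSec_tangent[OF X q]]]
        dual_space_scale[OF d bt[OF X]] dual_space_scale[OF d M.TSec_tangent[OF X q]]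
      by (simp add: algebra_simps)
  qed
qed

text \<open>Tensoriality in X, and by skewness in Y, makes the formula depend only on the values at
  q, so the description in \<open>ext_d\<close> is satisfied; X and Y themselves show that no other
  number satisfies it.\<close>

lemma ext_d_eval:
  assumes M: "manifold M" and \<beta>: "\<beta> \<in> one_forms M" and X: "X \<in> vector_fields M" and Y: "Y \<in> vector_fields M"
    and q: "q \<in> pts M"
  shows "ext_d M \<beta> q (X q) (Y q) = ext_d_form M \<beta> X Y q"
proof -
  interpret M: embedded M M by (rule embedded_self[OF M])
  have eq: "ext_d_form M \<beta> X Y q = ext_d_form M \<beta> X' Y' q"
    if X': "X' \<in> vector_fields M" "X' q = X q" and Y': "Y' \<in> vector_fields M" "Y' q = Y q" for X' Y'
  proof -
    have "ext_d_form M \<beta> X Y q = ext_d_form M \<beta> X' Y q"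
      by (rule M.tensorial_value[OF q ext_d_form_tensorial[OF M \<beta> Y q] X X'(1) X'(2)[symmetric]])
    also have "\<dots> = - ext_d_form M \<beta> Y X' q" by (rule ext_d_form_skew[OF M \<beta> X'(1) Y q])
    also have "ext_d_form M \<beta> Y X' q = ext_d_form M \<beta> Y' X' q"
      by (rule M.tensorial_value[OF q ext_d_form_tensorial[OF M \<beta> X'(1) q] Y Y'(1) Y'(2)[symmetric]])
    also have "- \<dots> = ext_d_form M \<beta> X' Y' q" by (rule ext_d_form_skew[OF M \<beta> X'(1) Y'(1) q, symmetric])
    finally show ?thesis .
  qed
  show ?thesis
    unfolding ext_d_def
  proof (rule the_equality)
    show "\<forall>X'\<in>vector_fields M. \<forall>Y'\<in>vector_fields M. X' q = X q \<longrightarrow> Y' q = Y q \<longrightarrow>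
        ext_d_form M \<beta> X Y q = X' q (\<lambda>p. \<beta> p (Y' p)) - Y' q (\<lambda>p. \<beta> p (X' p)) - \<beta> q (vf_bracket M X' Y' q)"
      using eq unfolding ext_d_form_def[of M \<beta> _ _ q] by blast
    fix r assume "\<forall>X'\<in>vector_fields M. \<forall>Y'\<in>vector_fields M. X' q = X q \<longrightarrow> Y' q = Y q \<longrightarrow>
        r = X' q (\<lambda>p. \<beta> p (Y' p)) - Y' q (\<lambda>p. \<beta> p (X' p)) - \<beta> q (vf_bracket M X' Y' q)"
    then show "r = ext_d_form M \<beta> X Y q" using X Y unfolding ext_d_form_def by blast
  qed
qed

context poisson_sub
begin

lemma embedded_M: "embedded M M"
  by (rule embedded_self[OF manifold_M])

interpretation M: embedded M M
  by (rule embedded_M)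

text \<open>A section \<sigma> along S need not be the restriction of a vector field. In a frame of
  M, u \<alpha>(\<sigma>) is a sum of products of \<sigma>(x i) with restrictions of \<alpha>(X
  i).\<close>

lemma one_form_restrict:
  assumes \<alpha>: "\<alpha> \<in> one_forms M"
  shows "res \<alpha> \<in> Cov"
proof (rule CovI)
  show "res \<alpha> p \<in> cotangent M p" if p: "p \<in> pts S" for p
    unfolding restrict_eval[OF p] by (rule M.Cov_cotangent[OF \<alpha> S_in_M[OF p]])
  show "res \<alpha> p = (\<lambda>v. 0)" if "p \<notin> pts S" for p
    using that by (simp add: restrict_to_def zero_fun_def)
  fix \<sigma> assume \<sigma>: "\<sigma> \<in> TSec"
  show "(\<lambda>p. res \<alpha> p (\<sigma> p)) \<in> CS"
  proof (rule smooth_functions_divide[OF manifold_S])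
    show "res \<alpha> p (\<sigma> p) = 0" if "p \<notin> pts S" for p using that by (simp add: restrict_to_def)
    fix q assume q: "q \<in> pts S"
    obtain n :: nat and x X u where fr: "\<And>i. i < n \<Longrightarrow> x i \<in> CM"
      "\<And>i. i < n \<Longrightarrow> X i \<in> vector_fields M" "u \<in> CM" "u q = 1"
      "\<And>p v f. p \<in> pts M \<Longrightarrow> v \<in> tangent M p \<Longrightarrow> f \<in> CM \<Longrightarrow> u p * v f = (\<Sum>i<n. v (x i) * X i p f)"
      by (rule M.frame[OF S_in_M[OF q]]) (rule that)
    have "res u p * res \<alpha> p (\<sigma> p) = (\<Sum>i<n. \<sigma> p (x i) * res (\<lambda>p. \<alpha> p (X i p)) p)" for p
    proof (cases "p \<in> pts S")
      case p: True
      show ?thesis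
        unfolding restrict_eval[OF p]
        by (rule M.frame_covector[OF fr(2,5) S_in_M[OF p] TSec_tangent[OF \<sigma> p] M.Cov_cotangent[OF \<alpha> S_in_M[OF p]]])
    qed (simp add: restrict_to_def)
    then have e: "(\<lambda>p. res u p * res \<alpha> p (\<sigma> p)) = (\<lambda>p. \<Sum>i<n. \<sigma> p (x i) * res (\<lambda>p. \<alpha> p (X i p)) p)"
      by (rule ext)
    have "(\<lambda>p. \<Sum>i<n. \<sigma> p (x i) * res (\<lambda>p. \<alpha> p (X i p)) p) \<in> CS"
    proof (rule CS_sum)
      fix i assume "i \<in> {..<n}"
      then have i: "x i \<in> CM" "X i \<in> vector_fields M" using fr(1,2) by auto
      show "(\<lambda>p. \<sigma> p (x i) * res (\<lambda>p. \<alpha> p (X i p)) p) \<in> CS"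
        by (rule CS_mult[OF TSec_smooth[OF \<sigma> i(1)] restrict_smooth[OF M.Cov_smooth[OF \<alpha> i(2)]]])
    qed
    then have "(\<lambda>p. res u p * res \<alpha> p (\<sigma> p)) \<in> CS" unfolding e .
    then show "\<exists>u\<in>CS. u q \<noteq> 0 \<and> (\<lambda>p. u p * res \<alpha> p (\<sigma> p)) \<in> CS"
      using restrict_smooth[OF fr(3)] fr(4) restrict_eval[OF q, of u] by (intro bexI[of _ "res u"]) auto
  qed
qed

section \<open>The bracket of 1-forms evaluated on vector fields\<close>

lemma sharp_vector_field:
  assumes \<alpha>: "\<alpha> \<in> one_forms M"
  shows "sharp M \<pi> \<alpha> \<in> vector_fields M"
proof (rule M.TSecI)
  show "sharp M \<pi> \<alpha> p \<in> tangent M p" if "p \<in> pts M" for p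
    unfolding sharp_def by (rule sharp_tangent[OF that M.Cov_cotangent[OF \<alpha> that]])
  show "sharp M \<pi> \<alpha> p = (\<lambda>f. 0)" if "p \<notin> pts M" for p
    by (rule ext) (simp add: sharp_def pi_outside that)
  show "(\<lambda>p. sharp M \<pi> \<alpha> p f) \<in> CM" if "f \<in> CM" for f
    using pi_field \<alpha> differential_one_form[OF that] unfolding bivector_fields_def sharp_def by blast
qed

lemma sharp_pairing:
  assumes \<alpha>: "\<alpha> \<in> one_forms M" and \<beta>: "\<beta> \<in> one_forms M"
  shows "(\<lambda>p. \<beta> p (sharp M \<pi> \<alpha> p)) = (\<lambda>p. \<pi> p (\<alpha> p) (\<beta> p))"
proof
  fix p show "\<beta> p (sharp M \<pi> \<alpha> p) = \<pi> p (\<alpha> p) (\<beta> p)"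
  proof (cases "p \<in> pts M")
    case p: True
    show ?thesis unfolding sharp_def
      by (rule pairing[OF manifold_M p pi_bivector[OF p] M.Cov_cotangent[OF \<alpha> p] M.Cov_cotangent[OF \<beta> p]])
  qed (simp add: pi_outside M.Cov_outside[OF \<beta>])
qed

lemma pi_skew: "\<pi> p \<xi> \<zeta> = - \<pi> p \<zeta> \<xi>"
  using bivector_skew[OF pi_bivector, of p \<xi> \<zeta>] pi_outside[of p] by (cases "p \<in> pts M") auto

text \<open>The bracket of 1-forms paired with Y, after both exterior derivatives are expanded: the
  derivative along Y of \<alpha> on the contraction of \<pi> by \<beta>, which comes from expanding
  d\<alpha>, cancels the last term of \<open>form_bracket\<close>.\<close>

definition form_bracket_on where
  "form_bracket_on Y q \<alpha> \<beta> = sharp M \<pi> \<alpha> q (\<lambda>p. \<beta> p (Y p)) - Y q (\<lambda>p. \<beta> p (sharp M \<pi> \<alpha> p))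
    - \<beta> q (vf_bracket M (sharp M \<pi> \<alpha>) Y q)
    - sharp M \<pi> \<beta> q (\<lambda>p. \<alpha> p (Y p)) + \<alpha> q (vf_bracket M (sharp M \<pi> \<beta>) Y q)"

lemma form_bracket_eval:
  assumes \<alpha>: "\<alpha> \<in> one_forms M" and \<beta>: "\<beta> \<in> one_forms M" and Y: "Y \<in> vector_fields M" and q: "q \<in> pts M"
  shows "form_bracket M \<pi> \<alpha> \<beta> q (Y q) = form_bracket_on Y q \<alpha> \<beta>"
  unfolding form_bracket_def form_bracket_on_def
    ext_d_eval[OF manifold_M \<beta> sharp_vector_field[OF \<alpha>] Y q]
    ext_d_eval[OF manifold_M \<alpha> sharp_vector_field[OF \<beta>] Y q] ext_d_form_def
  using q M.TSec_tangent[OF Y q] by simp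

lemma form_bracket_on_skew:
  assumes \<alpha>: "\<alpha> \<in> one_forms M" and \<beta>: "\<beta> \<in> one_forms M" and Y: "Y \<in> vector_fields M" and q: "q \<in> pts M"
  shows "form_bracket_on Y q \<alpha> \<beta> = - form_bracket_on Y q \<beta> \<alpha>"
proof -
  have "(\<lambda>p. \<alpha> p (sharp M \<pi> \<beta> p)) \<in> CM" by (rule M.Cov_smooth[OF \<alpha> sharp_vector_field[OF \<beta>]])
  moreover have "(\<lambda>p. \<beta> p (sharp M \<pi> \<alpha> p)) = (\<lambda>p. (- 1) * \<alpha> p (sharp M \<pi> \<beta> p))"
  proof
    show "\<beta> p (sharp M \<pi> \<alpha> p) = (- 1) * \<alpha> p (sharp M \<pi> \<beta> p)" for p
      using fun_cong[OF sharp_pairing[OF \<alpha> \<beta>], of p] fun_cong[OF sharp_pairing[OF \<beta> \<alpha>], of p]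
        pi_skew[of p "\<alpha> p" "\<beta> p"] by simp
  qed
  ultimately have "Y q (\<lambda>p. \<beta> p (sharp M \<pi> \<alpha> p)) = (- 1) * Y q (\<lambda>p. \<alpha> p (sharp M \<pi> \<beta> p))"
    using tangent_scale[OF M.TSec_tangent[OF Y q]] by (simp only:)
  then show ?thesis unfolding form_bracket_on_def by simp
qed

lemma sharp_add:
  "\<alpha> \<in> one_forms M \<Longrightarrow> \<beta> \<in> one_forms M \<Longrightarrow>
    sharp M \<pi> (\<lambda>p v. \<alpha> p v + \<beta> p v) = (\<lambda>p f. sharp M \<pi> \<alpha> p f + sharp M \<pi> \<beta> p f)"
proof (intro ext)
  fix p f assume ab: "\<alpha> \<in> one_forms M" "\<beta> \<in> one_forms M"
  show "sharp M \<pi> (\<lambda>p v. \<alpha> p v + \<beta> p v) p f = sharp M \<pi> \<alpha> p f + sharp M \<pi> \<beta> p f"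
  proof (cases "p \<in> pts M")
    case p: True
    show ?thesis
      unfolding sharp_def pi_skew[of p _ "differential M f p"]
        dual_space_add[OF bivector_dual[OF pi_bivector[OF p] differential_cotangent] M.Cov_cotangent[OF ab(1) p]
          M.Cov_cotangent[OF ab(2) p]] by simp
  qed (simp add: sharp_def pi_outside)
qed

lemma sharp_smult:
  "\<alpha> \<in> one_forms M \<Longrightarrow> sharp M \<pi> (\<lambda>p v. h p * \<alpha> p v) = (\<lambda>p f. h p * sharp M \<pi> \<alpha> p f)"
proof (intro ext)
  fix p f assume a: "\<alpha> \<in> one_forms M"
  show "sharp M \<pi> (\<lambda>p v. h p * \<alpha> p v) p f = h p * sharp M \<pi> \<alpha> p f"
  proof (cases "p \<in> pts M")
    case p: True
    show ?thesis
      unfolding sharp_def pi_skew[of p _ "differential M f p"]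
        dual_space_scale[OF bivector_dual[OF pi_bivector[OF p] differential_cotangent] M.Cov_cotangent[OF a p]]
      by simp
  qed (simp add: sharp_def pi_outside)
qed

text \<open>The correction in the first slot has the same shape as in \<open>ASb_smult'\<close>,
  which makes the difference of the two brackets tensorial.\<close>

lemma form_bracket_on_tensor:
  assumes \<beta>: "\<beta> \<in> one_forms M" and Y: "Y \<in> vector_fields M" and q: "q \<in> pts M"
  shows "\<alpha> \<in> one_forms M \<Longrightarrow> \<alpha>' \<in> one_forms M \<Longrightarrow>
      form_bracket_on Y q (\<lambda>p v. \<alpha> p v + \<alpha>' p v) \<beta> = form_bracket_on Y q \<alpha> \<beta> + form_bracket_on Y q \<alpha>' \<beta>"
    and "\<alpha> \<in> one_forms M \<Longrightarrow> h \<in> CM \<Longrightarrow>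
      form_bracket_on Y q (\<lambda>p v. h p * \<alpha> p v) \<beta> = h q * form_bracket_on Y q \<alpha> \<beta> - sharp M \<pi> \<beta> q h * \<alpha> q (Y q)"
proof -
  note d = M.Cov_dual[OF \<beta> q] and Yt = M.TSec_tangent[OF Y q]
  note sb = M.TSec_tangent[OF sharp_vector_field[OF \<beta>] q]
  note sv = sharp_vector_field
  note bt = vf_bracket_tangent[OF manifold_M _ Y q]
  {
    assume \<alpha>: "\<alpha> \<in> one_forms M" and \<alpha>': "\<alpha>' \<in> one_forms M"
    show "form_bracket_on Y q (\<lambda>p v. \<alpha> p v + \<alpha>' p v) \<beta> = form_bracket_on Y q \<alpha> \<beta> + form_bracket_on Y q \<alpha>' \<beta>"
      unfolding form_bracket_on_def sharp_add[OF \<alpha> \<alpha>'] M.Cov_app_add[OF \<beta> sv[OF \<alpha>] sv[OF \<alpha>']]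
        vf_bracket_add[OF manifold_M sv[OF \<alpha>] sv[OF \<alpha>'] Y q]
        tangent_add[OF Yt M.Cov_smooth[OF \<beta> sv[OF \<alpha>]] M.Cov_smooth[OF \<beta> sv[OF \<alpha>']]]
        tangent_add[OF sb M.Cov_smooth[OF \<alpha> Y] M.Cov_smooth[OF \<alpha>' Y]]
        dual_space_add[OF d bt[OF sv[OF \<alpha>]] bt[OF sv[OF \<alpha>']]] by simp
  next
    assume \<alpha>: "\<alpha> \<in> one_forms M" and h: "h \<in> CM"
    show "form_bracket_on Y q (\<lambda>p v. h p * \<alpha> p v) \<beta> = h q * form_bracket_on Y q \<alpha> \<beta> - sharp M \<pi> \<beta> q h * \<alpha> q (Y q)"
      unfolding form_bracket_on_def sharp_smult[OF \<alpha>] M.Cov_app_smult[OF \<beta> sv[OF \<alpha>]]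
        vf_bracket_smult[OF manifold_M sv[OF \<alpha>] Y q h]
        tangent_mult[OF Yt h M.Cov_smooth[OF \<beta> sv[OF \<alpha>]]]
        tangent_mult[OF sb h M.Cov_smooth[OF \<alpha> Y]]
        dual_space_add[OF d tangent_closed_scale[OF bt[OF sv[OF \<alpha>]]]
          tangent_closed_scale[OF M.TSec_tangent[OF sv[OF \<alpha>] q]]]
        dual_space_scale[OF d bt[OF sv[OF \<alpha>]]] dual_space_scale[OF d M.TSec_tangent[OF sv[OF \<alpha>] q]]
      by (simp add: algebra_simps)
  }
qed

lemma res_diff_M: "restrict_to M (differential M f) = differential M f"
  by (intro ext) (simp add: restrict_to_def differential_def zero_fun_def)

lemma form_bracket_on_exact:
  assumes f: "f \<in> CM" and g: "g \<in> CM" and Y: "Y \<in> vector_fields M" and q: "q \<in> pts M"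
  shows "form_bracket_on Y q (differential M f) (differential M g) = Y q (brM f g)"
proof -
  note sv = sharp_vector_field[OF differential_one_form]
  note app = M.dM_app[unfolded res_diff_M]
  note ev = differential_eval[OF q vf_bracket_tangent[OF manifold_M sv Y q]]
  have s: "(\<lambda>p. sharp M \<pi> (differential M f) p g) = brM f g" for f g
    by (rule ext) (simp add: sharp_def fun_bracket_def)
  have "brM g f = (\<lambda>p. (- 1) * brM f g p)" by (rule ext) (simp add: brM_skew[of g])
  then have "Y q (brM g f) = - Y q (brM f g)"
    using tangent_scale[OF M.TSec_tangent[OF Y q] brM_CM[OF f g], of "- 1"] by simp
  then show ?thesis
    unfolding form_bracket_on_def app[OF Y] app[OF sv[OF f]] ev[OF f] ev[OF g] s
    unfolding vf_bracket_def s using f g by simp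
qed

text \<open>The difference of the two sides is tensorial over the functions on M, since both acquire
  the same correction when a 1-form is multiplied by h, and it vanishes on exact forms. To write it
  down, the tangent vector v is extended to a vector field on M.\<close>

lemma ASb_form_bracket:
  assumes \<alpha>: "\<alpha> \<in> one_forms M" and \<beta>: "\<beta> \<in> one_forms M"
  shows "ASb (res \<alpha>) (res \<beta>) = res (form_bracket M \<pi> \<alpha> \<beta>)"
proof (intro ext)
  fix q v
  show "ASb (res \<alpha>) (res \<beta>) q v = res (form_bracket M \<pi> \<alpha> \<beta>) q v"
  proof (cases "q \<in> pts S \<and> v \<in> tangent M q")
    case False
    then show ?thesis by (auto simp: ASb_def restrict_to_def form_bracket_def)
  next
    case True
    then have q: "q \<in> pts S" and v: "v \<in> tangent M q" by auto
    note qM = S_in_M[OF q]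
    obtain Y where Y: "Y \<in> vector_fields M" "Y q = v" by (rule M.TSec_extend[OF qM v])
    define D where "D = (\<lambda>\<alpha> \<beta>. form_bracket_on Y q \<alpha> \<beta> - ASb (res \<alpha>) (res \<beta>) q v)"
    have radd: "res (\<lambda>p v. \<alpha> p v + \<alpha>' p v) = (\<lambda>p v. res \<alpha> p v + res \<alpha>' p v)" for \<alpha> \<alpha>' :: "'a \<Rightarrow> 'a covec"
      by (intro ext) (simp add: restrict_to_def)
    have rmul: "res (\<lambda>p v. h p * \<alpha> p v) = (\<lambda>p v. res h p * res \<alpha> p v)" for h and \<alpha> :: "'a \<Rightarrow> 'a covec"
      by (intro ext) (simp add: restrict_to_def)
    have t: "M.tensorial q (one_forms M) (\<lambda>\<alpha>. D \<alpha> \<beta>)" if \<beta>: "\<beta> \<in> one_forms M" for \<beta>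
    proof (rule M.tensorialI)
      note rb = one_form_restrict[OF \<beta>]
      fix \<alpha> \<alpha>' assume a: "\<alpha> \<in> one_forms M" "\<alpha>' \<in> one_forms M"
      show "D (\<lambda>p x. \<alpha> p x + \<alpha>' p x) \<beta> = D \<alpha> \<beta> + D \<alpha>' \<beta>"
        unfolding D_def form_bracket_on_tensor(1)[OF \<beta> Y(1) qM a] radd
          ASb_add'[OF rb one_form_restrict[OF a(1)] one_form_restrict[OF a(2)]] by simp
    next
      note rb = one_form_restrict[OF \<beta>]
      fix h \<alpha> assume h: "h \<in> CM" and a: "\<alpha> \<in> one_forms M"
      \<comment> \<open>The two corrections agree because the anchor on S restricts the contraction
        with \<pi> on M.\<close>
      have "rho (res \<beta>) q (res h) = sharp M \<pi> \<beta> q h"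
        unfolding rho_eval[OF rb q] pull_differential[OF q h, symmetric] sharp_def restrict_eval[OF q]
        by (rule PS_pull[OF q M.Cov_cotangent[OF \<beta> qM] differential_cotangent])
      then show "D (\<lambda>p x. h p * \<alpha> p x) \<beta> = h q * D \<alpha> \<beta>"
        unfolding D_def form_bracket_on_tensor(2)[OF \<beta> Y(1) qM a h] rmul
          ASb_smult'[OF rb one_form_restrict[OF a] restrict_smooth[OF h]] Y(2)
        by (simp add: restrict_eval[OF q] algebra_simps)
    qed
    have skew: "D \<alpha> \<beta> = - D \<beta> \<alpha>" if "\<alpha> \<in> one_forms M" "\<beta> \<in> one_forms M" for \<alpha> \<beta>
      unfolding D_def using form_bracket_on_skew[OF that Y(1) qM] ASb_skew[of "res \<alpha>" "res \<beta>" q v] by simp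
    have ex: "D (differential M f) (differential M g) = 0" if f: "f \<in> CM" and g: "g \<in> CM" for f g
      unfolding D_def form_bracket_on_exact[OF f g Y(1) qM] ASb_exact[OF f g] dM_eval[OF q v] Y(2) by simp
    have one: "D \<alpha> (differential M g) = 0" if \<alpha>: "\<alpha> \<in> one_forms M" and g: "g \<in> CM" for \<alpha> g
    proof (rule M.tensorial_exact[OF qM t[OF differential_one_form[OF g]] _ \<alpha>])
      show "D (restrict_to M (differential M f)) (differential M g) = 0" if "f \<in> CM" for f
        unfolding res_diff_M by (rule ex[OF that g])
    qed
    have "D \<alpha> \<beta> = 0"
    proof (rule M.tensorial_exact[OF qM t[OF \<beta>] _ \<alpha>])
      fix f assume f: "f \<in> CM"
      show "D (restrict_to M (differential M f)) \<beta> = 0"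
        unfolding res_diff_M using skew[OF differential_one_form[OF f] \<beta>] one[OF \<beta> f] by simp
    qed
    then show ?thesis
      unfolding D_def restrict_eval[OF q] using form_bracket_eval[OF \<alpha> \<beta> Y(1) qM] Y(2) by simp
  qed
qed

section \<open>Identification with the bracket of the restricted Lie algebroid\<close>

lemma lie_algebroid_ASb: "lie_algebroid_bracket M S rho ASb"
  unfolding lie_algebroid_bracket_def Let_def
proof (intro conjI ballI allI)
  fix a b assume a: "a \<in> Cov" and b: "b \<in> Cov"
  show "ASb a b \<in> Cov" by (rule ASb_Cov[OF a b])
  show "ASb a b = - ASb b a" by (intro ext) (simp add: ASb_skew[of a b] fun_Compl_def)
  show "ASb a (\<lambda>q v. r * b q v) = (\<lambda>q v. r * ASb a b q v)" for r by (rule ASb_scale[OF a b])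
  show "ASb a (\<lambda>q v. h q * b q v) = (\<lambda>q v. h q * ASb a b q v + rho a q h * b q v)" if "h \<in> CS" for h
    by (rule ASb_smult[OF a b that])
  fix c assume c: "c \<in> Cov"
  show "ASb a (b + c) = ASb a b + ASb a c" using ASb_add[OF a b c] by (simp add: plus_fun_def)
  show "ASb a (ASb b c) + ASb b (ASb c a) + ASb c (ASb a b) = 0"
    by (intro ext) (simp add: ASb_jacobi[OF a b c])
qed

text \<open>Two brackets with the same anchor obey the same Leibniz rule, so their difference is
  tensorial. Exact sections are restrictions of 1-forms, where both brackets are prescribed; the
  difference therefore vanishes, although a general section need not extend to M.\<close>

lemma lie_algebroid_unique:
  assumes B: "lie_algebroid_bracket M S rho B"
    and hom: "\<And>\<alpha> \<beta>. \<alpha> \<in> one_forms M \<Longrightarrow> \<beta> \<in> one_forms M \<Longrightarrow>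
      B (res \<alpha>) (res \<beta>) = res (form_bracket M \<pi> \<alpha> \<beta>)"
    and out: "\<And>a b. \<not> (a \<in> Cov \<and> b \<in> Cov) \<Longrightarrow> B a b = 0"
  shows "B = ASb"
proof (intro ext)
  have C: "B a b \<in> Cov" and sk: "B a b = - B b a"
    and ad: "c \<in> Cov \<Longrightarrow> B a (b + c) = B a b + B a c"
    and lb: "h \<in> CS \<Longrightarrow> B a (\<lambda>q v. h q * b q v) = (\<lambda>q v. h q * B a b q v + rho a q h * b q v)"
    if "a \<in> Cov" "b \<in> Cov" for a b c h
    using B that unfolding lie_algebroid_bracket_def Let_def by blast+
  fix a b q v
  show "B a b q v = ASb a b q v"
  proof (cases "a \<in> Cov \<and> b \<in> Cov")
    case False
    then show ?thesis using out[OF False] ASb_outside[OF False] by simp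
  next
    case True
    then have a: "a \<in> Cov" and b: "b \<in> Cov" by auto
    show ?thesis
    proof (cases "q \<in> pts S")
      case False
      then show ?thesis using Cov_outside[OF C[OF a b] False] by (simp add: ASb_outside_pts)
    next
      case q: True
      define D where "D = (\<lambda>a b. B a b q v - ASb a b q v)"
      have skew: "D a b = - D b a" if "a \<in> Cov" "b \<in> Cov" for a b
        unfolding D_def using fun_cong[OF fun_cong[OF sk[OF that]], of q v] ASb_skew[of a b q v] by simp
      have "D a b = 0"
      proof (rule tensorial_exact2[where D = D, OF q _ skew _ a b])
        fix b assume b: "b \<in> Cov"
        show "tensorial q Cov (\<lambda>a. D a b)"
        proof (rule tensorialI)
          fix s t assume s: "s \<in> Cov" and t: "t \<in> Cov"
          \<comment> \<open>The axioms of \<open>lie_algebroid_bracket\<close> constrain the second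
            slot; skewness carries them to the first.\<close>
          have "D b (\<lambda>p x. s p x + t p x) = D b s + D b t"
            using fun_cong[OF fun_cong[OF ad[OF b s t]], of q v] ASb_add[OF b s t]
            unfolding D_def by (simp add: plus_fun_def)
          then show "D (\<lambda>p x. s p x + t p x) b = D s b + D t b"
            using skew[OF Cov_add[OF s t] b] skew[OF s b] skew[OF t b] by simp
        next
          fix h s assume h: "h \<in> CS" and s: "s \<in> Cov"
          have "D b (\<lambda>p x. h p * s p x) = h q * D b s"
            unfolding D_def lb[OF b s h] ASb_smult[OF b s h] by (simp add: algebra_simps)
          then show "D (\<lambda>p x. h p * s p x) b = h q * D s b"
            using skew[OF Cov_smult[OF h s] b] skew[OF s b] by simp
        qed
      next
        fix f g assume fg: "f \<in> CM" "g \<in> CM"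
        show "D (dM f) (dM g) = 0"
          unfolding D_def hom[OF differential_one_form[OF fg(1)] differential_one_form[OF fg(2)]]
            ASb_form_bracket[OF differential_one_form[OF fg(1)] differential_one_form[OF fg(2)]] by simp
      qed
      then show ?thesis unfolding D_def by simp
    qed
  qed
qed

lemma AS_bracket_ASb: "AS_bracket M \<pi> S = ASb"
  unfolding AS_bracket_def
proof (rule the_equality)
  show "lie_algebroid_bracket M S rho ASb \<and>
    (\<forall>\<alpha>\<in>one_forms M. \<forall>\<beta>\<in>one_forms M. ASb (res \<alpha>) (res \<beta>) = res (form_bracket M \<pi> \<alpha> \<beta>)) \<and>
    (\<forall>a b. \<not> (a \<in> Cov \<and> b \<in> Cov) \<longrightarrow> ASb a b = 0)"
    using lie_algebroid_ASb ASb_form_bracket ASb_outside unfolding zero_fun_def by blast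
  fix B assume "lie_algebroid_bracket M S rho B \<and>
    (\<forall>\<alpha>\<in>one_forms M. \<forall>\<beta>\<in>one_forms M. B (res \<alpha>) (res \<beta>) = res (form_bracket M \<pi> \<alpha> \<beta>)) \<and>
    (\<forall>a b. \<not> (a \<in> Cov \<and> b \<in> Cov) \<longrightarrow> B a b = 0)"
  then show "B = ASb" by (intro lie_algebroid_unique) blast+
qed

end

section \<open>Conormal sections and dual frames\<close>

lemma poisson_algebra_transfer:
  assumes B: "poisson_algebra B" and hom: "poisson_hom A B h" and inj: "inj_on h (pcarrier A)"
    and c0: "0 \<in> pcarrier A"
    and ca: "\<And>x y. x \<in> pcarrier A \<Longrightarrow> y \<in> pcarrier A \<Longrightarrow> x + y \<in> pcarrier A"
    and cs: "\<And>r x. x \<in> pcarrier A \<Longrightarrow> pscale A r x \<in> pcarrier A"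
    and cm: "\<And>x y. x \<in> pcarrier A \<Longrightarrow> y \<in> pcarrier A \<Longrightarrow> pmult A x y \<in> pcarrier A"
    and cb: "\<And>x y. x \<in> pcarrier A \<Longrightarrow> y \<in> pcarrier A \<Longrightarrow> pbracket A x y \<in> pcarrier A"
  shows "poisson_algebra A"
proof -
  have hc: "h x \<in> pcarrier B" and hs: "h (pscale A r x) = pscale B r (h x)" if "x \<in> pcarrier A" for x r
    using hom that unfolding poisson_hom_def by auto
  have ha: "h (x + y) = h x + h y" and hm: "h (pmult A x y) = pmult B (h x) (h y)"
    and hb: "h (pbracket A x y) = pbracket B (h x) (h y)" if "x \<in> pcarrier A" "y \<in> pcarrier A" for x y
    using hom that unfolding poisson_hom_def by auto
  have h0: "h 0 = 0" using ha[OF c0 c0] by simp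
  have eq: "x = y" if "x \<in> pcarrier A" "y \<in> pcarrier A" "h x = h y" for x y
    using inj_onD[OF inj] that by blast
  note simps = hc ha hm hb hs h0 c0 ca cs cm cb
  have ax: "\<forall>r. \<forall>x\<in>pcarrier B. \<forall>y\<in>pcarrier B. pscale B r (x + y) = pscale B r x + pscale B r y"
    "\<forall>r r'. \<forall>x\<in>pcarrier B. pscale B (r + r') x = pscale B r x + pscale B r' x \<and>
      pscale B (r * r') x = pscale B r (pscale B r' x)"
    "\<forall>x\<in>pcarrier B. pscale B 1 x = x"
    "\<forall>x\<in>pcarrier B. \<forall>y\<in>pcarrier B. pmult B x y \<in> pcarrier B \<and> pmult B x y = pmult B y x"
    "\<forall>x\<in>pcarrier B. \<forall>y\<in>pcarrier B. \<forall>z\<in>pcarrier B. pmult B x (pmult B y z) = pmult B (pmult B x y) z \<and>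
      pmult B x (y + z) = pmult B x y + pmult B x z"
    "\<forall>r. \<forall>x\<in>pcarrier B. \<forall>y\<in>pcarrier B. pmult B x (pscale B r y) = pscale B r (pmult B x y)"
    "\<forall>x\<in>pcarrier B. \<forall>y\<in>pcarrier B. pbracket B x y \<in> pcarrier B \<and> pbracket B x y = - pbracket B y x"
    "\<forall>x\<in>pcarrier B. \<forall>y\<in>pcarrier B. \<forall>z\<in>pcarrier B. pbracket B x (y + z) = pbracket B x y + pbracket B x z"
    "\<forall>r. \<forall>x\<in>pcarrier B. \<forall>y\<in>pcarrier B. pbracket B x (pscale B r y) = pscale B r (pbracket B x y)"
    "\<forall>x\<in>pcarrier B. \<forall>y\<in>pcarrier B. \<forall>z\<in>pcarrier B. pbracket B x (pbracket B y z) +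
      pbracket B y (pbracket B z x) + pbracket B z (pbracket B x y) = 0"
    "\<forall>x\<in>pcarrier B. \<forall>y\<in>pcarrier B. \<forall>z\<in>pcarrier B. pbracket B x (pmult B y z) =
      pmult B (pbracket B x y) z + pmult B y (pbracket B x z)"
    "\<forall>x\<in>pcarrier B. \<forall>y\<in>pcarrier B. \<forall>z\<in>pcarrier B. pbracket B (pmult B x y) z =
      pmult B (pbracket B x z) y + pmult B x (pbracket B y z)"
    using B unfolding poisson_algebra_def Let_def by - (elim conjE, assumption)+
  \<comment> \<open>A homomorphism respects sums by definition, whereas negation is not among its
    operations; skewness is therefore transferred as a vanishing sum.\<close>
  have skew: "pbracket A x y = - pbracket A y x" if x: "x \<in> pcarrier A" and y: "y \<in> pcarrier A" for x y
  proof -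
    have "pbracket B (h x) (h y) = - pbracket B (h y) (h x)"
      by (rule conjunct2[OF ax(7)[rule_format, OF hc[OF x] hc[OF y]]])
    then have "h (pbracket A x y + pbracket A y x) = h 0"
      by (simp only: simps x y) simp
    then have "pbracket A x y + pbracket A y x = 0"
      by (rule eq[rotated 2]) (simp_all only: simps x y)
    then show ?thesis by (rule eq_neg_iff_add_eq_0[THEN iffD2])
  qed
  show ?thesis
    unfolding poisson_algebra_def Let_def
  proof (intro conjI ballI allI)
    fix x y z r r' assume x: "x \<in> pcarrier A" and y: "y \<in> pcarrier A" and z: "z \<in> pcarrier A"
    note hx = hc[OF x] and hy = hc[OF y] and hz = hc[OF z]
    show "pscale A r (x + y) = pscale A r x + pscale A r y"
      by (rule eq) (simp_all only: simps x y ax(1)[rule_format, OF hx hy])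
    show "pscale A (r + r') x = pscale A r x + pscale A r' x"
      by (rule eq) (simp_all only: simps x conjunct1[OF ax(2)[rule_format, OF hx]])
    show "pscale A (r * r') x = pscale A r (pscale A r' x)"
      by (rule eq) (simp_all only: simps x conjunct2[OF ax(2)[rule_format, OF hx]])
    show "pscale A 1 x = x"
      by (rule eq) (simp_all only: simps x ax(3)[rule_format, OF hx])
    show "pmult A x y = pmult A y x"
      by (rule eq) (simp_all only: simps x y, rule conjunct2[OF ax(4)[rule_format, OF hx hy]])
    show "pmult A x (pmult A y z) = pmult A (pmult A x y) z"
      by (rule eq) (simp_all only: simps x y z conjunct1[OF ax(5)[rule_format, OF hx hy hz]])
    show "pmult A x (y + z) = pmult A x y + pmult A x z"
      by (rule eq) (simp_all only: simps x y z conjunct2[OF ax(5)[rule_format, OF hx hy hz]])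
    show "pmult A x (pscale A r y) = pscale A r (pmult A x y)"
      by (rule eq) (simp_all only: simps x y ax(6)[rule_format, OF hx hy])
    show "pbracket A x (y + z) = pbracket A x y + pbracket A x z"
      by (rule eq) (simp_all only: simps x y z ax(8)[rule_format, OF hx hy hz])
    show "pbracket A x (pscale A r y) = pscale A r (pbracket A x y)"
      by (rule eq) (simp_all only: simps x y ax(9)[rule_format, OF hx hy])
    show "pbracket A x (pbracket A y z) + pbracket A y (pbracket A z x) + pbracket A z (pbracket A x y) = 0"
      by (rule eq) (simp_all only: simps x y z ax(10)[rule_format, OF hx hy hz])
    show "pbracket A x (pmult A y z) = pmult A (pbracket A x y) z + pmult A y (pbracket A x z)"
      by (rule eq) (simp_all only: simps x y z ax(11)[rule_format, OF hx hy hz])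
    show "pbracket A (pmult A x y) z = pmult A (pbracket A x z) y + pmult A x (pbracket A y z)"
      by (rule eq) (simp_all only: simps x y z ax(12)[rule_format, OF hx hy hz])
    show "x + y \<in> pcarrier A" "pscale A r x \<in> pcarrier A" "pmult A x y \<in> pcarrier A"
      "pbracket A x y \<in> pcarrier A"
      by (simp_all only: simps x y)
    show "pbracket A x y = - pbracket A y x" by (rule skew[OF x y])
  qed (rule c0)
qed

lemma poisson_algebra_closed:
  assumes D: "poisson_algebra D" and x: "x \<in> pcarrier D" and y: "y \<in> pcarrier D"
  shows "x + y \<in> pcarrier D" "pscale D r x \<in> pcarrier D" "pmult D x y \<in> pcarrier D" "pbracket D x y \<in> pcarrier D"
proof -
  have ax: "\<forall>x\<in>pcarrier D. \<forall>y\<in>pcarrier D. x + y \<in> pcarrier D"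
    "\<forall>r. \<forall>x\<in>pcarrier D. pscale D r x \<in> pcarrier D"
    "\<forall>x\<in>pcarrier D. \<forall>y\<in>pcarrier D. pmult D x y \<in> pcarrier D \<and> pmult D x y = pmult D y x"
    "\<forall>x\<in>pcarrier D. \<forall>y\<in>pcarrier D. pbracket D x y \<in> pcarrier D \<and> pbracket D x y = - pbracket D y x"
    using D unfolding poisson_algebra_def Let_def by - (elim conjE, assumption)+
  show "x + y \<in> pcarrier D" by (rule ax(1)[rule_format, OF x y])
  show "pscale D r x \<in> pcarrier D" by (rule ax(2)[rule_format, OF x])
  show "pmult D x y \<in> pcarrier D" by (rule conjunct1[OF ax(3)[rule_format, OF x y]])
  show "pbracket D x y \<in> pcarrier D" by (rule conjunct1[OF ax(4)[rule_format, OF x y]])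
qed

lemma poisson_isomorphic_common:
  assumes h: "poisson_hom A C h" "bij_betw h (pcarrier A) (pcarrier C)"
    and k: "poisson_hom B C k" "bij_betw k (pcarrier B) (pcarrier C)"
    and A: "poisson_algebra A" and B: "poisson_algebra B"
  shows "poisson_isomorphic A B"
proof -
  define g where "g = (\<lambda>x. inv_into (pcarrier B) k (h x))"
  have inj: "inj_on k (pcarrier B)" and img: "k ` pcarrier B = pcarrier C"
    using k(2) unfolding bij_betw_def by auto
  have hC: "h x \<in> pcarrier C" if "x \<in> pcarrier A" for x
    using h(1) that unfolding poisson_hom_def by blast
  have g: "g x \<in> pcarrier B" "k (g x) = h x" if "x \<in> pcarrier A" for x
    using hC[OF that] inv_into_into[of "h x" k "pcarrier B"] f_inv_into_f[of "h x" k "pcarrier B"] img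
    unfolding g_def by auto
  have gI: "g x = y" if "x \<in> pcarrier A" "y \<in> pcarrier B" "k y = h x" for x y
    using inj_onD[OF inj, of "g x" y] g that by simp
  have hh: "h (x + y) = h x + h y" "h (pmult A x y) = pmult C (h x) (h y)"
      "h (pbracket A x y) = pbracket C (h x) (h y)" "h (pscale A r x) = pscale C r (h x)"
    if "x \<in> pcarrier A" "y \<in> pcarrier A" for x y r
    using h(1) that unfolding poisson_hom_def by auto
  have kk: "k (x + y) = k x + k y" "k (pmult B x y) = pmult C (k x) (k y)"
      "k (pbracket B x y) = pbracket C (k x) (k y)" "k (pscale B r x) = pscale C r (k x)"
    if "x \<in> pcarrier B" "y \<in> pcarrier B" for x y r
    using k(1) that unfolding poisson_hom_def by auto
  have "poisson_hom A B g"
    unfolding poisson_hom_def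
  proof (intro conjI ballI allI)
    fix x y r assume x: "x \<in> pcarrier A" and y: "y \<in> pcarrier A"
    show "g x \<in> pcarrier B" by (rule g(1)[OF x])
    note clA = poisson_algebra_closed[OF A x y] and clB = poisson_algebra_closed[OF B g(1)[OF x] g(1)[OF y]]
    show "g (x + y) = g x + g y"
      by (rule gI[OF clA(1) clB(1)]) (simp only: x y g hh(1)[OF x y] kk(1)[OF g(1)[OF x] g(1)[OF y]])
    show "g (pmult A x y) = pmult B (g x) (g y)"
      by (rule gI[OF clA(3) clB(3)]) (simp only: x y g hh(2)[OF x y] kk(2)[OF g(1)[OF x] g(1)[OF y]])
    show "g (pbracket A x y) = pbracket B (g x) (g y)"
      by (rule gI[OF clA(4) clB(4)]) (simp only: x y g hh(3)[OF x y] kk(3)[OF g(1)[OF x] g(1)[OF y]])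
    show "g (pscale A r x) = pscale B r (g x)"
      by (rule gI[OF clA(2) clB(2)]) (simp only: x g hh(4)[OF x x] kk(4)[OF g(1)[OF x] g(1)[OF x]])
  qed
  moreover have "bij_betw g (pcarrier A) (pcarrier B)"
    using bij_betw_trans[OF h(2) bij_betw_inv_into[OF k(2)]] unfolding g_def comp_def .
  ultimately show ?thesis unfolding poisson_isomorphic_def by blast
qed

context embedded
begin

section \<open>The conormal bundle and the annihilator of TS\<close>

abbreviation "Con \<equiv> conormal_sections M S"

text \<open>The sections of the annihilator of TS. The condition is phrased through
  \<open>pull\<close> to match membership in \<open>jet\<close>: these are the second components of
  the pairs over the function 0.\<close>

definition Ann :: "('a \<Rightarrow> 'a covec) set" where
  "Ann = {a \<in> Cov. \<forall>q\<in>pts S. pull M S q (a q) = (\<lambda>w. 0)}"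

lemma TS_zero: "(\<lambda>f. 0) \<in> TS M S q"
proof -
  have "push M S (\<lambda>f. 0) = (\<lambda>f. 0)" by (rule ext) (simp add: push_def)
  then show ?thesis unfolding TS_def using tangent_closed_zero[of S q] by (metis imageI)
qed

lemma TS_add: "t \<in> TS M S q \<Longrightarrow> t' \<in> TS M S q \<Longrightarrow> (\<lambda>f. t f + t' f) \<in> TS M S q"
  unfolding TS_def by (auto simp: push_add[symmetric] intro!: imageI tangent_closed_add)

lemma TS_scale: "t \<in> TS M S q \<Longrightarrow> (\<lambda>f. c * t f) \<in> TS M S q"
  unfolding TS_def by (auto simp: push_scale[symmetric] intro!: imageI tangent_closed_scale)

lemma TS_tangent: "q \<in> pts S \<Longrightarrow> t \<in> TS M S q \<Longrightarrow> t \<in> tangent M q"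
  unfolding TS_def using push_tangent by blast

lemma nu_self: "v \<in> nu M S q v"
  unfolding nu_def using TS_zero[of q] by (force simp: plus_fun_def)

lemma nu_eqD:
  assumes "nu M S q v = nu M S q w"
  obtains t where "t \<in> TS M S q" "v = (\<lambda>f. w f + t f)"
  using nu_self[of v q] unfolding assms unfolding nu_def plus_fun_def by blast

lemma nu_TS:
  assumes t: "t \<in> TS M S q"
  shows "nu M S q t = nu M S q (\<lambda>f. 0)"
proof (intro equalityI subsetI)
  fix x assume "x \<in> nu M S q t"
  then obtain t' where t': "t' \<in> TS M S q" "x = (\<lambda>f. t f + t' f)" unfolding nu_def plus_fun_def by blast
  then have "x = (\<lambda>f. 0) + (\<lambda>f. t f + t' f)" by (simp add: plus_fun_def)
  then show "x \<in> nu M S q (\<lambda>f. 0)" unfolding nu_def using TS_add[OF t t'(1)] by blast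
next
  fix x assume "x \<in> nu M S q (\<lambda>f. 0)"
  then have x: "x \<in> TS M S q" unfolding nu_def plus_fun_def by auto
  have "x = t + (\<lambda>f. x f + (- 1) * t f)" by (rule ext) simp
  then show "x \<in> nu M S q t" unfolding nu_def using TS_add[OF x TS_scale[OF t, of "- 1"]] by blast
qed

text \<open>Cosets are formed for arbitrary functionals v. With this, vanishing of a conormal vector
  off the normal space becomes vanishing of \<open>nu_star\<close> off the tangent space, as
  membership in \<open>cotangent\<close> demands.\<close>

lemma nu_normal_iff:
  assumes q: "q \<in> pts S"
  shows "nu M S q v \<in> normal_space M S q \<longleftrightarrow> v \<in> tangent M q"
proof
  assume "nu M S q v \<in> normal_space M S q"
  then obtain w where w: "w \<in> tangent M q" "nu M S q v = nu M S q w" unfolding normal_space_def by blast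
  obtain t where "t \<in> TS M S q" "v = (\<lambda>f. w f + t f)" by (rule nu_eqD[OF w(2)])
  then show "v \<in> tangent M q" using tangent_closed_add[OF w(1) TS_tangent[OF q]] by blast
qed (auto simp: normal_space_def)

lemma Con_space: "\<eta> \<in> Con \<Longrightarrow> q \<in> pts S \<Longrightarrow> \<eta> q \<in> conormal_space M S q"
  unfolding conormal_sections_def by blast

lemma Con_outside: "\<eta> \<in> Con \<Longrightarrow> q \<notin> pts S \<Longrightarrow> \<eta> q = (\<lambda>z. 0)"
  unfolding conormal_sections_def zero_fun_def by blast

lemma Con_smooth: "\<eta> \<in> Con \<Longrightarrow> \<sigma> \<in> TSec \<Longrightarrow> (\<lambda>q. \<eta> q (nu M S q (\<sigma> q))) \<in> CS"
  unfolding conormal_sections_def by blast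

lemma ConI:
  "(\<And>q. q \<in> pts S \<Longrightarrow> \<eta> q \<in> conormal_space M S q) \<Longrightarrow> (\<And>q. q \<notin> pts S \<Longrightarrow> \<eta> q = (\<lambda>z. 0)) \<Longrightarrow>
    (\<And>\<sigma>. \<sigma> \<in> TSec \<Longrightarrow> (\<lambda>q. \<eta> q (nu M S q (\<sigma> q))) \<in> CS) \<Longrightarrow> \<eta> \<in> Con"
  unfolding conormal_sections_def zero_fun_def by blast

lemma Con_add: "\<eta> \<in> Con \<Longrightarrow> \<theta> \<in> Con \<Longrightarrow> (\<lambda>q z. \<eta> q z + \<theta> q z) \<in> Con"
proof (rule ConI)
  fix q assume "\<eta> \<in> Con" "\<theta> \<in> Con" "q \<in> pts S"
  then have "\<eta> q \<in> conormal_space M S q" "\<theta> q \<in> conormal_space M S q" using Con_space by auto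
  then show "(\<lambda>z. \<eta> q z + \<theta> q z) \<in> conormal_space M S q"
    unfolding conormal_space_def by (simp add: algebra_simps)
qed (simp_all add: Con_outside Con_smooth CS_add)

lemma Con_smult: "h \<in> CS \<Longrightarrow> \<eta> \<in> Con \<Longrightarrow> (\<lambda>q z. h q * \<eta> q z) \<in> Con"
proof (rule ConI)
  fix q assume "\<eta> \<in> Con" "q \<in> pts S"
  then have "\<eta> q \<in> conormal_space M S q" using Con_space by auto
  then show "(\<lambda>z. h q * \<eta> q z) \<in> conormal_space M S q"
    unfolding conormal_space_def by (simp add: algebra_simps)
qed (simp_all add: Con_outside Con_smooth CS_mult)

lemma Con_scale: "\<eta> \<in> Con \<Longrightarrow> (\<lambda>q z. c * \<eta> q z) \<in> Con"
proof (rule ConI)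
  fix q assume "\<eta> \<in> Con" "q \<in> pts S"
  then have "\<eta> q \<in> conormal_space M S q" using Con_space by auto
  then show "(\<lambda>z. c * \<eta> q z) \<in> conormal_space M S q"
    unfolding conormal_space_def by (simp add: algebra_simps)
qed (simp_all add: Con_outside Con_smooth CS_scale)

lemma Con_zero: "(\<lambda>q z. 0) \<in> Con"
  by (rule ConI) (simp_all add: conormal_space_def CS_zero)

lemma Con_diff: "\<eta> \<in> Con \<Longrightarrow> \<theta> \<in> Con \<Longrightarrow> (\<lambda>q z. \<eta> q z - \<theta> q z) \<in> Con"
  using Con_add[OF _ Con_scale, of \<eta> \<theta> "- 1"] by simp

lemma nu_star_Ann:
  assumes \<eta>: "\<eta> \<in> Con"
  shows "nu_star M S \<eta> \<in> Ann"
proof -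
  have sp: "\<eta> q (nu M S q (\<lambda>f. v f + w f)) = \<eta> q (nu M S q v) + \<eta> q (nu M S q w)"
      "\<eta> q (nu M S q (\<lambda>f. c * v f)) = c * \<eta> q (nu M S q v)"
    if "q \<in> pts S" "v \<in> tangent M q" "w \<in> tangent M q" for q v w c
    using Con_space[OF \<eta> that(1)] that(2,3) unfolding conormal_space_def plus_fun_def by auto
  have out: "\<eta> q z = 0" if "q \<in> pts S" "z \<notin> normal_space M S q" for q z
    using Con_space[OF \<eta> that(1)] that(2) unfolding conormal_space_def by auto
  have ct: "nu_star M S \<eta> q \<in> cotangent M q" if q: "q \<in> pts S" for q
    unfolding cotangent_def nu_star_def
    by (rule dual_spaceI) (simp_all add: sp[OF q] out[OF q] nu_normal_iff[OF q])
  have "nu_star M S \<eta> \<in> Cov"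
    by (rule CovI) (simp_all add: ct, simp_all add: nu_star_def Con_outside[OF \<eta>] Con_smooth[OF \<eta>])
  moreover have "pull M S q (nu_star M S \<eta> q) = (\<lambda>w. 0)" if q: "q \<in> pts S" for q
  proof
    fix w
    have "nu_star M S \<eta> q (push M S w) = 0" if w: "w \<in> tangent S q"
    proof -
      have "push M S w \<in> TS M S q" unfolding TS_def using w by blast
      then have "nu_star M S \<eta> q (push M S w) = nu_star M S \<eta> q (\<lambda>f. 0)"
        unfolding nu_star_def by (simp add: nu_TS)
      then show ?thesis using dual_space_zero[OF ct[OF q, unfolded cotangent_def]] by simp
    qed
    then show "pull M S q (nu_star M S \<eta> q) w = 0" by (simp add: pull_def)
  qed
  ultimately show ?thesis unfolding Ann_def by blast
qed

lemma Con_eq_0: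
  assumes "\<eta> \<in> Con" "\<not> (q \<in> pts S \<and> z \<in> normal_space M S q)"
  shows "\<eta> q z = 0"
proof (cases "q \<in> pts S")
  case True
  then show ?thesis using Con_space[OF assms(1) True] assms(2) unfolding conormal_space_def by auto
qed (simp add: Con_outside[OF assms(1)])

lemma nu_star_inj:
  assumes "\<eta> \<in> Con" "\<theta> \<in> Con" "nu_star M S \<eta> = nu_star M S \<theta>"
  shows "\<eta> = \<theta>"
proof (intro ext)
  fix q z show "\<eta> q z = \<theta> q z"
  proof (cases "q \<in> pts S \<and> z \<in> normal_space M S q")
    case True
    then obtain v where "z = nu M S q v" unfolding normal_space_def by blast
    then show ?thesis using fun_cong[OF fun_cong[OF assms(3)], of q v] unfolding nu_star_def by simp
  next
    case False
    then show ?thesis using Con_eq_0[OF assms(1) False] Con_eq_0[OF assms(2) False] by simp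
  qed
qed

text \<open>For a in \<open>Ann\<close> the representative chosen in the coset is immaterial,
  because a vanishes on TS.\<close>

definition nuinv :: "('a \<Rightarrow> 'a covec) \<Rightarrow> 'a conormal_section" where
  "nuinv a = (\<lambda>q z. if q \<in> pts S \<and> z \<in> normal_space M S q
     then a q (SOME v. v \<in> tangent M q \<and> nu M S q v = z) else 0)"

lemma nuinv_eval:
  assumes a: "a \<in> Ann" and q: "q \<in> pts S" and v: "v \<in> tangent M q"
  shows "nuinv a q (nu M S q v) = a q v"
proof -
  define w where "w = (SOME w. w \<in> tangent M q \<and> nu M S q w = nu M S q v)"
  have "w \<in> tangent M q \<and> nu M S q w = nu M S q v"
    unfolding w_def by (rule someI[of _ v]) (simp add: v)
  then obtain t where t: "t \<in> TS M S q" "w = (\<lambda>f. v f + t f)" using nu_eqD[of q w v] by metis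
  obtain u where u: "u \<in> tangent S q" "t = push M S u" using t(1) unfolding TS_def by blast
  have "a q t = pull M S q (a q) u" using u by (simp add: pull_eval)
  then have "a q t = 0" using a q unfolding Ann_def by simp
  moreover have "a \<in> Cov" using a unfolding Ann_def by blast
  ultimately have "a q w = a q v"
    using dual_space_add[OF Cov_dual[OF _ q] v TS_tangent[OF q t(1)], of a] t(2) by simp
  then show ?thesis
    unfolding nuinv_def w_def using q v nu_normal_iff[OF q] by simp
qed

lemma nuinv_Con:
  assumes a: "a \<in> Ann"
  shows "nuinv a \<in> Con" and "nu_star M S (nuinv a) = a"
proof -
  have aC: "a \<in> Cov" using a unfolding Ann_def by blast
  show ns: "nu_star M S (nuinv a) = a"
  proof (intro ext)
    fix q v show "nu_star M S (nuinv a) q v = a q v"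
    proof (cases "q \<in> pts S")
      case q: True
      show ?thesis
      proof (cases "v \<in> tangent M q")
        case True
        then show ?thesis unfolding nu_star_def by (rule nuinv_eval[OF a q])
      next
        case False
        then show ?thesis
          unfolding nu_star_def nuinv_def nu_normal_iff[OF q] dual_space_outside[OF Cov_dual[OF aC q] False] by simp
      qed
    qed (simp add: nu_star_def nuinv_def Cov_outside[OF aC])
  qed
  show "nuinv a \<in> Con"
  proof (rule ConI)
    fix q assume q: "q \<in> pts S"
    note d = Cov_dual[OF aC q] and ev = nuinv_eval[OF a q]
    show "nuinv a q \<in> conormal_space M S q"
      unfolding conormal_space_def plus_fun_def
    proof (intro CollectI conjI ballI allI impI)
      fix v w assume v: "v \<in> tangent M q" and w: "w \<in> tangent M q"
      show "nuinv a q (nu M S q (\<lambda>x. v x + w x)) = nuinv a q (nu M S q v) + nuinv a q (nu M S q w)"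
        unfolding ev[OF v] ev[OF w] ev[OF tangent_closed_add[OF v w]] by (rule dual_space_add[OF d v w])
    next
      fix c v assume v: "v \<in> tangent M q"
      show "nuinv a q (nu M S q (\<lambda>f. c * v f)) = c * nuinv a q (nu M S q v)"
        unfolding ev[OF v] ev[OF tangent_closed_scale[OF v]] by (rule dual_space_scale[OF d v])
    qed (simp add: nuinv_def)
  next
    fix \<sigma> assume \<sigma>: "\<sigma> \<in> TSec"
    have "(\<lambda>q. nu_star M S (nuinv a) q (\<sigma> q)) \<in> CS" unfolding ns by (rule Cov_smooth[OF aC \<sigma>])
    then show "(\<lambda>q. nuinv a q (nu M S q (\<sigma> q))) \<in> CS" unfolding nu_star_def .
  qed (simp add: nuinv_def)
qed

text \<open>The connection, the curvature and the bracket on the dual of E are all defined by a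
  description of this shape.\<close>

lemma nuinv_the:
  assumes a: "a \<in> Ann"
  shows "(THE \<theta>. \<theta> \<in> Con \<and> nu_star M S \<theta> = a) = nuinv a"
proof (rule the_equality)
  show "nuinv a \<in> Con \<and> nu_star M S (nuinv a) = a" by (intro conjI nuinv_Con[OF a])
  fix \<theta> assume \<theta>: "\<theta> \<in> Con \<and> nu_star M S \<theta> = a"
  show "\<theta> = nuinv a"
    by (rule nu_star_inj[OF conjunct1[OF \<theta>] nuinv_Con(1)[OF a]]) (simp only: conjunct2[OF \<theta>] nuinv_Con(2)[OF a])
qed

text \<open>An elimination with differentials: independence at q yields a function f that detects
  the part of \<open>r k\<close> outside the span of the earlier sections, and df is corrected to
  annihilate those. Duality is wanted on a neighbourhood, to which the nonvanishing of
  \<open>h\<close> at q extends.\<close>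

lemma dual_frame:
  fixes k :: nat
  assumes q: "q \<in> pts S"
  shows "(\<And>i. i < k \<Longrightarrow> r i \<in> TSec) \<Longrightarrow>
    (\<And>c i. (\<lambda>f. \<Sum>i<k. c i * r i q f) = (\<lambda>f. 0) \<Longrightarrow> i < k \<Longrightarrow> c i = 0) \<Longrightarrow>
    \<exists>a W. (\<forall>i<k. a i \<in> Cov) \<and> openin (mtop S) W \<and> q \<in> W \<and>
      (\<forall>p\<in>W. \<forall>i<k. \<forall>j<k. a i p (r j p) = (if i = j then 1 else 0))"
proof (induction k)
  case 0
  show ?case using q by (intro exI[of _ "\<lambda>_ _ _. 0"] exI[of _ "pts S"]) auto
next
  case (Suc k)
  note r = Suc.prems(1)
  have "\<exists>a W. (\<forall>i<k. a i \<in> Cov) \<and> openin (mtop S) W \<and> q \<in> W \<and>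
      (\<forall>p\<in>W. \<forall>i<k. \<forall>j<k. a i p (r j p) = (if i = j then 1 else 0))"
  proof (rule Suc.IH)
    fix c i assume c: "(\<lambda>f. \<Sum>i<k. c i * r i q f) = (\<lambda>f. 0)" and i: "i < k"
    have "(\<lambda>f. \<Sum>i<Suc k. (if i < k then c i else 0) * r i q f) = (\<lambda>f. 0)"
      using c by simp
    from Suc.prems(2)[OF this, of i] show "c i = 0" using i by simp
  qed (use r in simp)
  then obtain a W where a: "\<And>i. i < k \<Longrightarrow> a i \<in> Cov" and W: "openin (mtop S) W" "q \<in> W"
    and d: "\<And>p i j. p \<in> W \<Longrightarrow> i < k \<Longrightarrow> j < k \<Longrightarrow> a i p (r j p) = (if i = j then 1 else 0)" by blast
  have WS: "p \<in> pts S" if "p \<in> W" for p using that W openin_subset by blast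
  \<comment> \<open>The coefficients of \<open>r k\<close> minus its components along the earlier
    sections. The last one is 1, so independence makes the combination a nonzero derivation.\<close>
  define c where "c = (\<lambda>i. if i < k then - a i q (r k q) else (1::real))"
  have "(\<lambda>f. \<Sum>i<Suc k. c i * r i q f) \<noteq> (\<lambda>f. 0)"
    using Suc.prems(2)[of c k] unfolding c_def by auto
  then obtain f where f0: "(\<Sum>i<Suc k. c i * r i q f) \<noteq> 0" by blast
  have f: "f \<in> CM"
  proof (rule ccontr)
    assume "f \<notin> CM"
    then have "(\<Sum>i<Suc k. c i * r i q f) = 0"
      by (intro sum.neutral) (auto simp: tangent_outside[OF TSec_tangent[OF r q]])
    then show False using f0 by simp
  qed
  have t: "tensorial q Cov (\<lambda>s. 0)" by (rule tensorialI) simp_all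
  have sumC: "(\<lambda>p v. \<Sum>i<k. r i p f * a i p v) \<in> Cov"
    by (rule conjunct1[OF tensorial_sum[where s = a and h = "\<lambda>i p. r i p f",
          OF Cov_zero Cov_add Cov_smult t a TSec_smooth[OF r f]]]) simp_all
  \<comment> \<open>The differential of f minus its components along the earlier dual covectors; on
    W it is zero on \<open>r j\<close> for j < k.\<close>
  define b where "b = (\<lambda>p v. dM f p v - (\<Sum>i<k. r i p f * a i p v))"
  have b: "b \<in> Cov" unfolding b_def by (rule Cov_diff[OF dM_Cov[OF f] sumC])
  have br: "b p (r j p) = 0" if p: "p \<in> W" and j: "j < k" for p j
  proof -
    have "(\<Sum>i<k. r i p f * a i p (r j p)) = (\<Sum>i<k. if i = j then r i p f else 0)"
      by (rule sum.cong) (use d[OF p _ j] in auto)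
    also have "\<dots> = r j p f" using j by simp
    finally show ?thesis
      unfolding b_def using dM_eval[OF WS[OF p] TSec_tangent[OF r WS[OF p]], of j f] j by simp
  qed
  define h where "h = (\<lambda>p. b p (r k p))"
  have h: "h \<in> CS" unfolding h_def by (rule Cov_smooth[OF b r]) simp
  have "h q = (\<Sum>i<Suc k. c i * r i q f)"
    unfolding h_def b_def using dM_eval[OF q TSec_tangent[OF r q], of k f]
    by (simp add: c_def sum_negf mult.commute)
  then have hq: "h q \<noteq> 0" using f0 by simp
  obtain W1 where W1: "openin (mtop S) W1" "q \<in> W1" "\<And>p. p \<in> W1 \<Longrightarrow> h p \<noteq> 0"
    by (rule smooth_at_nonzero[OF manifold_S smooth_functions_smooth_at[OF manifold_S h q] hq]) (rule that)
  have sm: "smooth_at S (\<lambda>p. inverse (h p)) p" if p: "p \<in> W1" for p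
  proof -
    have "p \<in> pts S" using p W1(1) openin_subset by blast
    then show ?thesis
      using smooth_at_inverse[OF smooth_functions_smooth_at[OF manifold_S h] W1(3)[OF p]] by blast
  qed
  obtain g W2 where g: "g \<in> CS" "openin (mtop S) W2" "q \<in> W2" "W2 \<subseteq> W1"
      "\<And>p. p \<in> W2 \<Longrightarrow> g p = inverse (h p)"
    by (rule local_to_global[OF manifold_S W1(1,2) sm]) (assumption, rule that)
  define b' where "b' = (\<lambda>p v. g p * b p v)"
  have b': "b' \<in> Cov" unfolding b'_def by (rule Cov_smult[OF g(1) b])
  have b'r: "b' p (r j p) = (if j = k then 1 else 0)" if "p \<in> W" "p \<in> W2" "j < Suc k" for p j
    using br[OF that(1), of j] g(4,5) W1(3)[of p] that unfolding b'_def h_def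
    by (cases "j = k") auto
  \<comment> \<open>The earlier dual covectors are corrected by multiples of \<open>b'\<close> so
    that they vanish on \<open>r k\<close>.\<close>
  define a' where "a' = (\<lambda>i. if i < k then (\<lambda>p v. a i p v - a i p (r k p) * b' p v) else b')"
  have a': "a' i \<in> Cov" if "i < Suc k" for i
  proof (cases "i < k")
    case True
    have "(\<lambda>p v. a i p v - a i p (r k p) * b' p v) \<in> Cov"
      by (rule Cov_diff[OF a[OF True] Cov_smult[OF Cov_smooth[OF a[OF True] r] b']]) simp
    then show ?thesis using True unfolding a'_def by simp
  qed (simp add: a'_def b')
  have "a' i p (r j p) = (if i = j then 1 else 0)"
    if p: "p \<in> W \<inter> W2" and ij: "i < Suc k" "j < Suc k" for p i j
    using b'r[of p j] d[of p i j] p ij unfolding a'_def by (cases "i < k"; cases "j = k") auto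
  then show ?case
    using a' openin_Int[OF W(1) g(2)] W(2) g(3) by (intro exI[of _ a'] exI[of _ "W \<inter> W2"]) auto
qed

end

section \<open>Transversals\<close>

lemma sum_lessThan_plus:
  fixes k m :: nat and g :: "nat \<Rightarrow> real"
  shows "(\<Sum>i<k + m. g i) = (\<Sum>i<k. g i) + (\<Sum>j<m. g (k + j))"
  by (induction m) (simp_all add: add.assoc)

context embedded
begin

lemma transversal_decomp:
  assumes L: "transversal M S L" and q: "q \<in> pts S" and v: "v \<in> tangent M q"
  obtains w l where "w \<in> tangent S q" "l \<in> L q" "v = (\<lambda>f. push M S w f + l f)"
proof -
  have "v \<in> {t + l | t l. t \<in> TS M S q \<and> l \<in> L q}"
    using L q v unfolding transversal_def by blast
  then show ?thesis using that unfolding TS_def plus_fun_def by blast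
qed

lemma transversal_Int:
  assumes L: "transversal M S L" and q: "q \<in> pts S" and "t \<in> TS M S q" "t \<in> L q"
  shows "t = (\<lambda>f. 0)"
proof -
  have "TS M S q \<inter> L q = {0}" using L q unfolding transversal_def by blast
  then show ?thesis using assms(3,4) by (auto simp: zero_fun_def)
qed

lemma transversal_subset:
  assumes L: "transversal M S L" and q: "q \<in> pts S" and l: "l \<in> L q"
  shows "l \<in> tangent M q"
proof -
  have "tangent M q = {t + l | t l. t \<in> TS M S q \<and> l \<in> L q}"
    using L q unfolding transversal_def by blast
  moreover have "l = (\<lambda>f. 0) + l" by (simp add: plus_fun_def)
  ultimately show ?thesis using TS_zero[of q] l by blast
qed

text \<open>A transversal provides local frames of L only. Together with a frame of TS they form a
  frame along S, and the covectors \<open>b j\<close> dual to the TS part annihilate L. They express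
  \<tau> by smooth sections, which is how its smoothness is obtained.\<close>

lemma transversal_frame:
  assumes L: "transversal M S L" and q: "q \<in> pts S"
  obtains n :: nat and Z b W where "\<And>j. j < n \<Longrightarrow> Z j \<in> vector_fields S" "\<And>j. j < n \<Longrightarrow> b j \<in> Cov"
    "openin (mtop S) W" "q \<in> W" "\<And>p j l. p \<in> W \<Longrightarrow> j < n \<Longrightarrow> l \<in> L p \<Longrightarrow> b j p l = 0"
    "\<And>p w. p \<in> W \<Longrightarrow> w \<in> tangent S p \<Longrightarrow> w = (\<lambda>f. \<Sum>j<n. b j p (push M S w) * Z j p f)"
proof -
  interpret S: embedded S S by (rule embedded_self[OF manifold_S])
  have "\<exists>W (k::nat) s. openin (mtop S) W \<and> q \<in> W \<and>
        (\<forall>i<k. \<forall>p\<in>W. s i p \<in> tangent M p) \<and>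
        (\<forall>i<k. \<forall>f\<in>CM. smooth_fun_on S W (\<lambda>p. s i p f)) \<and>
        (\<forall>p\<in>W. L p = {v. \<exists>c. v = (\<lambda>f. \<Sum>i<k. c i * s i p f)}) \<and>
        (\<forall>p\<in>W. \<forall>c. (\<lambda>f. \<Sum>i<k. c i * s i p f) = 0 \<longrightarrow> (\<forall>i<k. c i = 0))"
    using L q unfolding transversal_def subbundle_def by blast
  then obtain W0 and k :: nat and s where W0: "openin (mtop S) W0" "q \<in> W0"
    and fr0: "\<forall>i<k. \<forall>p\<in>W0. s i p \<in> tangent M p"
      "\<forall>i<k. \<forall>f\<in>CM. smooth_fun_on S W0 (\<lambda>p. s i p f)"
      "\<forall>p\<in>W0. L p = {v. \<exists>c. v = (\<lambda>f. \<Sum>i<k. c i * s i p f)}"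
      "\<forall>p\<in>W0. \<forall>c. (\<lambda>f. \<Sum>i<k. c i * s i p f) = 0 \<longrightarrow> (\<forall>i<k. c i = 0)"
    by (elim exE conjE) (rule that)
  have s: "s i p \<in> tangent M p" if "i < k" "p \<in> W0" for i p
    using fr0(1) that by blast
  have s_smooth: "smooth_fun_on S W0 (\<lambda>p. s i p f)" if "i < k" "f \<in> CM" for i f
    using fr0(2) that by blast
  have Lp: "L p = {v. \<exists>c. v = (\<lambda>f. \<Sum>i<k. c i * s i p f)}" if "p \<in> W0" for p
    using fr0(3) that by blast
  have indep: "c i = 0" if "p \<in> W0" "(\<lambda>f. \<Sum>i<k. c i * s i p f) = (\<lambda>f. 0)" "i < k" for p c i
    using fr0(4)[rule_format, OF that(1), of c] that(2,3) unfolding zero_fun_def by blast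
  \<comment> \<open>The frame of L is given on W0 only; multiplied by u it becomes a family of
    sections over all of S, unchanged on W1.\<close>
  obtain u K W1 where u: "u \<in> CS" "openin (mtop S) W1" "q \<in> W1" "W1 \<subseteq> K" "K \<subseteq> W0"
    "closedin (mtop S) K" "\<And>p. p \<in> W1 \<Longrightarrow> u p = 1" "\<And>p. p \<notin> K \<Longrightarrow> u p = 0"
    by (rule manifold_bump[OF manifold_S W0]) (rule that)
  obtain n :: nat and y Z z where fr: "\<And>i. i < n \<Longrightarrow> y i \<in> CS"
    "\<And>i. i < n \<Longrightarrow> Z i \<in> vector_fields S" "z \<in> CS" "z q = 1"
    "\<And>p v f. p \<in> pts S \<Longrightarrow> v \<in> tangent S p \<Longrightarrow> f \<in> CS \<Longrightarrow> z p * v f = (\<Sum>i<n. v (y i) * Z i p f)"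
    "\<And>i j. i < n \<Longrightarrow> j < n \<Longrightarrow> Z i q (y j) = (if i = j then 1 else 0)"
    by (rule local_frame[OF manifold_S q]) (rule that)
  \<comment> \<open>Indices below k carry the cut-off frame of L, the remaining n the push-forwards
    of a frame of S.\<close>
  define r where "r = (\<lambda>i. if i < k then (\<lambda>p f. u p * s i p f) else (\<lambda>p. push M S (Z (i - k) p)))"
  have r_L: "r i = (\<lambda>p f. u p * s i p f)" if "i < k" for i using that unfolding r_def by simp
  have r_S: "r (k + j) = (\<lambda>p. push M S (Z j p))" for j unfolding r_def by simp
  have r: "r i \<in> TSec" if i: "i < k + n" for i
  proof (cases "i < k")
    case True
    have "(\<lambda>p f. u p * s i p f) \<in> TSec"
    proof (rule TSecI)
      fix p show "(\<lambda>f. u p * s i p f) \<in> tangent M p" if "p \<in> pts S"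
        using tangent_closed_scale[OF s[OF True]] u(5) u(8)[of p] tangent_closed_zero[of M p]
        by (cases "p \<in> K") auto
      show "(\<lambda>f. u p * s i p f) = (\<lambda>f. 0)" if "p \<notin> pts S"
        using smooth_functions_outside[OF u(1) that] by simp
    next
      fix f assume f: "f \<in> CM"
      show "(\<lambda>p. u p * s i p f) \<in> CS"
        by (rule cutoff_smooth[OF manifold_S u(1,6,8)
              smooth_fun_on_imp_smooth_at[OF manifold_S W0(1) _ s_smooth[OF True f]]]) (use u(5) in auto)
    qed
    then show ?thesis unfolding r_L[OF True] .
  next
    case False
    then obtain j where j: "i = k + j" "j < n" using i by (metis add_less_cancel_left le_Suc_ex not_less)
    show ?thesis unfolding j(1) r_S by (rule push_section[OF fr(2)[OF j(2)]])
  qed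
  have split: "(\<Sum>i<k + n. c i * r i p f) = (\<Sum>i<k. c i * (u p * s i p f)) + (\<Sum>j<n. c (k + j) * push M S (Z j p) f)"
    for c :: "nat \<Rightarrow> real" and p f
  proof -
    have "(\<Sum>i<k + n. c i * r i p f) = (\<Sum>i<k. c i * r i p f) + (\<Sum>j<n. c (k + j) * r (k + j) p f)"
      by (rule sum_lessThan_plus)
    then show ?thesis by (simp add: r_L r_S)
  qed
  have push_sum: "push M S (\<lambda>f. \<Sum>j<n. c j * Z j p f) = (\<lambda>f. \<Sum>j<n. c j * push M S (Z j p) f)"
    for c :: "nat \<Rightarrow> real" and p
    by (rule ext) (simp add: push_def)
  have Zt: "(\<lambda>f. \<Sum>j<n. c j * Z j p f) \<in> tangent S p" if p: "p \<in> pts S" for c :: "nat \<Rightarrow> real" and p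
    by (rule conjunct1[OF dual_space_sum[OF dual_closed_zero tangent_closed_zero tangent_closed_add
        tangent_closed_scale finite_lessThan]]) (simp_all add: S.TSec_tangent[OF fr(2) p])
  \<comment> \<open>A relation at q splits into a vector of L and one of TS, which vanish separately
    since the two spaces meet in 0. The first part is settled by independence of the frame of L, the
    second by evaluation on the coordinates \<open>y j\<close> of S.\<close>
  have indep_r: "c i = 0" if c: "(\<lambda>f. \<Sum>i<k + n. c i * r i q f) = (\<lambda>f. 0)" and i: "i < k + n"
    for c :: "nat \<Rightarrow> real" and i
  proof -
    let ?l = "\<lambda>f. \<Sum>i<k. c i * s i q f"
    let ?w = "\<lambda>f. \<Sum>j<n. c (k + j) * Z j q f"
    have uq: "u q = 1" by (rule u(7)[OF u(3)])
    have sum0: "?l f + push M S ?w f = 0" for f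
      using fun_cong[OF c, of f] unfolding split push_sum by (simp add: uq)
    have w: "?w \<in> tangent S q" by (rule Zt[OF q])
    have l: "?l \<in> L q" unfolding Lp[OF W0(2)] by blast
    have "?l = (\<lambda>f. (- 1) * push M S ?w f)"
      by (rule ext) (use sum0 in \<open>simp add: eq_neg_iff_add_eq_0\<close>)
    moreover have "(\<lambda>f. (- 1) * push M S ?w f) \<in> TS M S q"
      by (rule TS_scale) (use w in \<open>simp add: TS_def\<close>)
    ultimately have l0: "?l = (\<lambda>f. 0)" using transversal_Int[OF L q _ l] by simp
    have "push M S ?w = push M S (\<lambda>f. 0)"
      by (rule ext) (use sum0 fun_cong[OF l0] in \<open>simp add: push_def\<close>)
    then have w0: "?w = (\<lambda>f. 0)" by (rule push_inj[OF q w tangent_closed_zero])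
    show ?thesis
    proof (cases "i < k")
      case True
      show ?thesis by (rule indep[OF W0(2) l0 True])
    next
      case False
      then obtain j where j: "i = k + j" "j < n" using i by (metis add_less_cancel_left le_Suc_ex not_less)
      have "0 = ?w (y j)" using fun_cong[OF w0, of "y j"] by simp
      also have "\<dots> = (\<Sum>i<n. if i = j then c (k + i) else 0)"
        by (rule sum.cong) (use fr(6) j(2) in auto)
      also have "\<dots> = c (k + j)" using j(2) by simp
      finally show ?thesis using j(1) by simp
    qed
  qed
  have "\<exists>a W. (\<forall>i<k + n. a i \<in> Cov) \<and> openin (mtop S) W \<and> q \<in> W \<and>
      (\<forall>p\<in>W. \<forall>i<k + n. \<forall>j<k + n. a i p (r j p) = (if i = j then 1 else 0))"
  proof (rule dual_frame[OF q])
    show "r i \<in> TSec" if "i < k + n" for i by (rule r[OF that])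
    show "c i = 0" if "(\<lambda>f. \<Sum>i<k + n. c i * r i q f) = (\<lambda>f. 0)" "i < k + n" for c :: "nat \<Rightarrow> real" and i
      by (rule indep_r[OF that])
  qed
  then obtain a W2 where a: "\<And>i. i < k + n \<Longrightarrow> a i \<in> Cov" and W2: "openin (mtop S) W2" "q \<in> W2"
    and d: "\<And>p i j. p \<in> W2 \<Longrightarrow> i < k + n \<Longrightarrow> j < k + n \<Longrightarrow> a i p (r j p) = (if i = j then 1 else 0)"
    by blast
  have zq: "z q \<noteq> 0" using fr(4) by simp
  obtain W3 where W3: "openin (mtop S) W3" "q \<in> W3" "\<And>p. p \<in> W3 \<Longrightarrow> z p \<noteq> 0"
    by (rule smooth_at_nonzero[OF manifold_S smooth_functions_smooth_at[OF manifold_S fr(3) q] zq]) (rule that)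
  define W where "W = W1 \<inter> (W2 \<inter> W3)"
  have W: "p \<in> W1" "p \<in> W2" "p \<in> W3" "p \<in> pts S" "p \<in> W0" if "p \<in> W" for p
    using that openin_subset[OF W0(1)] u(4,5) unfolding W_def by auto
  have ev: "a (k + j) p (\<lambda>f. \<Sum>i<k + n. c i * r i p f) = c (k + j)"
    if p: "p \<in> W" and j: "j < n" for c :: "nat \<Rightarrow> real" and p j
  proof -
    have "a (k + j) p (\<lambda>f. \<Sum>i<k + n. c i * r i p f) = (\<Sum>i<k + n. c i * a (k + j) p (r i p))"
      by (rule cotangent_sum[OF Cov_cotangent[OF a W(4)[OF p]]]) (use j TSec_tangent[OF r W(4)[OF p]] in auto)
    also have "\<dots> = (\<Sum>i<k + n. if i = k + j then c i else 0)"
      by (rule sum.cong) (use d[OF W(2)[OF p], of "k + j"] j in auto)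
    also have "\<dots> = c (k + j)" using j by simp
    finally show ?thesis .
  qed
  show ?thesis
  proof (rule that[of n Z "\<lambda>j. a (k + j)" W])
    show "openin (mtop S) W" "q \<in> W"
      unfolding W_def using u(2,3) W2 W3 by (auto intro: openin_Int)
  next
    fix p j l assume p: "p \<in> W" and j: "j < n" and l: "l \<in> L p"
    obtain c where c: "l = (\<lambda>f. \<Sum>i<k. c i * s i p f)" using l unfolding Lp[OF W(5)[OF p]] by blast
    have up: "u p = 1" by (rule u(7)[OF W(1)[OF p]])
    have "l = (\<lambda>f. \<Sum>i<k + n. (if i < k then c i else 0) * r i p f)"
      unfolding c split up by simp
    then show "a (k + j) p l = 0" using ev[OF p j, of "\<lambda>i. if i < k then c i else 0"] by simp
  next
    fix p w assume p: "p \<in> W" and w: "w \<in> tangent S p"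
    note pS = W(4)[OF p]
    \<comment> \<open>On W3 the cut-off z of the frame of S does not vanish; dividing by it turns
      the frame identity into an expansion of w.\<close>
    define c where "c = (\<lambda>j. inverse (z p) * w (y j))"
    have wc: "w = (\<lambda>f. \<Sum>j<n. c j * Z j p f)"
    proof
      fix f show "w f = (\<Sum>j<n. c j * Z j p f)"
      proof (cases "f \<in> CS")
        case True
        have "(\<Sum>j<n. c j * Z j p f) = inverse (z p) * (\<Sum>j<n. w (y j) * Z j p f)"
          unfolding c_def by (simp add: sum_distrib_left mult.assoc)
        also have "\<dots> = inverse (z p) * (z p * w f)" by (simp only: fr(5)[OF pS w True])
        also have "\<dots> = w f" using W3(3)[OF W(3)[OF p]] by simp
        finally show ?thesis by simp
      next
        case False
        have "(\<Sum>j<n. c j * Z j p f) = 0"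
          by (rule sum.neutral) (use tangent_outside[OF S.TSec_tangent[OF fr(2) pS] False] in auto)
        then show ?thesis using tangent_outside[OF w False] by simp
      qed
    qed
    have "push M S w = push M S (\<lambda>f. \<Sum>j<n. c j * Z j p f)"
      by (rule arg_cong[OF wc])
    also have "\<dots> = (\<lambda>f. \<Sum>i<k + n. (if i < k then 0 else c (i - k)) * r i p f)"
      unfolding push_sum split by simp
    finally have pw: "push M S w = (\<lambda>f. \<Sum>i<k + n. (if i < k then 0 else c (i - k)) * r i p f)" .
    have "a (k + j) p (push M S w) = c j" if "j < n" for j
      unfolding pw ev[OF p that] by simp
    then have "(\<lambda>f. \<Sum>j<n. a (k + j) p (push M S w) * Z j p f) = (\<lambda>f. \<Sum>j<n. c j * Z j p f)"
      by simp
    then show "w = (\<lambda>f. \<Sum>j<n. a (k + j) p (push M S w) * Z j p f)"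
      by (rule trans[OF wc sym])
  qed (use fr(2) a in auto)
qed

section \<open>The splitting of covectors defined by a transversal\<close>

lemma transversal_covector_unique:
  assumes L: "transversal M S L" and q: "q \<in> pts S"
    and \<xi>: "\<xi> \<in> annihilator M q (L q)" and \<zeta>: "\<zeta> \<in> annihilator M q (L q)"
    and eq: "pull M S q \<xi> = pull M S q \<zeta>"
  shows "\<xi> = \<zeta>"
proof
  have \<xi>c: "\<xi> \<in> dual_space (tangent M q)" and \<zeta>c: "\<zeta> \<in> dual_space (tangent M q)"
    using \<xi> \<zeta> unfolding annihilator_def cotangent_def by auto
  fix v show "\<xi> v = \<zeta> v"
  proof (cases "v \<in> tangent M q")
    case True
    obtain w l where w: "w \<in> tangent S q" "l \<in> L q" "v = (\<lambda>f. push M S w f + l f)"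
      by (rule transversal_decomp[OF L q True])
    have "\<xi> (push M S w) = \<zeta> (push M S w)" using fun_cong[OF eq, of w] w(1) by (simp add: pull_eval)
    moreover have "\<xi> l = 0" "\<zeta> l = 0" using \<xi> \<zeta> w(2) unfolding annihilator_def by auto
    moreover note l = transversal_subset[OF L q w(2)] and p = push_tangent[OF q w(1)]
    ultimately show ?thesis
      unfolding w(3) dual_space_add[OF \<xi>c p l] dual_space_add[OF \<zeta>c p l] by simp
  qed (simp add: dual_space_outside[OF \<xi>c] dual_space_outside[OF \<zeta>c])
qed

lemma tau_eqI:
  assumes "transversal M S L" "q \<in> pts S" "\<xi> \<in> annihilator M q (L q)" "pull M S q \<xi> = \<alpha> q"
  shows "tau M S L \<alpha> q = \<xi>"
  unfolding tau_def if_P[OF assms(2)]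
proof (rule the_equality)
  show "\<xi> \<in> annihilator M q (L q) \<and> pull M S q \<xi> = \<alpha> q" by (intro conjI assms(3,4))
  fix \<zeta> assume \<zeta>: "\<zeta> \<in> annihilator M q (L q) \<and> pull M S q \<zeta> = \<alpha> q"
  show "\<zeta> = \<xi>"
    by (rule transversal_covector_unique[OF assms(1,2) conjunct1[OF \<zeta>] assms(3)
          trans[OF conjunct2[OF \<zeta>] assms(4)[symmetric]]])
qed

text \<open>The covectors \<open>b j\<close> annihilate L and by assumption expand vectors of TS in
  the frame \<open>Z j\<close>. A covector that annihilates L is determined by its restriction to
  TS, so \<tau>(\<alpha>) has the coefficients \<alpha>(Z j).\<close>

lemma tau_local:
  assumes L: "transversal M S L" and p: "p \<in> pts S" and \<alpha>: "\<alpha> p \<in> cotangent S p"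
    and Z: "\<And>j. j < n \<Longrightarrow> Z j \<in> vector_fields S" and b: "\<And>j. j < n \<Longrightarrow> b j \<in> Cov"
    and bL: "\<And>j l. j < n \<Longrightarrow> l \<in> L p \<Longrightarrow> b j p l = 0"
    and bS: "\<And>w. w \<in> tangent S p \<Longrightarrow> w = (\<lambda>f. \<Sum>j<n. b j p (push M S w) * Z j p f)"
  shows "tau M S L \<alpha> p = (\<lambda>v. \<Sum>j<(n::nat). \<alpha> p (Z j p) * b j p v)"
    and "(\<lambda>v. \<Sum>j<n. \<alpha> p (Z j p) * b j p v) \<in> annihilator M p (L p)"
    and "pull M S p (\<lambda>v. \<Sum>j<n. \<alpha> p (Z j p) * b j p v) = \<alpha> p"
proof -
  interpret S: embedded S S by (rule embedded_self[OF manifold_S])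
  let ?\<xi> = "\<lambda>v. \<Sum>j<n. \<alpha> p (Z j p) * b j p v"
  have "?\<xi> \<in> cotangent M p"
    unfolding cotangent_def by (rule dual_closed_sum) (simp_all add: Cov_dual[OF b p])
  then show ann: "?\<xi> \<in> annihilator M p (L p)"
    unfolding annihilator_def using bL by simp
  show pull: "pull M S p ?\<xi> = \<alpha> p"
  proof
    fix w show "pull M S p ?\<xi> w = \<alpha> p w"
    proof (cases "w \<in> tangent S p")
      case True
      have "\<alpha> p w = \<alpha> p (\<lambda>f. \<Sum>j<n. b j p (push M S w) * Z j p f)"
        by (rule arg_cong[OF bS[OF True]])
      also have "\<dots> = (\<Sum>j<n. b j p (push M S w) * \<alpha> p (Z j p))"
        by (rule cotangent_sum[OF \<alpha>]) (simp_all add: S.TSec_tangent[OF Z p])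
      finally show ?thesis unfolding pull_eval[OF True] by (simp add: mult.commute)
    next
      case False
      then show ?thesis using dual_space_outside[OF \<alpha>[unfolded cotangent_def] False] by (simp add: pull_def)
    qed
  qed
  show "tau M S L \<alpha> p = ?\<xi>" by (rule tau_eqI[where \<alpha> = \<alpha>, OF L p ann pull])
qed

lemma tau_spec:
  assumes L: "transversal M S L" and q: "q \<in> pts S" and \<alpha>: "\<alpha> q \<in> cotangent S q"
  shows "tau M S L \<alpha> q \<in> annihilator M q (L q)" "pull M S q (tau M S L \<alpha> q) = \<alpha> q"
proof -
  obtain n :: nat and Z b W where fr: "\<And>j. j < n \<Longrightarrow> Z j \<in> vector_fields S" "\<And>j. j < n \<Longrightarrow> b j \<in> Cov"
    "openin (mtop S) W" "q \<in> W" "\<And>p j l. p \<in> W \<Longrightarrow> j < n \<Longrightarrow> l \<in> L p \<Longrightarrow> b j p l = 0"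
    "\<And>p w. p \<in> W \<Longrightarrow> w \<in> tangent S p \<Longrightarrow> w = (\<lambda>f. \<Sum>j<n. b j p (push M S w) * Z j p f)"
    by (rule transversal_frame[OF L q]) (rule that)
  note t = tau_local[where \<alpha> = \<alpha> and Z = Z and b = b and n = n, OF L q \<alpha> fr(1,2) fr(5)[OF fr(4)] fr(6)[OF fr(4)]]
  have 1: "tau M S L \<alpha> q = (\<lambda>v. \<Sum>j<n. \<alpha> q (Z j q) * b j q v)" by (rule t(1))
  show "tau M S L \<alpha> q \<in> annihilator M q (L q)" unfolding 1 by (rule t(2))
  show "pull M S q (tau M S L \<alpha> q) = \<alpha> q" unfolding 1 by (rule t(3))
qed

text \<open>Near each point \<tau>(df) is the sum of the sections b j with the smooth coefficients Z
  j f.\<close>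

lemma tau_Cov:
  assumes L: "transversal M S L" and f: "f \<in> CS"
  shows "tau M S L (differential S f) \<in> Cov"
proof (rule CovI)
  interpret S: embedded S S by (rule embedded_self[OF manifold_S])
  let ?t = "tau M S L (differential S f)"
  show "?t q \<in> cotangent M q" if "q \<in> pts S" for q
    using tau_spec(1)[where \<alpha> = "differential S f", OF L that differential_cotangent] unfolding annihilator_def by blast
  show out: "?t q = (\<lambda>v. 0)" if "q \<notin> pts S" for q
    using that by (simp add: tau_def zero_fun_def)
  fix \<sigma> assume \<sigma>: "\<sigma> \<in> TSec"
  have "smooth_at S (\<lambda>p. ?t p (\<sigma> p)) q" if q: "q \<in> pts S" for q
  proof -
    obtain n :: nat and Z b W where fr: "\<And>j. j < n \<Longrightarrow> Z j \<in> vector_fields S" "\<And>j. j < n \<Longrightarrow> b j \<in> Cov"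
      "openin (mtop S) W" "q \<in> W" "\<And>p j l. p \<in> W \<Longrightarrow> j < n \<Longrightarrow> l \<in> L p \<Longrightarrow> b j p l = 0"
      "\<And>p w. p \<in> W \<Longrightarrow> w \<in> tangent S p \<Longrightarrow> w = (\<lambda>f. \<Sum>j<n. b j p (push M S w) * Z j p f)"
      by (rule transversal_frame[OF L q]) (rule that)
    have "(\<lambda>p. \<Sum>j<n. Z j p f * b j p (\<sigma> p)) \<in> CS"
    proof (rule CS_sum)
      fix j assume "j \<in> {..<n}"
      then have j: "Z j \<in> vector_fields S" "b j \<in> Cov" using fr(1,2) by auto
      show "(\<lambda>p. Z j p f * b j p (\<sigma> p)) \<in> CS"
        by (rule CS_mult[OF S.TSec_smooth[OF j(1) f] Cov_smooth[OF j(2) \<sigma>]])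
    qed
    from smooth_functions_smooth_at[OF manifold_S this q] show ?thesis
    proof (rule smooth_at_cong[OF manifold_S fr(3,4), rotated])
      fix p assume p: "p \<in> W"
      then have pS: "p \<in> pts S" using fr(3) openin_subset by blast
      have "?t p = (\<lambda>v. \<Sum>j<n. differential S f p (Z j p) * b j p v)"
        by (rule tau_local(1)[where \<alpha> = "differential S f", OF L pS differential_cotangent fr(1,2) fr(5)[OF p] fr(6)[OF p]])
      moreover have "differential S f p (Z j p) = Z j p f" if "j < n" for j
        by (rule differential_eval[OF pS S.TSec_tangent[OF fr(1)[OF that] pS]])
      ultimately show "(\<Sum>j<n. Z j p f * b j p (\<sigma> p)) = ?t p (\<sigma> p)" by simp
    qed
  qed
  then show "(\<lambda>p. ?t p (\<sigma> p)) \<in> CS"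
    unfolding smooth_functions_iff[OF manifold_S] using out by auto
qed

text \<open>If a restricts to df, then \<tau>(df) is its component in the annihilator of L, so a -
  \<tau>(df) is its component in the annihilator of TS.\<close>

lemma rho_proj_eq:
  assumes L: "transversal M S L" and a: "a \<in> Cov" and f: "f \<in> CS"
    and pa: "\<And>q. q \<in> pts S \<Longrightarrow> pull M S q (a q) = differential S f q"
  shows "rho_proj M S L a = (\<lambda>q v. a q v - tau M S L (differential S f) q v)"
    and "(\<lambda>q v. a q v - tau M S L (differential S f) q v) \<in> Ann"
proof -
  let ?t = "tau M S L (differential S f)"
  have t: "?t q \<in> annihilator M q (L q)" "pull M S q (?t q) = differential S f q" if "q \<in> pts S" for q
    using tau_spec[where \<alpha> = "differential S f", OF L that differential_cotangent] by auto
  have d: "(\<lambda>q v. a q v - ?t q v) \<in> Cov" by (rule Cov_diff[OF a tau_Cov[OF L f]])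
  have p0: "pull M S q (\<lambda>v. a q v - ?t q v) = (\<lambda>w. 0)" if q: "q \<in> pts S" for q
  proof
    show "pull M S q (\<lambda>v. a q v - ?t q v) w = 0" for w
      using fun_cong[OF pa[OF q], of w] fun_cong[OF t(2)[OF q], of w] by (simp add: pull_def split: if_splits)
  qed
  show "(\<lambda>q v. a q v - ?t q v) \<in> Ann" unfolding Ann_def using d p0 by simp
  show "rho_proj M S L a = (\<lambda>q v. a q v - ?t q v)"
  proof
    fix q show "rho_proj M S L a q = (\<lambda>v. a q v - ?t q v)"
    proof (cases "q \<in> pts S")
      case q: True
      have z: "pull M S q \<zeta> = (\<lambda>w. 0)" if "\<zeta> \<in> annihilator M q (TS M S q)" for \<zeta>
        by (rule ext) (use that in \<open>auto simp: pull_def annihilator_def TS_def\<close>)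
      have aq: "a q - (\<lambda>v. a q v - ?t q v) = ?t q" by (rule ext) simp
      show ?thesis
        unfolding rho_proj_def if_P[OF q]
      proof (rule the_equality)
        have "(\<lambda>v. a q v - ?t q v) \<in> annihilator M q (TS M S q)"
          unfolding annihilator_def
        proof (intro CollectI conjI ballI)
          show "(\<lambda>v. a q v - ?t q v) \<in> cotangent M q" by (rule Cov_cotangent[OF d q])
          fix v assume "v \<in> TS M S q"
          then obtain w where w: "w \<in> tangent S q" "v = push M S w" unfolding TS_def by blast
          then show "a q v - ?t q v = 0" using fun_cong[OF p0[OF q], of w] by (simp add: pull_eval)
        qed
        then show "(\<lambda>v. a q v - ?t q v) \<in> annihilator M q (TS M S q) \<and>
            a q - (\<lambda>v. a q v - ?t q v) \<in> annihilator M q (L q)"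
          unfolding aq using t(1)[OF q] by simp
        fix \<zeta> assume \<zeta>: "\<zeta> \<in> annihilator M q (TS M S q) \<and> a q - \<zeta> \<in> annihilator M q (L q)"
        have "pull M S q (a q - \<zeta>) = pull M S q (?t q)"
        proof
          fix w
          have "pull M S q (a q - \<zeta>) w = pull M S q (a q) w - pull M S q \<zeta> w" by (simp add: pull_def)
          then show "pull M S q (a q - \<zeta>) w = pull M S q (?t q) w"
            using z[OF conjunct1[OF \<zeta>]] pa[OF q] t(2)[OF q] by simp
        qed
        then have e: "a q - \<zeta> = ?t q"
          by (rule transversal_covector_unique[OF L q conjunct2[OF \<zeta>] t(1)[OF q]])
        show "\<zeta> = (\<lambda>v. a q v - ?t q v)"
          by (rule ext) (use fun_cong[OF e] in \<open>simp add: algebra_simps\<close>)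
      qed
    qed (simp add: rho_proj_def Cov_outside[OF d] zero_fun_def)
  qed
qed

end

section \<open>The canonical algebra and its splittings\<close>

lemma differential_zero: "differential M (\<lambda>p. 0) q = (\<lambda>v. 0)"
  by (rule ext) (auto simp: differential_def intro: tangent_zero)

lemma annihilator_add:
  "\<xi> \<in> annihilator M q V \<Longrightarrow> \<zeta> \<in> annihilator M q V \<Longrightarrow> (\<lambda>v. \<xi> v + \<zeta> v) \<in> annihilator M q V"
  unfolding annihilator_def cotangent_def by (simp add: dual_closed_add)

lemma annihilator_scale: "\<xi> \<in> annihilator M q V \<Longrightarrow> (\<lambda>v. c * \<xi> v) \<in> annihilator M q V"
  unfolding annihilator_def cotangent_def by (simp add: dual_closed_scale)

context embedded
begin

lemma tau_eq:
  assumes L: "transversal M S L" and f: "f \<in> CS" and t: "t \<in> Cov"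
    and "\<And>q. q \<in> pts S \<Longrightarrow> t q \<in> annihilator M q (L q)"
    and "\<And>q. q \<in> pts S \<Longrightarrow> pull M S q (t q) = differential S f q"
  shows "tau M S L (differential S f) = t"
proof
  fix q show "tau M S L (differential S f) q = t q"
  proof (cases "q \<in> pts S")
    case True
    show ?thesis by (rule tau_eqI[where \<alpha> = "differential S f", OF L True assms(4)[OF True] assms(5)[OF True]])
  qed (simp add: Cov_outside[OF t] Cov_outside[OF tau_Cov[OF L f]])
qed

lemma tau_add:
  assumes L: "transversal M S L" and f: "f \<in> CS" and g: "g \<in> CS"
  shows "tau M S L (differential S (\<lambda>p. f p + g p)) =
    (\<lambda>q v. tau M S L (differential S f) q v + tau M S L (differential S g) q v)"
  using tau_spec[where \<alpha> = "differential S f", OF L _ differential_cotangent]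
    tau_spec[where \<alpha> = "differential S g", OF L _ differential_cotangent]
  by (intro tau_eq[OF L CS_add[OF f g] Cov_add[OF tau_Cov[OF L f] tau_Cov[OF L g]]])
    (simp_all add: annihilator_add pull_add differential_add[OF f g])

lemma tau_scale:
  assumes L: "transversal M S L" and f: "f \<in> CS"
  shows "tau M S L (differential S (\<lambda>p. c * f p)) = (\<lambda>q v. c * tau M S L (differential S f) q v)"
  using tau_spec[where \<alpha> = "differential S f", OF L _ differential_cotangent]
  by (intro tau_eq[OF L CS_scale[OF f] Cov_scale[OF tau_Cov[OF L f]]])
    (simp_all add: annihilator_scale pull_scale differential_scale[OF f])

lemma tau_mult:
  assumes L: "transversal M S L" and f: "f \<in> CS" and g: "g \<in> CS"
  shows "tau M S L (differential S (\<lambda>p. f p * g p)) =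
    (\<lambda>q v. f q * tau M S L (differential S g) q v + g q * tau M S L (differential S f) q v)"
  using tau_spec[where \<alpha> = "differential S f", OF L _ differential_cotangent]
    tau_spec[where \<alpha> = "differential S g", OF L _ differential_cotangent]
  by (intro tau_eq[OF L CS_mult[OF f g] Cov_add[OF Cov_smult[OF f tau_Cov[OF L g]] Cov_smult[OF g tau_Cov[OF L f]]]])
    (simp_all add: annihilator_add annihilator_scale pull_add pull_scale differential_mult[OF f g])

lemma tau_zero:
  assumes L: "transversal M S L"
  shows "tau M S L (differential S (\<lambda>p. 0)) = (\<lambda>q v. 0)"
  using tau_scale[OF L CS_zero, of 0] by simp

end

context poisson_sub
begin

lemma hamiltonian_vector_field:
  assumes "f \<in> CS"
  shows "(\<lambda>p g. brS f g p) \<in> vector_fields S"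
proof -
  interpret S: embedded S S by (rule embedded_self[OF manifold_S])
  show ?thesis
  proof (rule S.TSecI)
    show "(\<lambda>g. brS f g p) = (\<lambda>g. 0)" if "p \<notin> pts S" for p by (rule ext) (simp add: brS_outside[OF that])
    show "(\<lambda>p. brS f g p) \<in> CS" if "g \<in> CS" for g by (rule brS_CS[OF assms that])
  qed (rule brS_tangent)
qed

text \<open>Along a vector field \<open>Z\<close> on \<open>S\<close>, the biderivation \<open>tri\<close> applied to \<open>f\<close> is \<open>[Z, X\<^sub>f] - X\<^sub>g\<close> with
  \<open>g = Z f\<close>, where \<open>X\<^sub>f = {f, _}\<^sub>S\<close>, so the covectors enter only through their restrictions to \<open>TS\<close>.\<close>

lemma pull_ASb:
  assumes f: "f \<in> CS" and g: "g \<in> CS" and a: "a \<in> Cov" and b: "b \<in> Cov"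
    and pa: "\<And>q. q \<in> pts S \<Longrightarrow> pull M S q (a q) = differential S f q"
    and pb: "\<And>q. q \<in> pts S \<Longrightarrow> pull M S q (b q) = differential S g q"
    and q: "q \<in> pts S"
  shows "pull M S q (ASb a b q) = differential S (brS f g) q"
proof
  interpret S: embedded S S by (rule embedded_self[OF manifold_S])
  fix w show "pull M S q (ASb a b q) w = differential S (brS f g) q w"
  proof (cases "w \<in> tangent S q")
    case False
    then show ?thesis by (simp add: pull_def differential_def)
  next
    case w: True
    obtain Z where Z: "Z \<in> vector_fields S" "Z q = w" by (rule S.TSec_extend[OF q w])
    note Zs = S.TSec_smooth[OF Z(1)] and Zt = S.TSec_tangent[OF Z(1)]
    define \<sigma> where "\<sigma> = (\<lambda>p. push M S (Z p))"
    have \<sigma>: "\<sigma> \<in> TSec" unfolding \<sigma>_def by (rule push_section[OF Z(1)])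
    have app: "(\<lambda>p. c p (\<sigma> p)) = (\<lambda>p. Z p h)"
      if c: "c \<in> Cov" and pc: "\<And>q. q \<in> pts S \<Longrightarrow> pull M S q (c q) = differential S h q" for c h
    proof
      fix p show "c p (\<sigma> p) = Z p h"
      proof (cases "p \<in> pts S")
        case p: True
        have "c p (\<sigma> p) = pull M S p (c p) (Z p)" unfolding \<sigma>_def by (rule pull_eval[OF Zt[OF p], symmetric])
        then show ?thesis unfolding pc[OF p] differential_eval[OF p Zt[OF p]] .
      qed (simp add: Cov_outside[OF c] S.TSec_outside[OF Z(1)])
    qed
    \<comment> \<open>\<open>U h\<close> is the derivation of S described above the lemma, with
      \<open>h\<close> in place of \<open>f\<close>; on restrictions of functions on M it computes
      \<open>tri\<close> along the push-forward of Z.\<close>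
    define U where "U = (\<lambda>h k. if k \<in> CS then Z q (brS h k) - brS h (\<lambda>p. Z p k) q - brS (\<lambda>p. Z p h) k q else 0)"
    have Ut: "U h \<in> tangent S q" if h: "h \<in> CS" for h
    proof -
      have "U h = (\<lambda>k. vf_bracket S Z (\<lambda>p k. brS h k p) q k + (- 1) * brS (\<lambda>p. Z p h) k q)"
        by (rule ext) (simp add: U_def vf_bracket_def tangent_outside[OF brS_tangent[OF q]])
      then show ?thesis
        using tangent_closed_add[OF vf_bracket_tangent[OF manifold_S Z(1) hamiltonian_vector_field[OF h] q]
            tangent_closed_scale[OF brS_tangent[OF q], of "- 1" "\<lambda>p. Z p h"]] by (simp only:)
    qed
    have Usk: "U h k = - U k h" if hk: "h \<in> CS" "k \<in> CS" for h k
    proof -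
      have "brS h k = (\<lambda>p. (- 1) * brS k h p)" by (rule ext) (simp add: brS_skew[of h])
      then have "Z q (brS h k) = - Z q (brS k h)"
        using tangent_scale[OF Zt[OF q] brS_CS[OF hk(2,1)], of "- 1"] by simp
      then show ?thesis
        using hk brS_skew[of h "\<lambda>p. Z p k" q] brS_skew[of k "\<lambda>p. Z p h" q] by (simp add: U_def)
    qed
    have tri: "tri \<sigma> q F G = U (res F) (res G)" if F: "F \<in> CM" and G: "G \<in> CM" for F G
      using F G unfolding tri_def \<sigma>_def
      by (simp add: push_eval brM_CM brS_restrict_fun[symmetric] U_def restrict_smooth)
    have in1: "a q (\<lambda>F. tri \<sigma> q F G) = U f (res G)" if G: "G \<in> CM" for G
    proof -
      note rG = restrict_smooth[OF G]
      \<comment> \<open>The covector a acts in the first slot, while U is a derivation in the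
        second; skewness exchanges them.\<close>
      have e: "(\<lambda>F. tri \<sigma> q F G) = (\<lambda>F. (- 1) * push M S (U (res G)) F)"
      proof
        fix F show "tri \<sigma> q F G = (- 1) * push M S (U (res G)) F"
        proof (cases "F \<in> CM")
          case F: True
          show ?thesis
            unfolding tri[OF F G] push_eval[OF F] using Usk[OF restrict_smooth[OF F] rG] by simp
        qed (simp add: tri_def push_def)
      qed
      have "a q (\<lambda>F. tri \<sigma> q F G) = (- 1) * a q (push M S (U (res G)))"
        unfolding e by (rule dual_space_scale[OF Cov_dual[OF a q] push_tangent[OF q Ut[OF rG]]])
      also have "a q (push M S (U (res G))) = pull M S q (a q) (U (res G))"
        by (rule pull_eval[OF Ut[OF rG], symmetric])
      also have "\<dots> = U (res G) f"
        unfolding pa[OF q] by (rule differential_eval[OF q Ut[OF rG]])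
      finally show ?thesis using Usk[OF f rG] by simp
    qed
    have e2: "(\<lambda>G. a q (\<lambda>F. tri \<sigma> q F G)) = push M S (U f)"
    proof
      fix G show "a q (\<lambda>F. tri \<sigma> q F G) = push M S (U f) G"
      proof (cases "G \<in> CM")
        case True
        show ?thesis unfolding in1[OF True] push_eval[OF True] by (rule refl)
      next
        case False
        then show ?thesis
          using tangent_outside[OF tri_half_tangent[OF \<sigma> q Cov_cotangent[OF a q]] False] by (simp add: push_def)
      qed
    qed
    have "triC \<sigma> q (a q) (b q) = b q (push M S (U f))" unfolding triC_def e2 by (rule refl)
    also have "\<dots> = pull M S q (b q) (U f)" by (rule pull_eval[OF Ut[OF f], symmetric])
    also have "\<dots> = U f g" unfolding pb[OF q] by (rule differential_eval[OF q Ut[OF f]])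
    finally have t: "triC \<sigma> q (a q) (b q) = U f g" .
    have appa: "(\<lambda>p. a p (\<sigma> p)) = (\<lambda>p. Z p f)" by (rule app[OF a pa])
    have appb: "(\<lambda>p. b p (\<sigma> p)) = (\<lambda>p. Z p g)" by (rule app[OF b pb])
    have "ASb a b q (push M S w) = Phi a b \<sigma> q"
      using ASb_eval[OF a b q \<sigma>] Z(2) by (simp add: \<sigma>_def)
    also have "\<dots> = Z q (brS f g)"
      unfolding Phi_def if_P[OF q] t appa appb rho_pull[OF a q pa[OF q]] rho_pull[OF b q pb[OF q]]
      using g brS_skew[of g "\<lambda>p. Z p f" q] by (simp add: U_def)
    finally show ?thesis unfolding pull_eval[OF w] differential_eval[OF q w] Z(2) .
  qed
qed

text \<open>Locally a pair (f, a) is the 1-jet along S of a function F on M: f is the restriction of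
  F, and a that of dF. The product is that of 1-jets, and the second component of the bracket
  extends [dF, dG] = d{F, G}.\<close>

definition jet :: "(('a \<Rightarrow> real) \<times> ('a \<Rightarrow> 'a covec)) palg" where
  "jet = \<lparr> pcarrier = {(f, a). f \<in> CS \<and> a \<in> Cov \<and> (\<forall>q\<in>pts S. pull M S q (a q) = differential S f q)},
     pscale = (\<lambda>r (f, a). (\<lambda>q. r * f q, \<lambda>q v. r * a q v)),
     pmult = (\<lambda>(f, a) (g, b). (f * g, \<lambda>q v. f q * b q v + g q * a q v)),
     pbracket = (\<lambda>(f, a) (g, b). (brS f g, ASb a b)) \<rparr>"

lemma jet_memI:
  "f \<in> CS \<Longrightarrow> a \<in> Cov \<Longrightarrow> (\<And>q. q \<in> pts S \<Longrightarrow> pull M S q (a q) = differential S f q) \<Longrightarrow> (f, a) \<in> pcarrier jet"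
  by (simp add: jet_def)

lemma jet_memE:
  assumes "x \<in> pcarrier jet"
  obtains f a where "x = (f, a)" "f \<in> CS" "a \<in> Cov" "\<And>q. q \<in> pts S \<Longrightarrow> pull M S q (a q) = differential S f q"
proof -
  have "x \<in> {(f, a). f \<in> CS \<and> a \<in> Cov \<and> (\<forall>q\<in>pts S. pull M S q (a q) = differential S f q)}"
    using assms by (simp add: jet_def)
  then show ?thesis using that by (cases x) auto
qed

lemma jet_ops:
  "pscale jet r (f, a) = (\<lambda>q. r * f q, \<lambda>q v. r * a q v)"
  "pmult jet (f, a) (g, b) = (\<lambda>q. f q * g q, \<lambda>q v. f q * b q v + g q * a q v)"
  "pbracket jet (f, a) (g, b) = (brS f g, ASb a b)"
  "(f, a) + (g, b) = (\<lambda>q. f q + g q, \<lambda>q v. a q v + b q v)"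
  for f g :: "'a \<Rightarrow> real" and a b :: "'a \<Rightarrow> 'a covec"
  by (simp_all add: jet_def times_fun_def plus_fun_def)

text \<open>Closure under the bracket is \<open>pull_ASb\<close>. For the Leibniz rule, the
  condition on (f, a) turns the anchor of a into {f, _}, so both components of the bracket
  differentiate coefficients in the same way.\<close>

lemma jet_poisson_algebra: "poisson_algebra jet"
  unfolding poisson_algebra_def Let_def
proof (intro conjI ballI allI)
  show "0 \<in> pcarrier jet"
    unfolding zero_prod_def zero_fun_def
    by (rule jet_memI[OF CS_zero Cov_zero]) (simp add: differential_zero pull_def)
next
  fix x y z r r' assume xJ: "x \<in> pcarrier jet" and yJ: "y \<in> pcarrier jet" and zJ: "z \<in> pcarrier jet"
  obtain f a where x: "x = (f, a)" and f: "f \<in> CS" and a: "a \<in> Cov"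
    and pa: "\<And>q. q \<in> pts S \<Longrightarrow> pull M S q (a q) = differential S f q" by (rule jet_memE[OF xJ]) (rule that)
  obtain g b where y: "y = (g, b)" and g: "g \<in> CS" and b: "b \<in> Cov"
    and pb: "\<And>q. q \<in> pts S \<Longrightarrow> pull M S q (b q) = differential S g q" by (rule jet_memE[OF yJ]) (rule that)
  obtain h c where z: "z = (h, c)" and h: "h \<in> CS" and c: "c \<in> Cov"
    and pc: "\<And>q. q \<in> pts S \<Longrightarrow> pull M S q (c q) = differential S h q" by (rule jet_memE[OF zJ]) (rule that)
  show "x + y \<in> pcarrier jet"
    unfolding x y jet_ops
    by (rule jet_memI[OF CS_add[OF f g] Cov_add[OF a b]]) (simp add: pull_add pa pb differential_add[OF f g])
  show "pscale jet r x \<in> pcarrier jet"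
    unfolding x jet_ops
    by (rule jet_memI[OF CS_scale[OF f] Cov_scale[OF a]]) (simp add: pull_scale pa differential_scale[OF f])
  show "pmult jet x y \<in> pcarrier jet"
    unfolding x y jet_ops
    by (rule jet_memI[OF CS_mult[OF f g] Cov_add[OF Cov_smult[OF f b] Cov_smult[OF g a]]])
      (simp add: pull_add pull_scale pa pb differential_mult[OF f g])
  show "pbracket jet x y \<in> pcarrier jet"
    unfolding x y jet_ops by (rule jet_memI[OF brS_CS[OF f g] ASb_Cov[OF a b] pull_ASb[OF f g a b pa pb]])
  show "pscale jet r (x + y) = pscale jet r x + pscale jet r y"
    unfolding x y jet_ops by (simp add: distrib_left)
  show "pscale jet (r + r') x = pscale jet r x + pscale jet r' x"
    unfolding x jet_ops by (simp add: distrib_right)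
  show "pscale jet (r * r') x = pscale jet r (pscale jet r' x)"
    unfolding x jet_ops by (simp add: mult.assoc)
  show "pscale jet 1 x = x" unfolding x jet_ops by simp
  show "pmult jet x y = pmult jet y x"
    unfolding x y jet_ops by (simp add: mult.commute add.commute)
  show "pmult jet x (pmult jet y z) = pmult jet (pmult jet x y) z"
    unfolding x y z jet_ops by (simp add: algebra_simps)
  show "pmult jet x (y + z) = pmult jet x y + pmult jet x z"
    unfolding x y z jet_ops by (simp add: algebra_simps)
  show "pmult jet x (pscale jet r y) = pscale jet r (pmult jet x y)"
    unfolding x y jet_ops by (simp add: algebra_simps)
  have bf: "brS f g = (\<lambda>q. - brS g f q)" by (rule ext) (rule brS_skew)
  have ba: "ASb a b = (\<lambda>q v. - ASb b a q v)" by (intro ext) (rule ASb_skew)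
  show "pbracket jet x y = - pbracket jet y x"
    unfolding x y jet_ops bf ba by (simp add: fun_Compl_def)
  show "pbracket jet x (y + z) = pbracket jet x y + pbracket jet x z"
    unfolding x y z jet_ops brS_add[OF g h] ASb_add[OF a b c] by (rule refl)
  show "pbracket jet x (pscale jet r y) = pscale jet r (pbracket jet x y)"
    unfolding x y jet_ops brS_scale[OF g] ASb_scale[OF a b] by (rule refl)
  show "pbracket jet x (pbracket jet y z) + pbracket jet y (pbracket jet z x) + pbracket jet z (pbracket jet x y) = 0"
    unfolding x y z jet_ops brS_jacobi[OF f g h] ASb_jacobi[OF a b c] by (simp add: zero_prod_def zero_fun_def)
  have ra: "(\<lambda>q. rho a q k) = brS f k" for k
  proof
    show "rho a q k = brS f k q" for q
      using rho_pull[OF a _ pa, of q k] by (cases "q \<in> pts S") (simp_all add: rho_outside brS_outside)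
  qed
  have rc: "(\<lambda>q. rho c q k) = brS h k" for k
  proof
    show "rho c q k = brS h k q" for q
      using rho_pull[OF c _ pc, of q k] by (cases "q \<in> pts S") (simp_all add: rho_outside brS_outside)
  qed
  show "pbracket jet x (pmult jet y z) = pmult jet (pbracket jet x y) z + pmult jet y (pbracket jet x z)"
    unfolding x y z jet_ops brS_mult[OF g h] ASb_add[OF a Cov_smult[OF g c] Cov_smult[OF h b]]
      ASb_smult[OF a c g] ASb_smult[OF a b h] fun_cong[OF ra]
    by (simp add: algebra_simps)
  have m: "brS (\<lambda>q. f q * g q) h = (\<lambda>q. f q * brS g h q + g q * brS f h q)"
    by (rule ext) (rule brS_mult'[OF f g])
  have sk: "brS h f = (\<lambda>q. - brS f h q)" "brS h g = (\<lambda>q. - brS g h q)" by (rule ext, rule brS_skew)+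
  show "pbracket jet (pmult jet x y) z = pmult jet (pbracket jet x z) y + pmult jet x (pbracket jet y z)"
    unfolding x y z jet_ops m ASb_add'[OF c Cov_smult[OF f b] Cov_smult[OF g a]]
      ASb_smult'[OF c b f] ASb_smult'[OF c a g] fun_cong[OF rc] sk
    by (simp add: algebra_simps)
qed

section \<open>Comparison of the algebra of a transversal with \<open>jet\<close>\<close>

definition split_jet where
  "split_jet L = (\<lambda>(f, \<eta>). (f, \<lambda>q v. tau M S L (differential S f) q v + nu_star M S \<eta> q v))"

abbreviation "affL L \<equiv> transversal_algebra M \<pi> S L"

lemma affine_carrier: "pcarrier (affL L) = CS \<times> Con"
  by (simp add: transversal_algebra_def affine_algebra_def)

lemma affine_ops:
  "pscale (affL L) r (f, \<eta>) = (\<lambda>q. r * f q, \<lambda>q z. r * \<eta> q z)"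
  "pmult (affL L) (f, \<eta>) (g, \<theta>) = (\<lambda>q. f q * g q, \<lambda>q z. f q * \<theta> q z + g q * \<eta> q z)"
  "(f, \<eta>) + (g, \<theta>) = (\<lambda>q. f q + g q, \<lambda>q z. \<eta> q z + \<theta> q z)"
  for f g :: "'a \<Rightarrow> real" and \<eta> \<theta> :: "'a conormal_section"
  by (simp_all add: transversal_algebra_def affine_algebra_def times_fun_def plus_fun_def)

lemma AnnD: "a \<in> Ann \<Longrightarrow> a \<in> Cov" "a \<in> Ann \<Longrightarrow> q \<in> pts S \<Longrightarrow> pull M S q (a q) = differential S (\<lambda>p. 0) q"
  unfolding Ann_def differential_zero by auto

lemma brS_zero: "brS f (\<lambda>p. 0) = (\<lambda>p. 0)" "brS (\<lambda>p. 0) f = (\<lambda>p. 0)"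
  using brS_scale[OF CS_zero, of f 0] brS_skew[of "\<lambda>p. 0" f] by (auto simp: fun_eq_iff)

text \<open>The annihilator of TS is an ideal: its sections belong to pairs over the function 0, and
  {f, 0} = 0.\<close>

lemma ASb_Ann:
  assumes f: "f \<in> CS" and a: "a \<in> Cov" and pa: "\<And>q. q \<in> pts S \<Longrightarrow> pull M S q (a q) = differential S f q"
    and b: "b \<in> Ann"
  shows "ASb a b \<in> Ann"
  unfolding Ann_def
  using ASb_Cov[OF a AnnD(1)[OF b]] pull_ASb[OF f CS_zero a AnnD(1)[OF b] pa AnnD(2)[OF b]]
  by (simp add: brS_zero differential_zero)

lemma conormal_bracket_eq:
  assumes "\<eta> \<in> Con" "\<theta> \<in> Con"
  shows "conormal_bracket M \<pi> S \<eta> \<theta> \<in> Con"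
    and "nu_star M S (conormal_bracket M \<pi> S \<eta> \<theta>) = ASb (nu_star M S \<eta>) (nu_star M S \<theta>)"
proof -
  note n = nu_star_Ann[OF assms(1)]
  have A: "ASb (nu_star M S \<eta>) (nu_star M S \<theta>) \<in> Ann"
    by (rule ASb_Ann[OF CS_zero AnnD(1)[OF n] AnnD(2)[OF n] nu_star_Ann[OF assms(2)]])
  show "conormal_bracket M \<pi> S \<eta> \<theta> \<in> Con"
    "nu_star M S (conormal_bracket M \<pi> S \<eta> \<theta>) = ASb (nu_star M S \<eta>) (nu_star M S \<theta>)"
    unfolding conormal_bracket_def AS_bracket_ASb nuinv_the[OF A] by (rule nuinv_Con[OF A])+
qed

lemma tau_pull:
  assumes L: "transversal M S L" and q: "q \<in> pts S"
  shows "pull M S q (tau M S L (differential S f) q) = differential S f q"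
  by (rule tau_spec(2)[where \<alpha> = "differential S f", OF L q differential_cotangent])

lemma conn_eq:
  assumes L: "transversal M S L" and f: "f \<in> CS" and \<eta>: "\<eta> \<in> Con"
  shows "conn M \<pi> S L (differential S f) \<eta> \<in> Con"
    and "nu_star M S (conn M \<pi> S L (differential S f) \<eta>) = ASb (tau M S L (differential S f)) (nu_star M S \<eta>)"
proof -
  have A: "ASb (tau M S L (differential S f)) (nu_star M S \<eta>) \<in> Ann"
    by (rule ASb_Ann[OF f tau_Cov[OF L f] tau_pull[OF L] nu_star_Ann[OF \<eta>]])
  show "conn M \<pi> S L (differential S f) \<eta> \<in> Con"
    "nu_star M S (conn M \<pi> S L (differential S f) \<eta>) = ASb (tau M S L (differential S f)) (nu_star M S \<eta>)"
    unfolding conn_def AS_bracket_ASb nuinv_the[OF A] by (rule nuinv_Con[OF A])+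
qed

text \<open>The bracket [\<tau>(df), \<tau>(dg)] restricts to d{f, g} on TS. Removing its component
  \<tau>(d{f, g}), which annihilates L, leaves the component in the annihilator of TS.\<close>

lemma curv_eq:
  assumes L: "transversal M S L" and f: "f \<in> CS" and g: "g \<in> CS"
  shows "curv M \<pi> S L (differential S f) (differential S g) \<in> Con"
    and "nu_star M S (curv M \<pi> S L (differential S f) (differential S g)) =
      (\<lambda>q v. ASb (tau M S L (differential S f)) (tau M S L (differential S g)) q v -
        tau M S L (differential S (brS f g)) q v)"
proof -
  let ?B = "ASb (tau M S L (differential S f)) (tau M S L (differential S g))"
  note r = rho_proj_eq[OF L ASb_Cov[OF tau_Cov[OF L f] tau_Cov[OF L g]] brS_CS[OF f g]
      pull_ASb[OF f g tau_Cov[OF L f] tau_Cov[OF L g] tau_pull[OF L] tau_pull[OF L]]]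
  have e: "rho_proj M S L ?B = (\<lambda>q v. ?B q v - tau M S L (differential S (brS f g)) q v)" by (rule r(1))
  have A: "(\<lambda>q v. ?B q v - tau M S L (differential S (brS f g)) q v) \<in> Ann" by (rule r(2))
  show "curv M \<pi> S L (differential S f) (differential S g) \<in> Con"
    "nu_star M S (curv M \<pi> S L (differential S f) (differential S g)) =
      (\<lambda>q v. ?B q v - tau M S L (differential S (brS f g)) q v)"
    unfolding curv_def AS_bracket_ASb e nuinv_the[OF A] by (rule nuinv_Con[OF A])+
qed

lemma affine_bracket:
  "pbracket (affL L) (f, \<eta>) (g, \<theta>) = (brS f g, \<lambda>q z. conn M \<pi> S L (differential S f) \<theta> q z
    - conn M \<pi> S L (differential S g) \<eta> q z + conormal_bracket M \<pi> S \<eta> \<theta> q z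
    + curv M \<pi> S L (differential S f) (differential S g) q z)"
  by (simp add: transversal_algebra_def affine_algebra_def plus_fun_def fun_diff_def)

lemma affine_closed:
  assumes L: "transversal M S L" and x: "x \<in> pcarrier (affL L)" and y: "y \<in> pcarrier (affL L)"
  shows "0 \<in> pcarrier (affL L)" "x + y \<in> pcarrier (affL L)" "pscale (affL L) r x \<in> pcarrier (affL L)"
    "pmult (affL L) x y \<in> pcarrier (affL L)" "pbracket (affL L) x y \<in> pcarrier (affL L)"
proof -
  obtain f \<eta> where xe: "x = (f, \<eta>)" and f: "f \<in> CS" and \<eta>: "\<eta> \<in> Con"
    using x unfolding affine_carrier by blast
  obtain g \<theta> where ye: "y = (g, \<theta>)" and g: "g \<in> CS" and \<theta>: "\<theta> \<in> Con"
    using y unfolding affine_carrier by blast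
  show "0 \<in> pcarrier (affL L)"
    unfolding affine_carrier zero_prod_def zero_fun_def by (intro SigmaI CS_zero Con_zero)
  show "x + y \<in> pcarrier (affL L)"
    unfolding affine_carrier xe ye affine_ops by (intro SigmaI CS_add[OF f g] Con_add[OF \<eta> \<theta>])
  show "pscale (affL L) r x \<in> pcarrier (affL L)"
    unfolding affine_carrier xe affine_ops by (intro SigmaI CS_scale[OF f] Con_scale[OF \<eta>])
  show "pmult (affL L) x y \<in> pcarrier (affL L)"
    unfolding affine_carrier xe ye affine_ops
    by (intro SigmaI CS_mult[OF f g] Con_add[OF Con_smult[OF f \<theta>] Con_smult[OF g \<eta>]])
  show "pbracket (affL L) x y \<in> pcarrier (affL L)"
    unfolding affine_carrier xe ye affine_bracket
    by (intro SigmaI brS_CS[OF f g] Con_add[OF Con_add[OF Con_diff[OF conn_eq(1)[OF L f \<theta>]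
            conn_eq(1)[OF L g \<eta>]] conormal_bracket_eq(1)[OF \<eta> \<theta>]] curv_eq(1)[OF L f g]])
qed

text \<open>Expanding the bracket of \<tau>(df) + \<nu>\<eta> and \<tau>(dg) + \<nu>\<theta>, where
  \<nu> stands for \<open>nu_star\<close>, gives two connection terms, the bracket on the dual of E,
  and [\<tau>(df), \<tau>(dg)], which is \<tau>(d{f, g}) plus the curvature.\<close>

lemma split_jet_hom:
  assumes L: "transversal M S L"
  shows "poisson_hom (affL L) jet (split_jet L)"
  unfolding poisson_hom_def
proof (intro conjI ballI allI)
  fix x y r assume x: "x \<in> pcarrier (affL L)" and y: "y \<in> pcarrier (affL L)"
  obtain f \<eta> where xe: "x = (f, \<eta>)" and f: "f \<in> CS" and \<eta>: "\<eta> \<in> Con"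
    using x unfolding affine_carrier by blast
  obtain g \<theta> where ye: "y = (g, \<theta>)" and g: "g \<in> CS" and \<theta>: "\<theta> \<in> Con"
    using y unfolding affine_carrier by blast
  note tf = tau_Cov[OF L f] and tg = tau_Cov[OF L g]
  note n\<eta> = AnnD[OF nu_star_Ann[OF \<eta>]] and n\<theta> = AnnD[OF nu_star_Ann[OF \<theta>]]
  show "split_jet L x \<in> pcarrier jet"
    unfolding xe split_jet_def prod.case
  proof (rule jet_memI[OF f Cov_add[OF tf n\<eta>(1)]])
    fix q assume q: "q \<in> pts S"
    show "pull M S q (\<lambda>v. tau M S L (differential S f) q v + nu_star M S \<eta> q v) = differential S f q"
      unfolding pull_add tau_pull[OF L q] n\<eta>(2)[OF q] differential_zero by simp
  qed
  show "split_jet L (x + y) = split_jet L x + split_jet L y"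
    unfolding xe ye affine_ops split_jet_def prod.case jet_ops tau_add[OF L f g]
    by (simp add: nu_star_def algebra_simps)
  show "split_jet L (pmult (affL L) x y) = pmult jet (split_jet L x) (split_jet L y)"
    unfolding xe ye affine_ops split_jet_def prod.case jet_ops tau_mult[OF L f g]
    by (simp add: nu_star_def algebra_simps)
  show "split_jet L (pscale (affL L) r x) = pscale jet r (split_jet L x)"
    unfolding xe affine_ops split_jet_def prod.case jet_ops tau_scale[OF L f]
    by (simp add: nu_star_def algebra_simps)
  let ?tf = "tau M S L (differential S f)" and ?tg = "tau M S L (differential S g)"
  have nu: "nu_star M S (\<lambda>q z. conn M \<pi> S L (differential S f) \<theta> q z
      - conn M \<pi> S L (differential S g) \<eta> q z + conormal_bracket M \<pi> S \<eta> \<theta> q z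
      + curv M \<pi> S L (differential S f) (differential S g) q z) =
    (\<lambda>q v. ASb ?tf (nu_star M S \<theta>) q v - ASb ?tg (nu_star M S \<eta>) q v
      + ASb (nu_star M S \<eta>) (nu_star M S \<theta>) q v
      + (ASb ?tf ?tg q v - tau M S L (differential S (brS f g)) q v))"
    unfolding conn_eq(2)[OF L f \<theta>, symmetric] conn_eq(2)[OF L g \<eta>, symmetric]
      conormal_bracket_eq(2)[OF \<eta> \<theta>, symmetric] fun_cong[OF fun_cong[OF curv_eq(2)[OF L f g]], symmetric]
    unfolding nu_star_def by (rule refl)
  have B: "ASb (\<lambda>q v. ?tf q v + nu_star M S \<eta> q v) (\<lambda>q v. ?tg q v + nu_star M S \<theta> q v) =
      (\<lambda>q v. (ASb ?tf ?tg q v + ASb (nu_star M S \<eta>) ?tg q v) +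
        (ASb ?tf (nu_star M S \<theta>) q v + ASb (nu_star M S \<eta>) (nu_star M S \<theta>) q v))"
    unfolding ASb_add[OF Cov_add[OF tf n\<eta>(1)] tg n\<theta>(1)] ASb_add'[OF tg tf n\<eta>(1)]
      ASb_add'[OF n\<theta>(1) tf n\<eta>(1)] by (rule refl)
  have sk: "ASb ?tg (nu_star M S \<eta>) = (\<lambda>q v. - ASb (nu_star M S \<eta>) ?tg q v)" by (intro ext) (rule ASb_skew)
  show "split_jet L (pbracket (affL L) x y) = pbracket jet (split_jet L x) (split_jet L y)"
    unfolding xe ye affine_bracket split_jet_def prod.case jet_ops B nu sk
    by (simp add: algebra_simps)
qed

lemma split_jet_bij:
  assumes L: "transversal M S L"
  shows "bij_betw (split_jet L) (pcarrier (affL L)) (pcarrier jet)"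
proof (rule bij_betwI')
  fix x y assume "x \<in> pcarrier (affL L)" "y \<in> pcarrier (affL L)"
  then obtain f \<eta> g \<theta> where e: "x = (f, \<eta>)" "y = (g, \<theta>)" and \<eta>: "\<eta> \<in> Con" "\<theta> \<in> Con"
    unfolding affine_carrier by blast
  show "split_jet L x = split_jet L y \<longleftrightarrow> x = y"
  proof
    assume "split_jet L x = split_jet L y"
    then have fg: "f = g" and n: "(\<lambda>q v. tau M S L (differential S f) q v + nu_star M S \<eta> q v) =
        (\<lambda>q v. tau M S L (differential S g) q v + nu_star M S \<theta> q v)"
      unfolding e split_jet_def prod.case by (auto dest: arg_cong[where f = fst] arg_cong[where f = snd])
    have "nu_star M S \<eta> q v = nu_star M S \<theta> q v" for q v
      using fun_cong[OF fun_cong[OF n], of q v] fg by simp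
    then have "nu_star M S \<eta> = nu_star M S \<theta>" by (intro ext)
    then show "x = y" unfolding e fg using nu_star_inj[OF \<eta>] by simp
  qed simp
next
  fix x assume "x \<in> pcarrier (affL L)"
  then show "split_jet L x \<in> pcarrier jet" using split_jet_hom[OF L] unfolding poisson_hom_def by blast
next
  fix y assume "y \<in> pcarrier jet"
  then obtain f a where y: "y = (f, a)" and f: "f \<in> CS" and a: "a \<in> Cov"
    and pa: "\<And>q. q \<in> pts S \<Longrightarrow> pull M S q (a q) = differential S f q"
    by (rule jet_memE) (rule that)
  \<comment> \<open>The preimage: the difference a - \<tau>(df) annihilates TS, hence comes from a
    conormal section.\<close>
  let ?n = "nuinv (\<lambda>q v. a q v - tau M S L (differential S f) q v)"
  have A: "(\<lambda>q v. a q v - tau M S L (differential S f) q v) \<in> Ann" by (rule rho_proj_eq(2)[OF L a f pa])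
  have "(f, ?n) \<in> pcarrier (affL L)" unfolding affine_carrier using f nuinv_Con(1)[OF A] by blast
  moreover have "y = split_jet L (f, ?n)"
    unfolding y split_jet_def prod.case nuinv_Con(2)[OF A] by simp
  ultimately show "\<exists>x\<in>pcarrier (affL L). y = split_jet L x" by blast
qed

lemma affine_poisson_algebra:
  assumes L: "transversal M S L"
  shows "poisson_algebra (affL L)"
proof (rule poisson_algebra_transfer[OF jet_poisson_algebra split_jet_hom[OF L]])
  show "inj_on (split_jet L) (pcarrier (affL L))"
    using split_jet_bij[OF L] unfolding bij_betw_def by blast
  have z: "(\<lambda>q. 0, \<lambda>q z. 0) \<in> pcarrier (affL L)"
    unfolding affine_carrier by (intro SigmaI CS_zero Con_zero)
  show "0 \<in> pcarrier (affL L)" by (rule affine_closed(1)[OF L z z])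
  show "pscale (affL L) r x \<in> pcarrier (affL L)" if "x \<in> pcarrier (affL L)" for r x
    by (rule affine_closed(3)[OF L that that])
qed (rule affine_closed[OF L]; assumption)+

lemma affine_infinitesimal:
  assumes L: "transversal M S L"
  shows "infinitesimal_poisson_algebra M \<pi> S (affL L)"
  unfolding infinitesimal_poisson_algebra_def
proof (intro conjI ballI)
  show "affL L = affine_algebra M S (pbracket (affL L))"
    by (simp add: transversal_algebra_def affine_algebra_def)
  show "poisson_algebra (affL L)" by (rule affine_poisson_algebra[OF L])
  show "poisson_hom (affL L) (function_algebra S PS) fst"
    unfolding poisson_hom_def affine_carrier
    by (auto simp: function_algebra_def affine_bracket affine_ops(1,2) times_fun_def)
  show "fst ` pcarrier (affL L) = CS"
    unfolding affine_carrier using Con_zero by (auto simp: image_iff)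
  fix \<eta> \<theta> assume \<eta>: "\<eta> \<in> Con" and \<theta>: "\<theta> \<in> Con"
  \<comment> \<open>Brackets with \<tau>(d0) = 0 vanish, so over the function 0 the connection and
    curvature terms drop out.\<close>
  have A0: "ASb (\<lambda>q v. 0) b = (\<lambda>q v. 0)" if "b \<in> Cov" for b
    using ASb_smult'[OF that Cov_zero CS_zero] by simp
  have nz: "nu_star M S (\<lambda>q z. 0) = (\<lambda>q v. 0)" by (simp add: nu_star_def)
  have "conn M \<pi> S L (differential S (\<lambda>p. 0)) \<zeta> = (\<lambda>q z. 0)" if \<zeta>: "\<zeta> \<in> Con" for \<zeta>
    by (rule nu_star_inj[OF conn_eq(1)[OF L CS_zero \<zeta>] Con_zero])
      (simp add: conn_eq(2)[OF L CS_zero \<zeta>] tau_zero[OF L] A0[OF AnnD(1)[OF nu_star_Ann[OF \<zeta>]]] nz)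
  moreover have "curv M \<pi> S L (differential S (\<lambda>p. 0)) (differential S (\<lambda>p. 0)) = (\<lambda>q z. 0)"
    by (rule nu_star_inj[OF curv_eq(1)[OF L CS_zero CS_zero] Con_zero])
      (simp add: curv_eq(2)[OF L CS_zero CS_zero] brS_zero tau_zero[OF L] A0[OF Cov_zero] nz)
  ultimately have "pbracket (affL L) (\<lambda>p. 0, \<eta>) (\<lambda>p. 0, \<theta>) = (\<lambda>p. 0, conormal_bracket M \<pi> S \<eta> \<theta>)"
    unfolding affine_bracket brS_zero using \<eta> \<theta> by simp
  then show "pbracket (affL L) (0, \<eta>) (0, \<theta>) = (0, conormal_bracket M \<pi> S \<eta> \<theta>)"
    unfolding zero_fun_def .
qed

lemma affine_isomorphic:
  assumes "transversal M S L" "transversal M S L'"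
  shows "poisson_isomorphic (affL L) (affL L')"
  by (rule poisson_isomorphic_common[OF split_jet_hom[OF assms(1)] split_jet_bij[OF assms(1)]
        split_jet_hom[OF assms(2)] split_jet_bij[OF assms(2)]
        affine_poisson_algebra[OF assms(1)] affine_poisson_algebra[OF assms(2)]])

end

theorem proposition5p2:
  fixes M S :: "('a, 'b::euclidean_space) mfd" and \<pi> :: "'a bivf"
  assumes "poisson_manifold M \<pi>" and "poisson_submanifold M \<pi> S"
  shows "(\<forall>L. transversal M S L \<longrightarrow>
            infinitesimal_poisson_algebra M \<pi> S (transversal_algebra M \<pi> S L)) \<and>
         (\<forall>L L'. transversal M S L \<longrightarrow> transversal M S L' \<longrightarrow>
            poisson_isomorphic (transversal_algebra M \<pi> S L) (transversal_algebra M \<pi> S L'))"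
proof -
  interpret poisson_sub M S \<pi>
    using assms by unfold_locales (simp_all add: poisson_manifold_def poisson_submanifold_def)
  show ?thesis using affine_infinitesimal affine_isomorphic by blast
qed

end
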